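(* Let $d\ge 1$, $0<m<1$, $R>0$. Assume $\rho_0\in L^\infty(B_R)$, $\rho_0\ge 0$; $V\in W^{2,\infty}(B_R)$, $V\ge 0$, $\nabla V\cdot\nu=0$ on $\partial B_R$; $K\in W^{2,\infty}(B_R\times B_R)$, $K(x,y)=K(y,x)\ge 0$, $\nabla_xK(x,y)\cdot\nu(x)=0$ for $(x,y)\in\partial B_R\times B_R$. Let $\rho$ be the strong solution of the problem (P) of the context. Then, for all $0\le t_1\le t_2$, $$\int_{t_1}^{t_2}\int_{B_R}\rho_t\left|\nabla\left(U'(\rho_t)+V+\int_{B_R}K(\cdot,y)\rho_t(y)\,dy\right)\right|^2dx\,dt=\mathcal F_R[\rho_{t_1}]-\mathcal F_R[\rho_{t_2}].$$ In particular, $t\mapsto\mathcal F_R[\rho_t]$ is non-increasing.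
   Context: $B_R\subset\mathbb R^d$ is the open ball of radius $R$ centred at $0$, $\nu$ its outward normal, $\rho_t=\rho(t,\cdot)$. $U(s)=\frac{s^m}{m-1}$, so $U'(s)=\frac{m}{m-1}s^{m-1}$. The free energy is $$\mathcal F_R[\rho]=\frac1{m-1}\int_{B_R}\rho^m\,dx+\int_{B_R}V\rho\,dx+\frac12\int_{B_R}\int_{B_R}K(x,y)\rho(y)\rho(x)\,dy\,dx.$$ Problem (P): $\frac{\partial\rho}{\partial t}=\Delta\rho^m+\nabla\cdot(\rho\nabla V)+\nabla\cdot(\rho\nabla\int_{B_R}K(\cdot,y)\rho(y)\,dy)$ in $(0,\infty)\times B_R$, $\rho(0,\cdot)=\rho_0$, with $(\nabla\rho^m+\rho\nabla V+\rho\nabla\int_{B_R}K(\cdot,y)\rho(y)\,dy)\cdot\nu=0$ on $(0,\infty)\times\partial B_R$. A strong solution is a nonnegative $\rho$ such that for every $T>0$: $\rho\in C([0,T];L^1(B_R))\cap L^\infty((0,T)\times B_R)$, $\rho^m\in L^2(0,T;H^2(B_R))$, $\frac{\partial\rho}{\partial t}\in L^2((0,T)\times B_R)$, and for all $\varphi\in C^\infty([0,T]\times\overline{B_R})$ with $\varphi(T,\cdot)=0$, $$\int_{B_R}\rho_0\varphi(0)+\int_0^T\!\!\int_{B_R}\rho_t\frac{\partial\varphi}{\partial t}=\int_0^T\!\!\int_{B_R}\nabla\rho_t^m\cdot\nabla\varphi+\int_0^T\!\!\int_{B_R}\rho_t\Big(\nabla V+\nabla\int_{B_R}K(\cdot,y)\rho_t(y)\,dy\Big)\cdot\nabla\varphi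 .$$ *)

theory Defs
  imports "HOL-Analysis.Analysis"
begin

section \<open>Smooth functions and test functions\<close>

definition dir_deriv :: "'a::euclidean_space \<Rightarrow> ('a \<Rightarrow> real) \<Rightarrow> 'a \<Rightarrow> real" where
  "dir_deriv e f x = frechet_derivative f (at x) e"

fun C_k :: "nat \<Rightarrow> ('a::euclidean_space \<Rightarrow> real) \<Rightarrow> bool" where
  "C_k 0 f \<longleftrightarrow> continuous_on UNIV f"
| "C_k (Suc k) f \<longleftrightarrow> (\<forall>x. f differentiable (at x)) \<and> (\<forall>e\<in>Basis. C_k k (dir_deriv e f))"

definition smooth :: "('a::euclidean_space \<Rightarrow> real) \<Rightarrow> bool" where
  "smooth f \<longleftrightarrow> (\<forall>k. C_k k f)"

definition test_fun :: "'a::euclidean_space set \<Rightarrow> ('a \<Rightarrow> real) \<Rightarrow> bool" where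
  "test_fun \<Omega> \<phi> \<longleftrightarrow> smooth \<phi> \<and> (\<exists>C. compact C \<and> C \<subseteq> \<Omega> \<and> (\<forall>x. x \<notin> C \<longrightarrow> \<phi> x = 0))"

section \<open>Lebesgue and Sobolev spaces\<close>

definition L_inf :: "'a::euclidean_space set \<Rightarrow> ('a \<Rightarrow> real) \<Rightarrow> bool" where
  "L_inf S f \<longleftrightarrow> f \<in> borel_measurable (lebesgue_on S) \<and> (\<exists>C. AE x in lebesgue_on S. \<bar>f x\<bar> \<le> C)"

definition L_two :: "'a::euclidean_space set \<Rightarrow> ('a \<Rightarrow> real) \<Rightarrow> bool" where
  "L_two S f \<longleftrightarrow> f \<in> borel_measurable (lebesgue_on S) \<and> integrable (lebesgue_on S) (\<lambda>x. (f x)\<^sup>2)"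

definition loc_integrable :: "'a::euclidean_space set \<Rightarrow> ('a \<Rightarrow> real) \<Rightarrow> bool" where
  "loc_integrable \<Omega> f \<longleftrightarrow> (\<forall>C. compact C \<and> C \<subseteq> \<Omega> \<longrightarrow> integrable (lebesgue_on C) f)"

text \<open>\<open>g\<close> is the weak derivative of \<open>f\<close> in the direction \<open>e\<close> on the open set \<open>\<Omega>\<close>.\<close>

definition weak_deriv ::
    "'a::euclidean_space set \<Rightarrow> 'a \<Rightarrow> ('a \<Rightarrow> real) \<Rightarrow> ('a \<Rightarrow> real) \<Rightarrow> bool" where
  "weak_deriv \<Omega> e f g \<longleftrightarrow> loc_integrable \<Omega> f \<and> loc_integrable \<Omega> g \<and>
     (\<forall>\<phi>. test_fun \<Omega> \<phi> \<longrightarrow>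
        (\<integral>x. f x * dir_deriv e \<phi> x \<partial>lebesgue_on \<Omega>) = - (\<integral>x. g x * \<phi> x \<partial>lebesgue_on \<Omega>))"

definition has_weak_grad ::
    "'a::euclidean_space set \<Rightarrow> ('a \<Rightarrow> real) \<Rightarrow> ('a \<Rightarrow> 'a) \<Rightarrow> bool" where
  "has_weak_grad \<Omega> f g \<longleftrightarrow> (\<forall>e\<in>Basis. weak_deriv \<Omega> e f (\<lambda>x. g x \<bullet> e))"

text \<open>The weak gradient is unique almost everywhere, and \<open>weak_grad\<close> is a representative of it.
  It is used only under integrals over \<open>\<Omega>\<close>.\<close>

definition weak_grad :: "'a::euclidean_space set \<Rightarrow> ('a \<Rightarrow> real) \<Rightarrow> 'a \<Rightarrow> 'a" where
  "weak_grad \<Omega> f = (SOME g. has_weak_grad \<Omega> f g)"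

fun W_inf :: "nat \<Rightarrow> 'a::euclidean_space set \<Rightarrow> ('a \<Rightarrow> real) \<Rightarrow> bool" where
  "W_inf 0 \<Omega> f \<longleftrightarrow> L_inf \<Omega> f"
| "W_inf (Suc k) \<Omega> f \<longleftrightarrow>
     L_inf \<Omega> f \<and> (\<forall>e\<in>Basis. \<exists>g. weak_deriv \<Omega> e f g \<and> W_inf k \<Omega> g)"

text \<open>\<open>L2_H k T \<Omega> w\<close>: \<open>w\<close> belongs to the Bochner space \<open>L\<^sup>2(0,T;H\<^sup>k(\<Omega>))\<close>, i.e. \<open>w\<close> and its
  spatial weak derivatives up to order \<open>k\<close> are (jointly measurable and) square integrable on
  \<open>(0,T) \<times> \<Omega>\<close>.\<close>

fun L2_H :: "nat \<Rightarrow> real \<Rightarrow> 'a::euclidean_space set \<Rightarrow> (real \<Rightarrow> 'a \<Rightarrow> real) \<Rightarrow> bool" where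
  "L2_H 0 T \<Omega> w \<longleftrightarrow> L_two ({0<..<T} \<times> \<Omega>) (\<lambda>(t, x). w t x)"
| "L2_H (Suc k) T \<Omega> w \<longleftrightarrow> L_two ({0<..<T} \<times> \<Omega>) (\<lambda>(t, x). w t x) \<and>
     (\<forall>e\<in>Basis. \<exists>g. (AE t in lebesgue_on {0<..<T}. weak_deriv \<Omega> e (w t) (g t)) \<and> L2_H k T \<Omega> g)"

definition C_L1 :: "real \<Rightarrow> 'a::euclidean_space set \<Rightarrow> (real \<Rightarrow> 'a \<Rightarrow> real) \<Rightarrow> bool" where
  "C_L1 T \<Omega> w \<longleftrightarrow> (\<forall>t\<in>{0..T}. integrable (lebesgue_on \<Omega>) (w t) \<and>
     ((\<lambda>s. \<integral>x. \<bar>w s x - w t x\<bar> \<partial>lebesgue_on \<Omega>) \<longlongrightarrow> 0) (at t within {0..T}))"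

section \<open>Generalized gradients of extended-real-valued functions\<close>

text \<open>For \<open>0 < m < 1\<close> one has \<open>U'(0) = -\<infinity>\<close>, so the potential \<open>U'(\<rho>) + V + \<integral>K(\<cdot>,y)\<rho>(y) dy\<close> is
  extended-real valued and in general is not known to be locally integrable. Its gradient is
  understood via truncations: \<open>g\<close> is the gradient of \<open>u\<close> if for all \<open>k > 0\<close> the truncation of \<open>u\<close>
  to \<open>[-k,k]\<close> has weak gradient \<open>g\<close> where \<open>|u| < k\<close> and \<open>0\<close> elsewhere. For a real-valued \<open>u\<close> in
  \<open>W\<^sup>1\<^sup>,\<^sup>1\<close> (locally) this is the usual weak gradient. Where \<open>|u| = \<infinity>\<close>, we put \<open>g = 0\<close>; for the
  potential this is the set where \<open>\<rho>\<close> vanishes.\<close>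

definition trunc :: "real \<Rightarrow> ereal \<Rightarrow> real" where
  "trunc k s = real_of_ereal (max (ereal (- k)) (min (ereal k) s))"

definition has_gen_grad ::
    "'a::euclidean_space set \<Rightarrow> ('a \<Rightarrow> ereal) \<Rightarrow> ('a \<Rightarrow> 'a) \<Rightarrow> bool" where
  "has_gen_grad \<Omega> u g \<longleftrightarrow>
     (\<forall>k>0. has_weak_grad \<Omega> (\<lambda>x. trunc k (u x)) (\<lambda>x. if \<bar>u x\<bar> < ereal k then g x else 0)) \<and>
     (\<forall>x\<in>\<Omega>. \<bar>u x\<bar> = \<infinity> \<longrightarrow> g x = 0)"

definition gen_grad :: "'a::euclidean_space set \<Rightarrow> ('a \<Rightarrow> ereal) \<Rightarrow> 'a \<Rightarrow> 'a" where
  "gen_grad \<Omega> u = (SOME g. has_gen_grad \<Omega> u g)"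

section \<open>The boundary conditions on the potentials\<close>

text \<open>The outward normal of \<open>ball 0 R\<close> at \<open>x\<close> is \<open>x / R\<close>. The gradient of a \<open>W\<^sup>2\<^sup>,\<^sup>\<infinity>\<close> function on a
  bounded convex open set has a (unique) continuous representative up to the boundary, which gives
  the boundary values.\<close>

definition neumann :: "real \<Rightarrow> ('a::euclidean_space \<Rightarrow> real) \<Rightarrow> bool" where
  "neumann R V \<longleftrightarrow> (\<exists>g. continuous_on (cball 0 R) g \<and> has_weak_grad (ball 0 R) V g \<and>
     (\<forall>x\<in>sphere 0 R. g x \<bullet> (x /\<^sub>R R) = 0))"

definition neumann_fst :: "real \<Rightarrow> ('a::euclidean_space \<Rightarrow> 'a \<Rightarrow> real) \<Rightarrow> bool" where
  "neumann_fst R K \<longleftrightarrow> (\<exists>g :: 'a \<times> 'a \<Rightarrow> 'a. continuous_on (cball 0 R \<times> cball 0 R) g \<and>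
     (\<forall>e\<in>Basis. weak_deriv (ball 0 R \<times> ball 0 R) (e, 0) (\<lambda>(x, y). K x y) (\<lambda>z. g z \<bullet> e)) \<and>
     (\<forall>x\<in>sphere 0 R. \<forall>y\<in>ball 0 R. g (x, y) \<bullet> (x /\<^sub>R R) = 0))"

section \<open>The equation and the free energy\<close>

definition interaction ::
    "real \<Rightarrow> ('a::euclidean_space \<Rightarrow> 'a \<Rightarrow> real) \<Rightarrow> ('a \<Rightarrow> real) \<Rightarrow> 'a \<Rightarrow> real" where
  "interaction R K \<rho> x = (\<integral>y. K x y * \<rho> y \<partial>lebesgue_on (ball 0 R))"

definition free_energy ::
    "real \<Rightarrow> real \<Rightarrow> ('a::euclidean_space \<Rightarrow> real) \<Rightarrow> ('a \<Rightarrow> 'a \<Rightarrow> real) \<Rightarrow> ('a \<Rightarrow> real) \<Rightarrow> real" where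
  "free_energy m R V K \<rho> =
     1 / (m - 1) * (\<integral>x. \<rho> x powr m \<partial>lebesgue_on (ball 0 R))
     + (\<integral>x. V x * \<rho> x \<partial>lebesgue_on (ball 0 R))
     + 1 / 2 * (\<integral>x. (\<integral>y. K x y * \<rho> y * \<rho> x \<partial>lebesgue_on (ball 0 R)) \<partial>lebesgue_on (ball 0 R))"

text \<open>\<open>U'(s)\<close> for \<open>U(s) = s\<^sup>m / (m - 1)\<close>, \<open>0 < m < 1\<close>, with the limit value \<open>-\<infinity>\<close> at \<open>s = 0\<close>
  (whereas \<open>0 powr (m - 1) = 0\<close>).\<close>

definition U_deriv :: "real \<Rightarrow> real \<Rightarrow> ereal" where
  "U_deriv m s = (if s > 0 then ereal (m / (m - 1) * s powr (m - 1)) else - \<infinity>)"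

definition potential ::
    "real \<Rightarrow> real \<Rightarrow> ('a::euclidean_space \<Rightarrow> real) \<Rightarrow> ('a \<Rightarrow> 'a \<Rightarrow> real) \<Rightarrow> ('a \<Rightarrow> real) \<Rightarrow> 'a \<Rightarrow> ereal" where
  "potential m R V K \<rho> x = U_deriv m (\<rho> x) + ereal (V x + interaction R K \<rho> x)"

definition time_deriv :: "(real \<times> 'a::euclidean_space \<Rightarrow> real) \<Rightarrow> real \<Rightarrow> 'a \<Rightarrow> real" where
  "time_deriv \<phi> t x = dir_deriv (1, 0) \<phi> (t, x)"

definition space_grad :: "(real \<times> 'a::euclidean_space \<Rightarrow> real) \<Rightarrow> real \<Rightarrow> 'a \<Rightarrow> 'a" where
  "space_grad \<phi> t x = (\<Sum>e\<in>Basis. dir_deriv (0, e) \<phi> (t, x) *\<^sub>R e)"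

text \<open>The test functions in \<open>C\<^sup>\<infinity>([0,T] \<times> cball 0 R)\<close> are the restrictions of smooth functions on
  the whole space.\<close>

definition strong_solution ::
    "real \<Rightarrow> real \<Rightarrow> ('a::euclidean_space \<Rightarrow> real) \<Rightarrow> ('a \<Rightarrow> 'a \<Rightarrow> real) \<Rightarrow> ('a \<Rightarrow> real) \<Rightarrow>
      (real \<Rightarrow> 'a \<Rightarrow> real) \<Rightarrow> bool" where
  "strong_solution m R V K \<rho>0 \<rho> \<longleftrightarrow>
     (\<forall>t\<ge>0. AE x in lebesgue_on (ball 0 R). \<rho> t x \<ge> 0) \<and>
     (\<forall>T>0.
        C_L1 T (ball 0 R) \<rho> \<and>
        L_inf ({0<..<T} \<times> ball 0 R) (\<lambda>(t, x). \<rho> t x) \<and>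
        L2_H 2 T (ball 0 R) (\<lambda>t x. \<rho> t x powr m) \<and>
        (\<exists>\<sigma>. weak_deriv ({0<..<T} \<times> ball 0 R) (1, 0) (\<lambda>(t, x). \<rho> t x) \<sigma> \<and>
             L_two ({0<..<T} \<times> ball 0 R) \<sigma>) \<and>
        (\<forall>\<phi>. smooth \<phi> \<and> (\<forall>x\<in>cball 0 R. \<phi> (T, x) = 0) \<longrightarrow>
           (\<integral>x. \<rho>0 x * \<phi> (0, x) \<partial>lebesgue_on (ball 0 R))
           + (\<integral>t. (\<integral>x. \<rho> t x * time_deriv \<phi> t x \<partial>lebesgue_on (ball 0 R)) \<partial>lebesgue_on {0<..<T})
           = (\<integral>t. (\<integral>x. weak_grad (ball 0 R) (\<lambda>x. \<rho> t x powr m) x \<bullet> space_grad \<phi> t x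
                \<partial>lebesgue_on (ball 0 R)) \<partial>lebesgue_on {0<..<T})
           + (\<integral>t. (\<integral>x. \<rho> t x * ((weak_grad (ball 0 R) V x
                   + weak_grad (ball 0 R) (interaction R K (\<rho> t)) x) \<bullet> space_grad \<phi> t x)
                \<partial>lebesgue_on (ball 0 R)) \<partial>lebesgue_on {0<..<T})))"

definition dissipation ::
    "real \<Rightarrow> real \<Rightarrow> ('a::euclidean_space \<Rightarrow> real) \<Rightarrow> ('a \<Rightarrow> 'a \<Rightarrow> real) \<Rightarrow> ('a \<Rightarrow> real) \<Rightarrow> 'a \<Rightarrow> real" where
  "dissipation m R V K \<rho> x = \<rho> x * (norm (gen_grad (ball 0 R) (potential m R V K \<rho>) x))\<^sup>2"

end

theory Submission
  imports Defs
begin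

text \<open>Replace \<open>U\<close> by the function \<open>U\<^sub>\<epsilon>\<close> with derivative \<open>U'(max s \<epsilon>)\<close>. Since \<open>\<rho>\<^sup>m\<close> is in \<open>H\<^sup>1\<close> at almost
  every time, so is \<open>U\<^sub>\<epsilon>'(\<rho>) + V + \<integral> K \<rho>\<close>, and it may be used as a test function. With \<open>J = \<nabla>\<rho>\<^sup>m + \<rho> \<nabla>\<psi>\<close>,
  \<open>\<psi> = V + \<integral> K \<rho>\<close>, this gives the derivative of the regularized energy: minus the integral of \<open>|J|\<^sup>2 / \<rho>\<close>
  over \<open>{\<rho> > \<epsilon>}\<close> and of \<open>J \<bullet> \<nabla>\<psi>\<close> over \<open>{\<rho> \<le> \<epsilon>}\<close>. The chain rule in time holds although \<open>\<partial>\<rho>/\<partial>t\<close> is only square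
  integrable: an increment of the energy is the integral of \<open>\<partial>\<rho>/\<partial>t\<close> against an averaged potential,
  which is close to the potential at each intermediate time because \<open>\<rho>\<close> is continuous in \<open>L\<^sup>1\<close>. As
  \<open>\<epsilon> \<rightarrow> 0\<close>, the first integral converges monotonically to the dissipation, and the second one tends to
  the integral over \<open>{\<rho> = 0}\<close>, which vanishes because \<open>\<nabla>\<rho>\<^sup>m = 0\<close> almost everywhere on that set.\<close>

text \<open>The obstacle is the vacuum. As U' is singular at 0, the potential need not be weakly
  differentiable and cannot be inserted into the equation. After the cut-off, U'(max \<rho>
  \<epsilon>) is a C^1 function, with bounded derivative, of max (\<rho>^m) (\<epsilon>^m), so
  \<rho> itself is never differentiated in space. No trace on the sphere is taken: the test
  functions need not vanish there, so the weak form already contains the no-flux condition, and what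
  remains is to reach every H^1 function from functions that are smooth up to the boundary. The
  function to be inserted changes with time, hence the exceptional set of times has to be fixed
  before the test function. In the interaction energy, the symmetry of K turns the increment of the
  quadratic form into the increment of \<rho> paired with the mean of the two interaction
  potentials; this absorbs the factor 1/2. Freezing the potential at an intermediate time costs a
  factor \<epsilon>^(m-2), harmless because \<epsilon> is fixed while the time step shrinks. Only
  then does \<epsilon> tend to 0, in the identity already integrated in time, and the integrability
  of the dissipation comes out as well.\<close>

section \<open>Smooth functions and mollifiers\<close>

lemma dir_deriv_eq: "(f has_derivative f') (at x) \<Longrightarrow> dir_deriv e f x = f' e"
  unfolding dir_deriv_def using frechet_derivative_at by metis

lemma dir_deriv_real:
  "(f has_real_derivative d) (at x) \<Longrightarrow> dir_deriv e f x = d * e"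
  using dir_deriv_eq[of f "(*) d" x e] by (simp add: has_field_derivative_def)

text \<open>The recursion defining \<open>C_k\<close> constrains only the partial derivatives, so
  the inclusion in the next lower class has to be proved; at order 0 it is the continuity of
  differentiable functions.\<close>

lemma C_k_SucD: "C_k (Suc k) f \<Longrightarrow> C_k k f"
proof (induction k arbitrary: f)
  case 0
  then show ?case
    by (auto intro!: continuous_at_imp_continuous_on differentiable_imp_continuous_within)
qed auto

lemma C_k_const: "C_k k (\<lambda>x. c)"
proof (induction k arbitrary: c)
  case (Suc k)
  have "dir_deriv e (\<lambda>x::'a. c) = (\<lambda>x. 0)" for e
    by (rule ext) (simp add: dir_deriv_eq[OF has_derivative_const])
  with Suc show ?case by simp
qed auto

lemma C_k_add: "C_k k f \<Longrightarrow> C_k k g \<Longrightarrow> C_k k (\<lambda>x. f x + g x)"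
proof (induction k arbitrary: f g)
  case 0 then show ?case by (auto intro!: continuous_on_add continuous_on_mult)
next
  case (Suc k)
  have "dir_deriv e (\<lambda>x. f x + g x) = (\<lambda>x. dir_deriv e f x + dir_deriv e g x)" for e
    using Suc.prems
    by (intro ext) (auto simp: dir_deriv_def frechet_derivative_works
        intro!: dir_deriv_eq[unfolded dir_deriv_def] has_derivative_add)
  with Suc show ?case by auto
qed

lemma C_k_mult: "C_k k f \<Longrightarrow> C_k k g \<Longrightarrow> C_k k (\<lambda>x. f x * g x)"
proof (induction k arbitrary: f g)
  case 0 then show ?case by (auto intro!: continuous_on_add continuous_on_mult)
next
  case (Suc k)
  have *: "dir_deriv e (\<lambda>x. f x * g x) = (\<lambda>x. f x * dir_deriv e g x + dir_deriv e f x * g x)" for e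
    using Suc.prems
    by (intro ext) (auto simp: dir_deriv_def frechet_derivative_works
        intro!: dir_deriv_eq[unfolded dir_deriv_def] has_derivative_mult)
  have "C_k k f" "C_k k g" using Suc.prems C_k_SucD by blast+
  with Suc show ?case by (auto simp: * intro!: C_k_add)
qed

lemma C_k_sum: "finite A \<Longrightarrow> (\<And>a. a \<in> A \<Longrightarrow> C_k k (f a)) \<Longrightarrow> C_k k (\<lambda>x. \<Sum>a\<in>A. f a x)"
  by (induction A rule: finite_induct) (auto intro: C_k_const C_k_add)

lemma C_k_prod: "finite A \<Longrightarrow> (\<And>a. a \<in> A \<Longrightarrow> C_k k (f a)) \<Longrightarrow> C_k k (\<lambda>x. \<Prod>a\<in>A. f a x)"
  by (induction A rule: finite_induct) (auto intro: C_k_const C_k_mult)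

text \<open>\<open>C_k\<close> records partial derivatives only; differentiability makes the
  derivative linear, hence determined by them.\<close>

lemma dir_deriv_basis_sum:
  assumes "f differentiable (at y)"
  shows "frechet_derivative f (at y) h = (\<Sum>b\<in>Basis. (h \<bullet> b) * dir_deriv b f y)"
proof -
  have bl: "linear (frechet_derivative f (at y))"
    using assms linear_frechet_derivative by blast
  have "frechet_derivative f (at y) h = frechet_derivative f (at y) (\<Sum>b\<in>Basis. (h \<bullet> b) *\<^sub>R b)"
    by (simp add: euclidean_representation)
  then show ?thesis by (simp add: linear_sum[OF bl] linear_scale[OF bl] dir_deriv_def)
qed

lemma has_derivative_affine:
  assumes "bounded_linear L" "f differentiable (at (L x + c))"
  shows "((\<lambda>x. f (L x + c)) has_derivative (\<lambda>h. frechet_derivative f (at (L x + c)) (L h))) (at x)"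
proof -
  have 1: "((\<lambda>x. L x + c) has_derivative L) (at x)"
    using has_derivative_add[OF bounded_linear_imp_has_derivative[OF assms(1)] has_derivative_const]
    by simp
  show ?thesis
    using diff_chain_at[OF 1, of f "frechet_derivative f (at (L x + c))"] assms(2)
    by (simp add: o_def frechet_derivative_works)
qed

lemma dir_deriv_affine:
  assumes "bounded_linear L" "f differentiable (at (L x + c))"
  shows "dir_deriv e (\<lambda>x. f (L x + c)) x = (\<Sum>b\<in>Basis. (L e \<bullet> b) * dir_deriv b f (L x + c))"
  using dir_deriv_eq[OF has_derivative_affine[OF assms]] dir_deriv_basis_sum[OF assms(2)] by simp

text \<open>One statement for translations, dilations, reflections and coordinate projections. The
  induction closes because the partial derivatives of the composition are constant linear
  combinations of partial derivatives of f composed with the same affine map.\<close>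

lemma C_k_affine: "bounded_linear L \<Longrightarrow> C_k k f \<Longrightarrow> C_k k (\<lambda>x. f (L x + c))"
proof (induction k arbitrary: f)
  case 0
  have "continuous_on UNIV (\<lambda>x. L x + c)"
    using 0 by (intro continuous_on_add linear_continuous_on continuous_on_const) auto
  with 0 show ?case using continuous_on_compose2[of UNIV f UNIV "\<lambda>x. L x + c"] by simp
next
  case (Suc k)
  have "(\<lambda>x. f (L x + c)) differentiable (at x)" for x
    using has_derivative_affine[OF Suc.prems(1), of f x c] Suc.prems(2)
    by (auto simp: differentiable_def)
  moreover have "dir_deriv e (\<lambda>x. f (L x + c)) =
      (\<lambda>x. \<Sum>b\<in>Basis. (L e \<bullet> b) * dir_deriv b f (L x + c))" for e
    using dir_deriv_affine[OF Suc.prems(1)] Suc.prems(2) by auto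
  ultimately show ?case using Suc
    by (auto intro!: C_k_sum C_k_mult C_k_const)
qed

text \<open>A sequence in which each function is the derivative of its predecessor spares the
  computation of iterated derivatives; it is meant for \<open>flat\<close>.\<close>

lemma C_k_real_seq:
  assumes "\<And>n x. (D n has_real_derivative D (Suc n) x) (at x)"
  shows "C_k k (D n)"
proof (induction k arbitrary: n)
  case 0
  show ?case using assms[of n]
    by (auto intro!: continuous_at_imp_continuous_on DERIV_isCont)
next
  case (Suc k)
  have "dir_deriv 1 (D n) = D (Suc n)" using dir_deriv_real[OF assms[of n]] by auto
  with Suc assms show ?case by (auto simp: Basis_real_def real_differentiable_def)
qed

lemma smooth_const: "smooth (\<lambda>x. r)"
  and smooth_add: "smooth f \<Longrightarrow> smooth g \<Longrightarrow> smooth (\<lambda>x. f x + g x)"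
  and smooth_mult: "smooth f \<Longrightarrow> smooth g \<Longrightarrow> smooth (\<lambda>x. f x * g x)"
  and smooth_affine: "bounded_linear L \<Longrightarrow> smooth f' \<Longrightarrow> smooth (\<lambda>x. f' (L x + y))"
  by (simp_all add: smooth_def C_k_const C_k_add C_k_mult C_k_affine)

lemma smooth_differentiable: "smooth f \<Longrightarrow> f differentiable (at x)"
  unfolding smooth_def by (drule spec[of _ 1]) simp

lemma smooth_continuous: "smooth f \<Longrightarrow> continuous_on A f"
  unfolding smooth_def using C_k.simps(1) continuous_on_subset by blast

lemma smooth_dir_deriv: "smooth f \<Longrightarrow> e \<in> Basis \<Longrightarrow> smooth (dir_deriv e f)"
  unfolding smooth_def using C_k.simps(2) by blast

lemma smooth_has_derivative:
  "smooth f \<Longrightarrow> (f has_derivative (\<lambda>h. \<Sum>b\<in>Basis. (h \<bullet> b) * dir_deriv b f x)) (at x)"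
  using smooth_differentiable[of f x] dir_deriv_basis_sum[of f x] frechet_derivative_works[of f "at x"]
  by presburger

section \<open>The flat function exp(-1/s)\<close>

definition flat :: "real poly \<Rightarrow> real \<Rightarrow> real" where
  "flat p s = (if s > 0 then poly p (1 / s) * exp (- (1 / s)) else 0)"

lemma poly_times_exp_tendsto_0: "((\<lambda>x::real. poly p x * exp (- x)) \<longlongrightarrow> 0) at_top"
proof -
  have "((\<lambda>x::real. \<Sum>i\<le>degree p. coeff p i * (x ^ i / exp x)) \<longlongrightarrow> (\<Sum>i\<le>degree p. coeff p i * 0)) at_top"
    by (intro tendsto_intros tendsto_power_div_exp_0)
  moreover have "(\<lambda>x::real. poly p x * exp (- x)) = (\<lambda>x. \<Sum>i\<le>degree p. coeff p i * (x ^ i / exp x))"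
    by (simp add: poly_altdef sum_divide_distrib exp_minus divide_inverse[symmetric])
  ultimately show ?thesis by simp
qed

lemma flat_over_tendsto_0: "((\<lambda>h. flat p h / h) \<longlongrightarrow> 0) (at 0)"
proof -
  \<comment> \<open>\<open>pCons 0 p\<close> is x p(x): with x = 1/h, the division by h raises the
    degree of the polynomial factor by one.\<close>
  have "((\<lambda>x::real. poly (pCons 0 p) x * exp (- x)) \<longlongrightarrow> 0) at_top"
    by (rule poly_times_exp_tendsto_0)
  then have "((\<lambda>h. poly (pCons 0 p) (inverse h) * exp (- inverse h)) \<longlongrightarrow> 0) (at_right 0)"
    by (rule filterlim_compose[OF _ filterlim_inverse_at_top_right])
  moreover have "\<forall>\<^sub>F h in at_right 0. poly (pCons 0 p) (inverse h) * exp (- inverse h) = flat p h / h"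
    by (rule eventually_at_right_less[THEN eventually_mono])
      (auto simp: flat_def field_simps)
  ultimately have 1: "((\<lambda>h. flat p h / h) \<longlongrightarrow> 0) (at_right 0)"
    using Lim_transform_eventually by fast
  have "((\<lambda>h. flat p h / h) \<longlongrightarrow> 0) (at_left 0)"
    by (rule Lim_transform_eventually[of "\<lambda>_. 0"])
      (auto simp: flat_def eventually_at_filter)
  with 1 show ?thesis by (simp add: filterlim_split_at_real)
qed

text \<open>In the variable x = 1/s the derivative of p(x) exp(-x) is x^2 (p - p')(x) exp(-x), and
  \<open>[:0, 0, 1:]\<close> is x^2. The polynomial factor in \<open>flat\<close> is there to make
  the family closed under differentiation.\<close>

lemma flat_deriv:
  "(flat p has_real_derivative flat ([:0, 0, 1:] * (p - pderiv p)) x) (at x)"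
proof -
  consider "x > 0" | "x < 0" | "x = 0" by linarith
  then show ?thesis
  proof cases
    case 1
    have "((\<lambda>s. poly p (1 / s) * exp (- (1 / s))) has_real_derivative
        flat ([:0, 0, 1:] * (p - pderiv p)) x) (at x)"
      using 1
      by (auto intro!: derivative_eq_intros simp: flat_def field_simps power2_eq_square)
    then show ?thesis
      by (rule has_field_derivative_transform_within_open[of _ _ _ "{0<..}"])
        (use 1 in \<open>auto simp: flat_def\<close>)
  next
    case 2
    have "((\<lambda>s. 0) has_real_derivative flat ([:0, 0, 1:] * (p - pderiv p)) x) (at x)"
      using 2 by (auto simp: flat_def)
    then show ?thesis
      by (rule has_field_derivative_transform_within_open[of _ _ _ "{..<0}"])
        (use 2 in \<open>auto simp: flat_def\<close>)
  next
    case 3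
    then show ?thesis using flat_over_tendsto_0[of p]
      by (simp add: has_field_derivative_iff flat_def)
  qed
qed

lemma smooth_flat: "smooth (flat p)"
proof -
  define q where "q = rec_nat p (\<lambda>_ p. [:0, 0, 1:] * (p - pderiv p))"
  have "C_k k (flat (q 0))" for k
    by (rule C_k_real_seq[where D = "\<lambda>n. flat (q n)"]) (simp only: q_def flat_deriv nat.rec)
  then show ?thesis by (simp add: smooth_def q_def)
qed

section \<open>Mollifiers and a smooth step\<close>

definition mollifier :: "('a::euclidean_space \<Rightarrow> real) \<Rightarrow> bool" where
  "mollifier \<kappa> \<longleftrightarrow> smooth \<kappa> \<and> (\<forall>x. 0 \<le> \<kappa> x) \<and> (\<forall>x. 1 < norm x \<longrightarrow> \<kappa> x = 0) \<and>
     integrable lborel \<kappa> \<and> integral\<^sup>L lborel \<kappa> = 1"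

lemma integrable_continuous_compact_support:
  fixes f :: "'a::euclidean_space \<Rightarrow> real"
  assumes "continuous_on UNIV f" "compact C" "\<And>x. x \<notin> C \<Longrightarrow> f x = 0"
  shows "integrable lborel f"
proof -
  have "integrable lborel (\<lambda>x. indicator C x *\<^sub>R f x)"
    using borel_integrable_compact[OF assms(2)] assms(1) continuous_on_subset by blast
  moreover have "(\<lambda>x. indicator C x *\<^sub>R f x) = f"
    using assms(3) by (intro ext) (metis indicator_simps(1) indicator_simps(2) mult_1 mult_zero_left real_scaleR_def)
  ultimately show ?thesis by simp
qed

text \<open>A product of one-dimensional bumps in the coordinates is smooth by the closure
  properties above, without composing with the norm. The bump \<open>\<beta>\<close> is positive
  exactly on (-1, 1).\<close>

lemma mollifier_exists: "\<exists>\<kappa> :: 'a::euclidean_space \<Rightarrow> real. mollifier \<kappa>"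
proof -
  define \<beta> where "\<beta> s = flat 1 (1 + s) * flat 1 (1 - s)" for s
  \<comment> \<open>Scaling each coordinate by the dimension shrinks the cube of support to side
    2/d; by the l^1 bound on the norm it then lies in the unit ball.\<close>
  define d where "d = real DIM('a)"
  have d: "d > 0" unfolding d_def using DIM_positive by simp
  have sm_\<beta>: "C_k k \<beta>" for k
  proof -
    have "C_k k (\<lambda>s. flat 1 (s + 1) * flat 1 (- s + 1))"
      using smooth_flat C_k_affine[of "\<lambda>s. s" k "flat 1" 1] C_k_affine[of "\<lambda>s. - s" k "flat 1" 1]
      by (intro C_k_mult) (auto simp: smooth_def bounded_linear_minus bounded_linear_ident)
    moreover have "\<beta> = (\<lambda>s. flat 1 (s + 1) * flat 1 (- s + 1))"
      by (auto simp: \<beta>_def add.commute)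
    ultimately show ?thesis by simp
  qed
  define k0 :: "'a \<Rightarrow> real" where "k0 x = (\<Prod>b\<in>Basis. \<beta> (d * (x \<bullet> b)))" for x
  have \<beta>0: "0 \<le> \<beta> s" for s by (simp add: \<beta>_def flat_def)
  have sm: "smooth k0"
    unfolding smooth_def k0_def
  proof (intro allI C_k_prod)
    fix k and b :: 'a assume "b \<in> Basis"
    have "bounded_linear (\<lambda>x::'a. d * (x \<bullet> b))"
      by (intro bounded_linear_const_mult bounded_linear_inner_left)
    from C_k_affine[OF this sm_\<beta>, of k 0] show "C_k k (\<lambda>x. \<beta> (d * (x \<bullet> b)))" by simp
  qed auto
  have nn: "0 \<le> k0 x" for x unfolding k0_def by (intro prod_nonneg) (simp add: \<beta>0)
  have supp: "k0 x = 0" if "1 < norm x" for x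
  proof (rule ccontr)
    assume "k0 x \<noteq> 0"
    then have nz: "\<beta> (d * (x \<bullet> b)) \<noteq> 0" if "b \<in> Basis" for b using that by (auto simp: k0_def)
    have "\<bar>x \<bullet> b\<bar> \<le> 1 / d" if "b \<in> Basis" for b
    proof -
      have "\<bar>d * (x \<bullet> b)\<bar> \<le> 1" using nz[OF that] by (auto simp: \<beta>_def flat_def split: if_splits)
      then show ?thesis using d by (simp add: abs_mult field_simps)
    qed
    then have "(\<Sum>b\<in>Basis. \<bar>x \<bullet> b\<bar>) \<le> (\<Sum>b\<in>(Basis::'a set). 1 / d)" by (intro sum_mono)
    then have "norm x \<le> 1" using norm_le_l1[of x] by (simp add: d_def)
    with that show False by simp
  qed
  have int: "integrable lborel k0"
    by (rule integrable_continuous_compact_support[of _ "cball 0 1"])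
      (auto simp: supp intro: smooth_continuous[OF sm])
  have "integral\<^sup>L lborel k0 \<noteq> 0"
  proof
    assume "integral\<^sup>L lborel k0 = 0"
    then have ae: "AE x in lborel. k0 x = 0"
      using integral_nonneg_eq_0_iff_AE[OF int] nn by simp
    have "open {x. k0 x \<noteq> 0}"
      using smooth_continuous[OF sm, of UNIV] by (intro open_Collect_neq) auto
    moreover have "k0 0 \<noteq> 0" by (simp add: k0_def \<beta>_def flat_def)
    ultimately obtain r where r: "r > 0" "ball 0 r \<subseteq> {x. k0 x \<noteq> 0}"
      unfolding open_contains_ball by blast
    have "AE x in lborel. x \<notin> ball (0::'a) r" using ae by eventually_elim (use r in blast)
    then have "emeasure lborel (ball (0::'a) r) = 0"
      by (subst (asm) AE_iff_measurable[of "ball 0 r"]) auto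
    then have "measure lborel (ball (0::'a) r) = 0" by (simp add: measure_def)
    then show False using content_ball_pos[OF r(1), of "0::'a"] by simp
  qed
  moreover have "integral\<^sup>L lborel k0 \<ge> 0" using nn by simp
  ultimately have pos: "integral\<^sup>L lborel k0 > 0" by simp
  have "smooth (\<lambda>x. (1 / integral\<^sup>L lborel k0) * k0 x)"
    by (rule smooth_mult[OF smooth_const sm])
  then have "mollifier (\<lambda>x. (1 / integral\<^sup>L lborel k0) * k0 x)"
    unfolding mollifier_def using nn supp int pos by auto
  then show ?thesis by blast
qed

text \<open>The derivative of the step is itself a mollifier, so the derivative of a rescaled step
  is \<open>mker\<close>. Testing with a difference of two steps therefore produces averages at the
  two end points.\<close>

lemma smooth_step_exists:
  "\<exists>\<Psi> \<kappa> :: real \<Rightarrow> real. smooth \<Psi> \<and> mollifier \<kappa> \<and> (\<forall>s. (\<Psi> has_real_derivative \<kappa> s) (at s)) \<and>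
     (\<forall>s\<le>-1. \<Psi> s = 0) \<and> (\<forall>s\<ge>1. \<Psi> s = 1) \<and> (\<forall>s. 0 \<le> \<Psi> s \<and> \<Psi> s \<le> 1)"
proof -
  obtain \<kappa> :: "real \<Rightarrow> real" where \<kappa>: "mollifier \<kappa>" using mollifier_exists by blast
  have cont: "continuous_on A \<kappa>" for A using \<kappa> smooth_continuous by (auto simp: mollifier_def)
  have out: "\<kappa> s = 0" if "\<bar>s\<bar> > 1" for s using \<kappa> that by (auto simp: mollifier_def)
  \<comment> \<open>Starting at -2 keeps -1 in the interior of the interval of integration, where
    the two-sided derivative is available.\<close>
  define \<Psi> where "\<Psi> s = integral {-2..s} \<kappa>" for s
  have z: "\<Psi> s = 0" if "s \<le> -1" for s
  proof -
    \<comment> \<open>\<open>mollifier\<close> says nothing about points of norm exactly 1, so the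
      point -1 is discarded as a null set.\<close>
    have "integral {-2..s} \<kappa> = integral {-2..s} (\<lambda>x. 0)"
      by (rule integral_spike[of "{-1}"]) (use that in \<open>auto intro!: out\<close>)
    then show ?thesis by (simp add: \<Psi>_def)
  qed
  have d: "(\<Psi> has_real_derivative \<kappa> s) (at s)" for s
  proof (cases "s < -1")
    case True
    have "((\<lambda>s. 0) has_real_derivative \<kappa> s) (at s)" using out[of s] True by simp
    then show ?thesis
      by (rule has_field_derivative_transform_within_open[of _ _ _ "{..<-1}"])
        (use True in \<open>auto simp: z\<close>)
  next
    case False
    have "(\<Psi> has_real_derivative \<kappa> s) (at s within {-2..s+1})"
      unfolding \<Psi>_def by (rule integral_has_real_derivative) (use False cont in auto)
    then show ?thesis using False by (simp add: at_within_Icc_at)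
  qed
  have mono: "mono \<Psi>"
    using d \<kappa> by (intro monoI) (rule DERIV_nonneg_imp_nondecreasing, auto simp: mollifier_def)
  have o: "\<Psi> s = 1" if "s \<ge> 1" for s
  proof -
    have "(\<kappa> has_integral 1) UNIV"
      using \<kappa> has_integral_integral_lborel[of \<kappa>] by (simp add: mollifier_def)
    then have "(\<kappa> has_integral 1) {-2..s}"
      using has_integral_restrict_UNIV[of "{-2..s}" \<kappa> 1] that out
      by (smt (verit) atLeastAtMost_iff has_integral_eq)
    then show ?thesis by (simp add: \<Psi>_def integral_unique)
  qed
  have b: "0 \<le> \<Psi> s \<and> \<Psi> s \<le> 1" for s
    using monoD[OF mono, of s 1] monoD[OF mono, of "-1" s] z[of "-1"] z[of s] o[of s] o[of 1]
    by (cases "s \<le> -1"; cases "s \<ge> 1") auto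
  have "smooth \<Psi>"
    unfolding smooth_def
  proof
    fix k
    have "dir_deriv 1 \<Psi> = \<kappa>" using dir_deriv_real[OF d] by auto
    then have "C_k (Suc k) \<Psi>" using d \<kappa>
      by (auto simp: Basis_real_def real_differentiable_def mollifier_def smooth_def)
    then show "C_k k \<Psi>" by (rule C_k_SucD)
  qed
  with \<kappa> d z o b show ?thesis by blast
qed

section \<open>Lebesgue measure on subsets and products\<close>

lemma AE_lebesgue_on_iff:
  "S \<in> sets lebesgue \<Longrightarrow> (AE x in lebesgue_on S. P x) \<longleftrightarrow> (AE x in lborel. x \<in> S \<longrightarrow> P x)"
  by (simp add: AE_restrict_space_iff AE_completion_iff)

text \<open>This is the completeness of Lebesgue measure.\<close>

lemma borel_measurable_lebesgue_on_AE:
  fixes f g :: "'a::euclidean_space \<Rightarrow> 'b::euclidean_space"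
  assumes S: "S \<in> sets lebesgue" and g: "g \<in> borel_measurable (lebesgue_on S)"
    and ae: "AE x in lebesgue_on S. f x = g x"
  shows "f \<in> borel_measurable (lebesgue_on S)"
proof -
  have "(\<lambda>x. if x \<in> S then f x else 0) \<in> borel_measurable lebesgue"
  proof (rule borel_measurable_AE)
    show "(\<lambda>x. if x \<in> S then g x else 0) \<in> borel_measurable lebesgue"
      using g S borel_measurable_if by blast
    have "AE x in lebesgue. x \<in> S \<longrightarrow> f x = g x"
      using ae S by (simp add: AE_restrict_space_iff)
    then show "AE x in lebesgue. (if x \<in> S then g x else 0) = (if x \<in> S then f x else 0)"
      by eventually_elim auto
  qed
  then show ?thesis using S borel_measurable_if by blast
qed

text \<open>Measurability of f comes from completeness, not from the hypotheses. This is what allows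
  functions known only almost everywhere, such as the representatives chosen by
  \<open>weak_grad\<close>, under the integral.\<close>

lemma lebesgue_on_cong_AE:
  fixes f g :: "'a::euclidean_space \<Rightarrow> 'b::euclidean_space"
  assumes S: "S \<in> sets lebesgue" and g: "integrable (lebesgue_on S) g"
    and ae: "AE x in lebesgue_on S. f x = g x"
  shows "integrable (lebesgue_on S) f"
    and "integral\<^sup>L (lebesgue_on S) f = integral\<^sup>L (lebesgue_on S) g"
proof -
  have "f \<in> borel_measurable (lebesgue_on S)"
    using borel_measurable_lebesgue_on_AE[OF S borel_measurable_integrable[OF g] ae] .
  with assms show "integrable (lebesgue_on S) f"
    "integral\<^sup>L (lebesgue_on S) f = integral\<^sup>L (lebesgue_on S) g"
    by (auto intro!: integrable_cong_AE_imp[of _ g] integral_cong_AE)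
qed

lemma borel_on_lebesgue_on: "f \<in> borel_measurable borel \<Longrightarrow> f \<in> borel_measurable (lebesgue_on S)"
  by (intro measurable_restrict_space1) (auto intro: measurable_completion simp: measurable_lborel1)

lemma lebesgue_on_borel_rep:
  fixes f :: "'a::euclidean_space \<Rightarrow> real"
  assumes S: "S \<in> sets lebesgue" and f: "f \<in> borel_measurable (lebesgue_on S)"
  obtains g where "g \<in> borel_measurable borel" "AE x in lebesgue_on S. f x = g x"
proof -
  have "(\<lambda>x. if x \<in> S then f x else 0) \<in> borel_measurable lebesgue"
    using f S borel_measurable_if by blast
  from completion_ex_borel_measurable_real[OF this] obtain g
    where g: "g \<in> borel_measurable borel" "AE x in lborel. (if x \<in> S then f x else 0) = g x" by auto
  from g(2) have "AE x in lebesgue_on S. f x = g x"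
    unfolding AE_lebesgue_on_iff[OF S] by eventually_elim auto
  with g that show ?thesis by blast
qed

text \<open>The predicate need not be measurable, so the order of the variables is exchanged for the
  complement of a measurable null set N that covers the exceptional set.\<close>

lemma AE_lborel_pair_swap:
  fixes P :: "'a::euclidean_space \<times> 'b::euclidean_space \<Rightarrow> bool"
  assumes "AE z in lborel. P z"
  shows "AE x in lborel. AE y in lborel. P (x, y)" "AE y in lborel. AE x in lborel. P (x, y)"
proof -
  have a: "AE z in lborel \<Otimes>\<^sub>M lborel. P z" using assms unfolding lborel_prod .
  show "AE x in lborel. AE y in lborel. P (x, y)" by (rule lborel_pair.AE_pair[OF a])
  obtain N where N: "N \<in> null_sets (lborel \<Otimes>\<^sub>M lborel)" "{z. \<not> P z} \<subseteq> N"
    using a by (auto simp: eventually_ae_filter space_pair_measure)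
  have "AE x in lborel. AE y in lborel. (x, y) \<notin> N"
    by (rule lborel_pair.AE_pair) (rule AE_not_in[OF N(1)])
  moreover have "{z \<in> space (lborel \<Otimes>\<^sub>M lborel). (fst z, snd z) \<notin> N} = space (lborel \<Otimes>\<^sub>M lborel) - N"
    by auto
  then have "{z \<in> space (lborel \<Otimes>\<^sub>M lborel). (fst z, snd z) \<notin> N} \<in> sets (lborel \<Otimes>\<^sub>M lborel)"
    using N(1) sets.compl_sets by (metis null_setsD2)
  ultimately have "AE y in lborel. AE x in lborel. (x, y) \<notin> N"
    using lborel_pair.AE_commute[of "\<lambda>x y. (x, y) \<notin> N"] by blast
  then show "AE y in lborel. AE x in lborel. P (x, y)"
    by (rule eventually_mono) (erule eventually_mono, use N(2) in blast)
qed

lemma borel_Times_lebesgue: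
  "A \<in> sets borel \<Longrightarrow> B \<in> sets borel \<Longrightarrow>
    (A :: 'a::euclidean_space set) \<times> (B :: 'b::euclidean_space set) \<in> sets lebesgue"
  using borel_Times[of A B] by (auto intro: sets_completionI_sets)

lemma AE_lebesgue_on_Times:
  fixes A :: "'a::euclidean_space set" and B :: "'b::euclidean_space set"
  assumes A: "A \<in> sets borel" and B: "B \<in> sets borel" and ae: "AE z in lebesgue_on (A \<times> B). P z"
  shows "AE x in lebesgue_on A. AE y in lebesgue_on B. P (x, y)"
    "AE y in lebesgue_on B. AE x in lebesgue_on A. P (x, y)"
proof -
  have ms: "A \<in> sets lebesgue" "B \<in> sets lebesgue" using A B by auto
  have "AE z in lborel. z \<in> A \<times> B \<longrightarrow> P z"
    using ae borel_Times_lebesgue[OF A B] by (simp add: AE_lebesgue_on_iff)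
  note * = AE_lborel_pair_swap[OF this]
  show "AE x in lebesgue_on A. AE y in lebesgue_on B. P (x, y)"
    unfolding AE_lebesgue_on_iff[OF ms(1)] AE_lebesgue_on_iff[OF ms(2)]
    using *(1) by eventually_elim (auto elim: eventually_mono)
  show "AE y in lebesgue_on B. AE x in lebesgue_on A. P (x, y)"
    unfolding AE_lebesgue_on_iff[OF ms(1)] AE_lebesgue_on_iff[OF ms(2)]
    using *(2) by eventually_elim (auto elim: eventually_mono)
qed

lemma integral_lebesgue_on_indicator:
  fixes g :: "'a::euclidean_space \<Rightarrow> real"
  assumes "S \<in> sets borel" "g \<in> borel_measurable borel"
  shows "integrable (lebesgue_on S) g \<longleftrightarrow> integrable lborel (\<lambda>x. indicator S x * g x)"
    and "integral\<^sup>L (lebesgue_on S) g = (\<integral>x. indicator S x * g x \<partial>lborel)"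
proof -
  have m: "(\<lambda>x. indicator S x * g x) \<in> borel_measurable lborel" using assms by simp
  have S: "S \<in> sets lebesgue" using assms by auto
  show "integrable (lebesgue_on S) g \<longleftrightarrow> integrable lborel (\<lambda>x. indicator S x * g x)"
    using integrable_restrict_space[of S lebesgue g] integrable_completion[OF m] S by simp
  show "integral\<^sup>L (lebesgue_on S) g = (\<integral>x. indicator S x * g x \<partial>lborel)"
    using integral_restrict_space[of S lebesgue g] integral_completion[OF m] S by simp
qed

text \<open>Lebesgue measure on a product is only the completion of the product of the two Lebesgue
  measures. Fubini is therefore applied to a Borel representative g with respect to
  \<open>lborel\<close>, and for almost every point the sections of f and g agree almost
  everywhere.\<close>

lemma lebesgue_on_Times_Fubini:
  fixes A :: "'a::euclidean_space set" and B :: "'b::euclidean_space set"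
    and f :: "'a \<times> 'b \<Rightarrow> real"
  assumes A: "A \<in> sets borel" and B: "B \<in> sets borel" and f: "integrable (lebesgue_on (A \<times> B)) f"
  shows "AE x in lebesgue_on A. integrable (lebesgue_on B) (\<lambda>y. f (x, y))"
    and "integrable (lebesgue_on A) (\<lambda>x. \<integral>y. f (x, y) \<partial>lebesgue_on B)"
    and "(\<integral>x. (\<integral>y. f (x, y) \<partial>lebesgue_on B) \<partial>lebesgue_on A) = integral\<^sup>L (lebesgue_on (A \<times> B)) f"
    and "AE y in lebesgue_on B. integrable (lebesgue_on A) (\<lambda>x. f (x, y))"
    and "integrable (lebesgue_on B) (\<lambda>y. \<integral>x. f (x, y) \<partial>lebesgue_on A)"
    and "(\<integral>y. (\<integral>x. f (x, y) \<partial>lebesgue_on A) \<partial>lebesgue_on B) = integral\<^sup>L (lebesgue_on (A \<times> B)) f"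
proof -
  have ms: "A \<in> sets lebesgue" "B \<in> sets lebesgue" using A B by auto
  have AB: "A \<times> B \<in> sets borel" using A B by (simp add: borel_Times)
  have ABl: "A \<times> B \<in> sets lebesgue" using borel_Times_lebesgue[OF A B] .
  obtain g where g[measurable]: "g \<in> borel_measurable borel"
    and fg: "AE z in lebesgue_on (A \<times> B). f z = g z"
    using lebesgue_on_borel_rep[OF ABl] f by blast
  have gf: "AE z in lebesgue_on (A \<times> B). g z = f z" using fg by eventually_elim simp
  have gi: "integrable (lebesgue_on (A \<times> B)) g"
    by (rule lebesgue_on_cong_AE(1)[OF ABl f gf])
  have gI: "integral\<^sup>L (lebesgue_on (A \<times> B)) f = integral\<^sup>L (lebesgue_on (A \<times> B)) g"
    using lebesgue_on_cong_AE(2)[OF ABl f gf] by simp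
  define h where "h z = indicator (A \<times> B) z * g z" for z
  have hint: "integrable lborel h" "integral\<^sup>L lborel h = integral\<^sup>L (lebesgue_on (A \<times> B)) g"
    using gi integral_lebesgue_on_indicator[OF AB g] unfolding h_def by auto
  have hi: "integrable (lborel \<Otimes>\<^sub>M lborel) (case_prod (\<lambda>x y. h (x, y)))"
    using hint by (simp add: lborel_prod)
  have gm1: "(\<lambda>y. g (x, y)) \<in> borel_measurable borel" and gm2: "(\<lambda>x. g (x, y)) \<in> borel_measurable borel" for x y
    by (intro measurable_compose[OF _ g] borel_measurable_Pair measurable_const measurable_ident_sets refl;
      simp)+
  have h1: "h (x, y) = indicator A x * (indicator B y * g (x, y))" for x y
    by (simp add: h_def indicator_times)
  have h2: "h (x, y) = indicator B y * (indicator A x * g (x, y))" for x y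
    by (simp add: h_def indicator_times)
  have I1: "(\<integral>y. h (x, y) \<partial>lborel) = indicator A x * (\<integral>y. g (x, y) \<partial>lebesgue_on B)" for x
    using integral_lebesgue_on_indicator(2)[OF B gm1] by (simp add: h1)
  have I2: "(\<integral>x. h (x, y) \<partial>lborel) = indicator B y * (\<integral>x. g (x, y) \<partial>lebesgue_on A)" for y
    using integral_lebesgue_on_indicator(2)[OF A gm2] by (simp add: h2)
  have ae1: "AE x in lebesgue_on A. integrable (lebesgue_on B) (\<lambda>y. g (x, y))"
    unfolding AE_lebesgue_on_iff[OF ms(1)] using lborel_pair.AE_integrable_fst[OF hi]
    by eventually_elim (auto simp: h1 integral_lebesgue_on_indicator(1)[OF B gm1])
  have ae2: "AE y in lebesgue_on B. integrable (lebesgue_on A) (\<lambda>x. g (x, y))"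
    unfolding AE_lebesgue_on_iff[OF ms(2)] using lborel_pair.AE_integrable_snd[OF hi]
    by eventually_elim (auto simp: h2 integral_lebesgue_on_indicator(1)[OF A gm2])
  have m1: "(\<lambda>x. \<integral>y. g (x, y) \<partial>lebesgue_on B) \<in> borel_measurable borel"
    unfolding integral_lebesgue_on_indicator(2)[OF B gm1] 
    using B by measurable
  have m2: "(\<lambda>y. \<integral>x. g (x, y) \<partial>lebesgue_on A) \<in> borel_measurable borel"
    unfolding integral_lebesgue_on_indicator(2)[OF A gm2]
    using A by measurable
  have G1: "integrable (lebesgue_on A) (\<lambda>x. \<integral>y. g (x, y) \<partial>lebesgue_on B)"
    using lborel_pair.integrable_fst[OF hi] by (simp add: integral_lebesgue_on_indicator(1)[OF A m1] I1)
  have G2: "integrable (lebesgue_on B) (\<lambda>y. \<integral>x. g (x, y) \<partial>lebesgue_on A)"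
    using lborel_pair.integrable_snd[OF hi] by (simp add: integral_lebesgue_on_indicator(1)[OF B m2] I2)
  have H1: "(\<integral>x. (\<integral>y. g (x, y) \<partial>lebesgue_on B) \<partial>lebesgue_on A) = integral\<^sup>L (lebesgue_on (A \<times> B)) g"
    using lborel_pair.integral_fst[OF hi] hint(2) by (simp add: integral_lebesgue_on_indicator(2)[OF A m1] I1 lborel_prod)
  have H2: "(\<integral>y. (\<integral>x. g (x, y) \<partial>lebesgue_on A) \<partial>lebesgue_on B) = integral\<^sup>L (lebesgue_on (A \<times> B)) g"
    using lborel_pair.integral_snd[OF hi] hint(2) by (simp add: integral_lebesgue_on_indicator(2)[OF B m2] I2 lborel_prod)
  have c1: "AE x in lebesgue_on A. integrable (lebesgue_on B) (\<lambda>y. f (x, y)) \<and>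
      (\<integral>y. f (x, y) \<partial>lebesgue_on B) = (\<integral>y. g (x, y) \<partial>lebesgue_on B)"
    using AE_lebesgue_on_Times(1)[OF A B fg] ae1
    by eventually_elim (auto intro: lebesgue_on_cong_AE[OF ms(2)])
  have c2: "AE y in lebesgue_on B. integrable (lebesgue_on A) (\<lambda>x. f (x, y)) \<and>
      (\<integral>x. f (x, y) \<partial>lebesgue_on A) = (\<integral>x. g (x, y) \<partial>lebesgue_on A)"
    using AE_lebesgue_on_Times(2)[OF A B fg] ae2
    by eventually_elim (auto intro: lebesgue_on_cong_AE[OF ms(1)])
  show "AE x in lebesgue_on A. integrable (lebesgue_on B) (\<lambda>y. f (x, y))"
    using c1 by eventually_elim auto
  show "AE y in lebesgue_on B. integrable (lebesgue_on A) (\<lambda>x. f (x, y))"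
    using c2 by eventually_elim auto
  have c1': "AE x in lebesgue_on A. (\<integral>y. f (x, y) \<partial>lebesgue_on B) = (\<integral>y. g (x, y) \<partial>lebesgue_on B)"
    using c1 by eventually_elim auto
  have c2': "AE y in lebesgue_on B. (\<integral>x. f (x, y) \<partial>lebesgue_on A) = (\<integral>x. g (x, y) \<partial>lebesgue_on A)"
    using c2 by eventually_elim auto
  show "integrable (lebesgue_on A) (\<lambda>x. \<integral>y. f (x, y) \<partial>lebesgue_on B)"
    by (rule lebesgue_on_cong_AE(1)[OF ms(1) G1 c1'])
  show "integrable (lebesgue_on B) (\<lambda>y. \<integral>x. f (x, y) \<partial>lebesgue_on A)"
    by (rule lebesgue_on_cong_AE(1)[OF ms(2) G2 c2'])
  show "(\<integral>x. (\<integral>y. f (x, y) \<partial>lebesgue_on B) \<partial>lebesgue_on A) = integral\<^sup>L (lebesgue_on (A \<times> B)) f"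
    using lebesgue_on_cong_AE(2)[OF ms(1) G1 c1'] H1 gI by simp
  show "(\<integral>y. (\<integral>x. f (x, y) \<partial>lebesgue_on A) \<partial>lebesgue_on B) = integral\<^sup>L (lebesgue_on (A \<times> B)) f"
    using lebesgue_on_cong_AE(2)[OF ms(2) G2 c2'] H2 gI by simp
qed

text \<open>A cylinder over a null set is null, even when the other factor is the whole
  space.\<close>

lemma AE_lebesgue_on_fst_snd:
  fixes A :: "'a::euclidean_space set" and B :: "'b::euclidean_space set"
  assumes A: "A \<in> sets borel" and B: "B \<in> sets borel"
  shows "AE x in lebesgue_on A. P x \<Longrightarrow> AE z in lebesgue_on (A \<times> B). P (fst z)"
    and "AE y in lebesgue_on B. Q y \<Longrightarrow> AE z in lebesgue_on (A \<times> B). Q (snd z)"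
proof -
  have ms: "A \<in> sets lebesgue" "B \<in> sets lebesgue" "A \<times> B \<in> sets lebesgue"
    using A B borel_Times_lebesgue by auto
  show "AE z in lebesgue_on (A \<times> B). P (fst z)" if P: "AE x in lebesgue_on A. P x"
  proof -
    obtain N where N: "N \<in> null_sets lborel" "{x. \<not> (x \<in> A \<longrightarrow> P x)} \<subseteq> N"
      using P unfolding AE_lebesgue_on_iff[OF ms(1)] by (auto simp: eventually_ae_filter)
    have "emeasure (lborel \<Otimes>\<^sub>M lborel) (N \<times> (UNIV :: 'b set)) = 0"
      using N(1) by (subst lborel.emeasure_pair_measure_Times) (auto simp: null_sets_def)
    then have "N \<times> (UNIV :: 'b set) \<in> null_sets lborel"
      using N(1) by (auto simp: null_sets_def lborel_prod intro!: borel_Times)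
    from AE_not_in[OF this] show ?thesis
      unfolding AE_lebesgue_on_iff[OF ms(3)] by eventually_elim (use N(2) in auto)
  qed
  show "AE z in lebesgue_on (A \<times> B). Q (snd z)" if Q: "AE x in lebesgue_on B. Q x"
  proof -
    obtain N where N: "N \<in> null_sets lborel" "{x. \<not> (x \<in> B \<longrightarrow> Q x)} \<subseteq> N"
      using Q unfolding AE_lebesgue_on_iff[OF ms(2)] by (auto simp: eventually_ae_filter)
    have "emeasure (lborel \<Otimes>\<^sub>M lborel) ((UNIV :: 'a set) \<times> N) = 0"
      using N(1) by (subst lborel.emeasure_pair_measure_Times) (auto simp: null_sets_def)
    then have "(UNIV :: 'a set) \<times> N \<in> null_sets lborel"
      using N(1) by (auto simp: null_sets_def lborel_prod intro!: borel_Times)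
    from AE_not_in[OF this] show ?thesis
      unfolding AE_lebesgue_on_iff[OF ms(3)] by eventually_elim (use N(2) in auto)
  qed
qed

text \<open>Lebesgue measurability does not survive an arbitrary continuous substitution. It
  survives a projection because cylinders over null sets are null.\<close>

lemma borel_measurable_lebesgue_on_snd:
  fixes A :: "'a::euclidean_space set" and B :: "'b::euclidean_space set" and g :: "'b \<Rightarrow> real"
  assumes A: "A \<in> sets borel" and B: "B \<in> sets borel" and g: "g \<in> borel_measurable (lebesgue_on B)"
  shows "(\<lambda>z. g (snd z)) \<in> borel_measurable (lebesgue_on (A \<times> B))"
proof -
  have "B \<in> sets lebesgue" using B by auto
  then obtain g' where g': "g' \<in> borel_measurable borel" and "AE x in lebesgue_on B. g x = g' x"
    using lebesgue_on_borel_rep[OF _ g] by blast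
  then have "AE z in lebesgue_on (A \<times> B). g (snd z) = g' (snd z)"
    using AE_lebesgue_on_fst_snd(2)[OF A B] by blast
  then show ?thesis
    by (rule borel_measurable_lebesgue_on_AE[OF borel_Times_lebesgue[OF A B], rotated])
      (intro borel_on_lebesgue_on measurable_compose[OF _ g'] borel_measurable_continuous_onI
        continuous_on_snd continuous_on_id)
qed

section \<open>Square integrable functions\<close>

lemma L_two_mult:
  assumes "L_two S f" "L_two S g"
  shows "integrable (lebesgue_on S) (\<lambda>x. f x * g x)"
proof (rule Bochner_Integration.integrable_bound)
  show "integrable (lebesgue_on S) (\<lambda>x. (f x)\<^sup>2 + (g x)\<^sup>2)"
    using assms by (auto simp: L_two_def)
  show "(\<lambda>x. f x * g x) \<in> borel_measurable (lebesgue_on S)"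
    using assms by (auto simp: L_two_def)
  have "\<bar>a * b\<bar> \<le> a\<^sup>2 + b\<^sup>2" for a b :: real
  proof -
    have "2 * \<bar>a * b\<bar> \<le> a\<^sup>2 + b\<^sup>2" using sum_squares_bound[of "\<bar>a\<bar>" "\<bar>b\<bar>"] by (simp add: abs_mult)
    then show ?thesis by (smt (verit) abs_ge_zero)
  qed
  then show "AE x in lebesgue_on S. norm (f x * g x) \<le> norm ((f x)\<^sup>2 + (g x)\<^sup>2)" by (simp add: )
qed

lemma L_two_bound:
  assumes "L_two S f" "g \<in> borel_measurable (lebesgue_on S)" "AE x in lebesgue_on S. \<bar>g x\<bar> \<le> C * \<bar>f x\<bar>"
  shows "L_two S g"
  unfolding L_two_def
proof (rule conjI[OF assms(2)], rule Bochner_Integration.integrable_bound)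
  show "integrable (lebesgue_on S) (\<lambda>x. C\<^sup>2 * (f x)\<^sup>2)" using assms(1) by (simp add: L_two_def)
  show "(\<lambda>x. (g x)\<^sup>2) \<in> borel_measurable (lebesgue_on S)" using assms(2) by simp
  show "AE x in lebesgue_on S. norm ((g x)\<^sup>2) \<le> norm (C\<^sup>2 * (f x)\<^sup>2)"
    using assms(3)
  proof eventually_elim
    case (elim x)
    then have "\<bar>g x\<bar>\<^sup>2 \<le> (C * \<bar>f x\<bar>)\<^sup>2" by (intro power_mono) auto
    then show ?case by (simp add: power_mult_distrib)
  qed
qed

lemma L_two_cmult: "L_two S f \<Longrightarrow> L_two S (\<lambda>x. c * f x)"
  by (rule L_two_bound[where C = "\<bar>c\<bar>"]) (auto simp: L_two_def abs_mult)

lemma L_two_add: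
  assumes "L_two S f" "L_two S g"
  shows "L_two S (\<lambda>x. f x + g x)"
proof -
  have "integrable (lebesgue_on S) (\<lambda>x. (f x)\<^sup>2 + (g x)\<^sup>2 + 2 * (f x * g x))"
    using assms L_two_mult[OF assms] by (auto simp: L_two_def)
  then have "integrable (lebesgue_on S) (\<lambda>x. (f x + g x)\<^sup>2)"
    by (simp add: power2_sum algebra_simps)
  then show ?thesis using assms by (auto simp: L_two_def)
qed

lemma L_two_diff: "L_two S f \<Longrightarrow> L_two S g \<Longrightarrow> L_two S (\<lambda>x. f x - g x)"
  using L_two_add[of S f "\<lambda>x. - 1 * g x"] L_two_cmult[of S g "-1"] by simp

lemma integrable_bounded_lebesgue_on:
  fixes f :: "'a::euclidean_space \<Rightarrow> 'b::{banach, second_countable_topology}"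
  assumes "S \<in> lmeasurable" "f \<in> borel_measurable (lebesgue_on S)" "AE x in lebesgue_on S. norm (f x) \<le> C"
  shows "integrable (lebesgue_on S) f"
proof -
  interpret finite_measure "lebesgue_on S" using finite_measure_lebesgue_on[OF assms(1)] .
  show ?thesis using integrable_const_bound assms(2,3) by blast
qed

lemma integrable_const_lebesgue_on: "S \<in> lmeasurable \<Longrightarrow> integrable (lebesgue_on S) (\<lambda>x. c::real)"
  by (rule integrable_bounded_lebesgue_on[where C = "\<bar>c\<bar>"]) auto

lemma L_two_bounded:
  assumes "S \<in> lmeasurable" "f \<in> borel_measurable (lebesgue_on S)" "AE x in lebesgue_on S. \<bar>f x\<bar> \<le> C"
  shows "L_two S f"
proof -
  have "L_two S (\<lambda>x. 1)" using integrable_const_lebesgue_on[OF assms(1)] by (simp add: L_two_def)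
  then show ?thesis by (rule L_two_bound[OF _ assms(2), of _ C]) (use assms(3) in simp)
qed

lemma L_two_integrable: "S \<in> lmeasurable \<Longrightarrow> L_two S f \<Longrightarrow> integrable (lebesgue_on S) f"
  using L_two_mult[of S f "\<lambda>x. 1"] L_two_bounded[of S "\<lambda>x. 1" 1] by simp

lemma L_two_mult_bounded:
  assumes "L_two S f" "g \<in> borel_measurable (lebesgue_on S)" "AE x in lebesgue_on S. \<bar>g x\<bar> \<le> C"
  shows "L_two S (\<lambda>x. g x * f x)"
proof (rule L_two_bound[OF assms(1), where C = C])
  show "(\<lambda>x. g x * f x) \<in> borel_measurable (lebesgue_on S)"
    using assms by (intro borel_measurable_times) (simp_all add: L_two_def)
  show "AE x in lebesgue_on S. \<bar>g x * f x\<bar> \<le> C * \<bar>f x\<bar>"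
    using assms(3) by eventually_elim (simp add: abs_mult mult_right_mono)
qed

lemma integrable_mult_bounded:
  fixes f g :: "'a::euclidean_space \<Rightarrow> real"
  assumes "integrable (lebesgue_on S) f" "g \<in> borel_measurable (lebesgue_on S)"
    "AE x in lebesgue_on S. \<bar>g x\<bar> \<le> C"
  shows "integrable (lebesgue_on S) (\<lambda>x. g x * f x)"
proof (rule Bochner_Integration.integrable_bound)
  show "integrable (lebesgue_on S) (\<lambda>x. C * f x)" using assms by simp
  show "AE x in lebesgue_on S. norm (g x * f x) \<le> norm (C * f x)"
    using assms(3) by eventually_elim (auto simp: abs_mult intro!: mult_right_mono)
qed (use assms in auto)

text \<open>Integrate \<open>2 \<bar>v u\<bar> \<le> \<epsilon> v\<^sup>2 + u\<^sup>2 / \<epsilon>\<close>.\<close>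

lemma L_two_tendsto_weak:
  assumes "\<And>n. L_two S (u n)" "L_two S v" "(\<lambda>n. \<integral>x. (u n x)\<^sup>2 \<partial>lebesgue_on S) \<longlonglongrightarrow> 0"
  shows "(\<lambda>n. \<integral>x. \<bar>v x * u n x\<bar> \<partial>lebesgue_on S) \<longlonglongrightarrow> 0"
proof (rule LIMSEQ_I)
  fix r :: real assume r: "r > 0"
  define I where "I = (\<integral>x. (v x)\<^sup>2 \<partial>lebesgue_on S)"
  have I: "I \<ge> 0" unfolding I_def by simp
  \<comment> \<open>Gives e I < r, also when I = 0.\<close>
  define e where "e = r / (I + 1)"
  have e: "e > 0" using r I by (simp add: e_def)
  have eI: "e * I < r" using r I by (simp add: e_def field_simps)
  have "\<forall>\<^sub>F n in sequentially. (\<integral>x. (u n x)\<^sup>2 \<partial>lebesgue_on S) < e * r"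
    using order_tendstoD(2)[OF assms(3), of "e * r"] e r by simp
  then obtain N where N: "\<And>n. n \<ge> N \<Longrightarrow> (\<integral>x. (u n x)\<^sup>2 \<partial>lebesgue_on S) < e * r"
    by (auto simp: eventually_sequentially)
  show "\<exists>N. \<forall>n\<ge>N. norm ((\<integral>x. \<bar>v x * u n x\<bar> \<partial>lebesgue_on S) - 0) < r"
  proof (intro exI allI impI)
    fix n assume n: "n \<ge> N"
    have "(\<integral>x. \<bar>v x * u n x\<bar> \<partial>lebesgue_on S) \<le> (\<integral>x. (e * (v x)\<^sup>2 + (u n x)\<^sup>2 / e) / 2 \<partial>lebesgue_on S)"
    proof (rule integral_mono)
      show "integrable (lebesgue_on S) (\<lambda>x. \<bar>v x * u n x\<bar>)"
        using L_two_mult[OF assms(2,1)] by simp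
      show "integrable (lebesgue_on S) (\<lambda>x. (e * (v x)\<^sup>2 + (u n x)\<^sup>2 / e) / 2)"
        using assms(1)[of n] assms(2) by (simp add: L_two_def)
      fix x
      have "0 \<le> (e * \<bar>v x\<bar> - \<bar>u n x\<bar>)\<^sup>2" by simp
      then have "2 * e * \<bar>v x * u n x\<bar> \<le> e\<^sup>2 * (v x)\<^sup>2 + (u n x)\<^sup>2"
        by (simp add: power2_diff power_mult_distrib abs_mult)
      then show "\<bar>v x * u n x\<bar> \<le> (e * (v x)\<^sup>2 + (u n x)\<^sup>2 / e) / 2"
        using e by (simp add: field_simps power2_eq_square)
    qed
    also have "\<dots> = (e * I + (\<integral>x. (u n x)\<^sup>2 \<partial>lebesgue_on S) / e) / 2"
      using assms(1)[of n] assms(2) by (simp add: L_two_def I_def)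
    also have "\<dots> < r"
    proof -
      have "(\<integral>x. (u n x)\<^sup>2 \<partial>lebesgue_on S) / e < r" using N[OF n] e by (simp add: field_simps)
      with eI show ?thesis by simp
    qed
    finally show "norm ((\<integral>x. \<bar>v x * u n x\<bar> \<partial>lebesgue_on S) - 0) < r" by simp
  qed
qed

lemma tendsto_0_if_abs_integral_tendsto_0:
  fixes f :: "nat \<Rightarrow> 'a \<Rightarrow> real"
  assumes "(\<lambda>n. \<integral>x. \<bar>f n x\<bar> \<partial>M) \<longlonglongrightarrow> 0"
  shows "(\<lambda>n. \<integral>x. f n x \<partial>M) \<longlonglongrightarrow> 0"
proof (rule Lim_null_comparison[OF _ assms], rule always_eventually, rule allI)
  show "norm (\<integral>x. f n x \<partial>M) \<le> (\<integral>x. \<bar>f n x\<bar> \<partial>M)" for n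
    using integral_abs_bound[of M "f n"] by simp
qed

lemma L_two_tendsto_integral:
  assumes "\<And>n. L_two S (u n)" "L_two S f" "L_two S v"
    "(\<lambda>n. \<integral>x. (u n x - f x)\<^sup>2 \<partial>lebesgue_on S) \<longlonglongrightarrow> 0"
  shows "(\<lambda>n. \<integral>x. v x * u n x \<partial>lebesgue_on S) \<longlonglongrightarrow> (\<integral>x. v x * f x \<partial>lebesgue_on S)"
proof -
  have "(\<lambda>n. \<integral>x. v x * (u n x - f x) \<partial>lebesgue_on S) \<longlonglongrightarrow> 0"
    by (rule tendsto_0_if_abs_integral_tendsto_0, rule L_two_tendsto_weak[OF _ assms(3,4)])
      (rule L_two_diff[OF assms(1,2)])
  moreover have "(\<integral>x. v x * (u n x - f x) \<partial>lebesgue_on S) =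
      (\<integral>x. v x * u n x \<partial>lebesgue_on S) - (\<integral>x. v x * f x \<partial>lebesgue_on S)" for n
    using L_two_mult[OF assms(3,1), of n] L_two_mult[OF assms(3,2)] by (simp add: right_diff_distrib)
  ultimately show ?thesis by (simp add: LIM_zero_cancel)
qed

text \<open>First f is truncated at height n. The truncation c n f is then approximated by c n (G
  k), where the continuous G k converge to f almost everywhere: applying the same truncation to G k
  keeps continuity and supplies the constant bound for dominated convergence.\<close>

lemma L_two_dense_continuous:
  fixes f :: "'a::euclidean_space \<Rightarrow> real"
  assumes S: "S \<in> lmeasurable" and f: "L_two S f" and e: "e > 0"
  obtains g B where "continuous_on UNIV g" "\<And>x. \<bar>g x\<bar> \<le> B" "(\<integral>x. (f x - g x)\<^sup>2 \<partial>lebesgue_on S) < e"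
proof -
  have Sm: "S \<in> sets lebesgue" using S by auto
  have fm[measurable]: "f \<in> borel_measurable (lebesgue_on S)" using f by (simp add: L_two_def)
  define c where "c n s = max (- real n) (min (real n) s)" for n :: nat and s :: real
  have c_abs: "\<bar>c n s\<bar> \<le> n" for n s by (auto simp: c_def)
  have c_cont: "continuous_on UNIV (c n)" for n unfolding c_def by (intro continuous_intros)
  then have cm[measurable]: "c n \<in> borel_measurable borel" for n by (rule borel_measurable_continuous_onI)
  have "(\<lambda>n. \<integral>x. (f x - c n (f x))\<^sup>2 \<partial>lebesgue_on S) \<longlonglongrightarrow> (\<integral>x. 0 \<partial>lebesgue_on S)"
  proof (rule integral_dominated_convergence[where w = "\<lambda>x. (f x)\<^sup>2"])
    show "integrable (lebesgue_on S) (\<lambda>x. (f x)\<^sup>2)" using f by (simp add: L_two_def)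
    show "AE x in lebesgue_on S. (\<lambda>n. (f x - c n (f x))\<^sup>2) \<longlonglongrightarrow> 0"
    proof (intro AE_I2)
      fix x
      obtain N :: nat where "\<bar>f x\<bar> \<le> N" using real_arch_simple by blast
      then have "\<forall>n\<ge>N. (f x - c n (f x))\<^sup>2 = 0" by (auto simp: c_def)
      then show "(\<lambda>n. (f x - c n (f x))\<^sup>2) \<longlonglongrightarrow> 0"
        by (intro tendsto_eventually) (auto simp: eventually_sequentially)
    qed
    show "AE x in lebesgue_on S. norm ((f x - c n (f x))\<^sup>2) \<le> (f x)\<^sup>2" for n
      by (intro AE_I2) (auto simp: c_def power2_le_iff_abs_le abs_le_square_iff[symmetric])
  qed auto
  then have "\<forall>\<^sub>F n in sequentially. (\<integral>x. (f x - c n (f x))\<^sup>2 \<partial>lebesgue_on S) < e / 4"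
    using e by (intro order_tendstoD(2)[where a = "e / 4"]) auto
  then obtain n where n: "(\<integral>x. (f x - c n (f x))\<^sup>2 \<partial>lebesgue_on S) < e / 4"
    by (auto simp: eventually_sequentially)
  have "f measurable_on S" using measurable_on_iff_borel_measurable[OF Sm] fm by blast
  then obtain N G where N: "negligible N" and G: "\<And>k. continuous_on UNIV (G k)"
    and lim: "\<And>x. x \<notin> N \<Longrightarrow> (\<lambda>k. G k x) \<longlonglongrightarrow> (if x \<in> S then f x else 0)"
    unfolding measurable_on_def by blast
  have Gm[measurable]: "(\<lambda>x. G k x) \<in> borel_measurable (lebesgue_on S)" for k
    by (intro borel_on_lebesgue_on borel_measurable_continuous_onI G)
  have aeN: "AE x in lebesgue_on S. x \<in> S \<and> x \<notin> N"
  proof -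
    have "AE x in lebesgue. x \<notin> N" using N AE_not_in negligible_iff_null_sets by blast
    then show ?thesis using Sm by (auto simp: AE_restrict_space_iff elim: eventually_mono)
  qed
  have "(\<lambda>k. \<integral>x. (c n (f x) - c n (G k x))\<^sup>2 \<partial>lebesgue_on S) \<longlonglongrightarrow> (\<integral>x. 0 \<partial>lebesgue_on S)"
  proof (rule integral_dominated_convergence[where w = "\<lambda>x. (2 * real n)\<^sup>2"])
    show "integrable (lebesgue_on S) (\<lambda>x. (2 * real n)\<^sup>2)" by (rule integrable_const_lebesgue_on[OF S])
    show "AE x in lebesgue_on S. (\<lambda>k. (c n (f x) - c n (G k x))\<^sup>2) \<longlonglongrightarrow> 0"
      using aeN
    proof eventually_elim
      case (elim x)
      then have "(\<lambda>k. G k x) \<longlonglongrightarrow> f x" using lim[of x] by simp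
      moreover have "isCont (c n) (f x)" using c_cont continuous_on_eq_continuous_at by blast
      ultimately have "(\<lambda>k. c n (G k x)) \<longlonglongrightarrow> c n (f x)" by (rule isCont_tendsto_compose[rotated])
      from tendsto_diff[OF tendsto_const[of "c n (f x)"] this] show ?case
        by (auto intro!: tendsto_eq_intros)
    qed
    show "AE x in lebesgue_on S. norm ((c n (f x) - c n (G k x))\<^sup>2) \<le> (2 * real n)\<^sup>2" for k
    proof (intro AE_I2)
      fix x
      have "\<bar>c n (f x) - c n (G k x)\<bar> \<le> 2 * real n" using c_abs[of n "f x"] c_abs[of n "G k x"] by linarith
      then show "norm ((c n (f x) - c n (G k x))\<^sup>2) \<le> (2 * real n)\<^sup>2"
        by (metis abs_ge_zero power2_abs power_mono real_norm_def abs_power2)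
    qed
  qed auto
  then have "\<forall>\<^sub>F k in sequentially. (\<integral>x. (c n (f x) - c n (G k x))\<^sup>2 \<partial>lebesgue_on S) < e / 4"
    using e by (intro order_tendstoD(2)[where a = "e / 4"]) auto
  then obtain k where k: "(\<integral>x. (c n (f x) - c n (G k x))\<^sup>2 \<partial>lebesgue_on S) < e / 4"
    by (auto simp: eventually_sequentially)
  define g where "g x = c n (G k x)" for x
  have Lc: "L_two S (\<lambda>x. c n (f x))" "L_two S g"
    unfolding g_def by (rule L_two_bounded[OF S, of _ "real n"]; use c_abs in simp)+
  have sq: "(a - b)\<^sup>2 \<le> 2 * (a - d)\<^sup>2 + 2 * (d - b)\<^sup>2" for a b d :: real
    using zero_le_power2[of "(a - d) - (d - b)"] by (simp add: power2_eq_square algebra_simps)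
  have "(\<integral>x. (f x - g x)\<^sup>2 \<partial>lebesgue_on S)
      \<le> (\<integral>x. 2 * (f x - c n (f x))\<^sup>2 + 2 * (c n (f x) - g x)\<^sup>2 \<partial>lebesgue_on S)"
    using L_two_diff[OF f Lc(2)] L_two_diff[OF f Lc(1)] L_two_diff[OF Lc]
    by (intro integral_mono sq) (auto simp: L_two_def)
  also have "\<dots> = 2 * (\<integral>x. (f x - c n (f x))\<^sup>2 \<partial>lebesgue_on S) + 2 * (\<integral>x. (c n (f x) - g x)\<^sup>2 \<partial>lebesgue_on S)"
    using L_two_diff[OF f Lc(1)] L_two_diff[OF Lc] by (simp add: L_two_def)
  also have "\<dots> < e" using n k by (simp add: g_def)
  finally have "(\<integral>x. (f x - g x)\<^sup>2 \<partial>lebesgue_on S) < e" .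
  moreover have "continuous_on UNIV g"
    unfolding g_def by (rule continuous_on_compose2[OF c_cont G]) simp
  moreover have "\<bar>g x\<bar> \<le> n" for x by (simp add: g_def c_abs)
  ultimately show ?thesis using that by blast
qed

lemma integrable_lebesgue_on_times:
  fixes A :: "'a::euclidean_space set" and B :: "'b::euclidean_space set"
    and f :: "'a \<Rightarrow> real" and g :: "'b \<Rightarrow> real"
  assumes A: "A \<in> sets borel" and B: "B \<in> sets borel"
    and f: "integrable (lebesgue_on A) f" and g: "integrable (lebesgue_on B) g"
  shows "integrable (lebesgue_on (A \<times> B)) (\<lambda>z. f (fst z) * g (snd z))"
proof -
  have ms: "A \<in> sets lebesgue" "B \<in> sets lebesgue" using A B by auto
  have AB: "A \<times> B \<in> sets lebesgue" using borel_Times_lebesgue[OF A B] .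
  obtain f' where f'[measurable]: "f' \<in> borel_measurable borel" and ff: "AE x in lebesgue_on A. f x = f' x"
    using lebesgue_on_borel_rep[OF ms(1)] f by blast
  obtain g' where g'[measurable]: "g' \<in> borel_measurable borel" and gg: "AE x in lebesgue_on B. g x = g' x"
    using lebesgue_on_borel_rep[OF ms(2)] g by blast
  have F: "integrable lborel (\<lambda>x. indicator A x * f' x)"
    using lebesgue_on_cong_AE(1)[OF ms(1) f, of f'] ff
    by (simp add: integral_lebesgue_on_indicator(1)[OF A f', symmetric] eq_commute)
  have G: "integrable lborel (\<lambda>x. indicator B x * g' x)"
    using lebesgue_on_cong_AE(1)[OF ms(2) g, of g'] gg
    by (simp add: integral_lebesgue_on_indicator(1)[OF B g', symmetric] eq_commute)
  define h where "h z = (indicator A (fst z) * f' (fst z)) * (indicator B (snd z) * g' (snd z))" for z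
  have h[measurable]: "h \<in> borel_measurable (lborel \<Otimes>\<^sub>M lborel)"
    unfolding h_def using A B by measurable
  have "integrable (lborel \<Otimes>\<^sub>M lborel) h"
  proof (rule lborel_pair.Fubini_integrable[OF h])
    show "integrable lborel (\<lambda>x. \<integral>y. norm (h (x, y)) \<partial>lborel)"
      using integrable_abs[OF F] by (simp add: h_def abs_mult)
    show "AE x in lborel. integrable lborel (\<lambda>y. h (x, y))"
      using G by (simp add: h_def)
  qed
  moreover have "h = (\<lambda>z. indicator (A \<times> B) z * (f' (fst z) * g' (snd z)))"
    by (intro ext) (simp add: h_def indicator_times split_beta mem_Times_iff indicator_def)
  ultimately have "integrable lborel (\<lambda>z. indicator (A \<times> B) z * (f' (fst z) * g' (snd z)))"
    unfolding lborel_prod by simp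
  then have *: "integrable (lebesgue_on (A \<times> B)) (\<lambda>z. f' (fst z) * g' (snd z))"
    by (subst integral_lebesgue_on_indicator(1)) (auto simp: borel_Times A B borel_prod[symmetric])
  have "AE z in lebesgue_on (A \<times> B). f (fst z) = f' (fst z)"
    "AE z in lebesgue_on (A \<times> B). g (snd z) = g' (snd z)"
    using AE_lebesgue_on_fst_snd[OF A B] ff gg by auto
  then have "AE z in lebesgue_on (A \<times> B). f (fst z) * g (snd z) = f' (fst z) * g' (snd z)"
    by eventually_elim simp
  from lebesgue_on_cong_AE(1)[OF AB * this] show ?thesis .
qed

section \<open>Mollification\<close>

definition mker :: "('a::euclidean_space \<Rightarrow> real) \<Rightarrow> real \<Rightarrow> 'a \<Rightarrow> real" where
  "mker \<kappa> \<delta> z = \<kappa> (z /\<^sub>R \<delta>) / \<delta> ^ DIM('a)"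

text \<open>The convolution of f, set to 0 outside S, with the kernel, evaluated at
  \<open>\<mu> *\<^sub>R x\<close>: one formula for dilating and mollifying at once. Plain
  mollification is \<mu> = 1.\<close>

definition conv ::
    "('a::euclidean_space \<Rightarrow> real) \<Rightarrow> 'a set \<Rightarrow> real \<Rightarrow> real \<Rightarrow> ('a \<Rightarrow> real) \<Rightarrow> 'a \<Rightarrow> real" where
  "conv \<kappa> S \<mu> \<delta> f x = (\<integral>y. mker \<kappa> \<delta> (\<mu> *\<^sub>R x - y) * f y \<partial>lebesgue_on S)"

lemma lborel_affine_integral:
  fixes f :: "'a::euclidean_space \<Rightarrow> real"
  assumes c: "c \<noteq> 0" and f[measurable]: "f \<in> borel_measurable borel"
  shows "integrable lborel (\<lambda>x. f (t + c *\<^sub>R x)) \<longleftrightarrow> integrable lborel f"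
    and "(\<integral>x. f (t + c *\<^sub>R x) \<partial>lborel) = integral\<^sup>L lborel f / \<bar>c\<bar> ^ DIM('a)"
proof -
  have "integrable lborel f \<longleftrightarrow> integrable lborel (\<lambda>x. \<bar>c\<bar> ^ DIM('a) * f (t + c *\<^sub>R x))"
    by (subst lborel_affine[OF c, of t]) (simp add: integrable_density integrable_distr_eq)
  then show "integrable lborel (\<lambda>x. f (t + c *\<^sub>R x)) \<longleftrightarrow> integrable lborel f" using c by simp
  have "integral\<^sup>L lborel f = (\<integral>x. \<bar>c\<bar> ^ DIM('a) * f (t + c *\<^sub>R x) \<partial>lborel)"
    by (subst lborel_affine[OF c, of t]) (simp add: integral_density integral_distr)
  then show "(\<integral>x. f (t + c *\<^sub>R x) \<partial>lborel) = integral\<^sup>L lborel f / \<bar>c\<bar> ^ DIM('a)" using c by simp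
qed

lemma smooth_mker: "smooth \<kappa> \<Longrightarrow> smooth (mker \<kappa> \<delta>)"
proof -
  assume sm: "smooth \<kappa>"
  have "smooth (\<lambda>z. (1 / \<delta> ^ DIM('a)) * \<kappa> (inverse \<delta> *\<^sub>R z + 0))"
    by (rule smooth_mult[OF smooth_const smooth_affine[OF bounded_linear_scaleR_right sm]])
  moreover have "mker \<kappa> \<delta> = (\<lambda>z. (1 / \<delta> ^ DIM('a)) * \<kappa> (inverse \<delta> *\<^sub>R z + 0))"
    by (rule ext) (simp add: mker_def)
  ultimately show "smooth (mker \<kappa> \<delta>)" by simp
qed

lemma mollifierD:
  assumes "mollifier \<kappa>"
  shows "smooth \<kappa>" "0 \<le> \<kappa> x" "1 < norm x \<Longrightarrow> \<kappa> x = 0" "integrable lborel \<kappa>" "integral\<^sup>L lborel \<kappa> = 1"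
  using assms by (auto simp: mollifier_def)

lemma mker_nonneg: "mollifier \<kappa> \<Longrightarrow> 0 < \<delta> \<Longrightarrow> 0 \<le> mker \<kappa> \<delta> z"
  by (simp add: mker_def mollifierD)

lemma mker_eq_0: "mollifier \<kappa> \<Longrightarrow> 0 < \<delta> \<Longrightarrow> \<delta> < norm z \<Longrightarrow> mker \<kappa> \<delta> z = 0"
  using mollifierD(3)[of \<kappa> "z /\<^sub>R \<delta>"] by (simp add: mker_def pos_less_divide_eq divide_inverse_commute[symmetric])

lemma borel_measurable_smooth: "smooth f \<Longrightarrow> f \<in> borel_measurable borel"
  by (intro borel_measurable_continuous_onI smooth_continuous)

lemma mker_integral:
  fixes \<kappa> :: "'a::euclidean_space \<Rightarrow> real"
  assumes "mollifier \<kappa>" "0 < \<delta>" "c \<noteq> 0"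
  shows "integrable lborel (\<lambda>x. mker \<kappa> \<delta> (t + c *\<^sub>R x))"
    and "(\<integral>x. mker \<kappa> \<delta> (t + c *\<^sub>R x) \<partial>lborel) = 1 / \<bar>c\<bar> ^ DIM('a)"
proof -
  have m: "\<kappa> \<in> borel_measurable borel" using borel_measurable_smooth mollifierD(1)[OF assms(1)] .
  have eq: "mker \<kappa> \<delta> (t + c *\<^sub>R x) = \<kappa> (t /\<^sub>R \<delta> + (c / \<delta>) *\<^sub>R x) / \<delta> ^ DIM('a)" for x
    by (simp add: mker_def scaleR_add_right divide_inverse mult.commute)
  show "integrable lborel (\<lambda>x. mker \<kappa> \<delta> (t + c *\<^sub>R x))"
    unfolding eq using lborel_affine_integral(1)[OF _ m, of "c / \<delta>" "t /\<^sub>R \<delta>"] assms mollifierD(4) by auto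
  show "(\<integral>x. mker \<kappa> \<delta> (t + c *\<^sub>R x) \<partial>lborel) = 1 / \<bar>c\<bar> ^ DIM('a)"
    unfolding eq using lborel_affine_integral(2)[OF _ m, of "c / \<delta>" "t /\<^sub>R \<delta>"] assms mollifierD(5)[OF assms(1)]
    by (simp add: power_divide abs_divide)
qed

lemma mker_bounded:
  assumes "mollifier \<kappa>" "0 < \<delta>"
  obtains B where "\<And>z. \<bar>mker \<kappa> \<delta> z\<bar> \<le> B"
proof -
  have "bounded (mker \<kappa> \<delta> ` cball 0 \<delta>)"
    by (intro compact_imp_bounded compact_continuous_image smooth_continuous smooth_mker)
      (auto simp: mollifierD[OF assms(1)])
  then have "\<exists>B. \<forall>z\<in>cball 0 \<delta>. \<bar>mker \<kappa> \<delta> z\<bar> \<le> B" by (auto simp: bounded_iff)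
  then obtain B where B: "\<And>z. z \<in> cball 0 \<delta> \<Longrightarrow> \<bar>mker \<kappa> \<delta> z\<bar> \<le> B" by blast
  have "0 \<le> \<bar>mker \<kappa> \<delta> 0\<bar>" by simp
  also have "\<dots> \<le> B" using B[of 0] assms(2) by simp
  finally have "B \<ge> 0" .
  have "\<bar>mker \<kappa> \<delta> z\<bar> \<le> B" for z
    using B[of z] mker_eq_0[OF assms, of z] \<open>B \<ge> 0\<close> by (cases "z \<in> cball 0 \<delta>") auto
  then show ?thesis using that by blast
qed

lemma borel_measurable_lebesgue_on_continuous:
  fixes f :: "'a::euclidean_space \<Rightarrow> 'b::euclidean_space"
  assumes "continuous_on UNIV f" shows "f \<in> borel_measurable (lebesgue_on S)"
  using assms by (intro borel_on_lebesgue_on borel_measurable_continuous_onI)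

lemma continuous_mker: "mollifier \<kappa> \<Longrightarrow> continuous_on A (mker \<kappa> \<delta>)"
  by (intro smooth_continuous smooth_mker mollifierD)

text \<open>Stated for a general bounded continuous k because it is applied to the derivatives of
  the mollifier as well as to the mollifier, and in either of the two variables.\<close>

lemma isCont_integral_kernel:
  fixes f :: "'a::euclidean_space \<Rightarrow> real"
  assumes f: "integrable (lebesgue_on S) f" and k: "continuous_on UNIV k" "\<And>z. \<bar>k z\<bar> \<le> B"
  shows "continuous_on UNIV (\<lambda>x. \<integral>y. k (a *\<^sub>R x + b *\<^sub>R y) * f y \<partial>lebesgue_on S)"
proof -
  have kc: "isCont k z" for z using k(1) continuous_on_eq_continuous_at by blast
  have [measurable]: "(\<lambda>y. k (a *\<^sub>R x + b *\<^sub>R y)) \<in> borel_measurable (lebesgue_on S)" for x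
    by (intro borel_measurable_lebesgue_on_continuous continuous_on_compose2[OF k(1)] continuous_intros) auto
  have "isCont (\<lambda>x. \<integral>y. k (a *\<^sub>R x + b *\<^sub>R y) * f y \<partial>lebesgue_on S) x" for x
    unfolding continuous_at_sequentially o_def
  proof (intro allI impI integral_dominated_convergence[where w = "\<lambda>y. B * \<bar>f y\<bar>"])
    fix X assume X: "X \<longlonglongrightarrow> x"
    show "AE y in lebesgue_on S. (\<lambda>n. k (a *\<^sub>R X n + b *\<^sub>R y) * f y) \<longlonglongrightarrow> k (a *\<^sub>R x + b *\<^sub>R y) * f y"
      by (intro AE_I2 tendsto_mult tendsto_const isCont_tendsto_compose[OF kc] tendsto_add tendsto_scaleR X)
    show "AE y in lebesgue_on S. norm (k (a *\<^sub>R X n + b *\<^sub>R y) * f y) \<le> B * \<bar>f y\<bar>" for n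
      using k(2) by (intro AE_I2) (simp add: abs_mult mult_right_mono)
  qed (use f in auto)
  then show ?thesis using continuous_at_imp_continuous_on by blast
qed

lemma continuous_conv:
  assumes "mollifier \<kappa>" "0 < \<delta>" "integrable (lebesgue_on S) f"
  shows "continuous_on UNIV (conv \<kappa> S \<mu> \<delta> f)"
proof -
  obtain B where B: "\<And>z. \<bar>mker \<kappa> \<delta> z\<bar> \<le> B" using mker_bounded assms by blast
  show ?thesis
    using isCont_integral_kernel[OF assms(3) continuous_mker[OF assms(1)] B, of \<mu> "-1"]
    by (simp add: conv_def[abs_def])
qed

lemma mker_shift_measurable:
  "mollifier \<kappa> \<Longrightarrow> (\<lambda>y. mker \<kappa> \<delta> (x - y)) \<in> borel_measurable (lebesgue_on S)"
  by (intro borel_measurable_lebesgue_on_continuous continuous_on_compose2[OF continuous_mker[where A = UNIV]]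
      continuous_intros) auto

lemma mker_mult_integrable:
  fixes f :: "'a::euclidean_space \<Rightarrow> real"
  assumes "mollifier \<kappa>" "0 < \<delta>" "integrable (lebesgue_on S) f"
  shows "integrable (lebesgue_on S) (\<lambda>y. mker \<kappa> \<delta> (x - y) * f y)"
proof -
  obtain B where B: "\<And>z. \<bar>mker \<kappa> \<delta> z\<bar> \<le> B" using mker_bounded assms by blast
  show ?thesis
    by (rule integrable_mult_bounded[OF assms(3) mker_shift_measurable[OF assms(1)], where C = B])
      (simp add: B)
qed

lemma mker_lebesgue_on_le:
  fixes \<kappa> :: "'a::euclidean_space \<Rightarrow> real"
  assumes "mollifier \<kappa>" "0 < \<delta>" "S \<in> sets borel" "c \<noteq> 0"
  shows "integrable (lebesgue_on S) (\<lambda>x. mker \<kappa> \<delta> (t + c *\<^sub>R x))"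
    and "(\<integral>x. mker \<kappa> \<delta> (t + c *\<^sub>R x) \<partial>lebesgue_on S) \<le> 1 / \<bar>c\<bar> ^ DIM('a)"
    and "(\<And>x. mker \<kappa> \<delta> (t + c *\<^sub>R x) \<noteq> 0 \<Longrightarrow> x \<in> S) \<Longrightarrow>
      (\<integral>x. mker \<kappa> \<delta> (t + c *\<^sub>R x) \<partial>lebesgue_on S) = 1 / \<bar>c\<bar> ^ DIM('a)"
proof -
  have m: "(\<lambda>x. mker \<kappa> \<delta> (t + c *\<^sub>R x)) \<in> borel_measurable borel"
    by (intro borel_measurable_continuous_onI continuous_on_compose2[OF continuous_mker[where A = UNIV]]
      continuous_intros assms(1)) auto
  note I = mker_integral[OF assms(1,2,4), of t]
  note L = integral_lebesgue_on_indicator[OF assms(3) m]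
  have i: "integrable lborel (\<lambda>x. indicator S x * mker \<kappa> \<delta> (t + c *\<^sub>R x))"
    using integrable_real_mult_indicator[OF _ I(1), of S] assms(3) by (simp add: mult.commute)
  then show "integrable (lebesgue_on S) (\<lambda>x. mker \<kappa> \<delta> (t + c *\<^sub>R x))" using L(1) by simp
  have "(\<integral>x. indicator S x * mker \<kappa> \<delta> (t + c *\<^sub>R x) \<partial>lborel) \<le> (\<integral>x. mker \<kappa> \<delta> (t + c *\<^sub>R x) \<partial>lborel)"
    by (intro integral_mono i I(1)) (simp add: indicator_def mker_nonneg[OF assms(1,2)])
  then show "(\<integral>x. mker \<kappa> \<delta> (t + c *\<^sub>R x) \<partial>lebesgue_on S) \<le> 1 / \<bar>c\<bar> ^ DIM('a)" using L(2) I(2) by simp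
  assume supp: "\<And>x. mker \<kappa> \<delta> (t + c *\<^sub>R x) \<noteq> 0 \<Longrightarrow> x \<in> S"
  have "indicator S x * mker \<kappa> \<delta> (t + c *\<^sub>R x) = mker \<kappa> \<delta> (t + c *\<^sub>R x)" for x
    using supp[of x] by (cases "x \<in> S") auto
  then have "(\<integral>x. indicator S x * mker \<kappa> \<delta> (t + c *\<^sub>R x) \<partial>lborel) = (\<integral>x. mker \<kappa> \<delta> (t + c *\<^sub>R x) \<partial>lborel)"
    by presburger
  then show "(\<integral>x. mker \<kappa> \<delta> (t + c *\<^sub>R x) \<partial>lebesgue_on S) = 1 / \<bar>c\<bar> ^ DIM('a)" using L(2) I(2) by simp
qed

text \<open>Jensen's inequality, from \<open>0 \<le> \<integral> k (f - c)\<^sup>2\<close> with \<open>c = \<integral> k f\<close>.\<close>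

lemma square_integral_kernel_le:
  fixes k f :: "'a \<Rightarrow> real"
  assumes "integrable M k" "integrable M (\<lambda>x. k x * f x)" "integrable M (\<lambda>x. k x * (f x)\<^sup>2)"
    and k: "\<And>x. 0 \<le> k x" "(\<integral>x. k x \<partial>M) \<le> 1"
  shows "(\<integral>x. k x * f x \<partial>M)\<^sup>2 \<le> (\<integral>x. k x * (f x)\<^sup>2 \<partial>M)"
proof -
  define c where "c = (\<integral>x. k x * f x \<partial>M)"
  have "0 \<le> (\<integral>x. k x * (f x)\<^sup>2 - 2 * c * (k x * f x) + c\<^sup>2 * k x \<partial>M)"
  proof (rule integral_nonneg_AE, rule AE_I2)
    fix x
    have "k x * (f x)\<^sup>2 - 2 * c * (k x * f x) + c\<^sup>2 * k x = k x * (f x - c)\<^sup>2"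
      by (simp add: power2_eq_square algebra_simps)
    then show "0 \<le> k x * (f x)\<^sup>2 - 2 * c * (k x * f x) + c\<^sup>2 * k x" using k(1) by simp
  qed
  also have "\<dots> = (\<integral>x. k x * (f x)\<^sup>2 \<partial>M) - 2 * c * c + c\<^sup>2 * (\<integral>x. k x \<partial>M)"
    using assms by (simp add: c_def)
  also have "\<dots> \<le> (\<integral>x. k x * (f x)\<^sup>2 \<partial>M) - 2 * c * c + c\<^sup>2 * 1"
    using mult_left_mono[OF k(2), of "c\<^sup>2"] by simp
  finally show ?thesis by (simp add: c_def power2_eq_square)
qed

text \<open>Boundedness of k makes k(\<mu> x - y) f(x) g(y) integrable on S x S, so Fubini moves the
  kernel from one factor to the other.\<close>

lemma kernel_duality:
  fixes f g :: "'a::euclidean_space \<Rightarrow> real"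
  assumes k: "continuous_on UNIV k" "\<And>z. \<bar>k z\<bar> \<le> B" and S: "S \<in> sets borel"
    and fg: "integrable (lebesgue_on S) f" "integrable (lebesgue_on S) g"
  shows "(\<integral>x. f x * (\<integral>y. k (\<mu> *\<^sub>R x - y) * g y \<partial>lebesgue_on S) \<partial>lebesgue_on S) =
    (\<integral>y. g y * (\<integral>x. k (\<mu> *\<^sub>R x - y) * f x \<partial>lebesgue_on S) \<partial>lebesgue_on S)"
    and "integrable (lebesgue_on S) (\<lambda>y. g y * (\<integral>x. k (\<mu> *\<^sub>R x - y) * f x \<partial>lebesgue_on S))"
    and "integrable (lebesgue_on S) (\<lambda>x. f x * (\<integral>y. k (\<mu> *\<^sub>R x - y) * g y \<partial>lebesgue_on S))"
proof -
  have m: "(\<lambda>z. k (\<mu> *\<^sub>R fst z - snd z)) \<in> borel_measurable (lebesgue_on (S \<times> S))"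
    by (intro borel_measurable_lebesgue_on_continuous continuous_on_compose2[OF k(1)] continuous_intros) auto
  have i: "integrable (lebesgue_on (S \<times> S)) (\<lambda>z. k (\<mu> *\<^sub>R fst z - snd z) * (f (fst z) * g (snd z)))"
    by (rule integrable_mult_bounded[OF integrable_lebesgue_on_times[OF S S fg] m, of B]) (simp add: k(2))
  note F = lebesgue_on_Times_Fubini[OF S S i]
  have "(\<integral>x. f x * (\<integral>y. k (\<mu> *\<^sub>R x - y) * g y \<partial>lebesgue_on S) \<partial>lebesgue_on S) =
      (\<integral>x. (\<integral>y. k (\<mu> *\<^sub>R x - y) * (f x * g y) \<partial>lebesgue_on S) \<partial>lebesgue_on S)"
    by (simp add: mult.left_commute flip: integral_mult_right_zero)
  also have "\<dots> = (\<integral>y. (\<integral>x. k (\<mu> *\<^sub>R x - y) * (f x * g y) \<partial>lebesgue_on S) \<partial>lebesgue_on S)"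
    using F(3,6) by simp
  also have "\<dots> = (\<integral>y. g y * (\<integral>x. k (\<mu> *\<^sub>R x - y) * f x \<partial>lebesgue_on S) \<partial>lebesgue_on S)"
    by (simp add: mult_ac flip: integral_mult_right_zero)
  finally show "(\<integral>x. f x * (\<integral>y. k (\<mu> *\<^sub>R x - y) * g y \<partial>lebesgue_on S) \<partial>lebesgue_on S) =
    (\<integral>y. g y * (\<integral>x. k (\<mu> *\<^sub>R x - y) * f x \<partial>lebesgue_on S) \<partial>lebesgue_on S)" .
  show "integrable (lebesgue_on S) (\<lambda>y. g y * (\<integral>x. k (\<mu> *\<^sub>R x - y) * f x \<partial>lebesgue_on S))"
    "integrable (lebesgue_on S) (\<lambda>x. f x * (\<integral>y. k (\<mu> *\<^sub>R x - y) * g y \<partial>lebesgue_on S))"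
    using F(5,2) by (simp_all add: mult_ac flip: integral_mult_right_zero)
qed

lemma conv_duality:
  fixes f g :: "'a::euclidean_space \<Rightarrow> real"
  assumes "mollifier \<kappa>" "0 < \<delta>" "S \<in> sets borel"
    and "integrable (lebesgue_on S) f" "integrable (lebesgue_on S) g"
  shows "(\<integral>x. f x * conv \<kappa> S \<mu> \<delta> g x \<partial>lebesgue_on S) =
    (\<integral>y. g y * (\<integral>x. mker \<kappa> \<delta> (\<mu> *\<^sub>R x - y) * f x \<partial>lebesgue_on S) \<partial>lebesgue_on S)"
    and "integrable (lebesgue_on S) (\<lambda>y. g y * (\<integral>x. mker \<kappa> \<delta> (\<mu> *\<^sub>R x - y) * f x \<partial>lebesgue_on S))"
    and "integrable (lebesgue_on S) (\<lambda>x. f x * conv \<kappa> S \<mu> \<delta> g x)"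
proof -
  obtain B where B: "\<And>z. \<bar>mker \<kappa> \<delta> z\<bar> \<le> B" using mker_bounded assms by blast
  note kernel_duality[OF continuous_mker[OF assms(1)] B assms(3-5), of \<mu>, folded conv_def]
  then show "(\<integral>x. f x * conv \<kappa> S \<mu> \<delta> g x \<partial>lebesgue_on S) =
    (\<integral>y. g y * (\<integral>x. mker \<kappa> \<delta> (\<mu> *\<^sub>R x - y) * f x \<partial>lebesgue_on S) \<partial>lebesgue_on S)"
    and "integrable (lebesgue_on S) (\<lambda>y. g y * (\<integral>x. mker \<kappa> \<delta> (\<mu> *\<^sub>R x - y) * f x \<partial>lebesgue_on S))"
    and "integrable (lebesgue_on S) (\<lambda>x. f x * conv \<kappa> S \<mu> \<delta> g x)" by simp_all
qed

text \<open>Jensen's inequality bounds the square of the mollified function by the mollified square.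
  After exchanging the integrals, the kernel is integrated in x, where the dilation produces the
  factor \<mu>^(-d), d being the dimension.\<close>

lemma conv_L_two:
  fixes f :: "'a::euclidean_space \<Rightarrow> real"
  assumes \<kappa>: "mollifier \<kappa>" and \<delta>: "0 < \<delta>" and \<mu>: "0 < \<mu>" and S: "S \<in> sets borel" "S \<in> lmeasurable" and f: "L_two S f"
  shows "L_two S (conv \<kappa> S \<mu> \<delta> f)"
    and "(\<integral>x. (conv \<kappa> S \<mu> \<delta> f x)\<^sup>2 \<partial>lebesgue_on S) \<le> (\<integral>x. (f x)\<^sup>2 \<partial>lebesgue_on S) / \<mu> ^ DIM('a)"
proof -
  have fi: "integrable (lebesgue_on S) f" using L_two_integrable[OF S(2) f] .
  have f2: "integrable (lebesgue_on S) (\<lambda>x. (f x)\<^sup>2)" using f by (simp add: L_two_def)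
  have one: "integrable (lebesgue_on S) (\<lambda>x. 1::real)" using integrable_const_lebesgue_on[OF S(2)] .
  obtain B where B: "\<And>z. \<bar>mker \<kappa> \<delta> z\<bar> \<le> B" using mker_bounded[OF \<kappa> \<delta>] by blast
  have "\<bar>conv \<kappa> S \<mu> \<delta> f x\<bar> \<le> (\<integral>y. B * \<bar>f y\<bar> \<partial>lebesgue_on S)" for x
  proof -
    have "\<bar>conv \<kappa> S \<mu> \<delta> f x\<bar> \<le> (\<integral>y. \<bar>mker \<kappa> \<delta> (\<mu> *\<^sub>R x - y) * f y\<bar> \<partial>lebesgue_on S)"
      unfolding conv_def by (rule integral_abs_bound)
    also have "\<dots> \<le> (\<integral>y. B * \<bar>f y\<bar> \<partial>lebesgue_on S)"
      using fi integrable_abs[OF mker_mult_integrable[OF \<kappa> \<delta> fi]] B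
      by (intro integral_mono) (auto simp: abs_mult mult_right_mono)
    finally show ?thesis .
  qed
  then show L: "L_two S (conv \<kappa> S \<mu> \<delta> f)"
    by (intro L_two_bounded[OF S(2) borel_measurable_lebesgue_on_continuous[OF continuous_conv[OF \<kappa> \<delta> fi]]])
      auto
  have A: "(conv \<kappa> S \<mu> \<delta> f x)\<^sup>2 \<le> conv \<kappa> S \<mu> \<delta> (\<lambda>x. (f x)\<^sup>2) x" for x
    unfolding conv_def
    using mker_mult_integrable[OF \<kappa> \<delta> fi] mker_mult_integrable[OF \<kappa> \<delta> f2]
      mker_lebesgue_on_le(1,2)[OF \<kappa> \<delta> S(1), of "-1" "\<mu> *\<^sub>R x"] mker_nonneg[OF \<kappa> \<delta>]
    by (intro square_integral_kernel_le) auto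
  have C: "integrable (lebesgue_on S) (conv \<kappa> S \<mu> \<delta> (\<lambda>x. (f x)\<^sup>2))"
    using conv_duality(3)[OF \<kappa> \<delta> S(1) one f2, of \<mu>] by simp
  have "(\<integral>x. (conv \<kappa> S \<mu> \<delta> f x)\<^sup>2 \<partial>lebesgue_on S) \<le> (\<integral>x. 1 * conv \<kappa> S \<mu> \<delta> (\<lambda>x. (f x)\<^sup>2) x \<partial>lebesgue_on S)"
    using L A C by (intro integral_mono) (auto simp: L_two_def)
  also have "\<dots> = (\<integral>y. (f y)\<^sup>2 * (\<integral>x. mker \<kappa> \<delta> (\<mu> *\<^sub>R x - y) * 1 \<partial>lebesgue_on S) \<partial>lebesgue_on S)"
    by (rule conv_duality(1)[OF \<kappa> \<delta> S(1) one f2])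
  also have "\<dots> \<le> (\<integral>y. (f y)\<^sup>2 * (1 / \<mu> ^ DIM('a)) \<partial>lebesgue_on S)"
  proof (rule integral_mono)
    show "integrable (lebesgue_on S) (\<lambda>y. (f y)\<^sup>2 * (\<integral>x. mker \<kappa> \<delta> (\<mu> *\<^sub>R x - y) * 1 \<partial>lebesgue_on S))"
      by (rule conv_duality(2)[OF \<kappa> \<delta> S(1) one f2])
    show "integrable (lebesgue_on S) (\<lambda>y. (f y)\<^sup>2 * (1 / \<mu> ^ DIM('a)))" using f2 by simp
    fix y
    have "(\<integral>x. mker \<kappa> \<delta> (\<mu> *\<^sub>R x - y) * 1 \<partial>lebesgue_on S) \<le> 1 / \<mu> ^ DIM('a)"
      using mker_lebesgue_on_le(2)[OF \<kappa> \<delta> S(1), of \<mu> "- y"] \<mu> by simp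
    then show "(f y)\<^sup>2 * (\<integral>x. mker \<kappa> \<delta> (\<mu> *\<^sub>R x - y) * 1 \<partial>lebesgue_on S) \<le> (f y)\<^sup>2 * (1 / \<mu> ^ DIM('a))"
      by (intro mult_left_mono) auto
  qed
  also have "\<dots> = (\<integral>x. (f x)\<^sup>2 \<partial>lebesgue_on S) / \<mu> ^ DIM('a)" by simp
  finally show "(\<integral>x. (conv \<kappa> S \<mu> \<delta> f x)\<^sup>2 \<partial>lebesgue_on S) \<le> (\<integral>x. (f x)\<^sup>2 \<partial>lebesgue_on S) / \<mu> ^ DIM('a)" .
qed

lemma kernel_average_close:
  fixes k g :: "'a \<Rightarrow> real"
  assumes "integrable M k" "integrable M (\<lambda>y. k y * g y)" "\<And>y. 0 \<le> k y" "(\<integral>y. k y \<partial>M) = 1"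
    and close: "\<And>y. k y \<noteq> 0 \<Longrightarrow> \<bar>g y - a\<bar> \<le> e"
  shows "\<bar>(\<integral>y. k y * g y \<partial>M) - a\<bar> \<le> e"
proof -
  have "(\<integral>y. k y * g y \<partial>M) - a = (\<integral>y. k y * g y - a * k y \<partial>M)"
    using assms by simp
  also have "\<bar>\<dots>\<bar> \<le> (\<integral>y. \<bar>k y * g y - a * k y\<bar> \<partial>M)" by (rule integral_abs_bound)
  also have "\<dots> \<le> (\<integral>y. e * k y \<partial>M)"
  proof (rule integral_mono)
    fix y
    have "k y * g y - a * k y = k y * (g y - a)" by (simp add: algebra_simps)
    then have "\<bar>k y * g y - a * k y\<bar> = k y * \<bar>g y - a\<bar>"
      using assms(3)[of y] by (simp add: abs_mult)
    also have "\<dots> \<le> k y * e" using close[of y] assms(3)[of y]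
      by (cases "k y = 0") (auto intro: mult_left_mono)
    finally show "\<bar>k y * g y - a * k y\<bar> \<le> e * k y" by (simp add: mult.commute)
  qed (use assms in auto)
  also have "\<dots> = e" using assms by simp
  finally show ?thesis .
qed

text \<open>Although centred at \<mu> x, the kernel is eventually supported near x, inside S; there
  it has full mass and g is close to g(x).\<close>

lemma conv_tendsto_pointwise:
  fixes g :: "'a::euclidean_space \<Rightarrow> real"
  assumes \<kappa>: "mollifier \<kappa>" and S: "open S" "S \<in> lmeasurable" and g: "continuous_on UNIV g" "\<And>x. \<bar>g x\<bar> \<le> B"
    and \<mu>: "\<mu> \<longlonglongrightarrow> 1" and \<delta>: "\<And>n. 0 < \<delta> n" "\<delta> \<longlonglongrightarrow> 0" and x: "x \<in> S"
  shows "(\<lambda>n. conv \<kappa> S (\<mu> n) (\<delta> n) g x) \<longlonglongrightarrow> g x"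
proof (rule LIMSEQ_I)
  fix r :: real assume r: "r > 0"
  have gi: "integrable (lebesgue_on S) g"
    by (rule integrable_bounded_lebesgue_on[OF S(2) borel_measurable_lebesgue_on_continuous[OF g(1)], of B])
      (simp add: g(2))
  obtain d1 where d1: "d1 > 0" "\<And>y. dist y x < d1 \<Longrightarrow> \<bar>g y - g x\<bar> < r / 2"
    using g(1) r by (metis continuous_on_iff dist_real_def half_gt_zero UNIV_I)
  obtain d2 where d2: "d2 > 0" "ball x d2 \<subseteq> S" using S(1) x open_contains_ball by blast
  define d where "d = min d1 d2"
  have d: "d > 0" using d1 d2 by (simp add: d_def)
  have "(\<lambda>n. dist (\<mu> n *\<^sub>R x) x + \<delta> n) \<longlonglongrightarrow> dist (1 *\<^sub>R x) x + 0"
    by (intro tendsto_intros \<mu> \<delta>)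
  then have "\<forall>\<^sub>F n in sequentially. dist (\<mu> n *\<^sub>R x) x + \<delta> n < d"
    using d by (intro order_tendstoD(2)) auto
  then obtain N where N: "\<And>n. n \<ge> N \<Longrightarrow> dist (\<mu> n *\<^sub>R x) x + \<delta> n < d" by (auto simp: eventually_sequentially)
  show "\<exists>N. \<forall>n\<ge>N. norm (conv \<kappa> S (\<mu> n) (\<delta> n) g x - g x) < r"
  proof (intro exI allI impI)
    fix n assume n: "n \<ge> N"
    have near: "dist y x < d" if "mker \<kappa> (\<delta> n) (\<mu> n *\<^sub>R x - y) \<noteq> 0" for y
    proof -
      have "norm (\<mu> n *\<^sub>R x - y) \<le> \<delta> n" using mker_eq_0[OF \<kappa> \<delta>(1)] that by (meson not_le)
      then show ?thesis using N[OF n] dist_triangle[of y x "\<mu> n *\<^sub>R x"] by (simp add: dist_norm norm_minus_commute)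
    qed
    note L = mker_lebesgue_on_le[OF \<kappa> \<delta>(1)[of n], of S "-1" "\<mu> n *\<^sub>R x", simplified]
    have "\<bar>conv \<kappa> S (\<mu> n) (\<delta> n) g x - g x\<bar> \<le> r / 2"
      unfolding conv_def
    proof (rule kernel_average_close)
      show "integrable (lebesgue_on S) (\<lambda>y. mker \<kappa> (\<delta> n) (\<mu> n *\<^sub>R x - y))" using L(1) S(1) by simp
      show "integrable (lebesgue_on S) (\<lambda>y. mker \<kappa> (\<delta> n) (\<mu> n *\<^sub>R x - y) * g y)"
        by (rule mker_mult_integrable[OF \<kappa> \<delta>(1) gi])
      show "(\<integral>y. mker \<kappa> (\<delta> n) (\<mu> n *\<^sub>R x - y) \<partial>lebesgue_on S) = 1"
        using S(1) near d2(2) by (intro L(3)) (auto simp: d_def dist_commute subset_iff)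
      show "\<bar>g y - g x\<bar> \<le> r / 2" if "mker \<kappa> (\<delta> n) (\<mu> n *\<^sub>R x - y) \<noteq> 0" for y
        using d1(2)[of y] near[OF that] by (simp add: d_def)
    qed (rule mker_nonneg[OF \<kappa> \<delta>(1)])
    then show "norm (conv \<kappa> S (\<mu> n) (\<delta> n) g x - g x) < r" using r by simp
  qed
qed

lemma L_twoD:
  assumes "L_two S f"
  shows "f \<in> borel_measurable (lebesgue_on S)" "integrable (lebesgue_on S) (\<lambda>x. (f x)\<^sup>2)"
  using assms by (auto simp: L_two_def)

lemma conv_abs_le:
  fixes f :: "'a::euclidean_space \<Rightarrow> real"
  assumes \<kappa>: "mollifier \<kappa>" and \<delta>: "0 < \<delta>" and S: "S \<in> sets borel"
    and f: "integrable (lebesgue_on S) f" "AE x in lebesgue_on S. \<bar>f x\<bar> \<le> B" and B: "0 \<le> B"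
  shows "\<bar>conv \<kappa> S \<mu> \<delta> f x\<bar> \<le> B"
proof -
  note L = mker_lebesgue_on_le[OF \<kappa> \<delta> S, of "-1" "\<mu> *\<^sub>R x", simplified]
  have "\<bar>conv \<kappa> S \<mu> \<delta> f x\<bar> \<le> (\<integral>y. \<bar>mker \<kappa> \<delta> (\<mu> *\<^sub>R x - y) * f y\<bar> \<partial>lebesgue_on S)"
    unfolding conv_def by (rule integral_abs_bound)
  also have "\<dots> \<le> (\<integral>y. B * mker \<kappa> \<delta> (\<mu> *\<^sub>R x - y) \<partial>lebesgue_on S)"
  proof (rule integral_mono_AE)
    show "integrable (lebesgue_on S) (\<lambda>y. \<bar>mker \<kappa> \<delta> (\<mu> *\<^sub>R x - y) * f y\<bar>)"
      using mker_mult_integrable[OF \<kappa> \<delta> f(1)] by (rule integrable_abs)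
    show "integrable (lebesgue_on S) (\<lambda>y. B * mker \<kappa> \<delta> (\<mu> *\<^sub>R x - y))"
      using L(1) by (rule integrable_mult_right)
    show "AE y in lebesgue_on S. \<bar>mker \<kappa> \<delta> (\<mu> *\<^sub>R x - y) * f y\<bar> \<le> B * mker \<kappa> \<delta> (\<mu> *\<^sub>R x - y)"
      using f(2) by eventually_elim
        (simp add: abs_mult mker_nonneg[OF \<kappa> \<delta>] mult.commute[of B] mult_left_mono)
  qed
  also have "\<dots> \<le> B * 1" using L(2) B by (simp add: mult_left_le)
  finally show ?thesis by simp
qed

lemma conv_diff:
  fixes f :: "'a::euclidean_space \<Rightarrow> real"
  assumes "mollifier \<kappa>" "0 < \<delta>" "integrable (lebesgue_on S) f" "integrable (lebesgue_on S) g"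
  shows "conv \<kappa> S \<mu> \<delta> (\<lambda>x. f x - g x) x = conv \<kappa> S \<mu> \<delta> f x - conv \<kappa> S \<mu> \<delta> g x"
  unfolding conv_def
  using mker_mult_integrable[OF assms(1,2,3)] mker_mult_integrable[OF assms(1,2,4)]
  by (simp add: right_diff_distrib)

text \<open>The error is split through a bounded continuous g close to f: the mollification of f -
  g, the mollification error of g, and g - f. The first is controlled by \<open>conv_L_two\<close>
  uniformly in n, since \<mu> \<ge> 1/2 bounds \<mu>^(-d) by C = 2^d.\<close>

lemma conv_tendsto_L_two:
  fixes f :: "'a::euclidean_space \<Rightarrow> real"
  assumes \<kappa>: "mollifier \<kappa>" and S: "open S" "S \<in> lmeasurable" and f: "L_two S f"
    and \<mu>: "\<mu> \<longlonglongrightarrow> 1" "\<And>n. 1 / 2 \<le> \<mu> n" and \<delta>: "\<And>n. 0 < \<delta> n" "\<delta> \<longlonglongrightarrow> 0"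
  shows "(\<lambda>n. \<integral>x. (conv \<kappa> S (\<mu> n) (\<delta> n) f x - f x)\<^sup>2 \<partial>lebesgue_on S) \<longlonglongrightarrow> 0"
proof (rule LIMSEQ_I)
  fix r :: real assume r: "r > 0"
  have Sb: "S \<in> sets borel" using S(1) by simp
  define C where "C = (2::real) ^ DIM('a)"
  have C: "C \<ge> 1" unfolding C_def by simp
  \<comment> \<open>The terms containing f - g then contribute at most 3 C e + 3 e = r/2, and the
    mollification error of g less than 3 (r/6) = r/2.\<close>
  define e where "e = r / (6 * (C + 1))"
  have e: "e > 0" using r C by (simp add: e_def)
  have "3 * C * e + 3 * e = 3 * ((C + 1) * e)" by (simp add: algebra_simps)
  also have "(C + 1) * e = r / 6" using C by (simp add: e_def field_simps)
  finally have e3: "3 * C * e + 3 * e = r / 2" by simp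
  obtain g B where g: "continuous_on UNIV g" "\<And>x. \<bar>g x\<bar> \<le> B" "(\<integral>x. (f x - g x)\<^sup>2 \<partial>lebesgue_on S) < e"
    using L_two_dense_continuous[OF S(2) f e] by blast
  have B: "B \<ge> 0" using g(2)[of 0] by linarith
  have gL: "L_two S g"
    by (rule L_two_bounded[OF S(2) borel_measurable_lebesgue_on_continuous[OF g(1)], of B]) (simp add: g(2))
  have fi: "integrable (lebesgue_on S) f" and gi: "integrable (lebesgue_on S) g"
    using L_two_integrable[OF S(2)] f gL by auto
  have \<mu>0: "0 < \<mu> n" for n using \<mu>(2)[of n] by linarith
  have cgL: "L_two S (conv \<kappa> S (\<mu> n) (\<delta> n) g)" for n
    by (rule conv_L_two(1)[OF \<kappa> \<delta>(1) \<mu>0 Sb S(2) gL])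
  have cfL: "L_two S (conv \<kappa> S (\<mu> n) (\<delta> n) f)" for n
    by (rule conv_L_two(1)[OF \<kappa> \<delta>(1) \<mu>0 Sb S(2) f])
  have fgL: "L_two S (\<lambda>x. f x - g x)" by (rule L_two_diff[OF f gL])
  have cfgL: "L_two S (conv \<kappa> S (\<mu> n) (\<delta> n) (\<lambda>x. f x - g x))" for n
    by (rule conv_L_two(1)[OF \<kappa> \<delta>(1) \<mu>0 Sb S(2) fgL])
  have "(\<lambda>n. \<integral>x. (conv \<kappa> S (\<mu> n) (\<delta> n) g x - g x)\<^sup>2 \<partial>lebesgue_on S) \<longlonglongrightarrow> (\<integral>x. 0 \<partial>lebesgue_on S)"
  proof (rule integral_dominated_convergence[where w = "\<lambda>x. (2 * B)\<^sup>2"])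
    show "integrable (lebesgue_on S) (\<lambda>x. (2 * B)\<^sup>2)" by (rule integrable_const_lebesgue_on[OF S(2)])
    show "AE x in lebesgue_on S. (\<lambda>n. (conv \<kappa> S (\<mu> n) (\<delta> n) g x - g x)\<^sup>2) \<longlonglongrightarrow> 0"
    proof (rule AE_I2)
      fix x assume "x \<in> space (lebesgue_on S)"
      then have "(\<lambda>n. conv \<kappa> S (\<mu> n) (\<delta> n) g x) \<longlonglongrightarrow> g x"
        using conv_tendsto_pointwise[OF \<kappa> S g(1,2) \<mu>(1) \<delta>] by simp
      then have "(\<lambda>n. (conv \<kappa> S (\<mu> n) (\<delta> n) g x - g x)\<^sup>2) \<longlonglongrightarrow> (g x - g x)\<^sup>2"
        by (intro tendsto_intros)
      then show "(\<lambda>n. (conv \<kappa> S (\<mu> n) (\<delta> n) g x - g x)\<^sup>2) \<longlonglongrightarrow> 0" by simp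
    qed
    show "AE x in lebesgue_on S. norm ((conv \<kappa> S (\<mu> n) (\<delta> n) g x - g x)\<^sup>2) \<le> (2 * B)\<^sup>2" for n
    proof (rule AE_I2)
      fix x
      have "\<bar>conv \<kappa> S (\<mu> n) (\<delta> n) g x\<bar> \<le> B"
        by (rule conv_abs_le[OF \<kappa> \<delta>(1) Sb gi _ B]) (simp add: g(2))
      then have "\<bar>conv \<kappa> S (\<mu> n) (\<delta> n) g x - g x\<bar> \<le> 2 * B" using g(2)[of x] by linarith
      then have "\<bar>conv \<kappa> S (\<mu> n) (\<delta> n) g x - g x\<bar>\<^sup>2 \<le> (2 * B)\<^sup>2" by (intro power_mono) auto
      then show "norm ((conv \<kappa> S (\<mu> n) (\<delta> n) g x - g x)\<^sup>2) \<le> (2 * B)\<^sup>2" by simp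
    qed
    show "(\<lambda>x. (conv \<kappa> S (\<mu> n) (\<delta> n) g x - g x)\<^sup>2) \<in> borel_measurable (lebesgue_on S)" for n
      by (rule borel_measurable_integrable[OF L_twoD(2)[OF L_two_diff[OF cgL gL]]])
  qed auto
  then have "\<forall>\<^sub>F n in sequentially. (\<integral>x. (conv \<kappa> S (\<mu> n) (\<delta> n) g x - g x)\<^sup>2 \<partial>lebesgue_on S) < r / 6"
    using r by (intro order_tendstoD(2)[where a = "r / 6"]) auto
  then obtain N where N: "\<And>n. n \<ge> N \<Longrightarrow> (\<integral>x. (conv \<kappa> S (\<mu> n) (\<delta> n) g x - g x)\<^sup>2 \<partial>lebesgue_on S) < r / 6"
    by (auto simp: eventually_sequentially)
  show "\<exists>N. \<forall>n\<ge>N. norm ((\<integral>x. (conv \<kappa> S (\<mu> n) (\<delta> n) f x - f x)\<^sup>2 \<partial>lebesgue_on S) - 0) < r"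
  proof (intro exI allI impI)
    fix n assume n: "n \<ge> N"
    let ?c = "conv \<kappa> S (\<mu> n) (\<delta> n)"
    let ?d = "\<lambda>x. f x - g x"
    have sq: "(a - b)\<^sup>2 \<le> 3 * u\<^sup>2 + 3 * v\<^sup>2 + 3 * w\<^sup>2" if "a - b = u + v - w" for a b u v w :: real
    proof -
      have "3 * u\<^sup>2 + 3 * v\<^sup>2 + 3 * w\<^sup>2 - (u + v - w)\<^sup>2 = (u - v)\<^sup>2 + (v + w)\<^sup>2 + (u + w)\<^sup>2"
        by (simp add: power2_eq_square algebra_simps)
      moreover have "0 \<le> (u - v)\<^sup>2 + (v + w)\<^sup>2 + (u + w)\<^sup>2" by simp
      ultimately show ?thesis unfolding that by linarith
    qed
    have i: "integrable (lebesgue_on S) (\<lambda>x. (?c f x - f x)\<^sup>2)"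
      "integrable (lebesgue_on S) (\<lambda>x. (?c ?d x)\<^sup>2)" "integrable (lebesgue_on S) (\<lambda>x. (?c g x - g x)\<^sup>2)"
      "integrable (lebesgue_on S) (\<lambda>x. (?d x)\<^sup>2)"
      using L_two_diff[OF cfL f] cfgL L_two_diff[OF cgL gL] fgL by (auto simp: L_two_def)
    have "(\<integral>x. (?c f x - f x)\<^sup>2 \<partial>lebesgue_on S)
        \<le> (\<integral>x. 3 * (?c ?d x)\<^sup>2 + 3 * (?c g x - g x)\<^sup>2 + 3 * (?d x)\<^sup>2 \<partial>lebesgue_on S)"
      by (intro integral_mono sq) (use i in \<open>auto simp: conv_diff[OF \<kappa> \<delta>(1) fi gi]\<close>)
    also have "\<dots> = 3 * (\<integral>x. (?c ?d x)\<^sup>2 \<partial>lebesgue_on S) + 3 * (\<integral>x. (?c g x - g x)\<^sup>2 \<partial>lebesgue_on S)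
        + 3 * (\<integral>x. (?d x)\<^sup>2 \<partial>lebesgue_on S)"
      using i by simp
    also have "\<dots> < r"
    proof -
      have I: "0 \<le> (\<integral>x. (?d x)\<^sup>2 \<partial>lebesgue_on S)" by simp
      have "(1 / 2) ^ DIM('a) \<le> \<mu> n ^ DIM('a)" using \<mu>(2)[of n] by (intro power_mono) auto
      then have "1 / \<mu> n ^ DIM('a) \<le> C"
        using \<mu>0[of n] by (simp add: C_def field_simps power_divide)
      then have "(\<integral>x. (?d x)\<^sup>2 \<partial>lebesgue_on S) * (1 / \<mu> n ^ DIM('a)) \<le> (\<integral>x. (?d x)\<^sup>2 \<partial>lebesgue_on S) * C"
        using I by (rule mult_left_mono)
      also have "\<dots> \<le> e * C" using g(3) C by (intro mult_right_mono) auto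
      finally have "(\<integral>x. (?c ?d x)\<^sup>2 \<partial>lebesgue_on S) \<le> e * C"
        using conv_L_two(2)[OF \<kappa> \<delta>(1)[of n] \<mu>0[of n] Sb S(2) fgL] by simp
      then show ?thesis using N[OF n] g(3) e3 by (simp add: mult.commute)
    qed
    finally show "norm ((\<integral>x. (?c f x - f x)\<^sup>2 \<partial>lebesgue_on S) - 0) < r" by simp
  qed
qed

section \<open>Weak derivatives\<close>

lemma lebesgue_on_zero_outside:
  fixes f :: "'a::euclidean_space \<Rightarrow> real"
  assumes "S \<in> sets lebesgue" "T \<in> sets lebesgue" "T \<subseteq> S" "\<And>x. x \<in> S \<Longrightarrow> x \<notin> T \<Longrightarrow> f x = 0"
  shows "integrable (lebesgue_on S) f \<longleftrightarrow> integrable (lebesgue_on T) f"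
    and "integral\<^sup>L (lebesgue_on S) f = integral\<^sup>L (lebesgue_on T) f"
proof -
  have "(\<lambda>x. indicator S x *\<^sub>R f x) = (\<lambda>x. indicator T x *\<^sub>R f x)"
    using assms(3,4) by (intro ext) (auto simp: indicator_def)
  then show "integrable (lebesgue_on S) f \<longleftrightarrow> integrable (lebesgue_on T) f"
    "integral\<^sup>L (lebesgue_on S) f = integral\<^sup>L (lebesgue_on T) f"
    using assms(1,2) by (simp_all add: integrable_restrict_space integral_restrict_space)
qed

lemma test_funE:
  assumes "test_fun S \<phi>"
  obtains C B where "compact C" "C \<subseteq> S" "\<And>x. x \<notin> C \<Longrightarrow> \<phi> x = 0" "\<And>x. \<bar>\<phi> x\<bar> \<le> B"
proof -
  obtain C where C: "compact C" "C \<subseteq> S" "\<And>x. x \<notin> C \<Longrightarrow> \<phi> x = 0"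
    using assms by (auto simp: test_fun_def)
  have "bounded (\<phi> ` C)"
    using assms C(1) by (intro compact_imp_bounded compact_continuous_image smooth_continuous)
      (auto simp: test_fun_def)
  then have "\<exists>B. \<forall>x\<in>C. \<bar>\<phi> x\<bar> \<le> B" by (auto simp: bounded_iff)
  then obtain B where B: "\<And>x. x \<in> C \<Longrightarrow> \<bar>\<phi> x\<bar> \<le> B" by blast
  have "\<bar>\<phi> x\<bar> \<le> max B 0" for x using B[of x] C(3)[of x] by (cases "x \<in> C") auto
  with C that show ?thesis by blast
qed

lemma dir_deriv_zero_outside:
  assumes "closed C" "\<And>x. x \<notin> C \<Longrightarrow> \<phi> x = 0" "x \<notin> C"
  shows "dir_deriv e \<phi> x = 0"
proof -
  have "((\<lambda>x. 0) has_derivative (\<lambda>h. 0)) (at x)" by simp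
  then have "(\<phi> has_derivative (\<lambda>h. 0)) (at x)"
    by (rule has_derivative_transform_within_open[where s = "- C"]) (use assms in auto)
  then show ?thesis by (simp add: dir_deriv_eq)
qed

lemma test_fun_dir_deriv: "test_fun S \<phi> \<Longrightarrow> e \<in> Basis \<Longrightarrow> test_fun S (dir_deriv e \<phi>)"
  unfolding test_fun_def
  by (meson compact_imp_closed dir_deriv_zero_outside smooth_dir_deriv)

lemma test_fun_continuous: "test_fun S \<phi> \<Longrightarrow> continuous_on A \<phi>"
  by (simp add: test_fun_def smooth_continuous)

lemma test_fun_measurable: "test_fun S \<phi> \<Longrightarrow> \<phi> \<in> borel_measurable (lebesgue_on T)"
  by (intro borel_measurable_lebesgue_on_continuous test_fun_continuous)

lemma loc_integrable_mult_test:
  assumes S: "S \<in> sets lebesgue" and g: "loc_integrable S g" and \<phi>: "test_fun S \<phi>"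
  shows "integrable (lebesgue_on S) (\<lambda>x. g x * \<phi> x)"
proof -
  obtain C B where C: "compact C" "C \<subseteq> S" "\<And>x. x \<notin> C \<Longrightarrow> \<phi> x = 0" "\<And>x. \<bar>\<phi> x\<bar> \<le> B"
    using test_funE[OF \<phi>] by blast
  have "integrable (lebesgue_on C) g" using g C by (simp add: loc_integrable_def)
  then have "integrable (lebesgue_on C) (\<lambda>x. \<phi> x * g x)"
    by (rule integrable_mult_bounded[OF _ test_fun_measurable[OF \<phi>], where C = B]) (simp add: C(4))
  then show ?thesis
    using lebesgue_on_zero_outside(1)[OF S _ C(2), of "\<lambda>x. g x * \<phi> x"] C
    by (simp add: mult.commute lmeasurable_compact fmeasurableD)
qed

lemma integrable_imp_loc_integrable:
  fixes f :: "'a::euclidean_space \<Rightarrow> real"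
  assumes S: "S \<in> sets lebesgue" and f: "integrable (lebesgue_on S) f"
  shows "loc_integrable S f"
  unfolding loc_integrable_def
proof (intro allI impI)
  fix C :: "'a set" assume C: "compact C \<and> C \<subseteq> S"
  then have Cm: "C \<in> sets lebesgue" by (simp add: lmeasurable_compact fmeasurableD)
  have "set_integrable lebesgue S f" using f S by (simp add: integrable_restrict_space set_integrable_def)
  then have "set_integrable lebesgue C f" by (rule set_integrable_subset) (use C Cm in auto)
  then show "integrable (lebesgue_on C) f" using Cm by (simp add: integrable_restrict_space set_integrable_def)
qed

lemma test_fun_mker:
  assumes \<kappa>: "mollifier \<kappa>" and \<delta>: "0 < \<delta>" and c: "\<bar>c\<bar> = 1" and sub: "cball (- c *\<^sub>R t) \<delta> \<subseteq> S"
  shows "test_fun S (\<lambda>x. mker \<kappa> \<delta> (c *\<^sub>R x + t))"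
  unfolding test_fun_def
proof (intro conjI exI[of _ "cball (- c *\<^sub>R t) \<delta>"])
  show "smooth (\<lambda>x. mker \<kappa> \<delta> (c *\<^sub>R x + t))"
    by (intro smooth_affine bounded_linear_scaleR_right smooth_mker mollifierD(1)[OF \<kappa>])
  show "\<forall>x. x \<notin> cball (- c *\<^sub>R t) \<delta> \<longrightarrow> mker \<kappa> \<delta> (c *\<^sub>R x + t) = 0"
  proof (intro allI impI mker_eq_0[OF \<kappa> \<delta>])
    fix x assume "x \<notin> cball (- c *\<^sub>R t) \<delta>"
    moreover have "norm (- c *\<^sub>R t - x) = norm (c *\<^sub>R x + t)"
    proof -
      have cc: "c * c = 1" using c by (metis abs_mult_self_eq mult_1)
      have "- c *\<^sub>R t - x = (- c) *\<^sub>R (c *\<^sub>R x + t)" by (simp add: cc scaleR_add_right)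
      then have "norm (- c *\<^sub>R t - x) = \<bar>- c\<bar> * norm (c *\<^sub>R x + t)" by (metis norm_scaleR)
      then show ?thesis using c by simp
    qed
    ultimately show "\<delta> < norm (c *\<^sub>R x + t)" by (simp add: dist_norm)
  qed
qed (use sub in auto)

text \<open>Test against \<open>x \<mapsto> mker (x - y)\<close>, average over \<open>y\<close> with weight \<open>sgn (h y)\<close>, and use Fubini:
  this way no smoothness of convolutions is needed.\<close>

lemma fundamental_lemma:
  fixes h :: "'a::euclidean_space \<Rightarrow> real"
  assumes S: "open S" and h: "loc_integrable S h"
    and orth: "\<And>\<phi>. test_fun S \<phi> \<Longrightarrow> (\<integral>x. h x * \<phi> x \<partial>lebesgue_on S) = 0"
  shows "AE x in lebesgue_on S. h x = 0"
proof -
  have Sm: "S \<in> sets lebesgue" using S by auto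
  obtain \<kappa> :: "'a \<Rightarrow> real" where \<kappa>: "mollifier \<kappa>" using mollifier_exists by blast
  have comp: "AE x in lebesgue. x \<in> C \<longrightarrow> h x = 0" if C: "compact C" "C \<subseteq> S" for C
  proof (cases "C = {}")
    case False
    obtain d where d: "d > 0" "{x. infdist x C \<le> d} \<subseteq> S"
      using compact_in_open_separated[OF False C(1) S C(2)] by blast
    define U where "U = {x. infdist x C < d}"
    have Uo: "open U" unfolding U_def by (intro open_Collect_less continuous_intros)
    have cC: "compact {x. infdist x C \<le> d}" using compact_infdist_le[OF False C(1) d(1)] .
    have US: "U \<subseteq> {x. infdist x C \<le> d}" by (auto simp: U_def)
    then have Ul: "U \<in> lmeasurable"
      using Uo bounded_subset[OF compact_imp_bounded[OF cC] US] by (intro lmeasurable_open) auto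
    have Ub: "U \<in> sets borel" and Um: "U \<in> sets lebesgue" using Uo by auto
    have hU: "integrable (lebesgue_on U) h"
    proof -
      have "integrable (lebesgue_on {x. infdist x C \<le> d}) h"
        using h cC d(2) unfolding loc_integrable_def by blast
      moreover have "{x. infdist x C \<le> d} \<in> sets lebesgue" using cC lmeasurable_compact by blast
      ultimately have "set_integrable lebesgue {x. infdist x C \<le> d} h"
        by (simp add: integrable_restrict_space set_integrable_def)
      then have "set_integrable lebesgue U h" by (rule set_integrable_subset) (use US Um in auto)
      then show ?thesis using Um by (simp add: integrable_restrict_space set_integrable_def)
    qed
    have CU: "C \<subseteq> U" using d(1) by (auto simp: U_def)
    have Cm: "C \<in> sets lebesgue" using C(1) lmeasurable_compact by blast
    \<comment> \<open>Cutting the sign off outside C ensures that only kernels centred in C occur;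
      their supports lie in U, hence in S.\<close>
    define s where "s x = (if x \<in> C then sgn (h x) else 0)" for x
    have sm: "s \<in> borel_measurable (lebesgue_on U)"
    proof -
      have "(\<lambda>x. indicator C x * sgn (h x)) \<in> borel_measurable (lebesgue_on U)"
        using hU Cm Um by (intro borel_measurable_times borel_measurable_sgn borel_measurable_indicator)
          (auto simp: sets_restrict_space_iff CU intro: borel_measurable_integrable)
      moreover have "s = (\<lambda>x. indicator C x * sgn (h x))" by (auto simp: s_def indicator_def)
      ultimately show ?thesis by simp
    qed
    have s1: "\<bar>s x\<bar> \<le> 1" for x by (simp add: s_def sgn_if)
    have sL: "L_two U s" by (rule L_two_bounded[OF Ul sm, of 1]) (simp add: s1)
    have si: "integrable (lebesgue_on U) s" by (rule L_two_integrable[OF Ul sL])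
    \<comment> \<open>Strictly below d for every n, including n = 0.\<close>
    define \<delta> where "\<delta> n = d / (real n + 2)" for n
    have \<delta>: "0 < \<delta> n" "\<delta> n < d" for n using d(1) mult_strict_left_mono[of 1 "real n + 2" d]
    by (simp_all add: \<delta>_def pos_divide_less_eq)
    have \<delta>0: "\<delta> \<longlonglongrightarrow> 0" unfolding \<delta>_def by real_asymp
    define c where "c n = conv \<kappa> U 1 (\<delta> n) s" for n
    have zero: "(\<integral>x. h x * c n x \<partial>lebesgue_on U) = 0" for n
    proof -
      have inner: "(\<integral>x. mker \<kappa> (\<delta> n) (1 *\<^sub>R x - y) * h x \<partial>lebesgue_on U) = 0" if y: "y \<in> C" for y
      proof -
        have sub: "cball y (\<delta> n) \<subseteq> U"
        proof
          fix x assume "x \<in> cball y (\<delta> n)"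
          then have "infdist x C \<le> \<delta> n"
            using infdist_le[OF y, of x] by (simp add: dist_commute)
          then show "x \<in> U" using \<delta>(2)[of n] by (simp add: U_def)
        qed
        have "test_fun S (\<lambda>x. mker \<kappa> (\<delta> n) (1 *\<^sub>R x + - y))"
          using sub US d(2) by (intro test_fun_mker[OF \<kappa> \<delta>(1)]) auto
        from orth[OF this] have "(\<integral>x. mker \<kappa> (\<delta> n) (1 *\<^sub>R x - y) * h x \<partial>lebesgue_on S) = 0"
          by (simp add: mult.commute)
        moreover have "mker \<kappa> (\<delta> n) (x - y) = 0" if "x \<notin> U" for x
          using sub that by (intro mker_eq_0[OF \<kappa> \<delta>(1)]) (metis dist_commute dist_norm mem_cball not_le subsetD)
        ultimately show ?thesis
          using lebesgue_on_zero_outside(2)[OF Sm Um, of "\<lambda>x. mker \<kappa> (\<delta> n) (1 *\<^sub>R x - y) * h x"] US d(2)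
          by auto
      qed
      have "(\<integral>x. h x * c n x \<partial>lebesgue_on U) =
          (\<integral>y. s y * (\<integral>x. mker \<kappa> (\<delta> n) (1 *\<^sub>R x - y) * h x \<partial>lebesgue_on U) \<partial>lebesgue_on U)"
        unfolding c_def by (rule conv_duality(1)[OF \<kappa> \<delta>(1) Ub hU si])
      also have "\<dots> = (\<integral>y. 0 \<partial>lebesgue_on U)"
        by (intro Bochner_Integration.integral_cong refl) (use inner in \<open>auto simp: s_def\<close>)
      finally show ?thesis by simp
    qed
    have cm: "L_two U (c n)" for n
      unfolding c_def by (rule conv_L_two(1)[OF \<kappa> \<delta>(1) _ Ub Ul sL]) simp
    have "(\<lambda>n. \<integral>x. norm ((c n x - s x)\<^sup>2) \<partial>lebesgue_on U) \<longlonglongrightarrow> 0"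
      unfolding c_def using conv_tendsto_L_two[OF \<kappa> Uo Ul sL tendsto_const _ \<delta>(1) \<delta>0] by simp
    moreover have "integrable (lebesgue_on U) (\<lambda>x. (c n x - s x)\<^sup>2)" for n
      using L_two_diff[OF cm sL] by (simp add: L_two_def)
    \<comment> \<open>h is only integrable on U, so convergence of c n in L^2 cannot be paired with
      it; an almost everywhere convergent subsequence, bounded by 1, can.\<close>
    ultimately obtain r where r: "strict_mono r" "AE x in lebesgue_on U. (\<lambda>n. (c (r n) x - s x)\<^sup>2) \<longlonglongrightarrow> 0"
      using tendsto_L1_AE_subseq[of "lebesgue_on U" "\<lambda>n x. (c n x - s x)\<^sup>2"] by blast
    have "(\<lambda>n. \<integral>x. h x * c (r n) x \<partial>lebesgue_on U) \<longlonglongrightarrow> (\<integral>x. h x * s x \<partial>lebesgue_on U)"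
    proof (rule integral_dominated_convergence[where w = "\<lambda>x. \<bar>h x\<bar>"])
      show "AE x in lebesgue_on U. (\<lambda>n. h x * c (r n) x) \<longlonglongrightarrow> h x * s x"
        using r(2)
      proof eventually_elim
        case (elim x)
        then have "(\<lambda>n. sqrt ((c (r n) x - s x)\<^sup>2)) \<longlonglongrightarrow> sqrt 0" by (intro tendsto_real_sqrt)
        then have "(\<lambda>n. c (r n) x - s x) \<longlonglongrightarrow> 0" by (simp add: tendsto_rabs_zero_iff)
        then show ?case by (intro tendsto_mult tendsto_const) (simp add: LIM_zero_iff)
      qed
      show "AE x in lebesgue_on U. norm (h x * c (r n) x) \<le> \<bar>h x\<bar>" for n
      proof (rule AE_I2)
        fix x
        have "\<bar>c (r n) x\<bar> \<le> 1"
          unfolding c_def by (rule conv_abs_le[OF \<kappa> \<delta>(1) Ub si]) (simp_all add: s1)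
        then show "norm (h x * c (r n) x) \<le> \<bar>h x\<bar>" by (simp add: abs_mult mult_left_le)
      qed
      show "(\<lambda>x. h x * c (r n) x) \<in> borel_measurable (lebesgue_on U)" for n
        by (intro borel_measurable_times borel_measurable_integrable[OF hU] L_twoD(1)[OF cm])
    qed (use hU sm in auto)
    then have I: "(\<integral>x. h x * s x \<partial>lebesgue_on U) = 0"
      using zero by (simp add: LIMSEQ_const_iff)
    have hs: "h x * s x = indicator C x * \<bar>h x\<bar>" for x by (simp add: s_def abs_sgn)
    have "integrable (lebesgue_on U) (\<lambda>x. s x * h x)"
      by (rule integrable_mult_bounded[OF hU sm, of 1]) (simp add: s1)
    then have "AE x in lebesgue_on U. h x * s x = 0"
      using I by (subst (asm) integral_nonneg_eq_0_iff_AE) (auto simp: hs mult.commute)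
    then have "AE x in lebesgue. x \<in> U \<longrightarrow> h x * s x = 0" using Um by (simp add: AE_restrict_space_iff)
    then show ?thesis by eventually_elim (use CU in \<open>auto simp: hs\<close>)
  qed simp
  obtain D :: "nat \<Rightarrow> 'a set" where D: "\<And>n. compact (D n)" "\<And>n. D n \<subseteq> S" "\<Union> (range D) = S"
    using open_Union_compact_subsets[OF S] by metis
  have "AE x in lebesgue. \<forall>n. x \<in> D n \<longrightarrow> h x = 0"
    unfolding AE_all_countable using comp D by blast
  then show ?thesis
    unfolding AE_restrict_space_iff[of S lebesgue, simplified, OF Sm]
    by eventually_elim (use D(3) in blast)
qed

lemma mean_value_direction:
  fixes p q :: "'a::euclidean_space \<Rightarrow> real"
  assumes d: "\<And>x. ((\<lambda>t. p (x + t *\<^sub>R e)) has_real_derivative q x) (at 0)"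
    and q: "\<And>x. \<bar>q x\<bar> \<le> B" and h: "h \<noteq> 0"
  shows "\<bar>(p (x + h *\<^sub>R e) - p x) / h\<bar> \<le> B"
proof -
  have D: "((\<lambda>t. p (x + t *\<^sub>R e)) has_real_derivative q (x + t *\<^sub>R e)) (at t)" for t
  proof -
    have "((\<lambda>s. p (x + (s + t) *\<^sub>R e)) has_real_derivative q (x + t *\<^sub>R e)) (at 0)"
      using d[of "x + t *\<^sub>R e"] by (simp add: scaleR_add_left add_ac)
    then show ?thesis using DERIV_shift[of "\<lambda>t. p (x + t *\<^sub>R e)" "q (x + t *\<^sub>R e)" 0 t] by simp
  qed
  have "norm (p (x + h *\<^sub>R e) - p (x + 0 *\<^sub>R e)) \<le> B * norm (h - 0)"
    by (rule field_differentiable_bound[of UNIV "\<lambda>t. p (x + t *\<^sub>R e)" "\<lambda>t. q (x + t *\<^sub>R e)" B])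
      (use D q in \<open>auto intro: DERIV_subset\<close>)
  then show ?thesis using h by (simp add: abs_divide divide_le_eq)
qed

lemma bounded_compact_support:
  fixes q :: "'a::euclidean_space \<Rightarrow> real"
  assumes "continuous_on UNIV q" "compact C" "\<And>x. x \<notin> C \<Longrightarrow> q x = 0"
  obtains B where "0 \<le> B" "\<And>x. \<bar>q x\<bar> \<le> B"
proof -
  have "bounded (q ` C)"
    using assms(1,2) by (intro compact_imp_bounded compact_continuous_image) (auto intro: continuous_on_subset)
  then have "\<exists>B. \<forall>x\<in>C. \<bar>q x\<bar> \<le> B" by (auto simp: bounded_iff)
  then obtain B where B: "\<And>x. x \<in> C \<Longrightarrow> \<bar>q x\<bar> \<le> B" by blast
  have "\<bar>q x\<bar> \<le> max B 0" for x using B[of x] assms(3)[of x] by (cases "x \<in> C") auto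
  then show ?thesis using that[of "max B 0"] by simp
qed

text \<open>By translation invariance the difference quotients of \<open>p\<close> integrate to zero.\<close>

lemma integral_directional_derivative_eq_0:
  fixes p q :: "'a::euclidean_space \<Rightarrow> real"
  assumes d: "\<And>x. ((\<lambda>t. p (x + t *\<^sub>R e)) has_real_derivative q x) (at 0)"
    and p: "continuous_on UNIV p" and q: "continuous_on UNIV q"
    and C: "compact C" "\<And>x. x \<notin> C \<Longrightarrow> p x = 0" "\<And>x. x \<notin> C \<Longrightarrow> q x = 0"
  shows "integral\<^sup>L lborel q = 0"
proof -
  obtain B where B: "0 \<le> B" "\<And>x. \<bar>q x\<bar> \<le> B" using bounded_compact_support[OF q C(1,3)] by blast
  obtain r where r: "\<And>x. x \<in> C \<Longrightarrow> norm x \<le> r"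
    using compact_imp_bounded[OF C(1)] by (auto simp: bounded_iff)
  \<comment> \<open>Steps of length at most 1 keep all difference quotients supported in the ball of
    radius r + norm e.\<close>
  define t where "t n = 1 / (real n + 1)" for n
  have t: "0 < t n" "t n \<le> 1" for n by (auto simp: t_def)
  have tn: "t n \<noteq> 0" for n using t(1)[of n] by simp
  have t0: "t \<longlonglongrightarrow> 0" unfolding t_def by real_asymp
  define Q where "Q n x = (p (x + t n *\<^sub>R e) - p x) / t n" for n x
  have pm[measurable]: "p \<in> borel_measurable borel" using p by (rule borel_measurable_continuous_onI)
  have pi: "integrable lborel p" by (rule integrable_continuous_compact_support[OF p C(1,2)])
  have pti: "integrable lborel (\<lambda>x. p (x + t n *\<^sub>R e))"
    and ptI: "(\<integral>x. p (x + t n *\<^sub>R e) \<partial>lborel) = integral\<^sup>L lborel p" for n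
    using lborel_affine_integral[OF _ pm, of 1 "t n *\<^sub>R e"] pi by (simp_all add: add.commute)
  have Q0: "integral\<^sup>L lborel (Q n) = 0" for n
    unfolding Q_def using pti pi ptI by simp
  have "(\<lambda>n. integral\<^sup>L lborel (Q n)) \<longlonglongrightarrow> integral\<^sup>L lborel q"
  proof (rule integral_dominated_convergence[where w = "\<lambda>x. indicator (cball (0::'a) (r + norm e)) x * B"])
    show "integrable lborel (\<lambda>x. indicator (cball (0::'a) (r + norm e)) x * B)"
      by (intro integrable_mult_left integrable_real_indicator)
        (simp, use emeasure_bounded_finite[OF bounded_cball, of "0::'a" "r + norm e"] in simp)
    show "AE x in lborel. (\<lambda>n. Q n x) \<longlonglongrightarrow> q x"
    proof (rule AE_I2)
      fix x
      have "((\<lambda>h. (p (x + h *\<^sub>R e) - p x) / h) \<longlongrightarrow> q x) (at 0)"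
        using d[of x] by (simp add: has_field_derivative_iff)
      then show "(\<lambda>n. Q n x) \<longlonglongrightarrow> q x"
        unfolding Q_def by (rule filterlim_compose)
          (use t0 tn in \<open>simp add: filterlim_at always_eventually\<close>)
    qed
    show "AE x in lborel. norm (Q n x) \<le> indicator (cball (0::'a) (r + norm e)) x * B" for n
    proof (rule AE_I2)
      fix x
      have b: "\<bar>Q n x\<bar> \<le> B" unfolding Q_def by (rule mean_value_direction[OF d B(2)]) (use t(1)[of n] in simp)
      show "norm (Q n x) \<le> indicator (cball (0::'a) (r + norm e)) x * B"
      proof (cases "x \<in> cball 0 (r + norm e)")
        case False
        then have nx: "norm x > r + norm e" by simp
        have "norm (t n *\<^sub>R e) \<le> norm e" using t[of n] by (simp add: mult_left_le_one_le)
        then have "norm (x + t n *\<^sub>R e) > r" using norm_diff_ineq[of x "t n *\<^sub>R e"] nx by linarith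
        then have "x + t n *\<^sub>R e \<notin> C" using r by force
        moreover have "x \<notin> C" using r[of x] nx norm_ge_zero[of e] by force
        ultimately show ?thesis using C(2) B(1) by (simp add: Q_def)
      qed (use b in simp)
    qed
    show "q \<in> borel_measurable lborel" using q by (simp add: borel_measurable_continuous_onI)
    show "Q n \<in> borel_measurable lborel" for n unfolding Q_def by measurable
  qed
  then show ?thesis using Q0 by (simp add: LIMSEQ_const_iff)
qed

section \<open>Linearity and uniqueness of weak derivatives\<close>

lemma loc_integrable_cong_AE:
  fixes f f' :: "'a::euclidean_space \<Rightarrow> real"
  assumes S: "S \<in> sets lebesgue" and f: "loc_integrable S f" and ae: "AE x in lebesgue_on S. f' x = f x"
  shows "loc_integrable S f'"
  unfolding loc_integrable_def
proof (intro allI impI)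
  fix C :: "'a set" assume C: "compact C \<and> C \<subseteq> S"
  then have Cm: "C \<in> sets lebesgue" using lmeasurable_compact by blast
  have "AE x in lebesgue_on C. f' x = f x"
    using ae unfolding AE_lebesgue_on_iff[OF Cm] AE_lebesgue_on_iff[OF S]
    by eventually_elim (use C in auto)
  then show "integrable (lebesgue_on C) f'"
    using lebesgue_on_cong_AE(1)[OF Cm] f C unfolding loc_integrable_def by blast
qed

lemma weak_deriv_cong_AE:
  assumes S: "S \<in> sets lebesgue" and e: "e \<in> Basis" and w: "weak_deriv S e f g"
    and f: "AE x in lebesgue_on S. f' x = f x" and g: "AE x in lebesgue_on S. g' x = g x"
  shows "weak_deriv S e f' g'"
  unfolding weak_deriv_def
proof (intro conjI allI impI)
  have L: "loc_integrable S f" "loc_integrable S g" using w by (auto simp: weak_deriv_def)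
  show "loc_integrable S f'" "loc_integrable S g'"
    using loc_integrable_cong_AE[OF S] L f g by blast+
  fix \<phi> assume \<phi>: "test_fun S \<phi>"
  have 1: "AE x in lebesgue_on S. f' x * dir_deriv e \<phi> x = f x * dir_deriv e \<phi> x"
    using f by eventually_elim simp
  have 2: "AE x in lebesgue_on S. g' x * \<phi> x = g x * \<phi> x"
    using g by eventually_elim simp
  show "(\<integral>x. f' x * dir_deriv e \<phi> x \<partial>lebesgue_on S) = - (\<integral>x. g' x * \<phi> x \<partial>lebesgue_on S)"
    using lebesgue_on_cong_AE(2)[OF S loc_integrable_mult_test[OF S L(1) test_fun_dir_deriv[OF \<phi> e]] 1]
      lebesgue_on_cong_AE(2)[OF S loc_integrable_mult_test[OF S L(2) \<phi>] 2] w \<phi>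
    by (simp add: weak_deriv_def)
qed

lemma loc_integrable_add: "loc_integrable S f \<Longrightarrow> loc_integrable S g \<Longrightarrow> loc_integrable S (\<lambda>x. f x + g x)"
  and loc_integrable_cmult: "loc_integrable S f \<Longrightarrow> loc_integrable S (\<lambda>x. c * f x)"
  unfolding loc_integrable_def by auto

lemma weak_deriv_add:
  assumes S: "S \<in> sets lebesgue" and e: "e \<in> Basis" and 1: "weak_deriv S e f g" and 2: "weak_deriv S e f' g'"
  shows "weak_deriv S e (\<lambda>x. f x + f' x) (\<lambda>x. g x + g' x)"
  unfolding weak_deriv_def
proof (intro conjI allI impI)
  have L: "loc_integrable S f" "loc_integrable S g" "loc_integrable S f'" "loc_integrable S g'"
    using 1 2 by (auto simp: weak_deriv_def)
  then show "loc_integrable S (\<lambda>x. f x + f' x)" "loc_integrable S (\<lambda>x. g x + g' x)"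
    by (auto intro: loc_integrable_add)
  fix \<phi> assume \<phi>: "test_fun S \<phi>"
  note T = loc_integrable_mult_test[OF S _ \<phi>] loc_integrable_mult_test[OF S _ test_fun_dir_deriv[OF \<phi> e]]
  show "(\<integral>x. (f x + f' x) * dir_deriv e \<phi> x \<partial>lebesgue_on S) = - (\<integral>x. (g x + g' x) * \<phi> x \<partial>lebesgue_on S)"
    using 1 2 \<phi> T L by (simp add: weak_deriv_def distrib_right)
qed

lemma weak_deriv_cmult: "weak_deriv S e f g \<Longrightarrow> weak_deriv S e (\<lambda>x. c * f x) (\<lambda>x. c * g x)"
  by (simp add: weak_deriv_def loc_integrable_cmult mult.assoc)

lemma weak_deriv_unique:
  assumes S: "open S" and e: "e \<in> Basis" and 1: "weak_deriv S e f g" and 2: "weak_deriv S e f' g'"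
    and f: "AE x in lebesgue_on S. f x = f' x"
  shows "AE x in lebesgue_on S. g x = g' x"
proof -
  have Sm: "S \<in> sets lebesgue" using S by auto
  have L: "loc_integrable S f" "loc_integrable S g" "loc_integrable S f'" "loc_integrable S g'"
    using 1 2 by (auto simp: weak_deriv_def)
  have "AE x in lebesgue_on S. g x + - 1 * g' x = 0"
  proof (rule fundamental_lemma[OF S])
    show "loc_integrable S (\<lambda>x. g x + - 1 * g' x)" by (intro loc_integrable_add loc_integrable_cmult L)
    fix \<phi> assume \<phi>: "test_fun S \<phi>"
    have "AE x in lebesgue_on S. f x * dir_deriv e \<phi> x = f' x * dir_deriv e \<phi> x"
      using f by eventually_elim simp
    from lebesgue_on_cong_AE(2)[OF Sm loc_integrable_mult_test[OF Sm L(3) test_fun_dir_deriv[OF \<phi> e]] this]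
    have "(\<integral>x. g x * \<phi> x \<partial>lebesgue_on S) = (\<integral>x. g' x * \<phi> x \<partial>lebesgue_on S)"
      using 1 2 \<phi> by (simp add: weak_deriv_def)
    moreover have "(\<integral>x. (g x + - 1 * g' x) * \<phi> x \<partial>lebesgue_on S) =
        (\<integral>x. g x * \<phi> x \<partial>lebesgue_on S) - (\<integral>x. g' x * \<phi> x \<partial>lebesgue_on S)"
      using loc_integrable_mult_test[OF Sm L(2) \<phi>] loc_integrable_mult_test[OF Sm L(4) \<phi>]
      by (simp add: left_diff_distrib)
    ultimately show "(\<integral>x. (g x + - 1 * g' x) * \<phi> x \<partial>lebesgue_on S) = 0" by simp
  qed
  then show ?thesis by eventually_elim simp
qed

section \<open>Derivatives of mollified functions\<close>

lemma smooth_directional: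
  assumes f: "smooth f" and e: "e \<in> Basis"
  shows "((\<lambda>t. f (x + t *\<^sub>R e)) has_real_derivative dir_deriv e f x) (at 0)"
proof -
  have 1: "((\<lambda>t. x + t *\<^sub>R e) has_derivative (\<lambda>t. t *\<^sub>R e)) (at (0::real))"
    by (auto intro!: derivative_eq_intros)
  have 2: "(f has_derivative (\<lambda>h. \<Sum>b\<in>Basis. (h \<bullet> b) * dir_deriv b f x)) (at (x + 0 *\<^sub>R e))"
    using smooth_has_derivative[OF f, of x] by simp
  from diff_chain_at[OF 1 2]
  have "((\<lambda>t. f (x + t *\<^sub>R e)) has_derivative (\<lambda>t. \<Sum>b\<in>Basis. ((t *\<^sub>R e) \<bullet> b) * dir_deriv b f x)) (at 0)"
    by (simp add: o_def)
  moreover have "(\<Sum>b\<in>Basis. ((t *\<^sub>R e) \<bullet> b) * dir_deriv b f x) = dir_deriv e f x * t" for t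
  proof -
    have "(\<Sum>b\<in>Basis. ((t *\<^sub>R e) \<bullet> b) * dir_deriv b f x) = (\<Sum>b\<in>Basis. if b = e then t * dir_deriv b f x else 0)"
      using e by (intro sum.cong) (auto simp: inner_Basis)
    then show ?thesis using e by (simp add: mult.commute)
  qed
  ultimately show ?thesis unfolding has_field_derivative_def by (simp only:)
qed

text \<open>The derivative falls on the kernel, whose difference quotients are bounded by the mean
  value theorem; \<mu> is the inner derivative of the dilation. The derivative along a line is
  exactly the form that \<open>integral_directional_derivative_eq_0\<close> takes.\<close>

lemma conv_directional:
  fixes f :: "'a::euclidean_space \<Rightarrow> real"
  assumes \<kappa>: "mollifier \<kappa>" and \<delta>: "0 < \<delta>" and \<mu>: "0 < \<mu>" and e: "e \<in> Basis" and f: "integrable (lebesgue_on S) f"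
  shows "((\<lambda>t. conv \<kappa> S \<mu> \<delta> f (x + t *\<^sub>R e)) has_real_derivative
      \<mu> * (\<integral>y. dir_deriv e (mker \<kappa> \<delta>) (\<mu> *\<^sub>R x - y) * f y \<partial>lebesgue_on S)) (at 0)"
proof -
  let ?k = "mker \<kappa> \<delta>"
  have ks: "smooth ?k" by (intro smooth_mker mollifierD(1)[OF \<kappa>])
  have dks: "smooth (dir_deriv e ?k)" by (rule smooth_dir_deriv[OF ks e])
  have supp: "?k z = 0" if "z \<notin> cball 0 \<delta>" for z using that mker_eq_0[OF \<kappa> \<delta>, of z] by simp
  have dsupp: "dir_deriv e ?k z = 0" if "z \<notin> cball 0 \<delta>" for z
    by (rule dir_deriv_zero_outside[OF _ supp that]) auto
  obtain B where B: "0 \<le> B" "\<And>z. \<bar>dir_deriv e ?k z\<bar> \<le> B"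
    using bounded_compact_support[OF smooth_continuous[OF dks] _ dsupp] by (metis compact_cball)
  have D: "((\<lambda>t. ?k (z + t *\<^sub>R e)) has_real_derivative dir_deriv e ?k z) (at 0)" for z
    by (rule smooth_directional[OF ks e])
  have dm: "(\<lambda>y. dir_deriv e ?k (\<mu> *\<^sub>R x - y)) \<in> borel_measurable (lebesgue_on S)"
    by (intro borel_measurable_lebesgue_on_continuous continuous_on_compose2[OF smooth_continuous[OF dks, of UNIV]]
        continuous_intros) auto
  have fm[measurable]: "f \<in> borel_measurable (lebesgue_on S)" using f by blast
  have "((\<lambda>h. (conv \<kappa> S \<mu> \<delta> f (x + h *\<^sub>R e) - conv \<kappa> S \<mu> \<delta> f x) / h) \<longlongrightarrow>
      (\<integral>y. \<mu> * (dir_deriv e ?k (\<mu> *\<^sub>R x - y) * f y) \<partial>lebesgue_on S)) (at 0)"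
    unfolding tendsto_at_iff_sequentially o_def
  proof (intro allI impI)
    fix h :: "nat \<Rightarrow> real" assume h: "\<forall>i. h i \<in> UNIV - {0}" "h \<longlonglongrightarrow> 0"
    define q where "q n y = (?k (\<mu> *\<^sub>R x - y + (\<mu> * h n) *\<^sub>R e) - ?k (\<mu> *\<^sub>R x - y)) / (\<mu> * h n)" for n y
    have hn: "\<mu> * h n \<noteq> 0" for n using h(1) \<mu> by auto
    have mh: "(\<lambda>n. \<mu> * h n) \<longlonglongrightarrow> 0" using tendsto_mult_right_zero[OF h(2), of \<mu>] by simp
    have "(conv \<kappa> S \<mu> \<delta> f (x + h n *\<^sub>R e) - conv \<kappa> S \<mu> \<delta> f x) / h n
        = (\<integral>y. \<mu> * (q n y * f y) \<partial>lebesgue_on S)" for n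
    proof -
      have "\<mu> * (q n y * f y) =
          (?k (\<mu> *\<^sub>R (x + h n *\<^sub>R e) - y) * f y - ?k (\<mu> *\<^sub>R x - y) * f y) / h n" for y
        using hn[of n] by (simp add: q_def scaleR_add_right left_diff_distrib algebra_simps diff_divide_distrib)
      then show ?thesis
        using mker_mult_integrable[OF \<kappa> \<delta> f] by (simp add: conv_def)
    qed
    moreover have "(\<lambda>n. \<integral>y. \<mu> * (q n y * f y) \<partial>lebesgue_on S) \<longlonglongrightarrow>
        (\<integral>y. \<mu> * (dir_deriv e ?k (\<mu> *\<^sub>R x - y) * f y) \<partial>lebesgue_on S)"
    proof (rule integral_dominated_convergence[where w = "\<lambda>y. \<mu> * (B * \<bar>f y\<bar>)"])
      show "AE y in lebesgue_on S. (\<lambda>n. \<mu> * (q n y * f y)) \<longlonglongrightarrow> \<mu> * (dir_deriv e ?k (\<mu> *\<^sub>R x - y) * f y)"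
      proof (intro AE_I2 tendsto_mult tendsto_const)
        fix y
        have "((\<lambda>s. (?k (\<mu> *\<^sub>R x - y + s *\<^sub>R e) - ?k (\<mu> *\<^sub>R x - y)) / s) \<longlongrightarrow> dir_deriv e ?k (\<mu> *\<^sub>R x - y)) (at 0)"
          using D[of "\<mu> *\<^sub>R x - y"] by (simp add: has_field_derivative_iff)
        then show "(\<lambda>n. q n y) \<longlonglongrightarrow> dir_deriv e ?k (\<mu> *\<^sub>R x - y)"
          unfolding q_def by (rule filterlim_compose)
            (use mh hn in \<open>simp add: filterlim_at always_eventually\<close>)
      qed
      show "AE y in lebesgue_on S. norm (\<mu> * (q n y * f y)) \<le> \<mu> * (B * \<bar>f y\<bar>)" for n
      proof (rule AE_I2)
        fix y
        have "\<bar>q n y\<bar> \<le> B" unfolding q_def by (rule mean_value_direction[OF D B(2) hn])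
        then show "norm (\<mu> * (q n y * f y)) \<le> \<mu> * (B * \<bar>f y\<bar>)"
          using \<mu> by (simp add: abs_mult mult_right_mono)
      qed
      show "integrable (lebesgue_on S) (\<lambda>y. \<mu> * (B * \<bar>f y\<bar>))" using f by simp
      have km: "(\<lambda>y. ?k (a - y)) \<in> borel_measurable (lebesgue_on S)" for a
        by (rule mker_shift_measurable[OF \<kappa>])
      show "(\<lambda>y. \<mu> * (q n y * f y)) \<in> borel_measurable (lebesgue_on S)" for n
        unfolding q_def using km[of "\<mu> *\<^sub>R x + (\<mu> * h n) *\<^sub>R e"] km[of "\<mu> *\<^sub>R x"]
        by (simp add: algebra_simps)
    qed (use dm in auto)
    ultimately show "(\<lambda>n. (conv \<kappa> S \<mu> \<delta> f (x + h n *\<^sub>R e) - conv \<kappa> S \<mu> \<delta> f x) / h n) \<longlonglongrightarrow>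
        (\<integral>y. \<mu> * (dir_deriv e ?k (\<mu> *\<^sub>R x - y) * f y) \<partial>lebesgue_on S)" by simp
  qed
  then show ?thesis by (simp add: has_field_derivative_iff)
qed

text \<open>Under the inclusion of balls, the kernel is a test function of y. Its derivative in y is
  minus that of \<open>mker\<close>, which cancels the sign in the definition of the weak
  derivative.\<close>

lemma conv_weak_deriv:
  fixes f :: "'a::euclidean_space \<Rightarrow> real"
  assumes \<kappa>: "mollifier \<kappa>" and \<delta>: "0 < \<delta>" and e: "e \<in> Basis" and w: "weak_deriv S e f g"
    and sub: "cball (\<mu> *\<^sub>R x) \<delta> \<subseteq> S"
  shows "(\<integral>y. dir_deriv e (mker \<kappa> \<delta>) (\<mu> *\<^sub>R x - y) * f y \<partial>lebesgue_on S) = conv \<kappa> S \<mu> \<delta> g x"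
proof -
  have T: "test_fun S (\<lambda>y. mker \<kappa> \<delta> (- 1 *\<^sub>R y + \<mu> *\<^sub>R x))"
    by (rule test_fun_mker[OF \<kappa> \<delta>]) (use sub in auto)
  have "dir_deriv e (\<lambda>y. mker \<kappa> \<delta> (- 1 *\<^sub>R y + \<mu> *\<^sub>R x)) y = - dir_deriv e (mker \<kappa> \<delta>) (\<mu> *\<^sub>R x - y)" for y
  proof -
    have "dir_deriv e (\<lambda>y. mker \<kappa> \<delta> (- 1 *\<^sub>R y + \<mu> *\<^sub>R x)) y =
        (\<Sum>b\<in>Basis. ((- 1 *\<^sub>R e) \<bullet> b) * dir_deriv b (mker \<kappa> \<delta>) (- 1 *\<^sub>R y + \<mu> *\<^sub>R x))"
      by (rule dir_deriv_affine[OF bounded_linear_scaleR_right])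
        (rule smooth_differentiable[OF smooth_mker[OF mollifierD(1)[OF \<kappa>]]])
    also have "\<dots> = (\<Sum>b\<in>Basis. if b = e then - dir_deriv b (mker \<kappa> \<delta>) (\<mu> *\<^sub>R x - y) else 0)"
      using e by (intro sum.cong) (auto simp: inner_Basis)
    finally show ?thesis using e by simp
  qed
  moreover have "(\<integral>y. f y * dir_deriv e (\<lambda>y. mker \<kappa> \<delta> (- 1 *\<^sub>R y + \<mu> *\<^sub>R x)) y \<partial>lebesgue_on S) =
      - (\<integral>y. g y * mker \<kappa> \<delta> (- 1 *\<^sub>R y + \<mu> *\<^sub>R x) \<partial>lebesgue_on S)"
    using w T unfolding weak_deriv_def by blast
  ultimately show ?thesis unfolding conv_def by (simp add: mult.commute)
qed

section \<open>Chain rules on a ball\<close>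

text \<open>Dilating by \<open>\<mu> < 1\<close> before mollifying keeps the kernel inside the ball, so the
  approximation holds up to the boundary.\<close>

definition dil :: "nat \<Rightarrow> real" where "dil n = 1 - 1 / (real n + 2)"

text \<open>Half of (1 - \<open>dil n\<close>) R, the gap between the dilated ball and the sphere.
  The 2 in the denominator of \<open>dil\<close> makes \<open>dil n\<close> at least 1/2, as
  \<open>conv_tendsto_L_two\<close> requires.\<close>

definition rad :: "real \<Rightarrow> nat \<Rightarrow> real" where "rad R n = R / (2 * (real n + 2))"

lemma dil_rad:
  assumes "0 < R"
  shows "dil \<longlonglongrightarrow> 1" "1 / 2 \<le> dil n" "0 < dil n" "dil n \<le> 1" "0 < rad R n" "rad R \<longlonglongrightarrow> 0"
    "x \<in> ball 0 R \<Longrightarrow> cball (dil n *\<^sub>R x) (rad R n) \<subseteq> ball (0::'a::euclidean_space) R"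
proof -
  show d: "dil \<longlonglongrightarrow> 1" unfolding dil_def[abs_def] by real_asymp
  show "rad R \<longlonglongrightarrow> 0" unfolding rad_def[abs_def] by real_asymp
  show h: "1 / 2 \<le> dil n" and pos: "0 < dil n" and "dil n \<le> 1" by (auto simp: dil_def field_simps)
  show "0 < rad R n" using assms by (simp add: rad_def)
  show "cball (dil n *\<^sub>R x) (rad R n) \<subseteq> ball 0 R" if x: "x \<in> ball 0 R"
  proof
    fix y assume "y \<in> cball (dil n *\<^sub>R x) (rad R n)"
    then have "norm y \<le> norm (dil n *\<^sub>R x) + rad R n"
      using norm_triangle_sub[of y "dil n *\<^sub>R x"] by (simp add: dist_norm norm_minus_commute)
    also have "\<dots> \<le> dil n * R + rad R n" using x pos by (simp add: mult_left_mono)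
    also have "\<dots> = R - R / (2 * (real n + 2))"
    proof -
      have "R / k = 2 * (R / (2 * k))" for k :: real by simp
      from this[of "real n + 2"] have "R / (real n + 2) = 2 * (R / (2 * (real n + 2)))" .
      then show ?thesis by (simp add: dil_def rad_def left_diff_distrib)
    qed
    also have "\<dots> < R" using assms by simp
    finally show "y \<in> ball 0 R" by simp
  qed
qed

text \<open>H^1 with respect to one coordinate direction, so that the chain rules can be proved for
  each partial derivative separately.\<close>

definition H1_deriv :: "real \<Rightarrow> 'a::euclidean_space \<Rightarrow> ('a \<Rightarrow> real) \<Rightarrow> ('a \<Rightarrow> real) \<Rightarrow> bool" where
  "H1_deriv R e f g \<longleftrightarrow> weak_deriv (ball 0 R) e f g \<and> L_two (ball 0 R) f \<and> L_two (ball 0 R) g"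

lemma ball_sets: "ball (0::'a::euclidean_space) R \<in> lmeasurable" "ball (0::'a) R \<in> sets lebesgue"
  "ball (0::'a) R \<in> sets borel" "open (ball (0::'a) R)"
  by auto

text \<open>Integration by parts is classical for F(u_n) times the test function, where u_n and v_n
  are the dilated mollifications of f and g. In the limit F(u_n) is controlled by the Lipschitz
  bound on F. The product F'(u_n) v_n is split into F'(u_n) (v_n - g), small because F' is bounded,
  and F'(u_n) g, treated by dominated convergence along a subsequence on which u_n converges almost
  everywhere.\<close>

lemma chain_rule_C1:
  fixes f :: "'a::euclidean_space \<Rightarrow> real"
  assumes R: "0 < R" and e: "e \<in> Basis" and fg: "H1_deriv R e f g"
    and F: "\<And>s. (F has_real_derivative F' s) (at s)" and F'c: "continuous_on UNIV F'" and F'b: "\<And>s. \<bar>F' s\<bar> \<le> B"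
    and \<phi>: "test_fun (ball 0 R) \<phi>"
  shows "(\<integral>x. F (f x) * dir_deriv e \<phi> x \<partial>lebesgue_on (ball 0 R)) =
    - (\<integral>x. F' (f x) * g x * \<phi> x \<partial>lebesgue_on (ball 0 R))"
proof -
  let ?S = "ball (0::'a) R"
  let ?M = "lebesgue_on ?S"
  note S = ball_sets[where 'a='a and R=R]
  obtain \<kappa> :: "'a \<Rightarrow> real" where \<kappa>: "mollifier \<kappa>" using mollifier_exists by blast
  have w: "weak_deriv ?S e f g" and f: "L_two ?S f" and g: "L_two ?S g" using fg by (auto simp: H1_deriv_def)
  note D = dil_rad[OF R]
  have fi: "integrable ?M f" and gi: "integrable ?M g" using L_two_integrable[OF S(1)] f g by auto
  define u where "u n = conv \<kappa> ?S (dil n) (rad R n) f" for n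
  define v where "v n = conv \<kappa> ?S (dil n) (rad R n) g" for n
  have uL: "L_two ?S (u n)" and vL: "L_two ?S (v n)" for n
    unfolding u_def v_def by (rule conv_L_two(1)[OF \<kappa> D(5) D(3) S(3,1)]; fact)+
  have uc: "continuous_on UNIV (u n)" for n unfolding u_def by (rule continuous_conv[OF \<kappa> D(5) fi])
  have ulim: "(\<lambda>n. \<integral>x. (u n x - f x)\<^sup>2 \<partial>?M) \<longlonglongrightarrow> 0"
    unfolding u_def by (rule conv_tendsto_L_two[OF \<kappa> S(4,1) f D(1,2,5,6)])
  have vlim: "(\<lambda>n. \<integral>x. (v n x - g x)\<^sup>2 \<partial>?M) \<longlonglongrightarrow> 0"
    unfolding v_def by (rule conv_tendsto_L_two[OF \<kappa> S(4,1) g D(1,2,5,6)])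
  have Fc: "continuous_on UNIV F" using F by (intro continuous_at_imp_continuous_on) (auto intro: DERIV_isCont)
  obtain C b where C: "compact C" "C \<subseteq> ?S" "\<And>x. x \<notin> C \<Longrightarrow> \<phi> x = 0" "\<And>x. \<bar>\<phi> x\<bar> \<le> b"
    using test_funE[OF \<phi>] by blast
  have T': "test_fun ?S (dir_deriv e \<phi>)" by (rule test_fun_dir_deriv[OF \<phi> e])
  have \<phi>s: "smooth \<phi>" using \<phi> by (simp add: test_fun_def)
  have d\<phi>0: "dir_deriv e \<phi> x = 0" if "x \<notin> C" for x
    by (rule dir_deriv_zero_outside[OF compact_imp_closed[OF C(1)] C(3) that])
  obtain C' b' where "compact C'" "C' \<subseteq> ?S" "\<And>x. x \<notin> C' \<Longrightarrow> dir_deriv e \<phi> x = 0"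
    and b': "\<And>x. \<bar>dir_deriv e \<phi> x\<bar> \<le> b'"
    using test_funE[OF T'] by blast
  have [measurable]: "\<phi> \<in> borel_measurable ?M" "dir_deriv e \<phi> \<in> borel_measurable ?M" "f \<in> borel_measurable ?M"
    "g \<in> borel_measurable ?M" "u n \<in> borel_measurable ?M" "v n \<in> borel_measurable ?M"
    "F \<in> borel_measurable borel" "F' \<in> borel_measurable borel" for n
    using test_fun_measurable[OF \<phi>] test_fun_measurable[OF T'] L_twoD(1)[OF f] L_twoD(1)[OF g] L_twoD(1)[OF uL]
      L_twoD(1)[OF vL] Fc F'c by (auto intro: borel_measurable_continuous_onI)
  have \<phi>L: "L_two ?S \<phi>" and d\<phi>L: "L_two ?S (dir_deriv e \<phi>)"
    by (rule L_two_bounded[OF S(1), where C = b], use C(4) in auto)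
      (rule L_two_bounded[OF S(1), where C = b'], use b' in auto)
  have FL: "L_two ?S (\<lambda>x. F (h x))" if h: "L_two ?S h" for h
  proof -
    have [measurable]: "h \<in> borel_measurable ?M" using L_twoD(1)[OF h] .
    have lip: "\<bar>F s - F 0\<bar> \<le> B * \<bar>s\<bar>" for s
      using field_differentiable_bound[of UNIV F F' B s 0] F F'b by simp
    have "L_two ?S (\<lambda>x. F (h x) - F 0)"
      by (rule L_two_bound[OF h, of _ B]) (use lip in auto)
    from L_two_add[OF this L_two_bounded[OF S(1), of "\<lambda>x. F 0" "\<bar>F 0\<bar>"]] show ?thesis by simp
  qed
  \<comment> \<open>The factor \<open>dil n\<close> is the inner derivative of the dilation; it
    tends to 1.\<close>
  have ibp: "(\<integral>x. F (u n x) * dir_deriv e \<phi> x \<partial>?M) = - (dil n * (\<integral>x. F' (u n x) * v n x * \<phi> x \<partial>?M))" for n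
  proof -
    define d where "d x = dil n * (\<integral>y. dir_deriv e (mker \<kappa> (rad R n)) (dil n *\<^sub>R x - y) * f y \<partial>?M)" for x
    have du: "((\<lambda>t. u n (x + t *\<^sub>R e)) has_real_derivative d x) (at 0)" for x
      unfolding u_def d_def by (rule conv_directional[OF \<kappa> D(5) D(3) e fi])
    have ks: "smooth (dir_deriv e (mker \<kappa> (rad R n)))"
      by (intro smooth_dir_deriv smooth_mker mollifierD(1)[OF \<kappa>] e)
    have supp: "mker \<kappa> (rad R n) z = 0" if "z \<notin> cball 0 (rad R n)" for z
      using that mker_eq_0[OF \<kappa> D(5), of n z] by simp
    have "dir_deriv e (mker \<kappa> (rad R n)) z = 0" if "z \<notin> cball 0 (rad R n)" for z
      by (rule dir_deriv_zero_outside[OF _ supp that]) auto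
    then obtain B1 where B1: "\<And>z. \<bar>dir_deriv e (mker \<kappa> (rad R n)) z\<bar> \<le> B1"
      using bounded_compact_support[OF smooth_continuous[OF ks]] by (metis compact_cball)
    have dc: "continuous_on UNIV d"
      unfolding d_def
      using isCont_integral_kernel[OF fi smooth_continuous[OF ks] B1, of "dil n" "-1"]
      by (intro continuous_on_mult continuous_on_const) simp
    define p where "p x = F (u n x) * \<phi> x" for x
    define q where "q x = F (u n x) * dir_deriv e \<phi> x + F' (u n x) * d x * \<phi> x" for x
    have Fuc: "continuous_on UNIV (\<lambda>x. F (u n x))" "continuous_on UNIV (\<lambda>x. F' (u n x))"
      using continuous_on_compose2[OF Fc uc] continuous_on_compose2[OF F'c uc] by auto
    have \<phi>c: "continuous_on UNIV \<phi>" "continuous_on UNIV (dir_deriv e \<phi>)"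
      using test_fun_continuous[OF \<phi>] test_fun_continuous[OF T'] by auto
    have qc: "continuous_on UNIV q"
      unfolding q_def by (intro continuous_on_add continuous_on_mult Fuc \<phi>c dc)
    have "integral\<^sup>L lborel q = 0"
    proof (rule integral_directional_derivative_eq_0[where p = p and C = C and e = e])
      show "((\<lambda>t. p (x + t *\<^sub>R e)) has_real_derivative q x) (at 0)" for x
      proof -
        have 1: "((\<lambda>t. F (u n (x + t *\<^sub>R e))) has_real_derivative F' (u n x) * d x) (at 0)"
          using DERIV_chain2[of F "F' (u n x)" "\<lambda>t. u n (x + t *\<^sub>R e)" 0 "d x" UNIV] F du by simp
        have 2: "((\<lambda>t. \<phi> (x + t *\<^sub>R e)) has_real_derivative dir_deriv e \<phi> x) (at 0)"
          by (rule smooth_directional[OF \<phi>s e])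
        show ?thesis
          unfolding p_def q_def using DERIV_mult[OF 1 2] by (simp add: algebra_simps)
      qed
      show "continuous_on UNIV p" unfolding p_def by (intro continuous_on_mult Fuc \<phi>c)
      show "continuous_on UNIV q" by (rule qc)
    qed (use C d\<phi>0 in \<open>auto simp: p_def q_def\<close>)
    moreover have iq: "indicator ?S x * q x = q x" for x
    proof (cases "x \<in> ?S")
      case False
      then have "x \<notin> C" using C(2) by blast
      then show ?thesis using C(3) d\<phi>0 by (simp add: q_def)
    qed simp
    ultimately have I: "(\<integral>x. q x \<partial>?M) = 0"
      using integral_lebesgue_on_indicator(2)[OF S(3) borel_measurable_continuous_onI[OF qc]]
      unfolding iq by simp
    have qv: "q x = F (u n x) * dir_deriv e \<phi> x + dil n * (F' (u n x) * v n x * \<phi> x)" if "x \<in> ?S" for x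
      using conv_weak_deriv[OF \<kappa> D(5) e w D(7)[OF that]] by (simp add: q_def d_def v_def)
    have i1: "integrable ?M (\<lambda>x. F (u n x) * dir_deriv e \<phi> x)" by (rule L_two_mult[OF FL[OF uL] d\<phi>L])
    have i2: "integrable ?M (\<lambda>x. F' (u n x) * (v n x * \<phi> x))"
      by (rule integrable_mult_bounded[OF L_two_mult[OF vL \<phi>L], of _ B]) (use F'b in auto)
    have "(\<integral>x. q x \<partial>?M) = (\<integral>x. F (u n x) * dir_deriv e \<phi> x + dil n * (F' (u n x) * (v n x * \<phi> x)) \<partial>?M)"
      by (intro Bochner_Integration.integral_cong refl) (use qv in \<open>auto simp: mult.assoc\<close>)
    also have "\<dots> = (\<integral>x. F (u n x) * dir_deriv e \<phi> x \<partial>?M) + dil n * (\<integral>x. F' (u n x) * (v n x * \<phi> x) \<partial>?M)"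
      using i1 i2 by simp
    finally show ?thesis using I by (simp add: mult.assoc)
  qed
  have A1: "(\<lambda>n. \<integral>x. F (u n x) * dir_deriv e \<phi> x \<partial>?M) \<longlonglongrightarrow> (\<integral>x. F (f x) * dir_deriv e \<phi> x \<partial>?M)"
  proof -
    have d\<phi>BL: "L_two ?S (\<lambda>x. B * dir_deriv e \<phi> x)" by (rule L_two_cmult[OF d\<phi>L])
    have "(\<lambda>n. \<integral>x. \<bar>B * dir_deriv e \<phi> x * (u n x - f x)\<bar> \<partial>?M) \<longlonglongrightarrow> 0"
      by (rule L_two_tendsto_weak[OF L_two_diff[OF uL f] d\<phi>BL ulim])
    then have "(\<lambda>n. (\<integral>x. F (u n x) * dir_deriv e \<phi> x \<partial>?M) - (\<integral>x. F (f x) * dir_deriv e \<phi> x \<partial>?M)) \<longlonglongrightarrow> 0"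
    proof (rule Lim_null_comparison[rotated], intro always_eventually allI)
      fix n
      have i: "integrable ?M (\<lambda>x. F (u n x) * dir_deriv e \<phi> x)" "integrable ?M (\<lambda>x. F (f x) * dir_deriv e \<phi> x)"
        by (rule L_two_mult[OF FL[OF uL] d\<phi>L], rule L_two_mult[OF FL[OF f] d\<phi>L])
      have "norm ((\<integral>x. F (u n x) * dir_deriv e \<phi> x \<partial>?M) - (\<integral>x. F (f x) * dir_deriv e \<phi> x \<partial>?M)) =
          \<bar>\<integral>x. F (u n x) * dir_deriv e \<phi> x - F (f x) * dir_deriv e \<phi> x \<partial>?M\<bar>" using i by simp
      also have "\<dots> \<le> (\<integral>x. \<bar>F (u n x) * dir_deriv e \<phi> x - F (f x) * dir_deriv e \<phi> x\<bar> \<partial>?M)"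
        by (rule integral_abs_bound)
      also have "\<dots> \<le> (\<integral>x. \<bar>B * dir_deriv e \<phi> x * (u n x - f x)\<bar> \<partial>?M)"
      proof (rule integral_mono)
        show "integrable ?M (\<lambda>x. \<bar>F (u n x) * dir_deriv e \<phi> x - F (f x) * dir_deriv e \<phi> x\<bar>)"
          using i by (intro integrable_abs Bochner_Integration.integrable_diff)
        show "integrable ?M (\<lambda>x. \<bar>B * dir_deriv e \<phi> x * (u n x - f x)\<bar>)"
          by (intro integrable_abs L_two_mult[OF d\<phi>BL L_two_diff[OF uL f]])
        fix x
        have "\<bar>F (u n x) - F (f x)\<bar> \<le> B * \<bar>u n x - f x\<bar>"
          using field_differentiable_bound[of UNIV F F' B "u n x" "f x"] F F'b by simp
        then have "\<bar>F (u n x) - F (f x)\<bar> * \<bar>dir_deriv e \<phi> x\<bar> \<le> \<bar>B\<bar> * \<bar>u n x - f x\<bar> * \<bar>dir_deriv e \<phi> x\<bar>"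
          by (intro mult_right_mono) (auto intro: order_trans[OF _ mult_right_mono[OF abs_ge_self]])
        moreover have "F (u n x) * dir_deriv e \<phi> x - F (f x) * dir_deriv e \<phi> x =
            (F (u n x) - F (f x)) * dir_deriv e \<phi> x" by (simp add: left_diff_distrib)
        ultimately show "\<bar>F (u n x) * dir_deriv e \<phi> x - F (f x) * dir_deriv e \<phi> x\<bar>
            \<le> \<bar>B * dir_deriv e \<phi> x * (u n x - f x)\<bar>"
          by (simp add: abs_mult mult_ac)
      qed
      finally show "norm ((\<integral>x. F (u n x) * dir_deriv e \<phi> x \<partial>?M) - (\<integral>x. F (f x) * dir_deriv e \<phi> x \<partial>?M))
          \<le> (\<integral>x. \<bar>B * dir_deriv e \<phi> x * (u n x - f x)\<bar> \<partial>?M)" .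
    qed
    then show ?thesis by (simp add: LIM_zero_iff)
  qed
  have "integrable ?M (\<lambda>x. (u n x - f x)\<^sup>2)" for n by (rule L_twoD(2)[OF L_two_diff[OF uL f]])
  then obtain r where r: "strict_mono r" "AE x in ?M. (\<lambda>n. (u (r n) x - f x)\<^sup>2) \<longlonglongrightarrow> 0"
    using tendsto_L1_AE_subseq[of ?M "\<lambda>n x. (u n x - f x)\<^sup>2"] ulim by auto
  have A2: "(\<lambda>n. \<integral>x. F' (u (r n) x) * g x * \<phi> x \<partial>?M) \<longlonglongrightarrow> (\<integral>x. F' (f x) * g x * \<phi> x \<partial>?M)"
  proof (rule integral_dominated_convergence[where w = "\<lambda>x. B * \<bar>g x * \<phi> x\<bar>"])
    show "integrable ?M (\<lambda>x. B * \<bar>g x * \<phi> x\<bar>)" using L_two_mult[OF g \<phi>L] by simp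
    show "AE x in ?M. (\<lambda>n. F' (u (r n) x) * g x * \<phi> x) \<longlonglongrightarrow> F' (f x) * g x * \<phi> x"
      using r(2)
    proof eventually_elim
      case (elim x)
      then have "(\<lambda>n. sqrt ((u (r n) x - f x)\<^sup>2)) \<longlonglongrightarrow> sqrt 0" by (intro tendsto_real_sqrt)
      then have "(\<lambda>n. u (r n) x) \<longlonglongrightarrow> f x" by (simp add: tendsto_rabs_zero_iff LIM_zero_iff)
      moreover have "isCont F' (f x)" using F'c continuous_on_eq_continuous_at by blast
      ultimately have "(\<lambda>n. F' (u (r n) x)) \<longlonglongrightarrow> F' (f x)" by (rule isCont_tendsto_compose[rotated])
      then show ?case by (intro tendsto_mult tendsto_const)
    qed
    show "AE x in ?M. norm (F' (u (r n) x) * g x * \<phi> x) \<le> B * \<bar>g x * \<phi> x\<bar>" for n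
      using F'b by (intro AE_I2) (simp add: abs_mult mult.assoc mult_right_mono)
  qed simp_all
  have A3: "(\<lambda>n. \<integral>x. F' (u n x) * (v n x - g x) * \<phi> x \<partial>?M) \<longlonglongrightarrow> 0"
  proof -
    have \<phi>BL: "L_two ?S (\<lambda>x. B * \<phi> x)" by (rule L_two_cmult[OF \<phi>L])
    have "(\<lambda>n. \<integral>x. \<bar>B * \<phi> x * (v n x - g x)\<bar> \<partial>?M) \<longlonglongrightarrow> 0"
      by (rule L_two_tendsto_weak[OF L_two_diff[OF vL g] \<phi>BL vlim])
    then show ?thesis
    proof (rule Lim_null_comparison[rotated], intro always_eventually allI)
      fix n
      have "norm (\<integral>x. F' (u n x) * (v n x - g x) * \<phi> x \<partial>?M) \<le> (\<integral>x. \<bar>F' (u n x) * (v n x - g x) * \<phi> x\<bar> \<partial>?M)"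
        using integral_abs_bound[of ?M] by simp
      also have "\<dots> \<le> (\<integral>x. \<bar>B * \<phi> x * (v n x - g x)\<bar> \<partial>?M)"
      proof (rule integral_mono)
        have "integrable ?M (\<lambda>x. F' (u n x) * ((v n x - g x) * \<phi> x))"
          by (rule integrable_mult_bounded[OF L_two_mult[OF L_two_diff[OF vL g] \<phi>L], of _ B]) (use F'b in auto)
        then show "integrable ?M (\<lambda>x. \<bar>F' (u n x) * (v n x - g x) * \<phi> x\<bar>)" by (simp add: mult.assoc)
        show "integrable ?M (\<lambda>x. \<bar>B * \<phi> x * (v n x - g x)\<bar>)"
          by (intro integrable_abs L_two_mult[OF \<phi>BL L_two_diff[OF vL g]])
        fix x
        have "\<bar>F' (u n x)\<bar> \<le> \<bar>B\<bar>" using F'b[of "u n x"] by linarith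
        then have "\<bar>F' (u n x)\<bar> * (\<bar>v n x - g x\<bar> * \<bar>\<phi> x\<bar>) \<le> \<bar>B\<bar> * (\<bar>v n x - g x\<bar> * \<bar>\<phi> x\<bar>)"
          by (intro mult_right_mono) auto
        then show "\<bar>F' (u n x) * (v n x - g x) * \<phi> x\<bar> \<le> \<bar>B * \<phi> x * (v n x - g x)\<bar>"
          by (simp add: abs_mult mult_ac)
      qed
      finally show "norm (\<integral>x. F' (u n x) * (v n x - g x) * \<phi> x \<partial>?M) \<le> (\<integral>x. \<bar>B * \<phi> x * (v n x - g x)\<bar> \<partial>?M)" .
    qed
  qed
  have "(\<lambda>n. (\<integral>x. F' (u (r n) x) * (v (r n) x - g x) * \<phi> x \<partial>?M) + (\<integral>x. F' (u (r n) x) * g x * \<phi> x \<partial>?M))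
      \<longlonglongrightarrow> 0 + (\<integral>x. F' (f x) * g x * \<phi> x \<partial>?M)"
    using LIMSEQ_subseq_LIMSEQ[OF A3 r(1)] A2 by (intro tendsto_add) (simp_all add: o_def)
  moreover have "(\<integral>x. F' (u n x) * (v n x - g x) * \<phi> x \<partial>?M) + (\<integral>x. F' (u n x) * g x * \<phi> x \<partial>?M)
      = (\<integral>x. F' (u n x) * v n x * \<phi> x \<partial>?M)" for n
  proof -
    have 1: "integrable ?M (\<lambda>x. F' (u n x) * ((v n x - g x) * \<phi> x))"
      by (rule integrable_mult_bounded[OF L_two_mult[OF L_two_diff[OF vL g] \<phi>L], of _ B]) (use F'b in auto)
    have 2: "integrable ?M (\<lambda>x. F' (u n x) * (g x * \<phi> x))"
      by (rule integrable_mult_bounded[OF L_two_mult[OF g \<phi>L], of _ B]) (use F'b in auto)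
    have "(\<integral>x. F' (u n x) * ((v n x - g x) * \<phi> x) \<partial>?M) + (\<integral>x. F' (u n x) * (g x * \<phi> x) \<partial>?M)
        = (\<integral>x. F' (u n x) * ((v n x - g x) * \<phi> x) + F' (u n x) * (g x * \<phi> x) \<partial>?M)" using 1 2 by simp
    also have "\<dots> = (\<integral>x. F' (u n x) * (v n x * \<phi> x) \<partial>?M)"
      by (intro Bochner_Integration.integral_cong refl) (simp add: algebra_simps)
    finally show ?thesis by (simp add: mult.assoc)
  qed
  ultimately have "(\<lambda>n. \<integral>x. F' (u (r n) x) * v (r n) x * \<phi> x \<partial>?M) \<longlonglongrightarrow> (\<integral>x. F' (f x) * g x * \<phi> x \<partial>?M)"
    by simp
  then have "(\<lambda>n. - (dil (r n) * (\<integral>x. F' (u (r n) x) * v (r n) x * \<phi> x \<partial>?M))) \<longlonglongrightarrow> - (1 * (\<integral>x. F' (f x) * g x * \<phi> x \<partial>?M))"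
    using LIMSEQ_subseq_LIMSEQ[OF D(1) r(1)] by (intro tendsto_minus tendsto_mult) (simp_all add: o_def)
  moreover have "(\<lambda>n. \<integral>x. F (u (r n) x) * dir_deriv e \<phi> x \<partial>?M) \<longlonglongrightarrow> (\<integral>x. F (f x) * dir_deriv e \<phi> x \<partial>?M)"
    using LIMSEQ_subseq_LIMSEQ[OF A1 r(1)] by (simp add: o_def)
  ultimately show ?thesis unfolding ibp using LIMSEQ_unique by fastforce
qed

lemma H1_derivD:
  assumes "H1_deriv R e f g"
  shows "weak_deriv (ball 0 R) e f g" "L_two (ball 0 R) f" "L_two (ball 0 R) g"
  using assms by (auto simp: H1_deriv_def)

lemma H1_deriv_cong_AE:
  assumes e: "e \<in> Basis" and fg: "H1_deriv R e f g"
    and f: "AE x in lebesgue_on (ball 0 R). f' x = f x" and g: "AE x in lebesgue_on (ball 0 R). g' x = g x"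
  shows "H1_deriv R e f' g'"
proof -
  have L: "L_two (ball 0 R) h'" if h: "L_two (ball 0 R) h" "AE x in lebesgue_on (ball 0 R). h' x = h x" for h h'
  proof (rule L_two_bound[OF h(1), of _ 1])
    show "h' \<in> borel_measurable (lebesgue_on (ball 0 R))"
      by (rule borel_measurable_lebesgue_on_AE[OF ball_sets(2) L_twoD(1)[OF h(1)] h(2)])
    show "AE x in lebesgue_on (ball 0 R). \<bar>h' x\<bar> \<le> 1 * \<bar>h x\<bar>" using h(2) by eventually_elim simp
  qed
  show ?thesis
    unfolding H1_deriv_def
    using weak_deriv_cong_AE[OF ball_sets(2) e H1_derivD(1)[OF fg] f g] L[OF _ f] L[OF _ g] H1_derivD(2,3)[OF fg]
    by blast
qed

lemma H1_deriv_add: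
  "e \<in> Basis \<Longrightarrow> H1_deriv R e f g \<Longrightarrow> H1_deriv R e f' g' \<Longrightarrow> H1_deriv R e (\<lambda>x. f x + f' x) (\<lambda>x. g x + g' x)"
  unfolding H1_deriv_def by (auto intro: weak_deriv_add[OF ball_sets(2)] L_two_add)

lemma H1_deriv_cmult: "H1_deriv R e f g \<Longrightarrow> H1_deriv R e (\<lambda>x. c * f x) (\<lambda>x. c * g x)"
  unfolding H1_deriv_def by (auto intro: weak_deriv_cmult L_two_cmult)

text \<open>Only pointwise convergence with uniform bounds is asked for, so h may be discontinuous
  and may differ from the derivative of G at some points. The level set argument and the maximum
  both use this freedom.\<close>

lemma chain_rule_limit:
  fixes f :: "'a::euclidean_space \<Rightarrow> real" and F F' :: "nat \<Rightarrow> real \<Rightarrow> real"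
  assumes R: "0 < R" and e: "e \<in> Basis" and fg: "H1_deriv R e f g"
    and F: "\<And>n s. (F n has_real_derivative F' n s) (at s)" and F'c: "\<And>n. continuous_on UNIV (F' n)"
    and F'b: "\<And>n s. \<bar>F' n s\<bar> \<le> B" and F0: "\<And>n. \<bar>F n 0\<bar> \<le> B"
    and G: "\<And>s. (\<lambda>n. F n s) \<longlonglongrightarrow> G s" and h: "\<And>s. (\<lambda>n. F' n s) \<longlonglongrightarrow> h s"
  shows "H1_deriv R e (\<lambda>x. G (f x)) (\<lambda>x. h (f x) * g x)"
proof -
  let ?S = "ball (0::'a) R"
  let ?M = "lebesgue_on ?S"
  note S = ball_sets[where 'a='a and R=R]
  have f: "L_two ?S f" and g: "L_two ?S g" using H1_derivD[OF fg] by auto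
  have Fm[measurable]: "F n \<in> borel_measurable borel" for n
    using F by (intro borel_measurable_continuous_onI continuous_at_imp_continuous_on) (auto intro: DERIV_isCont)
  have F'm[measurable]: "F' n \<in> borel_measurable borel" for n
    using F'c by (intro borel_measurable_continuous_onI)
  have Gm[measurable]: "G \<in> borel_measurable borel"
    by (rule borel_measurable_LIMSEQ_real[where u = F]) (use G in auto)
  have hm[measurable]: "h \<in> borel_measurable borel"
    by (rule borel_measurable_LIMSEQ_real[where u = F']) (use h in auto)
  have [measurable]: "f \<in> borel_measurable ?M" "g \<in> borel_measurable ?M" using L_twoD(1) f g by auto
  have Fb: "\<bar>F n s\<bar> \<le> B * (1 + \<bar>s\<bar>)" for n s
    using field_differentiable_bound[of UNIV "F n" "F' n" B s 0] F F'b[of n] F0[of n]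
    by (simp add: distrib_left)
  have Gb: "\<bar>G s\<bar> \<le> B * (1 + \<bar>s\<bar>)" for s
    by (rule LIMSEQ_le_const2[OF tendsto_rabs[OF G]]) (use Fb in auto)
  have hb: "\<bar>h s\<bar> \<le> B" for s
    by (rule LIMSEQ_le_const2[OF tendsto_rabs[OF h]]) (use F'b in auto)
  have f1: "L_two ?S (\<lambda>x. 1 + \<bar>f x\<bar>)"
    by (rule L_two_add[OF L_two_bounded[OF S(1), of _ 1] L_two_bound[OF f, of _ 1]]) auto
  have GL: "L_two ?S (\<lambda>x. G (f x))"
    by (rule L_two_bound[OF f1, of _ B]) (use Gb in auto)
  have hL: "L_two ?S (\<lambda>x. h (f x) * g x)"
    by (rule L_two_mult_bounded[OF g, of _ B]) (use hb in auto)
  have "weak_deriv ?S e (\<lambda>x. G (f x)) (\<lambda>x. h (f x) * g x)"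
    unfolding weak_deriv_def
  proof (intro conjI allI impI integrable_imp_loc_integrable[OF S(2)] L_two_integrable[OF S(1)] GL hL)
    fix \<phi> assume \<phi>: "test_fun ?S \<phi>"
    have T': "test_fun ?S (dir_deriv e \<phi>)" by (rule test_fun_dir_deriv[OF \<phi> e])
    have bl: "L_two ?S \<psi>" if \<psi>: "test_fun ?S \<psi>" for \<psi>
    proof -
      obtain C b where "compact C" "C \<subseteq> ?S" "\<And>x. x \<notin> C \<Longrightarrow> \<psi> x = 0" "\<And>x. \<bar>\<psi> x\<bar> \<le> b"
        using test_funE[OF \<psi>] by blast
      then show ?thesis by (intro L_two_bounded[OF S(1) test_fun_measurable[OF \<psi>], of b]) auto
    qed
    have [measurable]: "\<phi> \<in> borel_measurable ?M" "dir_deriv e \<phi> \<in> borel_measurable ?M"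
      using test_fun_measurable \<phi> T' by auto
    have 1: "(\<lambda>n. \<integral>x. F n (f x) * dir_deriv e \<phi> x \<partial>?M) \<longlonglongrightarrow> (\<integral>x. G (f x) * dir_deriv e \<phi> x \<partial>?M)"
    proof (rule integral_dominated_convergence[where w = "\<lambda>x. B * \<bar>(1 + \<bar>f x\<bar>) * dir_deriv e \<phi> x\<bar>"])
      show "integrable ?M (\<lambda>x. B * \<bar>(1 + \<bar>f x\<bar>) * dir_deriv e \<phi> x\<bar>)"
        using L_two_mult[OF f1 bl[OF T']] by (intro integrable_mult_right integrable_abs)
      show "AE x in ?M. (\<lambda>n. F n (f x) * dir_deriv e \<phi> x) \<longlonglongrightarrow> G (f x) * dir_deriv e \<phi> x"
        by (intro AE_I2 tendsto_mult tendsto_const G)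
      show "AE x in ?M. norm (F n (f x) * dir_deriv e \<phi> x) \<le> B * \<bar>(1 + \<bar>f x\<bar>) * dir_deriv e \<phi> x\<bar>" for n
      proof (rule AE_I2)
        fix x
        show "norm (F n (f x) * dir_deriv e \<phi> x) \<le> B * \<bar>(1 + \<bar>f x\<bar>) * dir_deriv e \<phi> x\<bar>"
          using mult_right_mono[OF Fb[of n "f x"], of "\<bar>dir_deriv e \<phi> x\<bar>"] by (simp add: abs_mult mult.assoc)
      qed
    qed simp_all
    have 2: "(\<lambda>n. \<integral>x. F' n (f x) * g x * \<phi> x \<partial>?M) \<longlonglongrightarrow> (\<integral>x. h (f x) * g x * \<phi> x \<partial>?M)"
    proof (rule integral_dominated_convergence[where w = "\<lambda>x. B * \<bar>g x * \<phi> x\<bar>"])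
      show "integrable ?M (\<lambda>x. B * \<bar>g x * \<phi> x\<bar>)"
        using L_two_mult[OF g bl[OF \<phi>]] by (intro integrable_mult_right integrable_abs)
      show "AE x in ?M. (\<lambda>n. F' n (f x) * g x * \<phi> x) \<longlonglongrightarrow> h (f x) * g x * \<phi> x"
        by (intro AE_I2 tendsto_mult tendsto_const h)
      show "AE x in ?M. norm (F' n (f x) * g x * \<phi> x) \<le> B * \<bar>g x * \<phi> x\<bar>" for n
        using F'b by (intro AE_I2) (simp add: abs_mult mult.assoc mult_right_mono)
    qed simp_all
    have "(\<lambda>n. \<integral>x. F n (f x) * dir_deriv e \<phi> x \<partial>?M) = (\<lambda>n. - (\<integral>x. F' n (f x) * g x * \<phi> x \<partial>?M))"
      using chain_rule_C1[OF R e fg F F'c F'b \<phi>] by simp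
    then show "(\<integral>x. G (f x) * dir_deriv e \<phi> x \<partial>?M) = - (\<integral>x. h (f x) * g x * \<phi> x \<partial>?M)"
      using LIMSEQ_unique[OF 1] tendsto_minus[OF 2] by simp
  qed
  then show ?thesis using GL hL by (simp add: H1_deriv_def)
qed

lemma H1_deriv_C1:
  fixes f :: "'a::euclidean_space \<Rightarrow> real"
  assumes "0 < R" "e \<in> Basis" "H1_deriv R e f g"
    and F: "\<And>s. (F has_real_derivative F' s) (at s)" "continuous_on UNIV F'" "\<And>s. \<bar>F' s\<bar> \<le> B"
  shows "H1_deriv R e (\<lambda>x. F (f x)) (\<lambda>x. F' (f x) * g x)"
proof (rule chain_rule_limit[OF assms(1-3), where F = "\<lambda>_. F" and F' = "\<lambda>_. F'" and B = "max B \<bar>F 0\<bar>"])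
  show "\<bar>F' s\<bar> \<le> max B \<bar>F 0\<bar>" for s using F(3)[of s] by simp
qed (use F in auto)

text \<open>Stampacchia: the functions \<open>arctan (n (s - a)) / n\<close> tend to \<open>0\<close>, while their derivatives
  tend boundedly to the indicator of \<open>{a}\<close>.\<close>

lemma H1_deriv_zero_on_level_set:
  fixes f :: "'a::euclidean_space \<Rightarrow> real"
  assumes R: "0 < R" and e: "e \<in> Basis" and fg: "H1_deriv R e f g"
  shows "AE x in lebesgue_on (ball 0 R). f x = a \<longrightarrow> g x = 0"
proof -
  define c where "c n = real n + 1" for n
  have c: "c n \<ge> 1" for n by (simp add: c_def)
  define F where "F n s = arctan (c n * (s - a)) / c n" for n s
  define F' where "F' n s = 1 / (1 + (c n * (s - a))\<^sup>2)" for n s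
  have "H1_deriv R e (\<lambda>x. (\<lambda>s. 0) (f x)) (\<lambda>x. (\<lambda>s. if s = a then 1 else 0) (f x) * g x)"
  proof (rule chain_rule_limit[OF R e fg, where F = F and F' = F' and B = "2"])
    show "(F n has_real_derivative F' n s) (at s)" for n s
      unfolding F_def F'_def using c[of n]
      by (auto intro!: derivative_eq_intros simp: inverse_eq_divide)
    show "continuous_on UNIV (F' n)" for n
      unfolding F'_def by (intro continuous_intros) (auto simp: add_nonneg_eq_0_iff)
    show "\<bar>F' n s\<bar> \<le> 2" for n s
    proof -
      have "1 \<le> 1 + (c n * (s - a))\<^sup>2" by simp
      then have "1 / (1 + (c n * (s - a))\<^sup>2) \<le> 1" by (intro divide_le_eq_1_pos[THEN iffD2]) (auto simp: add_pos_nonneg)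
      then show ?thesis by (simp add: F'_def)
    qed
    have Fb: "\<bar>F n s\<bar> \<le> 2 / c n" for n s
    proof -
      have "\<bar>arctan (c n * (s - a))\<bar> \<le> 2" using arctan_bounded[of "c n * (s - a)"] pi_less_4 by linarith
      then show ?thesis using c[of n] by (simp add: F_def divide_right_mono)
    qed
    show "\<bar>F n 0\<bar> \<le> 2" for n
    proof -
      have "2 / c n \<le> 2" using c[of n] by (simp add: divide_le_eq)
      then show ?thesis using Fb[of n 0] by linarith
    qed
    have c0: "(\<lambda>n. 2 / c n) \<longlonglongrightarrow> 0" unfolding c_def by real_asymp
    show "(\<lambda>n. F n s) \<longlonglongrightarrow> 0" for s
      by (rule Lim_null_comparison[OF _ c0]) (use Fb in auto)
    show "(\<lambda>n. F' n s) \<longlonglongrightarrow> (if s = a then 1 else 0)" for s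
    proof (cases "s = a")
      case False
      define b where "b = (s - a)\<^sup>2"
      have "b > 0" using False by (simp add: b_def)
      then have "(\<lambda>n. 1 / (1 + (real n + 1)\<^sup>2 * b)) \<longlonglongrightarrow> 0" by real_asymp
      then show ?thesis using False by (simp add: F'_def c_def b_def power_mult_distrib)
    qed (simp add: F'_def)
  qed
  from H1_derivD(1)[OF this]
  have 1: "weak_deriv (ball 0 R) e (\<lambda>x. 0) (\<lambda>x. (if f x = a then 1 else 0) * g x)" by simp
  have 2: "weak_deriv (ball (0::'a) R) e (\<lambda>x. 0) (\<lambda>x. 0)" by (simp add: weak_deriv_def loc_integrable_def)
  show ?thesis
    using weak_deriv_unique[OF ball_sets(4) e 1 2] by (auto elim: eventually_mono)
qed

text \<open>The maximum is approximated by (s + a + sqrt ((s - a)^2 + c)) / 2 with c tending to 0.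
  The derivatives tend to (1 + sgn (s - a)) / 2; its value 1/2 at s = a may be replaced by 0 since
  the derivative of f vanishes almost everywhere on {f = a}.\<close>

lemma H1_deriv_max:
  fixes f :: "'a::euclidean_space \<Rightarrow> real"
  assumes R: "0 < R" and e: "e \<in> Basis" and fg: "H1_deriv R e f g"
  shows "H1_deriv R e (\<lambda>x. max (f x) a) (\<lambda>x. if a < f x then g x else 0)"
proof -
  define c where "c n = 1 / (real n + 1)" for n
  have c: "0 < c n" "c n \<le> 1" for n by (auto simp: c_def)
  have c0: "c \<longlonglongrightarrow> 0" unfolding c_def by real_asymp
  have pos: "0 < (s - a)\<^sup>2 + c n" for n s using c(1)[of n] by (simp add: add_nonneg_pos)
  define F where "F n s = (s + a + sqrt ((s - a)\<^sup>2 + c n)) / 2" for n s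
  define F' where "F' n s = (1 + (s - a) / sqrt ((s - a)\<^sup>2 + c n)) / 2" for n s
  have "H1_deriv R e (\<lambda>x. (\<lambda>s. max s a) (f x)) (\<lambda>x. (\<lambda>s. (1 + sgn (s - a)) / 2) (f x) * g x)"
  proof (rule chain_rule_limit[OF R e fg, where F = F and F' = F' and B = "2 + \<bar>a\<bar>"])
    show "(F n has_real_derivative F' n s) (at s)" for n s
      unfolding F_def F'_def using pos[of s n]
      by (auto intro!: derivative_eq_intros simp: divide_simps)
    show "continuous_on UNIV (F' n)" for n
      unfolding F'_def
      by (intro continuous_intros ballI) (simp_all add: less_imp_neq[OF pos, symmetric])
    show "\<bar>F' n s\<bar> \<le> 2 + \<bar>a\<bar>" for n s
    proof -
      have "\<bar>s - a\<bar> \<le> sqrt ((s - a)\<^sup>2 + c n)"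
        using c(1)[of n] by (intro real_le_rsqrt) simp
      then have "\<bar>(s - a) / sqrt ((s - a)\<^sup>2 + c n)\<bar> \<le> 1"
        using pos[of s n] by (simp add: abs_divide divide_le_eq)
      moreover have "\<bar>(1 + y) / 2\<bar> \<le> 2 + \<bar>a\<bar>" if "\<bar>y\<bar> \<le> 1" for y :: real
      proof -
        have "- 1 \<le> y" "y \<le> 1" "0 \<le> \<bar>a\<bar>" using that by auto
        then show ?thesis by (intro abs_leI) (simp_all add: field_simps)
      qed
      ultimately show ?thesis unfolding F'_def by blast
    qed
    show "\<bar>F n 0\<bar> \<le> 2 + \<bar>a\<bar>" for n
    proof -
      have "sqrt ((0 - a)\<^sup>2 + c n) \<le> \<bar>a\<bar> + 1"
        using c(2)[of n] by (intro real_le_lsqrt) (auto simp: power2_sum)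
      moreover have "0 \<le> sqrt ((0 - a)\<^sup>2 + c n)" using pos[of 0 n] by simp
      moreover have "\<bar>(0 + a + y) / 2\<bar> \<le> 2 + \<bar>a\<bar>" if "y \<le> \<bar>a\<bar> + 1" "0 \<le> y" for y :: real
      proof -
        have "- \<bar>a\<bar> \<le> a" "a \<le> \<bar>a\<bar>" by auto
        then show ?thesis using that by (intro abs_leI) (simp_all add: field_simps)
      qed
      ultimately show ?thesis unfolding F_def by blast
    qed
    show "(\<lambda>n. F n s) \<longlonglongrightarrow> max s a" for s
    proof -
      have "(\<lambda>n. F n s) \<longlonglongrightarrow> (s + a + sqrt ((s - a)\<^sup>2 + 0)) / 2"
        unfolding F_def by (intro tendsto_intros c0) simp
      moreover have "(s + a + sqrt ((s - a)\<^sup>2 + 0)) / 2 = max s a" by (simp add: max_def abs_if)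
      ultimately show ?thesis by simp
    qed
    show "(\<lambda>n. F' n s) \<longlonglongrightarrow> (1 + sgn (s - a)) / 2" for s
    proof (cases "s = a")
      case False
      have "(\<lambda>n. F' n s) \<longlonglongrightarrow> (1 + (s - a) / sqrt ((s - a)\<^sup>2 + 0)) / 2"
        unfolding F'_def by (intro tendsto_intros c0) (use False in auto)
      moreover have "(1 + (s - a) / sqrt ((s - a)\<^sup>2 + 0)) / 2 = (1 + sgn (s - a)) / 2"
        using False by (cases "s < a") (simp_all add: sgn_real_def abs_if field_simps)
      ultimately show ?thesis by (simp only:)
    qed (simp add: F'_def)
  qed
  then show ?thesis
  proof (rule H1_deriv_cong_AE[OF e])
    show "AE x in lebesgue_on (ball 0 R). (if a < f x then g x else 0) = (1 + sgn (f x - a)) / 2 * g x"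
      using H1_deriv_zero_on_level_set[OF R e fg, of a] by eventually_elim (auto simp: sgn_real_def)
  qed simp
qed

text \<open>The minimum with k is minus the maximum of -f and -k, so two applications of
  \<open>H1_deriv_max\<close> suffice.\<close>

lemma H1_deriv_clamp:
  fixes f :: "'a::euclidean_space \<Rightarrow> real"
  assumes R: "0 < R" and e: "e \<in> Basis" and fg: "H1_deriv R e f g" and k: "0 < k"
  shows "H1_deriv R e (\<lambda>x. max (- k) (min k (f x))) (\<lambda>x. if \<bar>f x\<bar> < k then g x else 0)"
proof -
  from H1_deriv_cmult[OF H1_deriv_max[OF R e H1_deriv_cmult[OF fg, of "-1"], of "- k"], of "-1"]
  have "H1_deriv R e (\<lambda>x. min k (f x)) (\<lambda>x. if f x < k then g x else 0)"
    by (rule H1_deriv_cong_AE[OF e]) (auto simp: min_def max_def)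
  from H1_deriv_max[OF R e this, of "- k"] show ?thesis
    by (rule H1_deriv_cong_AE[OF e]) (use k in \<open>auto simp: min_def max_def abs_if\<close>)
qed

section \<open>Evolution in time\<close>

lemma smooth_tensor:
  fixes \<theta> :: "'b::euclidean_space \<Rightarrow> real" and \<zeta> :: "'a::euclidean_space \<Rightarrow> real"
  assumes "smooth \<theta>" "smooth \<zeta>"
  shows "smooth (\<lambda>z. \<theta> (fst z) * \<zeta> (snd z))"
    and "d \<in> Basis \<Longrightarrow> dir_deriv (d, 0) (\<lambda>z. \<theta> (fst z) * \<zeta> (snd z)) (t, x) = dir_deriv d \<theta> t * \<zeta> x"
    and "e \<in> Basis \<Longrightarrow> dir_deriv (0, e) (\<lambda>z. \<theta> (fst z) * \<zeta> (snd z)) (t, x) = \<theta> t * dir_deriv e \<zeta> x"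
proof -
  show "smooth (\<lambda>z. \<theta> (fst z) * \<zeta> (snd z))"
    using smooth_mult[OF smooth_affine[OF bounded_linear_fst assms(1), of 0]
        smooth_affine[OF bounded_linear_snd assms(2), of 0]] by simp
  have 1: "((\<lambda>z. \<theta> (fst z)) has_derivative (\<lambda>h. \<Sum>b\<in>Basis. (fst h \<bullet> b) * dir_deriv b \<theta> t)) (at (t, x))"
    using has_derivative_compose[OF has_derivative_fst[OF has_derivative_ident], of \<theta> "\<lambda>h. \<Sum>b\<in>Basis. (h \<bullet> b) * dir_deriv b \<theta> t" "(t, x)" UNIV]
      smooth_has_derivative[OF assms(1), of t] by simp
  have 2: "((\<lambda>z. \<zeta> (snd z)) has_derivative (\<lambda>h. \<Sum>b\<in>Basis. (snd h \<bullet> b) * dir_deriv b \<zeta> x)) (at (t, x))"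
    using has_derivative_compose[OF has_derivative_snd[OF has_derivative_ident], of \<zeta> "\<lambda>h. \<Sum>b\<in>Basis. (h \<bullet> b) * dir_deriv b \<zeta> x" "(t, x)" UNIV]
      smooth_has_derivative[OF assms(2), of x] by simp
  note D = dir_deriv_eq[OF has_derivative_mult[OF 1 2]]
  have S: "(\<Sum>b\<in>Basis. (e \<bullet> b) * dir_deriv b f y) = dir_deriv e f y" if e: "e \<in> Basis"
    for e y :: "'c::euclidean_space" and f
  proof -
    have "(\<Sum>b\<in>Basis. (e \<bullet> b) * dir_deriv b f y) = (\<Sum>b\<in>Basis. if b = e then dir_deriv b f y else 0)"
      using e by (intro sum.cong) (auto simp: inner_Basis)
    then show ?thesis using e by simp
  qed
  show "dir_deriv (d, 0) (\<lambda>z. \<theta> (fst z) * \<zeta> (snd z)) (t, x) = dir_deriv d \<theta> t * \<zeta> x" if "d \<in> Basis"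
    using D[of "(d, 0)"] S[OF that, of \<theta> t] by simp
  show "dir_deriv (0, e) (\<lambda>z. \<theta> (fst z) * \<zeta> (snd z)) (t, x) = \<theta> t * dir_deriv e \<zeta> x" if "e \<in> Basis"
    using D[of "(0, e)"] S[OF that, of \<zeta> x] by simp
qed

text \<open>Products are the only test functions used on product domains: Fubini separates the
  variables and leaves an identity in one variable, to which a one-variable argument
  applies.\<close>

lemma test_fun_tensor:
  fixes \<theta> :: "'b::euclidean_space \<Rightarrow> real" and \<zeta> :: "'a::euclidean_space \<Rightarrow> real"
  assumes "test_fun A \<theta>" "test_fun B \<zeta>"
  shows "test_fun (A \<times> B) (\<lambda>z. \<theta> (fst z) * \<zeta> (snd z))"
proof -
  obtain C1 where C1: "compact C1" "C1 \<subseteq> A" "\<forall>x. x \<notin> C1 \<longrightarrow> \<theta> x = 0" using assms(1) by (auto simp: test_fun_def)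
  obtain C2 where C2: "compact C2" "C2 \<subseteq> B" "\<forall>x. x \<notin> C2 \<longrightarrow> \<zeta> x = 0" using assms(2) by (auto simp: test_fun_def)
  have "compact (C1 \<times> C2)" "C1 \<times> C2 \<subseteq> A \<times> B" "\<forall>z. z \<notin> C1 \<times> C2 \<longrightarrow> \<theta> (fst z) * \<zeta> (snd z) = 0"
    using C1 C2 compact_Times by auto
  then show ?thesis using assms smooth_tensor(1) unfolding test_fun_def by blast
qed

section \<open>The fundamental theorem of calculus for weak derivatives on an interval\<close>

lemma mker_average_tendsto:
  fixes E :: "real \<Rightarrow> real"
  assumes \<kappa>: "mollifier \<kappa>" and E: "continuous_on {0..T} E" and r: "0 < r" "r < T"
    and \<delta>: "\<And>n. 0 < \<delta> n" "\<delta> \<longlonglongrightarrow> 0"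
  shows "(\<lambda>n. \<integral>\<tau>. mker \<kappa> (\<delta> n) (\<tau> - r) * E \<tau> \<partial>lebesgue_on {0<..<T}) \<longlonglongrightarrow> E r"
proof (rule LIMSEQ_I)
  fix \<epsilon> :: real assume \<epsilon>: "\<epsilon> > 0"
  have Ei: "integrable (lebesgue_on {0<..<T}) E"
  proof -
    have "set_integrable lebesgue {0..T} E"
      using E borel_integrable_compact[of "{0..T}" E] by (simp add: set_integrable_def integrable_completion)
    then have "set_integrable lebesgue {0<..<T} E" by (rule set_integrable_subset) auto
    then show ?thesis by (simp add: integrable_restrict_space set_integrable_def)
  qed
  obtain d where d: "d > 0" "\<And>y. y \<in> {0..T} \<Longrightarrow> dist y r < d \<Longrightarrow> dist (E y) (E r) < \<epsilon> / 2"
    using E r \<epsilon> unfolding continuous_on_iff by (metis atLeastAtMost_iff half_gt_zero less_imp_le)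
  define d' where "d' = min d (min r (T - r))"
  have d': "d' > 0" using d r by (simp add: d'_def)
  obtain N where N: "\<And>n. n \<ge> N \<Longrightarrow> \<delta> n < d'"
    using order_tendstoD(2)[OF \<delta>(2) d'] by (auto simp: eventually_sequentially)
  show "\<exists>N. \<forall>n\<ge>N. norm ((\<integral>\<tau>. mker \<kappa> (\<delta> n) (\<tau> - r) * E \<tau> \<partial>lebesgue_on {0<..<T}) - E r) < \<epsilon>"
  proof (intro exI allI impI)
    fix n assume n: "n \<ge> N"
    have near: "\<bar>y - r\<bar> < d'" if "mker \<kappa> (\<delta> n) (y - r) \<noteq> 0" for y
      using mker_eq_0[OF \<kappa> \<delta>(1)[of n], of "y - r"] that N[OF n] by force
    note L = mker_lebesgue_on_le[OF \<kappa> \<delta>(1)[of n], of "{0<..<T}" 1 "- r", simplified]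
    obtain B where B: "\<And>z. \<bar>mker \<kappa> (\<delta> n) z\<bar> \<le> B" using mker_bounded[OF \<kappa> \<delta>(1)] by blast
    have "\<bar>(\<integral>\<tau>. mker \<kappa> (\<delta> n) (\<tau> - r) * E \<tau> \<partial>lebesgue_on {0<..<T}) - E r\<bar> \<le> \<epsilon> / 2"
    proof (rule kernel_average_close)
      show i: "integrable (lebesgue_on {0<..<T}) (\<lambda>\<tau>. mker \<kappa> (\<delta> n) (\<tau> - r))" using L(1) by simp
      show "integrable (lebesgue_on {0<..<T}) (\<lambda>\<tau>. mker \<kappa> (\<delta> n) (\<tau> - r) * E \<tau>)"
        by (rule integrable_mult_bounded[OF Ei borel_measurable_integrable[OF i], of B]) (simp add: B)
      show "0 \<le> mker \<kappa> (\<delta> n) (y - r)" for y by (rule mker_nonneg[OF \<kappa> \<delta>(1)])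
      show "(\<integral>\<tau>. mker \<kappa> (\<delta> n) (\<tau> - r) \<partial>lebesgue_on {0<..<T}) = 1"
      proof -
        have "0 < y \<and> y < T" if "mker \<kappa> (\<delta> n) (y - r) \<noteq> 0" for y
          using near[OF that] by (auto simp: d'_def)
        then show ?thesis using L(3) by auto
      qed
      show "\<bar>E y - E r\<bar> \<le> \<epsilon> / 2" if "mker \<kappa> (\<delta> n) (y - r) \<noteq> 0" for y
      proof -
        have "y \<in> {0..T}" "dist y r < d" using near[OF that] by (auto simp: d'_def dist_real_def)
        then show ?thesis using d(2)[of y] by (simp add: dist_real_def)
      qed
    qed
    then show "norm ((\<integral>\<tau>. mker \<kappa> (\<delta> n) (\<tau> - r) * E \<tau> \<partial>lebesgue_on {0<..<T}) - E r) < \<epsilon>" using \<epsilon> by simp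
  qed
qed

text \<open>The test function is a smoothed indicator of (s, t), the difference of two steps. Its
  derivative is the kernel at s minus the kernel at t, which recovers E s - E t by continuity, while
  the function itself tends boundedly to the indicator except at s and t.\<close>

lemma integral_weak_derivative_interior:
  fixes E D :: "real \<Rightarrow> real"
  assumes E: "continuous_on {0..T} E" and D: "integrable (lebesgue_on {0<..<T}) D"
    and weak: "\<And>\<theta>. test_fun {0<..<T} \<theta> \<Longrightarrow>
      (\<integral>t. E t * dir_deriv 1 \<theta> t \<partial>lebesgue_on {0<..<T}) = - (\<integral>t. D t * \<theta> t \<partial>lebesgue_on {0<..<T})"
    and st: "0 < s" "s < t" "t < T"
  shows "E t - E s = (\<integral>r. indicator {s<..<t} r * D r \<partial>lebesgue_on {0<..<T})"
proof -
  let ?M = "lebesgue_on {0<..<T}"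
  obtain \<Psi> \<kappa> :: "real \<Rightarrow> real" where \<Psi>: "smooth \<Psi>" and \<kappa>: "mollifier \<kappa>"
    and d\<Psi>: "\<And>s. (\<Psi> has_real_derivative \<kappa> s) (at s)" and \<Psi>0: "\<And>s. s \<le> -1 \<Longrightarrow> \<Psi> s = 0"
    and \<Psi>1: "\<And>s. s \<ge> 1 \<Longrightarrow> \<Psi> s = 1" and \<Psi>b: "\<And>s. 0 \<le> \<Psi> s \<and> \<Psi> s \<le> 1"
    using smooth_step_exists by blast
  \<comment> \<open>The distance of s and t from the ends of the interval; steps of width \<delta> n
    < d keep the support inside (0, T).\<close>
  define d where "d = min s (T - t)"
  have d: "d > 0" using st by (simp add: d_def)
  define a where "a n = (real n + 2) / d" for n
  have a: "0 < a n" for n using d by (simp add: a_def)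
  have ad: "1 / a n < d" for n
    using d mult_strict_left_mono[of 1 "real n + 2" d] by (simp add: a_def pos_divide_less_eq)
  define \<delta> where "\<delta> n = 1 / a n" for n
  have \<delta>: "0 < \<delta> n" for n using a by (simp add: \<delta>_def)
  have \<delta>0: "\<delta> \<longlonglongrightarrow> 0" unfolding \<delta>_def a_def using d by real_asymp
  define \<theta> where "\<theta> n r = \<Psi> (a n * r + - (a n * s)) + - 1 * \<Psi> (a n * r + - (a n * t))" for n r
  have \<theta>s: "smooth (\<theta> n)" for n
    unfolding \<theta>_def
    by (rule smooth_add[OF smooth_affine[OF bounded_linear_mult_right \<Psi>]
          smooth_mult[OF smooth_const smooth_affine[OF bounded_linear_mult_right \<Psi>]]])
  have lo: "\<Psi> (a n * r + - (a n * u)) = 0" if "r \<le> u - \<delta> n" for n r u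
  proof -
    have "a n * r \<le> a n * (u - \<delta> n)" using that a[of n] by (intro mult_left_mono) auto
    then show ?thesis using a[of n] by (intro \<Psi>0) (simp add: \<delta>_def right_diff_distrib)
  qed
  have hi: "\<Psi> (a n * r + - (a n * u)) = 1" if "r \<ge> u + \<delta> n" for n r u
  proof -
    have "a n * r \<ge> a n * (u + \<delta> n)" using that a[of n] by (intro mult_left_mono) auto
    then show ?thesis using a[of n] by (intro \<Psi>1) (simp add: \<delta>_def distrib_left)
  qed
  have \<theta>T: "test_fun {0<..<T} (\<theta> n)" for n
    unfolding test_fun_def
  proof (intro conjI exI[of _ "{s - \<delta> n..t + \<delta> n}"] \<theta>s)
    show "{s - \<delta> n..t + \<delta> n} \<subseteq> {0<..<T}" using ad[of n] by (auto simp: \<delta>_def d_def)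
    show "\<forall>x. x \<notin> {s - \<delta> n..t + \<delta> n} \<longrightarrow> \<theta> n x = 0"
    proof (intro allI impI)
      fix x assume "x \<notin> {s - \<delta> n..t + \<delta> n}"
      then consider "x < s - \<delta> n" | "x > t + \<delta> n" by fastforce
      then show "\<theta> n x = 0"
      proof cases
        case 1
        then show ?thesis using lo[of x s n] lo[of x t n] st by (simp add: \<theta>_def)
      next
        case 2
        then show ?thesis using hi[where r = x and u = s and n = n] hi[where r = x and u = t and n = n] st by (simp add: \<theta>_def)
      qed
    qed
  qed simp
  have d\<theta>: "dir_deriv 1 (\<theta> n) r = mker \<kappa> (\<delta> n) (r - s) - mker \<kappa> (\<delta> n) (r - t)" for n r
  proof -
    have "(\<theta> n has_real_derivative \<kappa> (a n * r + - (a n * s)) * a n + - 1 * (\<kappa> (a n * r + - (a n * t)) * a n)) (at r)"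
      unfolding \<theta>_def by (rule derivative_eq_intros DERIV_chain2[OF d\<Psi>] refl | simp)+
    from dir_deriv_real[OF this, of 1] show ?thesis
      using a[of n] by (simp add: mker_def \<delta>_def algebra_simps)
  qed
  have Ei: "integrable ?M (\<lambda>\<tau>. mker \<kappa> (\<delta> n) (\<tau> - r) * E \<tau>)" for n r
  proof -
    have "set_integrable lebesgue {0..T} E"
      using E borel_integrable_compact[of "{0..T}" E] by (simp add: set_integrable_def integrable_completion)
    then have "set_integrable lebesgue {0<..<T} E" by (rule set_integrable_subset) auto
    then have Ei: "integrable ?M E" by (simp add: integrable_restrict_space set_integrable_def)
    obtain B where B: "\<And>z. \<bar>mker \<kappa> (\<delta> n) z\<bar> \<le> B" using mker_bounded[OF \<kappa> \<delta>(1)] by blast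
    have "(\<lambda>\<tau>. mker \<kappa> (\<delta> n) (\<tau> - r)) \<in> borel_measurable ?M"
      by (intro borel_measurable_lebesgue_on_continuous continuous_on_compose2[OF continuous_mker[where A = UNIV]]
        continuous_intros \<kappa>) auto
    then show ?thesis by (rule integrable_mult_bounded[OF Ei, of _ B]) (simp add: B)
  qed
  have "(\<integral>r. E r * dir_deriv 1 (\<theta> n) r \<partial>?M) =
      (\<integral>r. mker \<kappa> (\<delta> n) (r - s) * E r \<partial>?M) - (\<integral>r. mker \<kappa> (\<delta> n) (r - t) * E r \<partial>?M)" for n
    using Ei[of n s] Ei[of n t] unfolding d\<theta> by (simp add: right_diff_distrib mult.commute[of "E _"])
  moreover have "(\<lambda>n. (\<integral>r. mker \<kappa> (\<delta> n) (r - s) * E r \<partial>?M) - (\<integral>r. mker \<kappa> (\<delta> n) (r - t) * E r \<partial>?M)) \<longlonglongrightarrow> E s - E t"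
    using st by (intro tendsto_diff mker_average_tendsto \<kappa> E \<delta> \<delta>0) auto
  ultimately have 1: "(\<lambda>n. - (\<integral>r. D r * \<theta> n r \<partial>?M)) \<longlonglongrightarrow> E s - E t"
    using weak[OF \<theta>T] by simp
  have 2: "(\<lambda>n. \<integral>r. D r * \<theta> n r \<partial>?M) \<longlonglongrightarrow> (\<integral>r. D r * indicator {s<..<t} r \<partial>?M)"
  proof (rule integral_dominated_convergence[where w = "\<lambda>r. \<bar>D r\<bar>"])
    have "AE r in ?M. r \<noteq> s \<and> r \<noteq> t"
    proof -
      have "AE r in lborel. r \<noteq> s" "AE r in lborel. r \<noteq> t" using AE_lborel_singleton by blast+
      then show ?thesis by (subst AE_lebesgue_on_iff) auto
    qed
    then show "AE r in ?M. (\<lambda>n. D r * \<theta> n r) \<longlonglongrightarrow> D r * indicator {s<..<t} r"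
    proof eventually_elim
      case (elim r)
      have lo': "\<forall>\<^sub>F n in sequentially. \<Psi> (a n * r + - (a n * u)) = 0" if "r < u" for u
      proof -
        have "\<forall>\<^sub>F n in sequentially. \<delta> n < u - r" using order_tendstoD(2)[OF \<delta>0, of "u - r"] that by simp
        then show ?thesis by eventually_elim (rule lo, linarith)
      qed
      have hi': "\<forall>\<^sub>F n in sequentially. \<Psi> (a n * r + - (a n * u)) = 1" if "u < r" for u
      proof -
        have "\<forall>\<^sub>F n in sequentially. \<delta> n < r - u" using order_tendstoD(2)[OF \<delta>0, of "r - u"] that by simp
        then show ?thesis by eventually_elim (rule hi, linarith)
      qed
      consider "r < s" | "s < r" "r < t" | "t < r" using elim by linarith
      then have "\<forall>\<^sub>F n in sequentially. \<theta> n r = indicator {s<..<t} r"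
      proof cases
        case 1
        then have "r < t" using st by simp
        from lo'[OF 1] lo'[OF this] show ?thesis by eventually_elim (use 1 in \<open>simp add: \<theta>_def\<close>)
      next
        case 2
        from hi'[OF 2(1)] lo'[OF 2(2)] show ?thesis by eventually_elim (use 2 in \<open>simp add: \<theta>_def\<close>)
      next
        case 3
        then have "s < r" using st by simp
        from hi'[OF 3] hi'[OF this] show ?thesis by eventually_elim (use 3 in \<open>simp add: \<theta>_def\<close>)
      qed
      then show ?case by (intro tendsto_mult tendsto_const tendsto_eventually)
    qed
    show "AE r in ?M. norm (D r * \<theta> n r) \<le> \<bar>D r\<bar>" for n
    proof (rule AE_I2)
      fix r
      have "\<bar>\<theta> n r\<bar> \<le> 1"
        using \<Psi>b[of "a n * r + - (a n * s)"] \<Psi>b[of "a n * r + - (a n * t)"] unfolding \<theta>_def by linarith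
      then show "norm (D r * \<theta> n r) \<le> \<bar>D r\<bar>" by (simp add: abs_mult mult_left_le)
    qed
    show "(\<lambda>r. D r * \<theta> n r) \<in> borel_measurable ?M" for n
      by (intro borel_measurable_times borel_measurable_integrable[OF D] test_fun_measurable[OF \<theta>T])
    show "(\<lambda>r. D r * indicator {s<..<t} r) \<in> borel_measurable ?M"
      by (intro borel_measurable_times borel_measurable_integrable[OF D] borel_on_lebesgue_on) auto
  qed (use D in auto)
  show ?thesis using LIMSEQ_unique[OF 1 tendsto_minus[OF 2]] by (simp add: mult.commute)
qed

text \<open>The end points 0 and T are reached by shrinking (s, t) slightly and using the continuity
  of E on the closed interval.\<close>

lemma integral_weak_derivative:
  fixes E D :: "real \<Rightarrow> real"
  assumes E: "continuous_on {0..T} E" and D: "integrable (lebesgue_on {0<..<T}) D"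
    and weak: "\<And>\<theta>. test_fun {0<..<T} \<theta> \<Longrightarrow>
      (\<integral>t. E t * dir_deriv 1 \<theta> t \<partial>lebesgue_on {0<..<T}) = - (\<integral>t. D t * \<theta> t \<partial>lebesgue_on {0<..<T})"
    and st: "0 \<le> s" "s \<le> t" "t \<le> T"
  shows "E t - E s = (\<integral>r. D r \<partial>lebesgue_on {s<..<t})"
proof (cases "s = t")
  case False
  then have lt: "s < t" using st by simp
  let ?M = "lebesgue_on {0<..<T}"
  \<comment> \<open>The 3 makes 2 c n < t - s for every n, so the shrunken interval is never
    empty.\<close>
  define c where "c n = (t - s) / (real n + 3)" for n
  have c: "0 < c n" "2 * c n < t - s" for n
    using lt mult_strict_left_mono[of 2 "real n + 3" "t - s"] by (auto simp: c_def pos_divide_less_eq mult.commute)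
  have c0: "c \<longlonglongrightarrow> 0" unfolding c_def by real_asymp
  have *: "E (t - c n) - E (s + c n) = (\<integral>r. indicator {s + c n<..<t - c n} r * D r \<partial>?M)" for n
    using c[of n] st by (intro integral_weak_derivative_interior[OF E D weak]) auto
  have lim1: "(\<lambda>n. E (t - c n) - E (s + c n)) \<longlonglongrightarrow> E t - E s"
  proof (intro tendsto_diff continuous_on_tendsto_compose[OF E])
    show "(\<lambda>n. t - c n) \<longlonglongrightarrow> t" using tendsto_diff[OF tendsto_const c0, of t] by simp
    show "(\<lambda>n. s + c n) \<longlonglongrightarrow> s" using tendsto_add[OF tendsto_const c0, of s] by simp
    show "\<forall>\<^sub>F n in sequentially. t - c n \<in> {0..T}" "\<forall>\<^sub>F n in sequentially. s + c n \<in> {0..T}"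
      using c st by (auto intro!: always_eventually simp: less_imp_le) (smt (verit) c st)+
  qed (use st in auto)
  have lim2: "(\<lambda>n. \<integral>r. indicator {s + c n<..<t - c n} r * D r \<partial>?M) \<longlonglongrightarrow> (\<integral>r. indicator {s<..<t} r * D r \<partial>?M)"
  proof (rule integral_dominated_convergence[where w = "\<lambda>r. \<bar>D r\<bar>"])
    show "AE r in ?M. (\<lambda>n. indicator {s + c n<..<t - c n} r * D r) \<longlonglongrightarrow> indicator {s<..<t} r * D r"
    proof (intro AE_I2 tendsto_mult tendsto_const tendsto_eventually)
      fix r
      show "\<forall>\<^sub>F n in sequentially. indicator {s + c n<..<t - c n} r = (indicator {s<..<t} r :: real)"
      proof (cases "r \<in> {s<..<t}")
        case True
        then have "\<forall>\<^sub>F n in sequentially. c n < min (r - s) (t - r)"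
          by (intro order_tendstoD(2)[OF c0]) auto
        then show ?thesis by eventually_elim (use True in \<open>auto simp: indicator_def\<close>)
      next
        case False
        have "r \<notin> {s + c n<..<t - c n}" for n using False c(1)[of n] by auto
        then show ?thesis using False by simp
      qed
    qed
    show "AE r in ?M. norm (indicator {s + c n<..<t - c n} r * D r) \<le> \<bar>D r\<bar>" for n
      by (intro AE_I2) (simp add: indicator_def)
    show "(\<lambda>r. indicator {s + c n<..<t - c n} r * D r) \<in> borel_measurable ?M"
      "(\<lambda>r. indicator {s<..<t} r * D r) \<in> borel_measurable ?M" for n
      by (intro borel_measurable_times borel_measurable_integrable[OF D] borel_on_lebesgue_on; simp)+
  qed (use D in auto)
  have "E t - E s = (\<integral>r. indicator {s<..<t} r * D r \<partial>?M)"
    using LIMSEQ_unique[OF lim1] lim2 by (simp add: *)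
  also have "\<dots> = (\<integral>r. indicator {s<..<t} r * D r \<partial>lebesgue_on {s<..<t})"
    by (rule lebesgue_on_zero_outside(2)) (use st in auto)
  also have "\<dots> = (\<integral>r. D r \<partial>lebesgue_on {s<..<t})"
    by (intro Bochner_Integration.integral_cong) auto
  finally show ?thesis .
qed simp

lemma integrable_lebesgue_on_subset:
  fixes f :: "'a::euclidean_space \<Rightarrow> real"
  assumes "integrable (lebesgue_on S) f" "S \<in> sets lebesgue" "T \<in> sets lebesgue" "T \<subseteq> S"
  shows "integrable (lebesgue_on T) f"
proof -
  have "set_integrable lebesgue S f" using assms by (simp add: integrable_restrict_space set_integrable_def)
  then have "set_integrable lebesgue T f" by (rule set_integrable_subset) (use assms in auto)
  then show ?thesis using assms by (simp add: integrable_restrict_space set_integrable_def)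
qed

lemma borel_measurable_lebesgue_on_subset:
  "f \<in> borel_measurable (lebesgue_on S) \<Longrightarrow> T \<subseteq> S \<Longrightarrow> f \<in> borel_measurable (lebesgue_on T)"
  by (rule measurable_restrict_mono)

lemma AE_lebesgue_on_subset:
  assumes "AE x in lebesgue_on S. P x" "S \<in> sets lebesgue" "T \<in> sets lebesgue" "T \<subseteq> S"
  shows "AE x in lebesgue_on T. P x"
  using assms(1) unfolding AE_lebesgue_on_iff[OF assms(2)] AE_lebesgue_on_iff[OF assms(3)]
  by eventually_elim (use assms(4) in blast)

section \<open>Consequences of continuity in time with values in L^1\<close>

lemma C_L1D:
  assumes "C_L1 T S w" "t \<in> {0..T}"
  shows "integrable (lebesgue_on S) (w t)"
    and "((\<lambda>s. \<integral>x. \<bar>w s x - w t x\<bar> \<partial>lebesgue_on S) \<longlongrightarrow> 0) (at t within {0..T})"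
  using assms by (auto simp: C_L1_def)

lemma C_L1_continuous:
  assumes w: "C_L1 T S w" and \<zeta>: "\<zeta> \<in> borel_measurable (lebesgue_on S)" "AE x in lebesgue_on S. \<bar>\<zeta> x\<bar> \<le> B"
  shows "continuous_on {0..T} (\<lambda>t. \<integral>x. \<zeta> x * w t x \<partial>lebesgue_on S)"
  unfolding continuous_on_def
proof
  fix t assume t: "t \<in> {0..T}"
  have i: "integrable (lebesgue_on S) (\<lambda>x. \<zeta> x * w s x)" if "s \<in> {0..T}" for s
    by (rule integrable_mult_bounded[OF C_L1D(1)[OF w that] \<zeta>])
  have "((\<lambda>s. (\<integral>x. \<zeta> x * w s x \<partial>lebesgue_on S) - (\<integral>x. \<zeta> x * w t x \<partial>lebesgue_on S)) \<longlongrightarrow> 0) (at t within {0..T})"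
  proof (rule Lim_null_comparison)
    show "((\<lambda>s. B * (\<integral>x. \<bar>w s x - w t x\<bar> \<partial>lebesgue_on S)) \<longlongrightarrow> 0) (at t within {0..T})"
      using tendsto_mult_right_zero[OF C_L1D(2)[OF w t], of B] .
    have "norm ((\<integral>x. \<zeta> x * w s x \<partial>lebesgue_on S) - (\<integral>x. \<zeta> x * w t x \<partial>lebesgue_on S))
        \<le> B * (\<integral>x. \<bar>w s x - w t x\<bar> \<partial>lebesgue_on S)" if s: "s \<in> {0..T}" for s
    proof -
      have d: "integrable (lebesgue_on S) (\<lambda>x. w s x - w t x)"
        using C_L1D(1)[OF w s] C_L1D(1)[OF w t] by simp
      have "(\<integral>x. \<zeta> x * w s x \<partial>lebesgue_on S) - (\<integral>x. \<zeta> x * w t x \<partial>lebesgue_on S) =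
          (\<integral>x. \<zeta> x * (w s x - w t x) \<partial>lebesgue_on S)"
        using i[OF s] i[OF t] by (simp add: right_diff_distrib)
      also have "norm \<dots> \<le> (\<integral>x. \<bar>\<zeta> x * (w s x - w t x)\<bar> \<partial>lebesgue_on S)"
        using integral_abs_bound by simp
      also have "\<dots> \<le> (\<integral>x. B * \<bar>w s x - w t x\<bar> \<partial>lebesgue_on S)"
      proof (rule integral_mono_AE)
        show "integrable (lebesgue_on S) (\<lambda>x. \<bar>\<zeta> x * (w s x - w t x)\<bar>)"
          by (intro integrable_abs integrable_mult_bounded[OF d \<zeta>])
        show "AE x in lebesgue_on S. \<bar>\<zeta> x * (w s x - w t x)\<bar> \<le> B * \<bar>w s x - w t x\<bar>"
          using \<zeta>(2) by eventually_elim (simp add: abs_mult mult_right_mono)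
      qed (use d in simp)
      finally show ?thesis by simp
    qed
    then show "\<forall>\<^sub>F s in at t within {0..T}. norm ((\<integral>x. \<zeta> x * w s x \<partial>lebesgue_on S) - (\<integral>x. \<zeta> x * w t x \<partial>lebesgue_on S))
        \<le> B * (\<integral>x. \<bar>w s x - w t x\<bar> \<partial>lebesgue_on S)"
      unfolding eventually_at_filter by (intro always_eventually) blast
  qed
  then show "((\<lambda>s. \<integral>x. \<zeta> x * w s x \<partial>lebesgue_on S) \<longlongrightarrow> (\<integral>x. \<zeta> x * w t x \<partial>lebesgue_on S)) (at t within {0..T})"
    by (simp add: LIM_zero_iff)
qed

text \<open>The L^1 distance of two time slices satisfies the triangle inequality, hence is jointly
  continuous on the compact square of times and therefore uniformly continuous. A pair (s, t) is
  compared with the diagonal point (t, t), where the distance is 0.\<close>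

lemma C_L1_uniform:
  assumes w: "C_L1 T S w" and \<epsilon>: "0 < \<epsilon>"
  obtains \<delta> where "0 < \<delta>"
    "\<And>s t. s \<in> {0..T} \<Longrightarrow> t \<in> {0..T} \<Longrightarrow> \<bar>s - t\<bar> < \<delta> \<Longrightarrow> (\<integral>x. \<bar>w s x - w t x\<bar> \<partial>lebesgue_on S) < \<epsilon>"
proof -
  define d where "d s t = (\<integral>x. \<bar>w s x - w t x\<bar> \<partial>lebesgue_on S)" for s t
  note i = C_L1D(1)[OF w]
  have tri: "d s u \<le> d s t + d t u" if "s \<in> {0..T}" "t \<in> {0..T}" "u \<in> {0..T}" for s t u
  proof -
    have "d s u \<le> (\<integral>x. \<bar>w s x - w t x\<bar> + \<bar>w t x - w u x\<bar> \<partial>lebesgue_on S)"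
      unfolding d_def using that i by (intro integral_mono) auto
    also have "\<dots> = d s t + d t u" unfolding d_def using that i by simp
    finally show ?thesis .
  qed
  have sym: "d s t = d t s" for s t unfolding d_def by (simp add: abs_minus_commute)
  have dc: "continuous_on {0..T} (\<lambda>s. d s t)" if t: "t \<in> {0..T}" for t
    unfolding continuous_on_def
  proof
    fix s assume s: "s \<in> {0..T}"
    have "((\<lambda>s'. d s' t - d s t) \<longlongrightarrow> 0) (at s within {0..T})"
    proof (rule Lim_null_comparison)
      show "((\<lambda>s'. d s' s) \<longlongrightarrow> 0) (at s within {0..T})" using C_L1D(2)[OF w s] by (simp add: d_def)
      have "norm (d s' t - d s t) \<le> d s' s" if "s' \<in> {0..T}" for s'
        using tri[OF that s t] tri[OF s that t] sym[of s s'] by auto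
      then show "\<forall>\<^sub>F s' in at s within {0..T}. norm (d s' t - d s t) \<le> d s' s"
        unfolding eventually_at_filter by (intro always_eventually) blast
    qed
    then show "((\<lambda>s'. d s' t) \<longlongrightarrow> d s t) (at s within {0..T})" by (simp add: LIM_zero_iff)
  qed
  have "continuous_on ({0..T} \<times> {0..T}) (\<lambda>z. d (fst z) (snd z))"
    unfolding continuous_on_def
  proof
    fix z assume z: "z \<in> {0..T} \<times> {0..T}"
    let ?A = "{0..T} \<times> {0..T}"
    have 1: "continuous_on ?A (\<lambda>y. d (fst y) (fst z))"
      by (rule continuous_on_compose2[OF dc]) (use z in \<open>auto intro: continuous_intros\<close>)
    have 2: "continuous_on ?A (\<lambda>y. d (snd y) (snd z))"
      by (rule continuous_on_compose2[OF dc]) (use z in \<open>auto intro: continuous_intros\<close>)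
    have d0: "d s s = 0" for s by (simp add: d_def)
    have "((\<lambda>y. d (fst y) (snd y) - d (fst z) (snd z)) \<longlongrightarrow> 0) (at z within ?A)"
    proof (rule Lim_null_comparison)
      show "((\<lambda>y. d (fst y) (fst z) + d (snd y) (snd z)) \<longlongrightarrow> 0) (at z within ?A)"
        using tendsto_add[OF 1[unfolded continuous_on_def, rule_format, OF z] 2[unfolded continuous_on_def, rule_format, OF z]]
        by (simp add: d0)
      have "norm (d (fst y) (snd y) - d (fst z) (snd z)) \<le> d (fst y) (fst z) + d (snd y) (snd z)" if y: "y \<in> ?A" for y
      proof -
        have m: "fst y \<in> {0..T}" "snd y \<in> {0..T}" "fst z \<in> {0..T}" "snd z \<in> {0..T}" using y z by auto
        show ?thesis
          using tri[OF m(1) m(3) m(2)] tri[OF m(3) m(4) m(2)] tri[OF m(3) m(1) m(4)] tri[OF m(1) m(2) m(4)]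
            sym[of "fst z" "fst y"] sym[of "snd z" "snd y"] by (simp add: abs_le_iff)
      qed
      then show "\<forall>\<^sub>F y in at z within ?A. norm (d (fst y) (snd y) - d (fst z) (snd z)) \<le> d (fst y) (fst z) + d (snd y) (snd z)"
        unfolding eventually_at_filter by (intro always_eventually) blast
    qed
    then show "((\<lambda>y. d (fst y) (snd y)) \<longlongrightarrow> d (fst z) (snd z)) (at z within ?A)" by (simp add: LIM_zero_iff)
  qed
  then have "uniformly_continuous_on ({0..T} \<times> {0..T}) (\<lambda>z. d (fst z) (snd z))"
    by (intro compact_uniformly_continuous compact_Times compact_Icc)
  then obtain \<delta> where \<delta>: "\<delta> > 0" "\<And>y z. y \<in> {0..T} \<times> {0..T} \<Longrightarrow> z \<in> {0..T} \<times> {0..T} \<Longrightarrow> dist z y < \<delta> \<Longrightarrow>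
      dist (d (fst z) (snd z)) (d (fst y) (snd y)) < \<epsilon>"
    using \<epsilon> unfolding uniformly_continuous_on_def by metis
  have "d s t < \<epsilon>" if "s \<in> {0..T}" "t \<in> {0..T}" "\<bar>s - t\<bar> < \<delta>" for s t
  proof -
    have "dist (s, t) (t, t) < \<delta>" using that(3) by (simp add: dist_prod_def dist_real_def)
    then have "dist (d s t) (d t t) < \<epsilon>" using \<delta>(2)[of "(t, t)" "(s, t)"] that by simp
    then show ?thesis by (simp add: dist_real_def d_def[of t t])
  qed
  then show ?thesis using that \<delta>(1) unfolding d_def by blast
qed

text \<open>A subinterval of positive length is not a null set.\<close>

lemma AE_interval_dense:
  fixes T t \<delta> :: real
  assumes "AE r in lebesgue_on {0<..<T}. P r" "t \<in> {0..T}" "0 < \<delta>" "0 < T"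
  shows "\<exists>r\<in>{0<..<T}. \<bar>r - t\<bar> < \<delta> \<and> P r"
proof (rule ccontr)
  assume neg: "\<not> ?thesis"
  define J where "J = {max 0 (t - \<delta>)<..<min T (t + \<delta>)}"
  have ne: "max 0 (t - \<delta>) < min T (t + \<delta>)" using assms by auto
  have "AE r in lborel. r \<in> {0<..<T} \<longrightarrow> P r" using assms(1) by (simp add: AE_lebesgue_on_iff)
  then have "AE r in lborel. r \<notin> J"
  proof eventually_elim
    case (elim r)
    then show ?case using neg by (auto simp: J_def)
  qed
  then have "emeasure lborel J = 0" by (subst (asm) AE_iff_measurable[of J]) (auto simp: J_def)
  moreover have "emeasure lborel J = ennreal (min T (t + \<delta>) - max 0 (t - \<delta>))"
    using ne by (simp add: J_def)
  ultimately show False using ne by (simp only: ennreal_eq_0_iff)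
qed

text \<open>The L^\<infinity> bound in space and time controls almost every slice only, while the
  energy is evaluated at every time. Continuity in L^1 bridges the gap: the excess of |w t| over C
  is at most |w r - w t| for any good time r, and good times are dense.\<close>

lemma C_L1_bounded:
  assumes w: "C_L1 T S w" and T: "0 < T"
    and C: "AE r in lebesgue_on {0<..<T}. AE x in lebesgue_on S. \<bar>w r x\<bar> \<le> C" and t: "t \<in> {0..T}"
  shows "AE x in lebesgue_on S. \<bar>w t x\<bar> \<le> C"
proof -
  let ?M = "lebesgue_on S"
  define p where "p x = max 0 (\<bar>w t x\<bar> - C)" for x
  have wt: "integrable ?M (w t)" by (rule C_L1D(1)[OF w t])
  have p_le: "(\<integral>x. p x \<partial>?M) \<le> \<epsilon>" and pi: "integrable ?M p" if "0 < \<epsilon>" for \<epsilon>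
  proof -
    obtain \<delta> where \<delta>: "0 < \<delta>" "\<And>s t. s \<in> {0..T} \<Longrightarrow> t \<in> {0..T} \<Longrightarrow> \<bar>s - t\<bar> < \<delta> \<Longrightarrow> (\<integral>x. \<bar>w s x - w t x\<bar> \<partial>?M) < \<epsilon>"
      using C_L1_uniform[OF w \<open>0 < \<epsilon>\<close>] by metis
    obtain r where r: "r \<in> {0<..<T}" "\<bar>r - t\<bar> < \<delta>" "AE x in ?M. \<bar>w r x\<bar> \<le> C"
      using AE_interval_dense[OF C t \<delta>(1) T] by blast
    have r': "r \<in> {0..T}" using r(1) by auto
    have d: "integrable ?M (\<lambda>x. \<bar>w r x - w t x\<bar>)" using wt C_L1D(1)[OF w r'] by simp
    have le: "AE x in ?M. p x \<le> \<bar>w r x - w t x\<bar>" using r(3) by eventually_elim (auto simp: p_def)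
    show pi: "integrable ?M p"
    proof (rule Bochner_Integration.integrable_bound[OF d])
      show "p \<in> borel_measurable ?M" unfolding p_def using wt by measurable
      show "AE x in ?M. norm (p x) \<le> norm \<bar>w r x - w t x\<bar>"
        using le by eventually_elim (simp add: p_def)
    qed
    have "(\<integral>x. p x \<partial>?M) \<le> (\<integral>x. \<bar>w r x - w t x\<bar> \<partial>?M)" by (rule integral_mono_AE[OF pi d le])
    then show "(\<integral>x. p x \<partial>?M) \<le> \<epsilon>" using \<delta>(2)[OF r' t r(2)] by simp
  qed
  have "(\<integral>x. p x \<partial>?M) \<le> 0" by (rule field_le_epsilon) (use p_le in simp)
  moreover have "0 \<le> (\<integral>x. p x \<partial>?M)" by (intro integral_nonneg_AE) (simp add: p_def)
  ultimately have "(\<integral>x. p x \<partial>?M) = 0" by simp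
  moreover have "AE x in ?M. 0 \<le> p x" by (simp add: p_def)
  ultimately have "AE x in ?M. p x = 0"
    using integral_nonneg_eq_0_iff_AE[OF pi[of 1]] by simp
  then show ?thesis by eventually_elim (simp add: p_def max_def split: if_splits)
qed

section \<open>Increments in time and the weak time derivative\<close>

lemma lmeasurable_Times_bounded:
  fixes A :: "'a::euclidean_space set" and B :: "'b::euclidean_space set"
  assumes "A \<in> sets borel" "B \<in> sets borel" "bounded A" "bounded B"
  shows "A \<times> B \<in> lmeasurable"
  using bounded_set_imp_lmeasurable[OF bounded_Times[OF assms(3,4)] borel_Times_lebesgue[OF assms(1,2)]] .

text \<open>Testing with \<theta>(t) \<zeta>(x) shows that the scalar function given by the integral
  of \<zeta> \<rho>(t) has the integral of \<zeta> \<sigma>(t) as weak derivative. It is continuous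
  on [0, T], so its increments are known for all times, end points included, and varying \<zeta>
  gives the claim by the fundamental lemma.\<close>

lemma time_increment:
  fixes \<rho> :: "real \<Rightarrow> 'a::euclidean_space \<Rightarrow> real"
  assumes S: "open S" "bounded S" and w: "C_L1 T S \<rho>"
    and weak: "weak_deriv ({0<..<T} \<times> S) (1, 0) (\<lambda>(t, x). \<rho> t x) \<sigma>" and \<sigma>: "L_two ({0<..<T} \<times> S) \<sigma>"
    and st: "0 \<le> s" "s \<le> t" "t \<le> T"
  shows "AE x in lebesgue_on S. \<rho> t x - \<rho> s x = (\<integral>r. \<sigma> (r, x) \<partial>lebesgue_on {s<..<t})"
    and "integrable (lebesgue_on S) (\<lambda>x. \<integral>r. \<sigma> (r, x) \<partial>lebesgue_on {s<..<t})"
proof -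
  let ?I = "{0<..<T}" and ?J = "{s<..<t}"
  let ?M = "lebesgue_on S"
  have Sb: "S \<in> sets borel" and Sm: "S \<in> sets lebesgue" using S by auto
  have Ib: "?I \<in> sets borel" and Jb: "?J \<in> sets borel" by auto
  have Qm: "?I \<times> S \<in> sets lebesgue" "?J \<times> S \<in> sets lebesgue"
    using borel_Times_lebesgue[OF Ib Sb] borel_Times_lebesgue[OF Jb Sb] by auto
  have JI: "?J \<times> S \<subseteq> ?I \<times> S" using st by auto
  have lI: "?I \<times> S \<in> lmeasurable" by (rule lmeasurable_Times_bounded[OF Ib Sb _ S(2)]) simp
  have \<sigma>I: "integrable (lebesgue_on (?I \<times> S)) \<sigma>" by (rule L_two_integrable[OF lI \<sigma>])
  have \<sigma>J: "integrable (lebesgue_on (?J \<times> S)) \<sigma>"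
    by (rule integrable_lebesgue_on_subset[OF \<sigma>I Qm JI])
  define k where "k x = (\<integral>r. \<sigma> (r, x) \<partial>lebesgue_on ?J)" for x
  show ki: "integrable ?M (\<lambda>x. \<integral>r. \<sigma> (r, x) \<partial>lebesgue_on ?J)"
    by (rule lebesgue_on_Times_Fubini(5)[OF Jb Sb \<sigma>J])
  then have ki': "integrable ?M k" by (simp add: k_def[abs_def])
  have s_in: "s \<in> {0..T}" and t_in: "t \<in> {0..T}" using st by auto
  have "AE x in ?M. (\<rho> t x - \<rho> s x) - k x = 0"
  proof (rule fundamental_lemma[OF S(1)])
    have "integrable ?M (\<lambda>x. (\<rho> t x - \<rho> s x) - k x)"
      using C_L1D(1)[OF w t_in] C_L1D(1)[OF w s_in] ki' by simp
    then show "loc_integrable S (\<lambda>x. (\<rho> t x - \<rho> s x) - k x)" by (rule integrable_imp_loc_integrable[OF Sm])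
    fix \<zeta> assume \<zeta>: "test_fun S \<zeta>"
    obtain C B where C: "compact C" "C \<subseteq> S" "\<And>x. x \<notin> C \<Longrightarrow> \<zeta> x = 0" "\<And>x. \<bar>\<zeta> x\<bar> \<le> B"
      using test_funE[OF \<zeta>] by blast
    have \<zeta>m: "\<zeta> \<in> borel_measurable ?M" by (rule test_fun_measurable[OF \<zeta>])
    have \<zeta>b: "AE x in ?M. \<bar>\<zeta> x\<bar> \<le> B" using C(4) by simp
    define E where "E \<tau> = (\<integral>x. \<zeta> x * \<rho> \<tau> x \<partial>?M)" for \<tau>
    define D where "D \<tau> = (\<integral>x. \<zeta> x * \<sigma> (\<tau>, x) \<partial>?M)" for \<tau>
    have Ec: "continuous_on {0..T} E" unfolding E_def by (rule C_L1_continuous[OF w \<zeta>m \<zeta>b])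
    have \<zeta>sm: "(\<lambda>z. \<zeta> (snd z)) \<in> borel_measurable (lebesgue_on (A \<times> S))" if "A \<in> sets borel" for A :: "real set"
      by (rule borel_measurable_lebesgue_on_snd[OF that Sb \<zeta>m])
    have \<sigma>\<zeta>I: "integrable (lebesgue_on (?I \<times> S)) (\<lambda>z. \<zeta> (snd z) * \<sigma> z)"
      by (rule integrable_mult_bounded[OF \<sigma>I \<zeta>sm[OF Ib], of B]) (simp add: C(4))
    have \<sigma>\<zeta>J: "integrable (lebesgue_on (?J \<times> S)) (\<lambda>z. \<zeta> (snd z) * \<sigma> z)"
      by (rule integrable_lebesgue_on_subset[OF \<sigma>\<zeta>I Qm JI])
    have Di: "integrable (lebesgue_on ?I) D"
      unfolding D_def using lebesgue_on_Times_Fubini(2)[OF Ib Sb \<sigma>\<zeta>I] by simp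
    have "E t - E s = (\<integral>r. D r \<partial>lebesgue_on ?J)"
    proof (rule integral_weak_derivative[OF Ec Di _ st])
      fix \<theta> assume \<theta>: "test_fun ?I \<theta>"
      let ?\<phi> = "\<lambda>z. \<theta> (fst z) * \<zeta> (snd z)"
      have \<phi>: "test_fun (?I \<times> S) ?\<phi>" by (rule test_fun_tensor[OF \<theta> \<zeta>])
      have sm: "smooth \<theta>" "smooth \<zeta>" using \<theta> \<zeta> by (auto simp: test_fun_def)
      have e: "(1, 0) \<in> (Basis :: (real \<times> 'a) set)" by (simp add: Basis_prod_def)
      have L: "loc_integrable (?I \<times> S) (\<lambda>(t, x). \<rho> t x)" "loc_integrable (?I \<times> S) \<sigma>"
        using weak by (auto simp: weak_deriv_def)
      have W: "(\<integral>z. (case z of (t, x) \<Rightarrow> \<rho> t x) * dir_deriv (1, 0) ?\<phi> z \<partial>lebesgue_on (?I \<times> S)) =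
          - (\<integral>z. \<sigma> z * ?\<phi> z \<partial>lebesgue_on (?I \<times> S))"
        using weak \<phi> unfolding weak_deriv_def by blast
      have F1: "(\<integral>z. (case z of (t, x) \<Rightarrow> \<rho> t x) * dir_deriv (1, 0) ?\<phi> z \<partial>lebesgue_on (?I \<times> S)) =
          (\<integral>t. E t * dir_deriv 1 \<theta> t \<partial>lebesgue_on ?I)"
        unfolding lebesgue_on_Times_Fubini(3)[OF Ib Sb loc_integrable_mult_test[OF Qm(1) L(1) test_fun_dir_deriv[OF \<phi> e]], symmetric]
        by (simp add: smooth_tensor(2)[OF sm, of 1] E_def mult_ac flip: integral_mult_right_zero)
      have F2: "(\<integral>z. \<sigma> z * ?\<phi> z \<partial>lebesgue_on (?I \<times> S)) = (\<integral>t. D t * \<theta> t \<partial>lebesgue_on ?I)"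
        unfolding lebesgue_on_Times_Fubini(3)[OF Ib Sb loc_integrable_mult_test[OF Qm(1) L(2) \<phi>], symmetric]
        by (simp add: D_def mult_ac flip: integral_mult_right_zero)
      show "(\<integral>t. E t * dir_deriv 1 \<theta> t \<partial>lebesgue_on ?I) = - (\<integral>t. D t * \<theta> t \<partial>lebesgue_on ?I)"
        using W F1 F2 by simp
    qed
    also have "(\<integral>r. D r \<partial>lebesgue_on ?J) = (\<integral>x. \<zeta> x * k x \<partial>?M)"
      using lebesgue_on_Times_Fubini(3,6)[OF Jb Sb \<sigma>\<zeta>J] by (simp add: D_def k_def)
    finally have fin: "E t - E s = (\<integral>x. \<zeta> x * k x \<partial>?M)" .
    have i3: "integrable ?M (\<lambda>x. \<zeta> x * \<rho> t x)" "integrable ?M (\<lambda>x. \<zeta> x * \<rho> s x)" "integrable ?M (\<lambda>x. \<zeta> x * k x)"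
      by (rule integrable_mult_bounded[OF _ \<zeta>m \<zeta>b]; use C_L1D(1)[OF w] s_in t_in ki' in blast)+
    have "(\<integral>x. (\<rho> t x - \<rho> s x - k x) * \<zeta> x \<partial>?M) = (\<integral>x. \<zeta> x * \<rho> t x - \<zeta> x * \<rho> s x - \<zeta> x * k x \<partial>?M)"
      by (intro Bochner_Integration.integral_cong refl) (simp add: algebra_simps)
    also have "\<dots> = E t - E s - (\<integral>x. \<zeta> x * k x \<partial>?M)" using i3 by (simp add: E_def)
    finally show "(\<integral>x. (\<rho> t x - \<rho> s x - k x) * \<zeta> x \<partial>?M) = 0" using fin by simp
  qed
  then show "AE x in ?M. \<rho> t x - \<rho> s x = (\<integral>r. \<sigma> (r, x) \<partial>lebesgue_on ?J)"
    by eventually_elim (simp add: k_def)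
qed

text \<open>The weight is merely bounded and measurable, since it will be the averaged potential
  \<open>avg\<close>, which has no smoothness.\<close>

lemma time_increment_integral:
  fixes \<rho> :: "real \<Rightarrow> 'a::euclidean_space \<Rightarrow> real"
  assumes S: "open S" "bounded S" and w: "C_L1 T S \<rho>"
    and weak: "weak_deriv ({0<..<T} \<times> S) (1, 0) (\<lambda>(t, x). \<rho> t x) \<sigma>" and \<sigma>: "L_two ({0<..<T} \<times> S) \<sigma>"
    and st: "0 \<le> s" "s \<le> t" "t \<le> T"
    and \<zeta>: "\<zeta> \<in> borel_measurable (lebesgue_on S)" "AE x in lebesgue_on S. \<bar>\<zeta> x\<bar> \<le> B"
  shows "(\<integral>x. \<zeta> x * (\<rho> t x - \<rho> s x) \<partial>lebesgue_on S) =
      (\<integral>r. (\<integral>x. \<zeta> x * \<sigma> (r, x) \<partial>lebesgue_on S) \<partial>lebesgue_on {s<..<t})"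
    and "integrable (lebesgue_on {s<..<t}) (\<lambda>r. \<integral>x. \<zeta> x * \<sigma> (r, x) \<partial>lebesgue_on S)"
proof -
  let ?I = "{0<..<T}" and ?J = "{s<..<t}"
  let ?M = "lebesgue_on S"
  have Sb: "S \<in> sets borel" and Sm: "S \<in> sets lebesgue" using S by auto
  have Ib: "?I \<in> sets borel" and Jb: "?J \<in> sets borel" by auto
  have Qm: "?I \<times> S \<in> sets lebesgue" "?J \<times> S \<in> sets lebesgue"
    using borel_Times_lebesgue[OF Ib Sb] borel_Times_lebesgue[OF Jb Sb] by auto
  have JI: "?J \<times> S \<subseteq> ?I \<times> S" using st by auto
  have lI: "?I \<times> S \<in> lmeasurable" by (rule lmeasurable_Times_bounded[OF Ib Sb _ S(2)]) simp
  have \<sigma>J: "integrable (lebesgue_on (?J \<times> S)) \<sigma>"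
    by (rule integrable_lebesgue_on_subset[OF L_two_integrable[OF lI \<sigma>] Qm JI])
  have "AE z in lebesgue_on (?J \<times> S). \<bar>\<zeta> (snd z)\<bar> \<le> B"
    by (rule AE_lebesgue_on_fst_snd(2)[OF Jb Sb \<zeta>(2)])
  then have i: "integrable (lebesgue_on (?J \<times> S)) (\<lambda>z. \<zeta> (snd z) * \<sigma> z)"
    by (rule integrable_mult_bounded[OF \<sigma>J borel_measurable_lebesgue_on_snd[OF Jb Sb \<zeta>(1)]])
  note F = lebesgue_on_Times_Fubini[OF Jb Sb i]
  note inc = time_increment[OF S w weak \<sigma> st]
  have ae: "AE x in ?M. \<zeta> x * (\<rho> t x - \<rho> s x) = \<zeta> x * (\<integral>r. \<sigma> (r, x) \<partial>lebesgue_on ?J)"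
    using inc(1) by eventually_elim simp
  have "(\<integral>x. \<zeta> x * (\<rho> t x - \<rho> s x) \<partial>?M) = (\<integral>x. \<zeta> x * (\<integral>r. \<sigma> (r, x) \<partial>lebesgue_on ?J) \<partial>?M)"
    by (rule lebesgue_on_cong_AE(2)[OF Sm integrable_mult_bounded[OF inc(2) \<zeta>] ae])
  also have "\<dots> = (\<integral>r. (\<integral>x. \<zeta> x * \<sigma> (r, x) \<partial>?M) \<partial>lebesgue_on ?J)" using F(3,6) by simp
  finally show "(\<integral>x. \<zeta> x * (\<rho> t x - \<rho> s x) \<partial>?M) =
      (\<integral>r. (\<integral>x. \<zeta> x * \<sigma> (r, x) \<partial>?M) \<partial>lebesgue_on ?J)" .
  show "integrable (lebesgue_on ?J) (\<lambda>r. \<integral>x. \<zeta> x * \<sigma> (r, x) \<partial>?M)" using F(2) by simp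
qed

section \<open>From short intervals to all intervals\<close>

lemma integral_interval_additive:
  fixes D :: "real \<Rightarrow> real"
  assumes D: "integrable (lebesgue_on {0<..<T}) D" and st: "0 \<le> s" "s \<le> t" "t \<le> T"
  shows "(\<integral>r. D r \<partial>lebesgue_on {0<..<t}) = (\<integral>r. D r \<partial>lebesgue_on {0<..<s}) + (\<integral>r. D r \<partial>lebesgue_on {s<..<t})"
proof -
  have sub: "integrable (lebesgue_on {a<..<b}) D" if "0 \<le> a" "b \<le> T" for a b
    by (rule integrable_lebesgue_on_subset[OF D]) (use that in auto)
  have r: "(\<integral>r. D r \<partial>lebesgue_on {a<..<b}) = (\<integral>r. indicator {a<..<b} r * D r \<partial>lebesgue)"
    "integrable lebesgue (\<lambda>r. indicator {a<..<b} r * D r)" if "0 \<le> a" "b \<le> T" for a b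
    using sub[OF that] by (simp_all add: integral_restrict_space integrable_restrict_space)
  have "AE x in lebesgue. x \<noteq> s" using AE_completion[OF AE_lborel_singleton] .
  then have "AE r in lebesgue. indicator {0<..<t} r * D r = indicator {0<..<s} r * D r + indicator {s<..<t} r * D r"
    by eventually_elim (use st in \<open>auto simp: indicator_def\<close>)
  then have "(\<integral>r. indicator {0<..<t} r * D r \<partial>lebesgue) =
      (\<integral>r. indicator {0<..<s} r * D r + indicator {s<..<t} r * D r \<partial>lebesgue)"
    using st r(2)[of 0 t] r(2)[of 0 s] r(2)[of s t] by (intro integral_cong_AE) auto
  then show ?thesis using st r(1)[of 0 t] r(1)[of 0 s] r(1)[of s t] r(2)[of 0 s] r(2)[of s t] by simp
qed

text \<open>Induction on the number of steps of length \<delta>/2, half the admissible length so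
  that each step stays strictly below \<delta>. The bound adds up because H enters by its
  increments.\<close>

lemma small_increments_imp_le:
  fixes G H :: "real \<Rightarrow> real"
  assumes \<delta>: "0 < \<delta>" and small: "\<And>s t. 0 \<le> s \<Longrightarrow> s \<le> t \<Longrightarrow> t \<le> T \<Longrightarrow> t - s < \<delta> \<Longrightarrow> \<bar>G t - G s\<bar> \<le> H t - H s"
    and st: "0 \<le> s" "s \<le> t" "t \<le> T"
  shows "\<bar>G t - G s\<bar> \<le> H t - H s"
proof -
  have "\<bar>G t - G s\<bar> \<le> H t - H s" if "t - s < (real n + 1) * (\<delta> / 2)" "s \<le> t" "t \<le> T" for n t
    using that
  proof (induction n arbitrary: t)
    case 0
    then show ?case using small[OF st(1) 0(2,3)] \<delta> by simp
  next
    case (Suc n)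
    show ?case
    proof (cases "t - s < \<delta>")
      case True
      then show ?thesis using small[OF st(1) Suc(3,4)] by simp
    next
      case False
      let ?u = "t - \<delta> / 2"
      have "?u - s < (real n + 1) * (\<delta> / 2)" using Suc(2) by (simp add: algebra_simps)
      then have "\<bar>G ?u - G s\<bar> \<le> H ?u - H s" using Suc.IH[of ?u] False \<delta> Suc(4) by simp
      moreover have "\<bar>G t - G ?u\<bar> \<le> H t - H ?u" using small[of ?u t] False \<delta> Suc(4) st(1) by simp
      ultimately show ?thesis by linarith
    qed
  qed
  moreover obtain n :: nat where "(t - s) / (\<delta> / 2) < real n" using reals_Archimedean2 by blast
  then have "t - s < (real n + 1) * (\<delta> / 2)" using \<delta> by (simp add: field_simps)
  ultimately show ?thesis using st by blast
qed

text \<open>The error on a short interval is \<epsilon> times an interval integral, hence additive: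
  summed over any subdivision it stays \<epsilon> times the integral of W. Letting \<epsilon> tend
  to 0 gives the identity with no prior regularity of F.\<close>

lemma integral_of_approximate_derivative:
  fixes F D W :: "real \<Rightarrow> real"
  assumes D: "integrable (lebesgue_on {0<..<T}) D" and W: "integrable (lebesgue_on {0<..<T}) W"
    and approx: "\<And>\<epsilon>. 0 < \<epsilon> \<Longrightarrow> \<exists>\<delta>>0. \<forall>s t. 0 \<le> s \<and> s \<le> t \<and> t \<le> T \<and> t - s < \<delta> \<longrightarrow>
      \<bar>F t - F s - (\<integral>r. D r \<partial>lebesgue_on {s<..<t})\<bar> \<le> \<epsilon> * (\<integral>r. W r \<partial>lebesgue_on {s<..<t})"
    and st: "0 \<le> s" "s \<le> t" "t \<le> T"
  shows "F t - F s = (\<integral>r. D r \<partial>lebesgue_on {s<..<t})"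
proof -
  define G where "G t = F t - (\<integral>r. D r \<partial>lebesgue_on {0<..<t})" for t
  define H where "H t = (\<integral>r. W r \<partial>lebesgue_on {0<..<t})" for t
  have Gd: "G t - G s = F t - F s - (\<integral>r. D r \<partial>lebesgue_on {s<..<t})" if "0 \<le> s" "s \<le> t" "t \<le> T" for s t
    using integral_interval_additive[OF D that] by (simp add: G_def)
  have Hd: "H t - H s = (\<integral>r. W r \<partial>lebesgue_on {s<..<t})" if "0 \<le> s" "s \<le> t" "t \<le> T" for s t
    using integral_interval_additive[OF W that] by (simp add: H_def)
  have le: "\<bar>G t - G s\<bar> \<le> \<epsilon> * (H t - H s)" if \<epsilon>: "0 < \<epsilon>" for \<epsilon>
  proof -
    obtain \<delta> where \<delta>: "\<delta> > 0" "\<And>s t. 0 \<le> s \<Longrightarrow> s \<le> t \<Longrightarrow> t \<le> T \<Longrightarrow> t - s < \<delta> \<Longrightarrow>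
        \<bar>F t - F s - (\<integral>r. D r \<partial>lebesgue_on {s<..<t})\<bar> \<le> \<epsilon> * (\<integral>r. W r \<partial>lebesgue_on {s<..<t})"
      using approx[OF \<epsilon>] by blast
    have "\<bar>G t - G s\<bar> \<le> \<epsilon> * H t - \<epsilon> * H s"
      by (rule small_increments_imp_le[OF \<delta>(1) _ st])
        (use \<delta>(2) in \<open>simp add: Gd Hd flip: right_diff_distrib\<close>)
    then show ?thesis by (simp add: right_diff_distrib)
  qed
  have "\<bar>G t - G s\<bar> \<le> 0 + e" if e: "0 < e" for e
  proof -
    have "0 \<le> \<bar>G t - G s\<bar>" by simp
    also have "\<dots> \<le> 1 * (H t - H s)" by (rule le) simp
    finally have h: "0 \<le> H t - H s" by simp
    have "\<bar>G t - G s\<bar> \<le> e / (H t - H s + 1) * (H t - H s)" by (rule le) (use h e in simp)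
    also have "\<dots> \<le> e" using h e by (simp add: field_simps)
    finally show ?thesis by simp
  qed
  then have "\<bar>G t - G s\<bar> \<le> 0" by (rule field_le_epsilon)
  then show ?thesis using Gd[OF st] by simp
qed

text \<open>Dynkin's argument: the Borel sets over which the integral vanishes contain the
  intersection-stable generator of open intervals and are closed under complements and disjoint
  countable unions, so they are all Borel sets.\<close>

lemma interval_integrals_eq_0_imp_AE_eq_0:
  fixes D :: "real \<Rightarrow> real"
  assumes D: "integrable (lebesgue_on {0<..<T}) D" and T: "0 < T"
    and zero: "\<And>s t. 0 \<le> s \<Longrightarrow> s \<le> t \<Longrightarrow> t \<le> T \<Longrightarrow> (\<integral>r. D r \<partial>lebesgue_on {s<..<t}) = 0"
  shows "AE r in lebesgue_on {0<..<T}. D r = 0"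
proof -
  let ?I = "{0<..<T}"
  have Im: "?I \<in> sets lebesgue" by simp
  obtain D' where D': "D' \<in> borel_measurable borel" and ae: "AE r in lebesgue_on ?I. D r = D' r"
    using lebesgue_on_borel_rep[OF Im] D by blast
  \<comment> \<open>Extension by zero turns an arbitrary interval of the line into one clipped to
    [0, T].\<close>
  define f where "f r = indicator ?I r * D' r" for r
  have ae': "AE r in lebesgue_on ?I. D' r = D r" using ae by eventually_elim simp
  have D'i: "integrable (lebesgue_on ?I) D'" by (rule lebesgue_on_cong_AE(1)[OF Im D ae'])
  have fi: "integrable lborel f"
    using D'i by (simp add: f_def[abs_def] integral_lebesgue_on_indicator(1)[OF _ D'])
  have si: "set_integrable lborel A f" if "A \<in> sets borel" for A
    unfolding set_integrable_def using integrable_mult_indicator[OF _ fi, of A] that by simp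
  have interval: "(LINT r:{s<..<t}|lborel. f r) = 0" for s t
  proof -
    define s' t' where "s' = max 0 s" and "t' = min T t"
    have eq: "indicator {s<..<t} r *\<^sub>R f r = indicator {s'<..<t'} r * D' r" for r
      by (auto simp: f_def s'_def t'_def indicator_def)
    have I: "(LINT r:{s<..<t}|lborel. f r) = (\<integral>r. D' r \<partial>lebesgue_on {s'<..<t'})"
      unfolding set_lebesgue_integral_def eq using integral_lebesgue_on_indicator(2)[OF _ D', of "{s'<..<t'}"] by simp
    show ?thesis
    proof (cases "s' \<le> t'")
      case True
      have st: "0 \<le> s'" "t' \<le> T" by (auto simp: s'_def t'_def)
      have sub: "{s'<..<t'} \<subseteq> ?I" using st by auto
      have "AE r in lebesgue_on {s'<..<t'}. D' r = D r"
        by (rule AE_lebesgue_on_subset[OF ae' _ _ sub]) auto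
      then have "(\<integral>r. D' r \<partial>lebesgue_on {s'<..<t'}) = (\<integral>r. D r \<partial>lebesgue_on {s'<..<t'})"
        by (intro lebesgue_on_cong_AE(2) integrable_lebesgue_on_subset[OF D _ _ sub]) auto
      then show ?thesis using I zero[OF st(1) True st(2)] by simp
    next
      case False
      then show ?thesis using I by (simp add: set_lebesgue_integral_def)
    qed
  qed
  have total: "(LINT r:UNIV|lborel. f r) = 0"
  proof -
    have eq: "indicator UNIV r *\<^sub>R f r = indicator {0<..<T} r *\<^sub>R f r" for r by (simp add: f_def indicator_def)
    show ?thesis using interval[of 0 T] unfolding set_lebesgue_integral_def eq .
  qed
  have all: "(LINT r:A|lborel. f r) = 0" if A: "A \<in> sets borel" for A
  proof -
    let ?G = "range (\<lambda>(a, b). box a b :: real set)"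
    have bs: "sets borel = sigma_sets UNIV ?G" by (simp add: borel_eq_box)
    then have "A \<in> sigma_sets UNIV ?G" using A by simp
    have G: "Int_stable ?G" "?G \<subseteq> Pow UNIV" by (auto simp: Int_stable_def box_Int_box)
    from G \<open>A \<in> sigma_sets UNIV ?G\<close> show ?thesis
    proof (induction rule: sigma_sets_induct_disjoint)
      case (basic A)
      then show ?case using interval by auto
    next
      case empty
      then show ?case by (simp add: set_lebesgue_integral_def)
    next
      case (compl A)
      have Am: "A \<in> sets borel" using compl(1) bs by simp
      have "(LINT r:UNIV|lborel. f r) = (LINT r:A|lborel. f r) + (LINT r:UNIV - A|lborel. f r)"
        using set_integral_Un[of A "UNIV - A" lborel f] si Am by (simp add: Un_Diff_cancel)
      then show ?case using total compl(2) by simp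
    next
      case (union A)
      have Am: "A i \<in> sets borel" for i using union(2) bs by auto
      have "(LINT r:(\<Union>i. A i)|lborel. f r) = (\<Sum>i. (LINT r:(A i)|lborel. f r))"
        using union(1) Am by (intro lebesgue_integral_countable_add si) (auto simp: disjoint_family_on_def)
      then show ?case using union(3) by simp
    qed
  qed
  have "AE r in lborel. f r = 0"
    by (rule sigma_finite_measure.density_zero[OF sigma_finite_lborel fi]) (use all in simp)
  then have "AE r in lebesgue_on ?I. D' r = 0"
    by (subst AE_lebesgue_on_iff) (auto simp: f_def elim: eventually_mono)
  with ae show ?thesis by eventually_elim simp
qed

section \<open>The interaction potential\<close>

lemma continuous_on_borel_measurable_lebesgue_on:
  fixes f :: "'a::euclidean_space \<Rightarrow> 'b::euclidean_space"
  assumes "continuous_on A f" "S \<subseteq> A" "S \<in> sets lebesgue"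
  shows "f \<in> borel_measurable (lebesgue_on S)"
  using assms continuous_imp_measurable_on_sets_lebesgue continuous_on_subset by blast

lemma kernel_times_integrable:
  fixes k :: "'a::euclidean_space \<times> 'b::euclidean_space \<Rightarrow> real"
  assumes A: "A \<in> sets borel" "B \<in> sets borel"
    and k: "k \<in> borel_measurable (lebesgue_on (A \<times> B))" "AE z in lebesgue_on (A \<times> B). \<bar>k z\<bar> \<le> C"
    and a: "integrable (lebesgue_on A) a" and b: "integrable (lebesgue_on B) b"
  shows "integrable (lebesgue_on (A \<times> B)) (\<lambda>z. k z * (a (fst z) * b (snd z)))"
  by (rule integrable_mult_bounded[OF integrable_lebesgue_on_times[OF A a b] k])

text \<open>\<open>K\<close> is controlled only almost everywhere on the product, so the integral
  defining \<open>interaction\<close> is under control for almost every x only.\<close>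

lemma interaction_bound:
  fixes K :: "'a::euclidean_space \<Rightarrow> 'a \<Rightarrow> real"
  assumes k: "(\<lambda>(x, y). K x y) \<in> borel_measurable (lebesgue_on (ball 0 R \<times> ball 0 R))"
      "AE z in lebesgue_on (ball 0 R \<times> ball 0 R). \<bar>case z of (x, y) \<Rightarrow> K x y\<bar> \<le> C"
    and r: "integrable (lebesgue_on (ball 0 R)) r"
  shows "AE x in lebesgue_on (ball 0 R). integrable (lebesgue_on (ball 0 R)) (\<lambda>y. K x y * r y)"
    and "integrable (lebesgue_on (ball 0 R)) (interaction R K r)"
    and "AE x in lebesgue_on (ball 0 R). \<bar>interaction R K r x\<bar> \<le> C * (\<integral>y. \<bar>r y\<bar> \<partial>lebesgue_on (ball 0 R))"
proof -
  let ?S = "ball (0::'a) R"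
  let ?M = "lebesgue_on ?S"
  note S = ball_sets[where 'a='a and R=R]
  have one: "integrable ?M (\<lambda>x. 1::real)" by (rule integrable_const_lebesgue_on[OF S(1)])
  note F = lebesgue_on_Times_Fubini[OF S(3) S(3) kernel_times_integrable[OF S(3) S(3) k one r]]
  show i: "AE x in ?M. integrable ?M (\<lambda>y. K x y * r y)" using F(1) by simp
  show "integrable ?M (interaction R K r)" using F(2) by (simp add: interaction_def[abs_def])
  have "AE x in ?M. AE y in ?M. \<bar>K x y\<bar> \<le> C" using AE_lebesgue_on_Times(1)[OF S(3) S(3) k(2)] by simp
  with i show "AE x in ?M. \<bar>interaction R K r x\<bar> \<le> C * (\<integral>y. \<bar>r y\<bar> \<partial>?M)"
  proof eventually_elim
    case (elim x)
    have "\<bar>interaction R K r x\<bar> \<le> (\<integral>y. \<bar>K x y * r y\<bar> \<partial>?M)"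
      unfolding interaction_def by (rule integral_abs_bound)
    also have "\<dots> \<le> (\<integral>y. C * \<bar>r y\<bar> \<partial>?M)"
    proof (rule integral_mono_AE)
      show "AE y in ?M. \<bar>K x y * r y\<bar> \<le> C * \<bar>r y\<bar>"
        using elim(2) by eventually_elim (simp add: abs_mult mult_right_mono)
    qed (use elim r in auto)
    finally show ?case using r by simp
  qed
qed

text \<open>Fubini exchanges the roles of the two densities; the symmetry of \<open>K\<close>, known
  almost everywhere on the product, is used on almost every slice.\<close>

lemma interaction_symmetric:
  fixes K :: "'a::euclidean_space \<Rightarrow> 'a \<Rightarrow> real"
  assumes k: "(\<lambda>(x, y). K x y) \<in> borel_measurable (lebesgue_on (ball 0 R \<times> ball 0 R))"
      "AE z in lebesgue_on (ball 0 R \<times> ball 0 R). \<bar>case z of (x, y) \<Rightarrow> K x y\<bar> \<le> C"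
    and sym: "AE z in lebesgue_on (ball 0 R \<times> ball 0 R). case z of (x, y) \<Rightarrow> K x y = K y x"
    and a: "integrable (lebesgue_on (ball 0 R)) a" and b: "integrable (lebesgue_on (ball 0 R)) b"
  shows "(\<integral>x. a x * interaction R K b x \<partial>lebesgue_on (ball 0 R)) =
    (\<integral>x. b x * interaction R K a x \<partial>lebesgue_on (ball 0 R))"
    and "integrable (lebesgue_on (ball 0 R)) (\<lambda>x. a x * interaction R K b x)"
proof -
  let ?S = "ball (0::'a) R"
  let ?M = "lebesgue_on ?S"
  note S = ball_sets[where 'a='a and R=R]
  note F = lebesgue_on_Times_Fubini[OF S(3) S(3) kernel_times_integrable[OF S(3) S(3) k a b]]
  have 1: "(\<lambda>x. a x * interaction R K b x) = (\<lambda>x. \<integral>y. K x y * (a x * b y) \<partial>?M)"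
    by (simp add: interaction_def mult.left_commute flip: integral_mult_right_zero)
  show "integrable ?M (\<lambda>x. a x * interaction R K b x)" unfolding 1 using F(2) by simp
  have "(\<integral>x. a x * interaction R K b x \<partial>?M) = (\<integral>y. (\<integral>x. K x y * (a x * b y) \<partial>?M) \<partial>?M)"
    unfolding 1 using F(3,6) by simp
  also have "\<dots> = (\<integral>y. b y * interaction R K a y \<partial>?M)"
  proof -
    have "AE y in ?M. (\<integral>x. K x y * (a x * b y) \<partial>?M) = b y * interaction R K a y"
      using AE_lebesgue_on_Times(2)[OF S(3) S(3) sym] F(4)
    proof eventually_elim
      case (elim y)
      have "b y * interaction R K a y = (\<integral>x. K y x * (a x * b y) \<partial>?M)"
        by (simp add: interaction_def mult_ac flip: integral_mult_right_zero)
      also have "\<dots> = (\<integral>x. K x y * (a x * b y) \<partial>?M)"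
        by (rule lebesgue_on_cong_AE(2)[OF S(2)]) (use elim in \<open>auto elim: eventually_mono\<close>)
      finally show ?case by simp
    qed
    then have "AE y in ?M. b y * interaction R K a y = (\<integral>x. K x y * (a x * b y) \<partial>?M)"
      by eventually_elim simp
    from lebesgue_on_cong_AE(2)[OF S(2) _ this] F(5) show ?thesis by simp
  qed
  finally show "(\<integral>x. a x * interaction R K b x \<partial>?M) = (\<integral>x. b x * interaction R K a x \<partial>?M)" .
qed

text \<open>The continuous extension of the gradient of \<open>K\<close> gives a representative
  defined at every point of the closed ball, so that joint continuity in time and space makes
  sense.\<close>

definition interaction_grad ::
    "real \<Rightarrow> ('a::euclidean_space \<times> 'a \<Rightarrow> 'a) \<Rightarrow> ('a \<Rightarrow> real) \<Rightarrow> 'a \<Rightarrow> 'a" where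
  "interaction_grad R gK r x = (\<integral>y. r y *\<^sub>R gK (x, y) \<partial>lebesgue_on (ball 0 R))"

lemma continuous_kernel_bounded:
  fixes gK :: "'a::euclidean_space \<times> 'a \<Rightarrow> 'a"
  assumes "continuous_on (cball 0 R \<times> cball 0 R) gK"
  obtains B where "\<And>x y. x \<in> cball 0 R \<Longrightarrow> y \<in> cball 0 R \<Longrightarrow> norm (gK (x, y)) \<le> B"
proof -
  have "bounded (gK ` (cball 0 R \<times> cball 0 R))"
    using assms by (intro compact_imp_bounded compact_continuous_image compact_Times compact_cball)
  then show ?thesis using that unfolding bounded_iff by (metis imageI mem_Sigma_iff)
qed

lemma interaction_grad_integrable:
  fixes gK :: "'a::euclidean_space \<times> 'a \<Rightarrow> 'a"
  assumes gK: "continuous_on (cball 0 R \<times> cball 0 R) gK" and x: "x \<in> cball 0 R"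
    and r: "integrable (lebesgue_on (ball 0 R)) r"
  shows "integrable (lebesgue_on (ball 0 R)) (\<lambda>y. r y *\<^sub>R gK (x, y))"
    and "(\<lambda>y. gK (x, y)) \<in> borel_measurable (lebesgue_on (ball 0 R))"
proof -
  let ?M = "lebesgue_on (ball (0::'a) R)"
  obtain B where B: "\<And>x y. x \<in> cball 0 R \<Longrightarrow> y \<in> cball 0 R \<Longrightarrow> norm (gK (x, y)) \<le> B"
    using continuous_kernel_bounded[OF gK] by metis
  have "continuous_on (cball 0 R) (\<lambda>y. gK (x, y))"
    using x by (intro continuous_on_compose2[OF gK] continuous_intros) auto
  then show m: "(\<lambda>y. gK (x, y)) \<in> borel_measurable ?M"
    by (rule continuous_on_borel_measurable_lebesgue_on) auto
  show "integrable ?M (\<lambda>y. r y *\<^sub>R gK (x, y))"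
  proof (rule Bochner_Integration.integrable_bound)
    show "integrable ?M (\<lambda>y. B * r y)" using r by simp
    show "(\<lambda>y. r y *\<^sub>R gK (x, y)) \<in> borel_measurable ?M" using m r by measurable
    show "AE y in ?M. norm (r y *\<^sub>R gK (x, y)) \<le> norm (B * r y)"
    proof (rule AE_I2)
      fix y assume "y \<in> space ?M"
      then have "norm (gK (x, y)) \<le> \<bar>B\<bar>" using B[OF x, of y] by simp
      then show "norm (r y *\<^sub>R gK (x, y)) \<le> norm (B * r y)"
        using mult_right_mono[of "norm (gK (x, y))" "\<bar>B\<bar>" "\<bar>r y\<bar>"] by (simp add: abs_mult mult.commute)
    qed
  qed
qed

text \<open>The derivative of \<open>K\<close> is weak on the product. Testing with \<phi>(x)
  \<eta>(y) and varying \<eta> yields, for almost every y, the integration by parts of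
  \<open>K\<close> in x against \<phi>. Only then is the identity multiplied by r(y), which is
  merely integrable, and integrated.\<close>

lemma interaction_weak_deriv:
  fixes K :: "'a::euclidean_space \<Rightarrow> 'a \<Rightarrow> real"
  assumes k: "(\<lambda>(x, y). K x y) \<in> borel_measurable (lebesgue_on (ball 0 R \<times> ball 0 R))"
      "AE z in lebesgue_on (ball 0 R \<times> ball 0 R). \<bar>case z of (x, y) \<Rightarrow> K x y\<bar> \<le> C"
    and gK: "continuous_on (cball 0 R \<times> cball 0 R) gK"
    and e: "e \<in> Basis"
    and weak: "weak_deriv (ball 0 R \<times> ball 0 R) (e, 0) (\<lambda>(x, y). K x y) (\<lambda>z. gK z \<bullet> e)"
    and r: "integrable (lebesgue_on (ball 0 R)) r"
  shows "weak_deriv (ball 0 R) e (interaction R K r) (\<lambda>x. interaction_grad R gK r x \<bullet> e)"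
proof -
  let ?S = "ball (0::'a) R"
  let ?M = "lebesgue_on ?S"
  note S = ball_sets[where 'a='a and R=R]
  have SS: "?S \<times> ?S \<in> sets lebesgue" by (rule borel_Times_lebesgue[OF S(3) S(3)])
  have one: "integrable ?M (\<lambda>x. 1::real)" by (rule integrable_const_lebesgue_on[OF S(1)])
  obtain B where B: "\<And>x y. x \<in> cball 0 R \<Longrightarrow> y \<in> cball 0 R \<Longrightarrow> norm (gK (x, y)) \<le> B"
    using continuous_kernel_bounded[OF gK] by metis
  define g where "g z = gK z \<bullet> e" for z
  have gm: "g \<in> borel_measurable (lebesgue_on (?S \<times> ?S))"
    unfolding g_def by (rule continuous_on_borel_measurable_lebesgue_on[OF continuous_on_inner[OF gK continuous_on_const] _ SS]) auto
  have gb: "AE z in lebesgue_on (?S \<times> ?S). \<bar>g z\<bar> \<le> B"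
  proof (rule AE_I2)
    fix z assume "z \<in> space (lebesgue_on (?S \<times> ?S))"
    then have "norm (gK z) \<le> B" using B[of "fst z" "snd z"] by (cases z) auto
    then show "\<bar>g z\<bar> \<le> B" unfolding g_def using Basis_le_norm[OF e, of "gK z"] by linarith
  qed
  have gI: "interaction_grad R gK r x \<bullet> e = (\<integral>y. g (x, y) * r y \<partial>?M)" if "x \<in> ?S" for x
  proof -
    have "integrable ?M (\<lambda>y. r y *\<^sub>R gK (x, y))" by (rule interaction_grad_integrable(1)[OF gK _ r]) (use that in auto)
    from integral_inner_left[OF this, of e] show ?thesis
      by (simp add: interaction_grad_def g_def mult.commute)
  qed
  note FK = lebesgue_on_Times_Fubini[OF S(3) S(3) kernel_times_integrable[OF S(3) S(3) k _ _]]
  note Fg = lebesgue_on_Times_Fubini[OF S(3) S(3) kernel_times_integrable[OF S(3) S(3) gm gb _ _]]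
  show ?thesis
    unfolding weak_deriv_def
  proof (intro conjI allI impI)
    show "loc_integrable ?S (interaction R K r)"
      by (rule integrable_imp_loc_integrable[OF S(2) interaction_bound(2)[OF k r]])
    have gi: "integrable ?M (\<lambda>x. \<integral>y. g (x, y) * r y \<partial>?M)" using Fg(2)[OF one r] by simp
    have "AE x in ?M. interaction_grad R gK r x \<bullet> e = (\<integral>y. g (x, y) * r y \<partial>?M)"
      by (rule AE_I2) (simp add: gI)
    from integrable_imp_loc_integrable[OF S(2) lebesgue_on_cong_AE(1)[OF S(2) gi this]]
    show "loc_integrable ?S (\<lambda>x. interaction_grad R gK r x \<bullet> e)" .
    fix \<phi> assume \<phi>: "test_fun ?S \<phi>"
    have d\<phi>: "test_fun ?S (dir_deriv e \<phi>)" by (rule test_fun_dir_deriv[OF \<phi> e])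
    have ti: "integrable ?M \<psi>" if "test_fun ?S \<psi>" for \<psi>
      using loc_integrable_mult_test[OF S(2) integrable_imp_loc_integrable[OF S(2) one] that] by simp
    note \<phi>i = ti[OF \<phi>] and d\<phi>i = ti[OF d\<phi>]
    define h1 where "h1 y = (\<integral>x. K x y * dir_deriv e \<phi> x \<partial>?M)" for y
    define h2 where "h2 y = (\<integral>x. g (x, y) * \<phi> x \<partial>?M)" for y
    have h1i: "integrable ?M h1" using FK(5)[OF d\<phi>i one] by (simp add: h1_def[abs_def])
    have h2i: "integrable ?M h2" using Fg(5)[OF \<phi>i one] by (simp add: h2_def[abs_def])
    have "AE y in ?M. h1 y + h2 y = 0"
    proof (rule fundamental_lemma[OF S(4)])
      show "loc_integrable ?S (\<lambda>y. h1 y + h2 y)"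
        using h1i h2i by (intro integrable_imp_loc_integrable[OF S(2)]) simp
      fix \<eta> assume \<eta>: "test_fun ?S \<eta>"
      let ?\<Phi> = "\<lambda>z. \<phi> (fst z) * \<eta> (snd z)"
      have T: "test_fun (?S \<times> ?S) ?\<Phi>" by (rule test_fun_tensor[OF \<phi> \<eta>])
      have sm: "smooth \<phi>" "smooth \<eta>" using \<phi> \<eta> by (auto simp: test_fun_def)
      have D: "dir_deriv (e, 0) ?\<Phi> = (\<lambda>z. dir_deriv e \<phi> (fst z) * \<eta> (snd z))"
        using smooth_tensor(2)[OF sm e] by auto
      have "(\<integral>z. (case z of (x, y) \<Rightarrow> K x y) * dir_deriv (e, 0) ?\<Phi> z \<partial>lebesgue_on (?S \<times> ?S)) =
          - (\<integral>z. g z * ?\<Phi> z \<partial>lebesgue_on (?S \<times> ?S))"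
        using weak T unfolding weak_deriv_def g_def by blast
      moreover have "(\<integral>z. (case z of (x, y) \<Rightarrow> K x y) * dir_deriv (e, 0) ?\<Phi> z \<partial>lebesgue_on (?S \<times> ?S)) = (\<integral>y. h1 y * \<eta> y \<partial>?M)"
        unfolding D FK(6)[OF d\<phi>i ti[OF \<eta>], symmetric]
        by (simp add: h1_def mult_ac flip: integral_mult_right_zero)
      moreover have "(\<integral>z. g z * ?\<Phi> z \<partial>lebesgue_on (?S \<times> ?S)) = (\<integral>y. h2 y * \<eta> y \<partial>?M)"
        unfolding Fg(6)[OF \<phi>i ti[OF \<eta>], symmetric]
        by (simp add: h2_def mult_ac flip: integral_mult_right_zero)
      moreover have "integrable ?M (\<lambda>y. h1 y * \<eta> y)" "integrable ?M (\<lambda>y. h2 y * \<eta> y)"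
        using loc_integrable_mult_test[OF S(2) integrable_imp_loc_integrable[OF S(2)] \<eta>] h1i h2i by auto
      ultimately show "(\<integral>y. (h1 y + h2 y) * \<eta> y \<partial>?M) = 0" by (simp add: distrib_right)
    qed
    then have ae: "AE y in ?M. r y * h1 y = - (r y * h2 y)"
      by eventually_elim (simp add: eq_neg_iff_add_eq_0 flip: distrib_left)
    have "(\<integral>x. interaction R K r x * dir_deriv e \<phi> x \<partial>?M) =
        (\<integral>x. (\<integral>y. K x y * (dir_deriv e \<phi> x * r y) \<partial>?M) \<partial>?M)"
      by (simp add: interaction_def mult_ac flip: integral_mult_right_zero)
    also have "\<dots> = (\<integral>y. (\<integral>x. K x y * (dir_deriv e \<phi> x * r y) \<partial>?M) \<partial>?M)"
      using FK(3,6)[OF d\<phi>i r] by simp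
    also have "\<dots> = (\<integral>y. r y * h1 y \<partial>?M)"
      by (simp add: h1_def mult_ac flip: integral_mult_right_zero)
    also have "\<dots> = (\<integral>y. - (r y * h2 y) \<partial>?M)"
    proof (rule lebesgue_on_cong_AE(2)[OF S(2) _ ae])
      show "integrable ?M (\<lambda>y. - (r y * h2 y))"
        using Fg(5)[OF \<phi>i r] by (simp add: h2_def mult_ac flip: integral_mult_right_zero)
    qed
    also have "\<dots> = - (\<integral>y. (\<integral>x. g (x, y) * (\<phi> x * r y) \<partial>?M) \<partial>?M)"
      by (simp add: h2_def mult_ac flip: integral_mult_right_zero)
    also have "\<dots> = - (\<integral>x. (\<integral>y. g (x, y) * (\<phi> x * r y) \<partial>?M) \<partial>?M)"
      using Fg(3,6)[OF \<phi>i r] by simp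
    also have "(\<integral>x. (\<integral>y. g (x, y) * (\<phi> x * r y) \<partial>?M) \<partial>?M) = (\<integral>x. interaction_grad R gK r x \<bullet> e * \<phi> x \<partial>?M)"
      by (intro Bochner_Integration.integral_cong refl)
        (simp add: gI mult_ac flip: integral_mult_right_zero)
    finally show "(\<integral>x. interaction R K r x * dir_deriv e \<phi> x \<partial>?M) =
        - (\<integral>x. interaction_grad R gK r x \<bullet> e * \<phi> x \<partial>?M)" .
  qed
qed

text \<open>For a frozen density, continuity in x is dominated convergence. The change of the
  density costs at most the bound on \<open>gK\<close> times the L^1 distance of the slices,
  uniformly in x.\<close>

lemma interaction_grad_continuous:
  fixes gK :: "'a::euclidean_space \<times> 'a \<Rightarrow> 'a" and \<rho> :: "real \<Rightarrow> 'a \<Rightarrow> real"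
  assumes gK: "continuous_on (cball 0 R \<times> cball 0 R) gK" and w: "C_L1 T (ball 0 R) \<rho>"
  shows "continuous_on ({0..T} \<times> cball 0 R) (\<lambda>(t, x). interaction_grad R gK (\<rho> t) x)"
  unfolding continuous_on_sequentially o_def
proof (intro allI ballI impI, elim conjE)
  let ?M = "lebesgue_on (ball (0::'a) R)"
  fix Z :: "nat \<Rightarrow> real \<times> 'a" and z assume z: "z \<in> {0..T} \<times> cball 0 R" and Z: "\<forall>n. Z n \<in> {0..T} \<times> cball 0 R" "Z \<longlonglongrightarrow> z"
  obtain t x where tx: "z = (t, x)" "t \<in> {0..T}" "x \<in> cball 0 R" using z by auto
  define s y where "s n = fst (Z n)" and "y n = snd (Z n)" for n
  have sy: "Z n = (s n, y n)" "s n \<in> {0..T}" "y n \<in> cball 0 R" for n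
    using Z(1) by (auto simp: s_def y_def mem_Times_iff)
  have st: "s \<longlonglongrightarrow> t" "y \<longlonglongrightarrow> x"
    using tendsto_fst[OF Z(2)] tendsto_snd[OF Z(2)] by (auto simp: s_def[abs_def] y_def[abs_def] tx)
  obtain B where B: "\<And>x y. x \<in> cball 0 R \<Longrightarrow> y \<in> cball 0 R \<Longrightarrow> norm (gK (x, y)) \<le> B"
    using continuous_kernel_bounded[OF gK] by metis
  note ri = C_L1D(1)[OF w]
  note gi = interaction_grad_integrable[OF gK]
  have lim1: "(\<lambda>n. interaction_grad R gK (\<rho> t) (y n)) \<longlonglongrightarrow> interaction_grad R gK (\<rho> t) x"
    unfolding interaction_grad_def
  proof (rule integral_dominated_convergence[where w = "\<lambda>y. B * \<bar>\<rho> t y\<bar>"])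
    show "integrable ?M (\<lambda>y. B * \<bar>\<rho> t y\<bar>)" using ri[OF tx(2)] by simp
    show "AE q in ?M. (\<lambda>n. \<rho> t q *\<^sub>R gK (y n, q)) \<longlonglongrightarrow> \<rho> t q *\<^sub>R gK (x, q)"
    proof (rule AE_I2)
      fix q assume "q \<in> space ?M"
      then have q: "q \<in> cball 0 R" by simp
      have "(\<lambda>n. gK (y n, q)) \<longlonglongrightarrow> gK (x, q)"
        by (rule continuous_on_tendsto_compose[OF gK tendsto_Pair[OF st(2) tendsto_const]])
          (use q tx(3) sy(3) in \<open>auto intro!: always_eventually\<close>)
      then show "(\<lambda>n. \<rho> t q *\<^sub>R gK (y n, q)) \<longlonglongrightarrow> \<rho> t q *\<^sub>R gK (x, q)" by (intro tendsto_scaleR tendsto_const)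
    qed
    show "AE q in ?M. norm (\<rho> t q *\<^sub>R gK (y n, q)) \<le> B * \<bar>\<rho> t q\<bar>" for n
    proof (rule AE_I2)
      fix q assume "q \<in> space ?M"
      then have "norm (gK (y n, q)) \<le> B" using B[OF sy(3)] by simp
      then show "norm (\<rho> t q *\<^sub>R gK (y n, q)) \<le> B * \<bar>\<rho> t q\<bar>"
        using mult_right_mono[of "norm (gK (y n, q))" B "\<bar>\<rho> t q\<bar>"] by (simp add: mult.commute)
    qed
  qed (use gi(1)[OF tx(3) ri[OF tx(2)]] gi(1)[OF sy(3) ri[OF tx(2)]] in auto)
  have lim2: "(\<lambda>n. interaction_grad R gK (\<rho> (s n)) (y n) - interaction_grad R gK (\<rho> t) (y n)) \<longlonglongrightarrow> 0"
  proof (rule LIMSEQ_I)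
    fix r :: real assume r: "0 < r"
    define B' where "B' = \<bar>B\<bar> + 1"
    have B': "0 < B'" "B \<le> B'" by (auto simp: B'_def)
    obtain \<delta> where \<delta>: "0 < \<delta>" "\<And>s t. s \<in> {0..T} \<Longrightarrow> t \<in> {0..T} \<Longrightarrow> \<bar>s - t\<bar> < \<delta> \<Longrightarrow> (\<integral>x. \<bar>\<rho> s x - \<rho> t x\<bar> \<partial>?M) < r / B'"
      using C_L1_uniform[OF w, of "r / B'"] r B' by auto
    obtain N where N: "\<And>n. n \<ge> N \<Longrightarrow> \<bar>s n - t\<bar> < \<delta>"
      using LIMSEQ_D[OF st(1) \<delta>(1)] by auto
    show "\<exists>N. \<forall>n\<ge>N. norm (interaction_grad R gK (\<rho> (s n)) (y n) - interaction_grad R gK (\<rho> t) (y n) - 0) < r"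
    proof (intro exI allI impI)
      fix n assume n: "n \<ge> N"
      have d: "integrable ?M (\<lambda>q. \<rho> (s n) q - \<rho> t q)" using ri[OF sy(2)] ri[OF tx(2)] by simp
      have "interaction_grad R gK (\<rho> (s n)) (y n) - interaction_grad R gK (\<rho> t) (y n) =
          (\<integral>q. (\<rho> (s n) q - \<rho> t q) *\<^sub>R gK (y n, q) \<partial>?M)"
        using gi(1)[OF sy(3) ri[OF sy(2)]] gi(1)[OF sy(3) ri[OF tx(2)]]
        by (simp add: interaction_grad_def scaleR_left_diff_distrib)
      also have "norm \<dots> \<le> (\<integral>q. norm ((\<rho> (s n) q - \<rho> t q) *\<^sub>R gK (y n, q)) \<partial>?M)"
        by (rule integral_norm_bound)
      also have "\<dots> \<le> (\<integral>q. B' * \<bar>\<rho> (s n) q - \<rho> t q\<bar> \<partial>?M)"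
      proof (rule integral_mono)
        show "integrable ?M (\<lambda>q. norm ((\<rho> (s n) q - \<rho> t q) *\<^sub>R gK (y n, q)))"
          by (rule integrable_norm[OF gi(1)[OF sy(3) d]])
        show "integrable ?M (\<lambda>q. B' * \<bar>\<rho> (s n) q - \<rho> t q\<bar>)" using d by simp
        fix q assume "q \<in> space ?M"
        then have "norm (gK (y n, q)) \<le> B'" using B[OF sy(3)[of n], of q] B'(2) by simp
        then show "norm ((\<rho> (s n) q - \<rho> t q) *\<^sub>R gK (y n, q)) \<le> B' * \<bar>\<rho> (s n) q - \<rho> t q\<bar>"
          using mult_right_mono[of "norm (gK (y n, q))" B' "\<bar>\<rho> (s n) q - \<rho> t q\<bar>"] by (simp add: mult.commute)
      qed
      also have "\<dots> = B' * (\<integral>q. \<bar>\<rho> (s n) q - \<rho> t q\<bar> \<partial>?M)" by simp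
      also have "\<dots> < B' * (r / B')" using \<delta>(2)[OF sy(2) tx(2) N[OF n]] B' by (intro mult_strict_left_mono) auto
      also have "\<dots> = r" using B' by simp
      finally show "norm (interaction_grad R gK (\<rho> (s n)) (y n) - interaction_grad R gK (\<rho> t) (y n) - 0) < r" by simp
    qed
  qed
  show "(\<lambda>n. case Z n of (t, x) \<Rightarrow> interaction_grad R gK (\<rho> t) x) \<longlonglongrightarrow> (case z of (t, x) \<Rightarrow> interaction_grad R gK (\<rho> t) x)"
    using tendsto_add[OF lim2 lim1] by (simp add: sy(1) tx(1))
qed

section \<open>The weak equation\<close>

lemma weak_grad_AE:
  assumes S: "open S" and g: "has_weak_grad S f g"
  shows "AE x in lebesgue_on S. weak_grad S f x = g x"
proof -
  have w: "has_weak_grad S f (weak_grad S f)" unfolding weak_grad_def by (rule someI[of "has_weak_grad S f", OF g])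
  have "AE x in lebesgue_on S. weak_grad S f x \<bullet> e = g x \<bullet> e" if "e \<in> Basis" for e
    by (rule weak_deriv_unique[OF S that]) (use w g that in \<open>auto simp: has_weak_grad_def\<close>)
  then have "AE x in lebesgue_on S. \<forall>e\<in>Basis. weak_grad S f x \<bullet> e = g x \<bullet> e"
    by (simp add: AE_finite_all)
  then show ?thesis by eventually_elim (auto intro: euclidean_eqI)
qed

lemma L_two_slice:
  fixes A :: "'a::euclidean_space set" and B :: "'b::euclidean_space set"
  assumes A: "A \<in> sets borel" "bounded A" and B: "B \<in> sets borel" "bounded B" and f: "L_two (A \<times> B) f"
  shows "AE x in lebesgue_on A. L_two B (\<lambda>y. f (x, y))"
proof -
  have l: "A \<times> B \<in> lmeasurable" by (rule lmeasurable_Times_bounded[OF A(1) B(1) A(2) B(2)])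
  have "AE x in lebesgue_on A. integrable (lebesgue_on B) (\<lambda>y. f (x, y))"
    by (rule lebesgue_on_Times_Fubini(1)[OF A(1) B(1) L_two_integrable[OF l f]])
  moreover have "AE x in lebesgue_on A. integrable (lebesgue_on B) (\<lambda>y. (f (x, y))\<^sup>2)"
    by (rule lebesgue_on_Times_Fubini(1)[OF A(1) B(1) L_twoD(2)[OF f]])
  ultimately show ?thesis by eventually_elim (auto simp: L_two_def)
qed

lemma continuous_eq_0_dense:
  fixes h :: "'a::topological_space \<Rightarrow> real"
  assumes h: "continuous_on UNIV h" and D: "\<And>X. open X \<Longrightarrow> X \<noteq> {} \<Longrightarrow> \<exists>d\<in>D. d \<in> X" and z: "\<And>d. d \<in> D \<Longrightarrow> h d = 0"
  shows "h x = 0"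
proof (rule ccontr)
  assume "h x \<noteq> 0"
  moreover have "open {x. h x \<noteq> 0}" using h by (intro open_Collect_neq) auto
  ultimately show False using D[of "{x. h x \<noteq> 0}"] z by blast
qed

text \<open>Everything extracted from the hypotheses up to a final time T, with representatives
  fixed once: \<open>\<sigma>\<close> is the time derivative of \<rho>, and \<open>G e\<close> the
  partial derivative of \<rho>^m along e. The equation is kept for products \<theta>(t) \<zeta>(x)
  only. As \<theta> is supported inside (0, T), no initial term occurs; \<zeta> is free on the
  sphere, and this is the form in which the no-flux condition enters.\<close>

locale aggregation_diffusion =
  fixes m R T C CV CK :: real
    and V :: "'a::euclidean_space \<Rightarrow> real" and K :: "'a \<Rightarrow> 'a \<Rightarrow> real" and \<rho> :: "real \<Rightarrow> 'a \<Rightarrow> real"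
    and gV :: "'a \<Rightarrow> 'a" and gK :: "'a \<times> 'a \<Rightarrow> 'a" and \<sigma> :: "real \<times> 'a \<Rightarrow> real" and G :: "'a \<Rightarrow> real \<times> 'a \<Rightarrow> real"
  assumes m: "0 < m" "m < 1" and R: "0 < R" and T: "0 < T"
    and V: "V \<in> borel_measurable (lebesgue_on (ball 0 R))" "AE x in lebesgue_on (ball 0 R). \<bar>V x\<bar> \<le> CV"
    and K: "(\<lambda>(x, y). K x y) \<in> borel_measurable (lebesgue_on (ball 0 R \<times> ball 0 R))"
      "AE z in lebesgue_on (ball 0 R \<times> ball 0 R). \<bar>case z of (x, y) \<Rightarrow> K x y\<bar> \<le> CK"
      "AE z in lebesgue_on (ball 0 R \<times> ball 0 R). case z of (x, y) \<Rightarrow> K x y = K y x"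
    and gV: "continuous_on (cball 0 R) gV" "\<And>e. e \<in> Basis \<Longrightarrow> weak_deriv (ball 0 R) e V (\<lambda>x. gV x \<bullet> e)"
    and gK: "continuous_on (cball 0 R \<times> cball 0 R) gK"
      "\<And>e. e \<in> Basis \<Longrightarrow> weak_deriv (ball 0 R \<times> ball 0 R) (e, 0) (\<lambda>(x, y). K x y) (\<lambda>z. gK z \<bullet> e)"
    and nonneg: "\<And>t. 0 \<le> t \<Longrightarrow> AE x in lebesgue_on (ball 0 R). 0 \<le> \<rho> t x"
    and CL1: "C_L1 T (ball 0 R) \<rho>"
    and \<rho>Q: "(\<lambda>(t, x). \<rho> t x) \<in> borel_measurable (lebesgue_on ({0<..<T} \<times> ball 0 R))"
      "AE z in lebesgue_on ({0<..<T} \<times> ball 0 R). \<bar>case z of (t, x) \<Rightarrow> \<rho> t x\<bar> \<le> C"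
    and \<sigma>: "weak_deriv ({0<..<T} \<times> ball 0 R) (1, 0) (\<lambda>(t, x). \<rho> t x) \<sigma>" "L_two ({0<..<T} \<times> ball 0 R) \<sigma>"
    and G: "\<And>e. e \<in> Basis \<Longrightarrow> AE t in lebesgue_on {0<..<T}. weak_deriv (ball 0 R) e (\<lambda>x. \<rho> t x powr m) (\<lambda>x. G e (t, x))"
      "\<And>e. e \<in> Basis \<Longrightarrow> L_two ({0<..<T} \<times> ball 0 R) (G e)"
    and equation: "\<And>\<theta> \<zeta>. test_fun {0<..<T} \<theta> \<Longrightarrow> smooth \<zeta> \<Longrightarrow>
      (\<integral>t. (\<integral>x. \<rho> t x * (dir_deriv 1 \<theta> t * \<zeta> x) \<partial>lebesgue_on (ball 0 R)) \<partial>lebesgue_on {0<..<T}) =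
      (\<integral>t. (\<integral>x. weak_grad (ball 0 R) (\<lambda>x. \<rho> t x powr m) x \<bullet> (\<Sum>e\<in>Basis. (\<theta> t * dir_deriv e \<zeta> x) *\<^sub>R e)
        \<partial>lebesgue_on (ball 0 R)) \<partial>lebesgue_on {0<..<T})
      + (\<integral>t. (\<integral>x. \<rho> t x * ((weak_grad (ball 0 R) V x + weak_grad (ball 0 R) (interaction R K (\<rho> t)) x)
          \<bullet> (\<Sum>e\<in>Basis. (\<theta> t * dir_deriv e \<zeta> x) *\<^sub>R e)) \<partial>lebesgue_on (ball 0 R)) \<partial>lebesgue_on {0<..<T})"
begin

abbreviation \<Omega> where "\<Omega> \<equiv> ball (0::'a) R"
abbreviation I where "I \<equiv> {0<..<T}"
abbreviation M where "M \<equiv> lebesgue_on (ball (0::'a) R)"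

definition \<psi> where "\<psi> t x = V x + interaction R K (\<rho> t) x"

definition g\<psi> where "g\<psi> t x = gV x + interaction_grad R gK (\<rho> t) x"

text \<open>One component of the flux; where \<rho> > 0 it is \<rho> times the corresponding
  derivative of the potential.\<close>

definition J where "J e t x = G e (t, x) + \<rho> t x * (g\<psi> t x \<bullet> e)"

section \<open>Bounds, measurability and time slices\<close>

lemma \<Omega>: "\<Omega> \<in> lmeasurable" "\<Omega> \<in> sets lebesgue" "\<Omega> \<in> sets borel" "open \<Omega>" "bounded \<Omega>"
  by auto

lemma I: "I \<in> sets borel" "bounded I" "I \<in> sets lebesgue"
  by auto

lemma Q: "I \<times> \<Omega> \<in> sets lebesgue" "I \<times> \<Omega> \<in> lmeasurable"
  using borel_Times_lebesgue[OF I(1) \<Omega>(3)] lmeasurable_Times_bounded[OF I(1) \<Omega>(3) I(2) \<Omega>(5)] by auto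

lemma \<rho>_integrable: "t \<in> {0..T} \<Longrightarrow> integrable M (\<rho> t)"
  by (rule C_L1D(1)[OF CL1])

lemma \<rho>_abs_le:
  assumes "t \<in> {0..T}" shows "AE x in M. \<bar>\<rho> t x\<bar> \<le> C"
proof (rule C_L1_bounded[OF CL1 T _ assms])
  show "AE r in lebesgue_on I. AE x in M. \<bar>\<rho> r x\<bar> \<le> C"
    using AE_lebesgue_on_Times(1)[OF I(1) \<Omega>(3) \<rho>Q(2)] by simp
qed

lemma \<rho>_bounds: "t \<in> {0..T} \<Longrightarrow> AE x in M. 0 \<le> \<rho> t x \<and> \<rho> t x \<le> C"
proof -
  assume t: "t \<in> {0..T}"
  then have "AE x in M. 0 \<le> \<rho> t x" using nonneg by simp
  with \<rho>_abs_le[OF t] show ?thesis by eventually_elim simp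
qed

lemma \<rho>_L_two: "t \<in> {0..T} \<Longrightarrow> L_two \<Omega> (\<rho> t)"
  by (rule L_two_bounded[OF \<Omega>(1) borel_measurable_integrable[OF \<rho>_integrable] \<rho>_abs_le])

lemma g\<psi>_continuous: "continuous_on ({0..T} \<times> cball 0 R) (\<lambda>(t, x). g\<psi> t x)"
proof -
  have "continuous_on ({0..T} \<times> cball 0 R) (\<lambda>z. gV (snd z))"
    by (rule continuous_on_compose2[OF gV(1) continuous_on_snd[OF continuous_on_id]]) auto
  from continuous_on_add[OF this interaction_grad_continuous[OF gK(1) CL1]] show ?thesis
    by (simp add: g\<psi>_def case_prod_unfold)
qed

lemma g\<psi>_bounded: "\<exists>B. \<forall>t\<in>{0..T}. \<forall>x\<in>cball 0 R. norm (g\<psi> t x) \<le> B"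
proof -
  have "bounded ((\<lambda>(t, x). g\<psi> t x) ` ({0..T} \<times> cball 0 R))"
    by (intro compact_imp_bounded compact_continuous_image[OF g\<psi>_continuous] compact_Times) auto
  then show ?thesis unfolding bounded_iff by fastforce
qed

lemma g\<psi>Q: "(\<lambda>z. g\<psi> (fst z) (snd z) \<bullet> e) \<in> borel_measurable (lebesgue_on (I \<times> \<Omega>))"
proof -
  have "continuous_on ({0..T} \<times> cball 0 R) (\<lambda>z. g\<psi> (fst z) (snd z) \<bullet> e)"
    using continuous_on_inner[OF g\<psi>_continuous continuous_on_const, of e] by (simp add: case_prod_unfold)
  then show ?thesis by (rule continuous_on_borel_measurable_lebesgue_on[OF _ _ Q(1)]) auto
qed

lemma interaction_le:
  assumes "t \<in> {0..T}" "s \<in> {0..T}"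
  shows "AE x in M. \<bar>interaction R K (\<rho> t) x - interaction R K (\<rho> s) x\<bar> \<le> CK * (\<integral>y. \<bar>\<rho> t y - \<rho> s y\<bar> \<partial>M)"
proof -
  have d: "integrable M (\<lambda>y. \<rho> t y - \<rho> s y)" using assms \<rho>_integrable by auto
  show ?thesis
    using interaction_bound(3)[OF K(1,2) d] interaction_bound(1)[OF K(1,2) \<rho>_integrable[OF assms(1)]]
      interaction_bound(1)[OF K(1,2) \<rho>_integrable[OF assms(2)]]
    by eventually_elim (simp add: interaction_def right_diff_distrib)
qed

lemma interaction_measurable: "t \<in> {0..T} \<Longrightarrow> interaction R K (\<rho> t) \<in> borel_measurable M"
  by (rule borel_measurable_integrable[OF interaction_bound(2)[OF K(1,2) \<rho>_integrable]])

lemma \<psi>_bounded: "\<exists>B. \<forall>t\<in>{0..T}. AE x in M. \<bar>\<psi> t x\<bar> \<le> B"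
proof (intro exI ballI)
  fix t assume t: "t \<in> {0..T}"
  have "(\<integral>y. \<bar>\<rho> t y\<bar> \<partial>M) \<le> (\<integral>y. C \<partial>M)"
    by (rule integral_mono_AE[OF _ integrable_const_lebesgue_on[OF \<Omega>(1)] \<rho>_abs_le[OF t]]) (use \<rho>_integrable[OF t] in simp)
  then have "\<bar>CK\<bar> * (\<integral>y. \<bar>\<rho> t y\<bar> \<partial>M) \<le> \<bar>CK\<bar> * (\<integral>y. C \<partial>M)" by (intro mult_left_mono) auto
  moreover have "CK * (\<integral>y. \<bar>\<rho> t y\<bar> \<partial>M) \<le> \<bar>CK\<bar> * (\<integral>y. \<bar>\<rho> t y\<bar> \<partial>M)" by (intro mult_right_mono) auto
  ultimately have le: "CK * (\<integral>y. \<bar>\<rho> t y\<bar> \<partial>M) \<le> \<bar>CK\<bar> * (\<integral>y. C \<partial>M)" by linarith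
  show "AE x in M. \<bar>\<psi> t x\<bar> \<le> CV + \<bar>CK\<bar> * (\<integral>y. C \<partial>M)"
    using V(2) interaction_bound(3)[OF K(1,2) \<rho>_integrable[OF t]]
  proof eventually_elim
    case (elim x)
    then show ?case using le abs_triangle_ineq[of "V x" "interaction R K (\<rho> t) x"] unfolding \<psi>_def by linarith
  qed
qed

lemma \<psi>_measurable: "t \<in> {0..T} \<Longrightarrow> \<psi> t \<in> borel_measurable M"
  unfolding \<psi>_def using V(1) interaction_measurable by measurable

lemma g\<psi>_slice: "t \<in> {0..T} \<Longrightarrow> (\<lambda>x. g\<psi> t x \<bullet> e) \<in> borel_measurable M"
proof -
  assume t: "t \<in> {0..T}"
  have "continuous_on (cball 0 R) (\<lambda>x. (\<lambda>(t, x). g\<psi> t x) (t, x))"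
    by (rule continuous_on_compose2[OF g\<psi>_continuous]) (use t in \<open>auto intro!: continuous_intros\<close>)
  then have "continuous_on (cball 0 R) (\<lambda>x. g\<psi> t x \<bullet> e)" by (intro continuous_intros) simp
  then show ?thesis by (rule continuous_on_borel_measurable_lebesgue_on) auto
qed

lemma interaction_has_weak_grad:
  "t \<in> {0..T} \<Longrightarrow> has_weak_grad \<Omega> (interaction R K (\<rho> t)) (interaction_grad R gK (\<rho> t))"
  unfolding has_weak_grad_def using interaction_weak_deriv[OF K(1,2) gK(1) _ gK(2) \<rho>_integrable] by blast

lemma \<psi>_H1:
  assumes t: "t \<in> {0..T}" and e: "e \<in> Basis"
  shows "H1_deriv R e (\<psi> t) (\<lambda>x. g\<psi> t x \<bullet> e)"
  unfolding H1_deriv_def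
proof (intro conjI)
  show "weak_deriv \<Omega> e (\<psi> t) (\<lambda>x. g\<psi> t x \<bullet> e)"
    using weak_deriv_add[OF \<Omega>(2) e gV(2)[OF e], of "interaction R K (\<rho> t)" "\<lambda>x. interaction_grad R gK (\<rho> t) x \<bullet> e"]
      interaction_has_weak_grad[OF t] e
    by (simp add: \<psi>_def[abs_def] g\<psi>_def inner_add_left has_weak_grad_def)
  obtain B where "\<forall>t\<in>{0..T}. AE x in M. \<bar>\<psi> t x\<bar> \<le> B" using \<psi>_bounded by blast
  then show "L_two \<Omega> (\<psi> t)" using t by (intro L_two_bounded[OF \<Omega>(1) \<psi>_measurable[OF t], of B]) auto
  obtain B where B: "\<forall>t\<in>{0..T}. \<forall>x\<in>cball 0 R. norm (g\<psi> t x) \<le> B" using g\<psi>_bounded by blast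
  show "L_two \<Omega> (\<lambda>x. g\<psi> t x \<bullet> e)"
  proof (rule L_two_bounded[OF \<Omega>(1) g\<psi>_slice[OF t], of _ B], rule AE_I2)
    fix x assume "x \<in> space M"
    then have "norm (g\<psi> t x) \<le> B" using B t by simp
    then show "\<bar>g\<psi> t x \<bullet> e\<bar> \<le> B" using Basis_le_norm[OF e, of "g\<psi> t x"] by linarith
  qed
qed

lemma \<rho>g\<psi>_L_two:
  assumes e: "e \<in> Basis" shows "L_two (I \<times> \<Omega>) (\<lambda>z. \<rho> (fst z) (snd z) * (g\<psi> (fst z) (snd z) \<bullet> e))"
proof -
  obtain B where B: "\<forall>t\<in>{0..T}. \<forall>x\<in>cball 0 R. norm (g\<psi> t x) \<le> B" using g\<psi>_bounded by blast
  have gL: "L_two (I \<times> \<Omega>) (\<lambda>z. g\<psi> (fst z) (snd z) \<bullet> e)"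
  proof (rule L_two_bounded[OF Q(2) g\<psi>Q, of _ B], rule AE_I2)
    fix z assume "z \<in> space (lebesgue_on (I \<times> \<Omega>))"
    then have "norm (g\<psi> (fst z) (snd z)) \<le> B" using B by auto
    then show "\<bar>g\<psi> (fst z) (snd z) \<bullet> e\<bar> \<le> B" using Basis_le_norm[OF e, of "g\<psi> (fst z) (snd z)"] by linarith
  qed
  show ?thesis
    by (rule L_two_mult_bounded[OF gL, where C = C]) (use \<rho>Q in \<open>simp_all add: case_prod_unfold\<close>)
qed

lemma J_L_two: "e \<in> Basis \<Longrightarrow> L_two (I \<times> \<Omega>) (\<lambda>z. J e (fst z) (snd z))"
  unfolding J_def using L_two_add[OF G(2) \<rho>g\<psi>_L_two] by simp

lemma J_slice: "AE t in lebesgue_on I. \<forall>e\<in>Basis. L_two \<Omega> (J e t)"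
proof -
  have "AE t in lebesgue_on I. L_two \<Omega> (J e t)" if "e \<in> Basis" for e
    using L_two_slice[OF I(1,2) \<Omega>(3,5) J_L_two[OF that]] by simp
  then show ?thesis by (simp add: AE_finite_all)
qed

lemma G_H1: "AE t in lebesgue_on I. \<forall>e\<in>Basis. H1_deriv R e (\<lambda>x. \<rho> t x powr m) (\<lambda>x. G e (t, x))"
proof -
  have "AE t in lebesgue_on I. H1_deriv R e (\<lambda>x. \<rho> t x powr m) (\<lambda>x. G e (t, x))" if e: "e \<in> Basis" for e
  proof -
    have "AE t in lebesgue_on I. t \<in> I" by (rule AE_I2) simp
    with G(1)[OF e] L_two_slice[OF I(1,2) \<Omega>(3,5) G(2)[OF e]] show ?thesis
    proof eventually_elim
      case (elim t)
      then have t: "t \<in> {0..T}" by auto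
      have "L_two \<Omega> (\<lambda>x. \<rho> t x powr m)"
      proof (rule L_two_bounded[OF \<Omega>(1)])
        show "(\<lambda>x. \<rho> t x powr m) \<in> borel_measurable M"
          using borel_measurable_integrable[OF \<rho>_integrable[OF t]] by measurable
        show "AE x in M. \<bar>\<rho> t x powr m\<bar> \<le> C powr m"
          using \<rho>_bounds[OF t] by eventually_elim (use m in \<open>auto intro: powr_mono2\<close>)
      qed
      with elim show ?case by (simp add: H1_deriv_def)
    qed
  qed
  then show ?thesis by (simp add: AE_finite_all)
qed

section \<open>The equation at almost every time\<close>

lemma smooth_bounded:
  assumes "smooth \<zeta>" shows "\<exists>B. \<forall>x\<in>\<Omega>. \<bar>\<zeta> x\<bar> \<le> B"
proof -
  have "bounded (\<zeta> ` cball 0 R)"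
    using assms by (intro compact_imp_bounded compact_continuous_image smooth_continuous) auto
  then obtain B where "\<forall>x\<in>cball 0 R. \<bar>\<zeta> x\<bar> \<le> B" by (auto simp: bounded_iff)
  then have "\<forall>x\<in>\<Omega>. \<bar>\<zeta> x\<bar> \<le> B" by simp
  then show ?thesis ..
qed

lemma smooth_lift_measurable: "smooth \<zeta> \<Longrightarrow> (\<lambda>z. \<zeta> (snd z)) \<in> borel_measurable (lebesgue_on (I \<times> \<Omega>))"
  by (intro borel_measurable_lebesgue_on_snd[OF I(1) \<Omega>(3)] borel_measurable_lebesgue_on_continuous smooth_continuous)

lemma smooth_mult_integrable:
  assumes "smooth \<zeta>" "L_two (I \<times> \<Omega>) f"
  shows "integrable (lebesgue_on (I \<times> \<Omega>)) (\<lambda>z. \<zeta> (snd z) * f z)"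
proof -
  obtain B where B: "\<forall>x\<in>\<Omega>. \<bar>\<zeta> x\<bar> \<le> B" using smooth_bounded[OF assms(1)] by blast
  have "AE z in lebesgue_on (I \<times> \<Omega>). \<bar>\<zeta> (snd z)\<bar> \<le> B" using B by (intro AE_I2) auto
  then show ?thesis
    by (rule integrable_mult_bounded[OF L_two_integrable[OF Q(2) assms(2)] smooth_lift_measurable[OF assms(1)]])
qed

text \<open>The gradients in the notion of solution are chosen separately at each time. At almost
  every time they agree almost everywhere with \<open>G\<close>, \<open>gV\<close> and
  \<open>interaction_grad\<close>, so the right-hand side becomes an integral of jointly measurable
  functions.\<close>

lemma weak_equation:
  assumes \<theta>: "test_fun I \<theta>" and \<zeta>: "smooth \<zeta>"
  shows "(\<integral>t. (\<integral>x. \<zeta> x * \<rho> t x \<partial>M) * dir_deriv 1 \<theta> t \<partial>lebesgue_on I) =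
    (\<integral>t. (\<integral>x. (\<Sum>e\<in>Basis. dir_deriv e \<zeta> x * J e t x) \<partial>M) * \<theta> t \<partial>lebesgue_on I)"
proof -
  have d\<zeta>: "smooth (dir_deriv e \<zeta>)" if "e \<in> Basis" for e by (rule smooth_dir_deriv[OF \<zeta> that])
  obtain B where B: "\<And>t. \<bar>\<theta> t\<bar> \<le> B" using test_funE[OF \<theta>] by metis
  have \<theta>m: "\<theta> \<in> borel_measurable (lebesgue_on I)" by (rule test_fun_measurable[OF \<theta>])
  define a1 where "a1 t x = (\<Sum>e\<in>Basis. dir_deriv e \<zeta> x * G e (t, x))" for t x
  define a2 where "a2 t x = (\<Sum>e\<in>Basis. dir_deriv e \<zeta> x * (\<rho> t x * (g\<psi> t x \<bullet> e)))" for t x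
  have a1i: "integrable (lebesgue_on (I \<times> \<Omega>)) (\<lambda>z. a1 (fst z) (snd z))"
    unfolding a1_def using smooth_mult_integrable[OF d\<zeta> G(2)] by (intro Bochner_Integration.integrable_sum) simp
  have a2i: "integrable (lebesgue_on (I \<times> \<Omega>)) (\<lambda>z. a2 (fst z) (snd z))"
    unfolding a2_def using smooth_mult_integrable[OF d\<zeta> \<rho>g\<psi>_L_two] by (intro Bochner_Integration.integrable_sum) simp
  note F1 = lebesgue_on_Times_Fubini[OF I(1) \<Omega>(3) a1i, simplified]
  note F2 = lebesgue_on_Times_Fubini[OF I(1) \<Omega>(3) a2i, simplified]
  have i1: "integrable (lebesgue_on I) (\<lambda>t. \<theta> t * (\<integral>x. a1 t x \<partial>M))"
    by (rule integrable_mult_bounded[OF F1(2) \<theta>m, of B]) (simp add: B)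
  have i2: "integrable (lebesgue_on I) (\<lambda>t. \<theta> t * (\<integral>x. a2 t x \<partial>M))"
    by (rule integrable_mult_bounded[OF F2(2) \<theta>m, of B]) (simp add: B)
  have inn: "g \<bullet> (\<Sum>e\<in>Basis. (c * dir_deriv e \<zeta> x) *\<^sub>R e) = c * (\<Sum>e\<in>Basis. dir_deriv e \<zeta> x * (g \<bullet> e))" for g c x
    by (simp add: inner_sum_right sum_distrib_left mult.assoc)
  have ae1: "AE t in lebesgue_on I. (\<integral>x. weak_grad \<Omega> (\<lambda>x. \<rho> t x powr m) x \<bullet> (\<Sum>e\<in>Basis. (\<theta> t * dir_deriv e \<zeta> x) *\<^sub>R e) \<partial>M)
      = \<theta> t * (\<integral>x. a1 t x \<partial>M)"
    using G_H1 F1(1)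
  proof eventually_elim
    case (elim t)
    have "has_weak_grad \<Omega> (\<lambda>x. \<rho> t x powr m) (\<lambda>x. \<Sum>e\<in>Basis. G e (t, x) *\<^sub>R e)"
      using elim(1) by (simp add: has_weak_grad_def H1_deriv_def inner_sum_left inner_Basis if_distrib cong: if_cong)
    from weak_grad_AE[OF \<Omega>(4) this]
    have "AE x in M. weak_grad \<Omega> (\<lambda>x. \<rho> t x powr m) x \<bullet> (\<Sum>e\<in>Basis. (\<theta> t * dir_deriv e \<zeta> x) *\<^sub>R e) = \<theta> t * a1 t x"
      by eventually_elim
        (simp add: inn a1_def inner_sum_left inner_Basis if_distrib cong: if_cong)
    from lebesgue_on_cong_AE(2)[OF \<Omega>(2) _ this] elim(2) show ?case by simp
  qed
  have ae2: "AE t in lebesgue_on I. (\<integral>x. \<rho> t x * ((weak_grad \<Omega> V x + weak_grad \<Omega> (interaction R K (\<rho> t)) x)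
          \<bullet> (\<Sum>e\<in>Basis. (\<theta> t * dir_deriv e \<zeta> x) *\<^sub>R e)) \<partial>M) = \<theta> t * (\<integral>x. a2 t x \<partial>M)"
  proof -
    have "AE t in lebesgue_on I. t \<in> I" by (rule AE_I2) simp
    with F2(1) show ?thesis
    proof eventually_elim
      case (elim t)
      then have t: "t \<in> {0..T}" by auto
      have "has_weak_grad \<Omega> V gV" using gV(2) by (simp add: has_weak_grad_def)
      from weak_grad_AE[OF \<Omega>(4) this] weak_grad_AE[OF \<Omega>(4) interaction_has_weak_grad[OF t]]
      have "AE x in M. \<rho> t x * ((weak_grad \<Omega> V x + weak_grad \<Omega> (interaction R K (\<rho> t)) x)
          \<bullet> (\<Sum>e\<in>Basis. (\<theta> t * dir_deriv e \<zeta> x) *\<^sub>R e)) = \<theta> t * a2 t x"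
        by eventually_elim (simp only: inn, simp add: g\<psi>_def a2_def sum_distrib_left mult_ac)
      from lebesgue_on_cong_AE(2)[OF \<Omega>(2) _ this] elim(1) show ?case by simp
    qed
  qed
  have "(\<integral>t. (\<integral>x. \<zeta> x * \<rho> t x \<partial>M) * dir_deriv 1 \<theta> t \<partial>lebesgue_on I) =
      (\<integral>t. (\<integral>x. \<rho> t x * (dir_deriv 1 \<theta> t * \<zeta> x) \<partial>M) \<partial>lebesgue_on I)"
    by (simp add: mult_ac flip: integral_mult_right_zero)
  also have "\<dots> = (\<integral>t. \<theta> t * (\<integral>x. a1 t x \<partial>M) \<partial>lebesgue_on I) + (\<integral>t. \<theta> t * (\<integral>x. a2 t x \<partial>M) \<partial>lebesgue_on I)"
    unfolding equation[OF \<theta> \<zeta>]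
    using lebesgue_on_cong_AE(2)[OF I(3) i1 ae1] lebesgue_on_cong_AE(2)[OF I(3) i2 ae2] by simp
  also have "\<dots> = (\<integral>t. \<theta> t * (\<integral>x. a1 t x \<partial>M) + \<theta> t * (\<integral>x. a2 t x \<partial>M) \<partial>lebesgue_on I)"
    using i1 i2 by simp
  also have "\<dots> = (\<integral>t. (\<integral>x. (\<Sum>e\<in>Basis. dir_deriv e \<zeta> x * J e t x) \<partial>M) * \<theta> t \<partial>lebesgue_on I)"
  proof -
    have "AE t in lebesgue_on I. (\<integral>x. (\<Sum>e\<in>Basis. dir_deriv e \<zeta> x * J e t x) \<partial>M) * \<theta> t =
        \<theta> t * (\<integral>x. a1 t x \<partial>M) + \<theta> t * (\<integral>x. a2 t x \<partial>M)"
      using F1(1) F2(1)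
    proof eventually_elim
      case (elim t)
      have "(\<Sum>e\<in>Basis. dir_deriv e \<zeta> x * J e t x) = a1 t x + a2 t x" for x
        by (simp add: J_def a1_def a2_def distrib_left sum.distrib)
      then show ?case using elim by (simp add: algebra_simps)
    qed
    from lebesgue_on_cong_AE(2)[OF I(3) _ this] i1 i2 show ?thesis by simp
  qed
  finally show ?thesis .
qed

text \<open>The increments of the integral of \<zeta> \<rho>(t) are computed twice, from the
  equation and from \<open>\<sigma>\<close>. The two derivatives have the same integral over every
  interval, hence agree almost everywhere, with an exceptional set that still depends on
  \<zeta>.\<close>

lemma weak_equation_AE:
  assumes \<zeta>: "smooth \<zeta>"
  shows "AE t in lebesgue_on I. (\<integral>x. \<zeta> x * \<sigma> (t, x) \<partial>M) + (\<integral>x. (\<Sum>e\<in>Basis. dir_deriv e \<zeta> x * J e t x) \<partial>M) = 0"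
proof -
  have \<zeta>m: "\<zeta> \<in> borel_measurable M" by (intro borel_measurable_lebesgue_on_continuous smooth_continuous \<zeta>)
  obtain B where "\<forall>x\<in>\<Omega>. \<bar>\<zeta> x\<bar> \<le> B" using smooth_bounded[OF \<zeta>] by blast
  then have \<zeta>b: "AE x in M. \<bar>\<zeta> x\<bar> \<le> B" by (intro AE_I2) simp
  define D1 where "D1 t = (\<integral>x. \<zeta> x * \<sigma> (t, x) \<partial>M)" for t
  define D2 where "D2 t = (\<integral>x. (\<Sum>e\<in>Basis. dir_deriv e \<zeta> x * J e t x) \<partial>M)" for t
  have Ji: "integrable (lebesgue_on (I \<times> \<Omega>)) (\<lambda>z. \<Sum>e\<in>Basis. dir_deriv e \<zeta> (snd z) * J e (fst z) (snd z))"
    using smooth_mult_integrable[OF smooth_dir_deriv[OF \<zeta>] J_L_two] by (intro Bochner_Integration.integrable_sum) simp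
  have D1i: "integrable (lebesgue_on I) D1"
    using lebesgue_on_Times_Fubini(2)[OF I(1) \<Omega>(3) smooth_mult_integrable[OF \<zeta> \<sigma>(2)]] by (simp add: D1_def[abs_def])
  have D2i: "integrable (lebesgue_on I) D2"
    using lebesgue_on_Times_Fubini(2)[OF I(1) \<Omega>(3) Ji] by (simp add: D2_def[abs_def])
  have "AE t in lebesgue_on I. D1 t + D2 t = 0"
  proof (rule interval_integrals_eq_0_imp_AE_eq_0[OF _ T])
    show "integrable (lebesgue_on I) (\<lambda>t. D1 t + D2 t)" using D1i D2i by simp
    fix s t assume st: "0 \<le> s" "s \<le> t" "t \<le> T"
    have st': "s \<in> {0..T}" "t \<in> {0..T}" using st by auto
    have sub: "integrable (lebesgue_on {s<..<t}) D1" "integrable (lebesgue_on {s<..<t}) D2"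
      using st by (auto intro!: integrable_lebesgue_on_subset[OF D1i] integrable_lebesgue_on_subset[OF D2i])
    have "(\<integral>x. \<zeta> x * \<rho> t x \<partial>M) - (\<integral>x. \<zeta> x * \<rho> s x \<partial>M) = (\<integral>r. - D2 r \<partial>lebesgue_on {s<..<t})"
    proof (rule integral_weak_derivative[OF C_L1_continuous[OF CL1 \<zeta>m \<zeta>b] _ _ st])
      show "integrable (lebesgue_on I) (\<lambda>r. - D2 r)" using D2i by simp
      show "(\<integral>t. (\<integral>x. \<zeta> x * \<rho> t x \<partial>M) * dir_deriv 1 \<theta> t \<partial>lebesgue_on I) = - (\<integral>t. - D2 t * \<theta> t \<partial>lebesgue_on I)"
        if "test_fun I \<theta>" for \<theta>
        using weak_equation[OF that \<zeta>] by (simp add: D2_def)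
    qed
    moreover have "(\<integral>x. \<zeta> x * \<rho> t x \<partial>M) - (\<integral>x. \<zeta> x * \<rho> s x \<partial>M) = (\<integral>r. D1 r \<partial>lebesgue_on {s<..<t})"
      using time_increment_integral(1)[OF \<Omega>(4,5) CL1 \<sigma> st \<zeta>m \<zeta>b]
        integrable_mult_bounded[OF \<rho>_integrable[OF st'(1)] \<zeta>m \<zeta>b] integrable_mult_bounded[OF \<rho>_integrable[OF st'(2)] \<zeta>m \<zeta>b]
      by (simp add: D1_def right_diff_distrib)
    ultimately show "(\<integral>r. D1 r + D2 r \<partial>lebesgue_on {s<..<t}) = 0" using sub by simp
  qed
  then show ?thesis by (simp add: D1_def D2_def)
qed

end

context aggregation_diffusion
begin

text \<open>For almost every time the equation can be tested with every \<open>H\<^sup>1\<close> function: first with the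
  kernels \<open>mker (\<mu> x - y)\<close> for \<open>y\<close> in a countable dense set, by continuity with all of them, and then
  with their superpositions.\<close>

lemma weak_equation_H1:
  "AE t in lebesgue_on I. \<forall>\<eta> \<eta>'. (\<forall>e\<in>Basis. H1_deriv R e \<eta> (\<eta>' e)) \<longrightarrow>
     (\<integral>x. \<sigma> (t, x) * \<eta> x \<partial>M) + (\<Sum>e\<in>Basis. \<integral>x. J e t x * \<eta>' e x \<partial>M) = 0"
proof -
  obtain \<kappa> :: "'a \<Rightarrow> real" where \<kappa>: "mollifier \<kappa>" using mollifier_exists by blast
  note D = dil_rad[OF R]
  obtain Y :: "'a set" where Y: "countable Y" "\<And>X. open X \<Longrightarrow> X \<noteq> {} \<Longrightarrow> \<exists>d\<in>Y. d \<in> X"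
    using countable_dense_exists by metis
  define k where "k n = mker \<kappa> (rad R n)" for n
  have ks: "smooth (k n)" for n unfolding k_def by (rule smooth_mker[OF mollifierD(1)[OF \<kappa>]])
  have dks: "smooth (dir_deriv e (k n))" if "e \<in> Basis" for e n by (rule smooth_dir_deriv[OF ks that])
  have "\<exists>B. \<forall>z. \<bar>k n z\<bar> \<le> B" for n
    using mker_bounded[OF \<kappa> D(5)] unfolding k_def by metis
  then obtain b where b: "\<And>n z. \<bar>k n z\<bar> \<le> b n" by metis
  have supp: "k n z = 0" if "z \<notin> cball 0 (rad R n)" for n z
    using mker_eq_0[OF \<kappa> D(5), of n z] that by (simp add: k_def)
  have "\<exists>B. \<forall>z. \<bar>dir_deriv e (k n) z\<bar> \<le> B" if e: "e \<in> Basis" for e n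
  proof -
    have "dir_deriv e (k n) z = 0" if "z \<notin> cball 0 (rad R n)" for z
      by (rule dir_deriv_zero_outside[OF _ supp that]) auto
    then show ?thesis using bounded_compact_support[OF smooth_continuous[OF dks[OF e]] compact_cball] by metis
  qed
  then obtain b' where b': "\<And>e n z. e \<in> Basis \<Longrightarrow> \<bar>dir_deriv e (k n) z\<bar> \<le> b' e n" by metis
  define \<zeta> where "\<zeta> n y x = k n (dil n *\<^sub>R x + - y)" for n y x
  have \<zeta>s: "smooth (\<zeta> n y)" for n y
    unfolding \<zeta>_def by (rule smooth_affine[OF bounded_linear_scaleR_right ks])
  have d\<zeta>: "dir_deriv e (\<zeta> n y) x = dil n * dir_deriv e (k n) (dil n *\<^sub>R x - y)" if e: "e \<in> Basis" for e n y x
  proof -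
    have "dir_deriv e (\<zeta> n y) x = (\<Sum>b\<in>Basis. ((dil n *\<^sub>R e) \<bullet> b) * dir_deriv b (k n) (dil n *\<^sub>R x + - y))"
      unfolding \<zeta>_def by (rule dir_deriv_affine[OF bounded_linear_scaleR_right smooth_differentiable[OF ks]])
    also have "\<dots> = (\<Sum>b\<in>Basis. if b = e then dil n * dir_deriv b (k n) (dil n *\<^sub>R x - y) else 0)"
      using e by (intro sum.cong) (auto simp: inner_Basis)
    finally show ?thesis using e by simp
  qed
  have "AE t in lebesgue_on I. \<forall>n. \<forall>y\<in>Y. (\<integral>x. \<zeta> n y x * \<sigma> (t, x) \<partial>M) +
      (\<integral>x. (\<Sum>e\<in>Basis. dir_deriv e (\<zeta> n y) x * J e t x) \<partial>M) = 0"
    unfolding AE_all_countable AE_ball_countable[OF Y(1)] using weak_equation_AE[OF \<zeta>s] by blast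
  with J_slice L_two_slice[OF I(1,2) \<Omega>(3,5) \<sigma>(2)] show ?thesis
  proof eventually_elim
    case (elim t)
    note JL = elim(1)[rule_format] and \<sigma>L = elim(2)
    have \<sigma>i: "integrable M (\<lambda>x. \<sigma> (t, x))" by (rule L_two_integrable[OF \<Omega>(1) \<sigma>L])
    have Ji: "integrable M (J e t)" if "e \<in> Basis" for e by (rule L_two_integrable[OF \<Omega>(1) JL[OF that]])
    define h where "h n y = (\<integral>x. k n (dil n *\<^sub>R x - y) * \<sigma> (t, x) \<partial>M) +
        (\<Sum>e\<in>Basis. dil n * (\<integral>x. dir_deriv e (k n) (dil n *\<^sub>R x - y) * J e t x \<partial>M))" for n y
    have h0: "h n y = 0" for n y
    proof (rule continuous_eq_0_dense[OF _ Y(2)])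
      show "continuous_on UNIV (h n)"
        unfolding h_def
        using isCont_integral_kernel[OF \<sigma>i smooth_continuous[OF ks] b, of n "-1" "dil n"]
          isCont_integral_kernel[OF Ji smooth_continuous[OF dks] b', of _ _ n "-1" "dil n"]
        by (intro continuous_on_add continuous_on_sum continuous_on_mult continuous_on_const)
          (simp_all add: add.commute)
      fix y assume "y \<in> Y"
      then have "(\<integral>x. \<zeta> n y x * \<sigma> (t, x) \<partial>M) + (\<integral>x. (\<Sum>e\<in>Basis. dir_deriv e (\<zeta> n y) x * J e t x) \<partial>M) = 0"
        using elim(3) by blast
      moreover have "(\<integral>x. (\<Sum>e\<in>Basis. dir_deriv e (\<zeta> n y) x * J e t x) \<partial>M) =
          (\<Sum>e\<in>Basis. \<integral>x. dir_deriv e (\<zeta> n y) x * J e t x \<partial>M)"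
      proof (rule Bochner_Integration.integral_sum)
        fix e :: 'a assume e: "e \<in> Basis"
        have "smooth (dir_deriv e (\<zeta> n y))" by (rule smooth_dir_deriv[OF \<zeta>s e])
        then have m: "dir_deriv e (\<zeta> n y) \<in> borel_measurable M"
          by (intro borel_measurable_lebesgue_on_continuous smooth_continuous)
        show "integrable M (\<lambda>x. dir_deriv e (\<zeta> n y) x * J e t x)"
          by (rule integrable_mult_bounded[OF Ji[OF e] m, of "\<bar>dil n\<bar> * b' e n"])
            (simp add: d\<zeta>[OF e] abs_mult mult_left_mono b'[OF e])
      qed
      ultimately show "h n y = 0"
        by (simp add: h_def d\<zeta> mult.assoc \<zeta>_def)
    qed
    show ?case
    proof (intro allI impI)
      fix \<eta> and \<eta>' :: "'a \<Rightarrow> 'a \<Rightarrow> real" assume H: "\<forall>e\<in>Basis. H1_deriv R e \<eta> (\<eta>' e)"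
      have \<eta>L: "L_two \<Omega> \<eta>" using H nonempty_Basis H1_derivD(2) by blast
      have \<eta>'L: "L_two \<Omega> (\<eta>' e)" if "e \<in> Basis" for e using H that H1_derivD(3) by blast
      have \<eta>i: "integrable M \<eta>" by (rule L_two_integrable[OF \<Omega>(1) \<eta>L])
      have eq: "(\<integral>x. \<sigma> (t, x) * conv \<kappa> \<Omega> (dil n) (rad R n) \<eta> x \<partial>M) +
          (\<Sum>e\<in>Basis. dil n * (\<integral>x. J e t x * conv \<kappa> \<Omega> (dil n) (rad R n) (\<eta>' e) x \<partial>M)) = 0" for n
      proof -
        note k1 = kernel_duality[OF smooth_continuous[OF ks] b \<Omega>(3) \<sigma>i \<eta>i, of n "dil n"]
        have k2: "(\<integral>x. J e t x * conv \<kappa> \<Omega> (dil n) (rad R n) (\<eta>' e) x \<partial>M) =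
            (\<integral>y. \<eta> y * (\<integral>x. dir_deriv e (k n) (dil n *\<^sub>R x - y) * J e t x \<partial>M) \<partial>M)"
          "integrable M (\<lambda>y. \<eta> y * (\<integral>x. dir_deriv e (k n) (dil n *\<^sub>R x - y) * J e t x \<partial>M))" if e: "e \<in> Basis" for e
        proof -
          note kd = kernel_duality[OF smooth_continuous[OF dks[OF e]] b'[OF e] \<Omega>(3) Ji[OF e] \<eta>i, of n "dil n"]
          have w: "weak_deriv \<Omega> e \<eta> (\<eta>' e)" using H e H1_derivD(1) by blast
          have "(\<integral>x. J e t x * conv \<kappa> \<Omega> (dil n) (rad R n) (\<eta>' e) x \<partial>M) =
              (\<integral>x. J e t x * (\<integral>y. dir_deriv e (k n) (dil n *\<^sub>R x - y) * \<eta> y \<partial>M) \<partial>M)"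
            by (intro Bochner_Integration.integral_cong refl)
              (simp add: k_def conv_weak_deriv[OF \<kappa> D(5) e w D(7)])
          then show "(\<integral>x. J e t x * conv \<kappa> \<Omega> (dil n) (rad R n) (\<eta>' e) x \<partial>M) =
            (\<integral>y. \<eta> y * (\<integral>x. dir_deriv e (k n) (dil n *\<^sub>R x - y) * J e t x \<partial>M) \<partial>M)" using kd(1) by simp
          show "integrable M (\<lambda>y. \<eta> y * (\<integral>x. dir_deriv e (k n) (dil n *\<^sub>R x - y) * J e t x \<partial>M))" by (rule kd(2))
        qed
        \<comment> \<open>Weighting with \<eta>(y) and exchanging the integrals turns the kernels
          into the dilated mollification of \<eta>, and their derivatives, through the weak
          derivative of \<eta>, into the mollification of \<eta>'.\<close>
        have "0 = (\<integral>y. \<eta> y * h n y \<partial>M)" by (simp add: h0)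
        also have "\<dots> = (\<integral>y. \<eta> y * (\<integral>x. k n (dil n *\<^sub>R x - y) * \<sigma> (t, x) \<partial>M) +
            (\<Sum>e\<in>Basis. dil n * (\<eta> y * (\<integral>x. dir_deriv e (k n) (dil n *\<^sub>R x - y) * J e t x \<partial>M))) \<partial>M)"
          by (simp add: h_def distrib_left sum_distrib_left mult.left_commute)
        also have "\<dots> = (\<integral>y. \<eta> y * (\<integral>x. k n (dil n *\<^sub>R x - y) * \<sigma> (t, x) \<partial>M) \<partial>M) +
            (\<Sum>e\<in>Basis. dil n * (\<integral>y. \<eta> y * (\<integral>x. dir_deriv e (k n) (dil n *\<^sub>R x - y) * J e t x \<partial>M) \<partial>M))"
          using k1(2) k2(2) by simp
        also have "\<dots> = (\<integral>x. \<sigma> (t, x) * conv \<kappa> \<Omega> (dil n) (rad R n) \<eta> x \<partial>M) +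
            (\<Sum>e\<in>Basis. dil n * (\<integral>x. J e t x * conv \<kappa> \<Omega> (dil n) (rad R n) (\<eta>' e) x \<partial>M))"
          using k1(1) k2(1) by (simp add: conv_def k_def)
        finally show ?thesis by simp
      qed
      have cL: "L_two \<Omega> (conv \<kappa> \<Omega> (dil n) (rad R n) f)" if "L_two \<Omega> f" for f n
        by (rule conv_L_two(1)[OF \<kappa> D(5) D(3) \<Omega>(3,1) that])
      have lim: "(\<lambda>n. \<integral>x. v x * conv \<kappa> \<Omega> (dil n) (rad R n) f x \<partial>M) \<longlonglongrightarrow> (\<integral>x. v x * f x \<partial>M)"
        if "L_two \<Omega> f" "L_two \<Omega> v" for f v
        by (rule L_two_tendsto_integral[OF cL[OF that(1)] that conv_tendsto_L_two[OF \<kappa> \<Omega>(4,1) that(1) D(1,2,5,6)]])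
      have "(\<lambda>n. (\<integral>x. \<sigma> (t, x) * conv \<kappa> \<Omega> (dil n) (rad R n) \<eta> x \<partial>M) +
          (\<Sum>e\<in>Basis. dil n * (\<integral>x. J e t x * conv \<kappa> \<Omega> (dil n) (rad R n) (\<eta>' e) x \<partial>M)))
          \<longlonglongrightarrow> (\<integral>x. \<sigma> (t, x) * \<eta> x \<partial>M) + (\<Sum>e\<in>Basis. 1 * (\<integral>x. J e t x * \<eta>' e x \<partial>M))"
        using lim[OF \<eta>L \<sigma>L] lim[OF \<eta>'L JL] by (intro tendsto_add tendsto_sum tendsto_mult D(1)) auto
      then show "(\<integral>x. \<sigma> (t, x) * \<eta> x \<partial>M) + (\<Sum>e\<in>Basis. \<integral>x. J e t x * \<eta>' e x \<partial>M) = 0"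
        unfolding eq by (simp add: LIMSEQ_const_iff)
    qed
  qed
qed

end

section \<open>The generalized gradient and the dissipation\<close>

text \<open>As values and slopes match at a, the left and right difference quotients there have the
  same limit.\<close>

lemma DERIV_piecewise:
  fixes f g :: "real \<Rightarrow> real"
  assumes f: "\<And>s. s \<le> a \<Longrightarrow> (f has_real_derivative f' s) (at s)"
    and g: "\<And>s. a \<le> s \<Longrightarrow> (g has_real_derivative g' s) (at s)"
    and eq: "f a = g a" "f' a = g' a"
  shows "((\<lambda>s. if s \<le> a then f s else g s) has_real_derivative (if s \<le> a then f' s else g' s)) (at s)"
proof -
  let ?h = "\<lambda>s. if s \<le> a then f s else g s"
  consider "s < a" | "a < s" | "s = a" by linarith
  then show ?thesis
  proof cases
    case 1
    have "(f has_real_derivative (if s \<le> a then f' s else g' s)) (at s)" using f[of s] 1 by simp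
    then show ?thesis
      by (rule has_field_derivative_transform_within_open[of _ _ _ "{..<a}"]) (use 1 in auto)
  next
    case 2
    have "(g has_real_derivative (if s \<le> a then f' s else g' s)) (at s)" using g[of s] 2 by simp
    then show ?thesis
      by (rule has_field_derivative_transform_within_open[of _ _ _ "{a<..}"]) (use 2 in auto)
  next
    case 3
    have L: "((\<lambda>y. (f y - f a) / (y - a)) \<longlongrightarrow> f' a) (at a)" and Rt: "((\<lambda>y. (g y - g a) / (y - a)) \<longlongrightarrow> f' a) (at a)"
      using f[of a] g[of a] eq by (simp_all add: has_field_derivative_iff)
    have "((\<lambda>y. (?h y - ?h a) / (y - a)) \<longlongrightarrow> f' a) (at_left a)"
      by (rule Lim_transform_eventually[OF tendsto_mono[OF at_le L]])
        (auto simp: eventually_at_filter)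
    moreover have "((\<lambda>y. (?h y - ?h a) / (y - a)) \<longlongrightarrow> f' a) (at_right a)"
      by (rule Lim_transform_eventually[OF tendsto_mono[OF at_le Rt]])
        (auto simp: eventually_at_filter eq)
    ultimately have "((\<lambda>y. (?h y - ?h a) / (y - a)) \<longlongrightarrow> f' a) (at a)"
      by (simp add: filterlim_split_at_real)
    then show ?thesis using 3 by (simp add: has_field_derivative_iff)
  qed
qed

text \<open>The truncation at level n + 1 determines the gradient where |u| < n + 1; these sets
  exhaust the points where u is finite, and at infinite values the definition prescribes 0.\<close>

lemma has_gen_grad_unique:
  assumes S: "open S" and 1: "has_gen_grad S u g1" and 2: "has_gen_grad S u g2"
  shows "AE x in lebesgue_on S. g1 x = g2 x"
proof -
  have "AE x in lebesgue_on S. (if \<bar>u x\<bar> < ereal (real n + 1) then g1 x else 0) \<bullet> e =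
      (if \<bar>u x\<bar> < ereal (real n + 1) then g2 x else 0) \<bullet> e" if "e \<in> Basis" for e n
    by (rule weak_deriv_unique[OF S that, where f = "\<lambda>x. trunc (real n + 1) (u x)" and f' = "\<lambda>x. trunc (real n + 1) (u x)"])
      (use 1 2 that in \<open>auto simp: has_gen_grad_def has_weak_grad_def\<close>)
  then have "AE x in lebesgue_on S. \<forall>n. \<forall>e\<in>Basis. (if \<bar>u x\<bar> < ereal (real n + 1) then g1 x else 0) \<bullet> e =
      (if \<bar>u x\<bar> < ereal (real n + 1) then g2 x else 0) \<bullet> e"
    by (simp add: AE_finite_all AE_all_countable)
  moreover have "AE x in lebesgue_on S. x \<in> S" by (rule AE_I2) simp
  ultimately show ?thesis
  proof eventually_elim
    case (elim x)
    show ?case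
    proof (cases "\<bar>u x\<bar> = \<infinity>")
      case True
      then show ?thesis using 1 2 elim(2) by (simp add: has_gen_grad_def)
    next
      case False
      then obtain r where r: "u x = ereal r" by (cases "u x") auto
      obtain n :: nat where "\<bar>r\<bar> < real n" using reals_Archimedean2 by blast
      then have "\<bar>u x\<bar> < ereal (real n + 1)" by (simp add: r)
      then have "\<forall>e\<in>Basis. g1 x \<bullet> e = g2 x \<bullet> e" using elim(1)[rule_format, of _ n] by auto
      then show ?thesis by (auto intro: euclidean_eqI)
    qed
  qed
qed

lemma trunc_simps: "trunc k (ereal r) = max (- k) (min k r)" "0 < k \<Longrightarrow> trunc k (- \<infinity>) = - k"
  unfolding trunc_def by (auto simp: max_def min_def)

context aggregation_diffusion
begin

definition U1 where "U1 \<epsilon> s = m / (m - 1) * max s \<epsilon> powr (m - 1)"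

text \<open>In terms of w = \<rho>^m, U'(\<rho>) is P(w) with P(s) = m/(m-1) s^((m-1)/m) and P'(s) =
  s^(-1/m), which is bounded for s \<ge> a = \<epsilon>^m. As P'(w) = 1/\<rho>, the derivative is
  G/\<rho> on {\<rho> > \<epsilon>}.\<close>

lemma power_max_H1:
  assumes \<epsilon>: "0 < \<epsilon>" and e: "e \<in> Basis" and t: "t \<in> {0..T}"
    and H: "H1_deriv R e (\<lambda>x. \<rho> t x powr m) (\<lambda>x. G e (t, x))"
  shows "H1_deriv R e (\<lambda>x. U1 \<epsilon> (\<rho> t x)) (\<lambda>x. if \<epsilon> < \<rho> t x then G e (t, x) / \<rho> t x else 0)"
proof -
  define a where "a = \<epsilon> powr m"
  have a: "0 < a" using \<epsilon> by (simp add: a_def)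
  define P where "P s = m / (m - 1) * s powr ((m - 1) / m)" for s
  define P' where "P' s = s powr (- 1 / m)" for s
  have dP: "(P has_real_derivative P' s) (at s)" if "a \<le> s" for s
  proof -
    have s: "0 < s" using that a by simp
    have "(m - 1) / m - 1 = - 1 / m" using m by (simp add: field_simps)
    then show ?thesis unfolding P_def P'_def using s m
      by (auto intro!: derivative_eq_intros)
  qed
  \<comment> \<open>The tangent line at a continues P to a C^1 function on the whole line with
    bounded derivative; the arguments inserted are at least a.\<close>
  define F where "F s = (if s \<le> a then P a + P' a * (s - a) else P s)" for s
  define F' where "F' s = (if s \<le> a then P' a else P' s)" for s
  have dF: "(F has_real_derivative F' s) (at s)" for s
    unfolding F_def F'_def
    by (rule DERIV_piecewise) (auto intro!: derivative_eq_intros dP)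
  have F'm: "F' s = P' (max s a)" for s by (simp add: F'_def max_def)
  have F'c: "continuous_on UNIV F'"
    unfolding F'm P'_def using a by (intro continuous_intros) (auto simp: max_def)
  have F'b: "\<bar>F' s\<bar> \<le> P' a" for s
  proof -
    have "max s a powr (- 1 / m) \<le> a powr (- 1 / m)"
      using a m by (intro powr_mono2') auto
    then show ?thesis by (simp add: F'm P'_def)
  qed
  have H1: "H1_deriv R e (\<lambda>x. F (max (\<rho> t x powr m) a))
      (\<lambda>x. F' (max (\<rho> t x powr m) a) * (if a < \<rho> t x powr m then G e (t, x) else 0))"
    by (rule H1_deriv_C1[OF R e H1_deriv_max[OF R e H] dF F'c F'b])
  have nn: "AE x in M. 0 \<le> \<rho> t x" using \<rho>_bounds[OF t] by eventually_elim simp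
  show ?thesis
  proof (rule H1_deriv_cong_AE[OF e H1])
    show "AE x in M. U1 \<epsilon> (\<rho> t x) = F (max (\<rho> t x powr m) a)"
      using nn
    proof eventually_elim
      case (elim x)
      have "max (\<rho> t x powr m) a = max (\<rho> t x) \<epsilon> powr m"
        unfolding a_def using elim \<epsilon> m powr_less_mono2[of m \<epsilon> "\<rho> t x"] powr_mono2[of m "\<rho> t x" \<epsilon>]
        by (cases "\<epsilon> < \<rho> t x") (auto simp: max_def)
      moreover have "F (max (\<rho> t x powr m) a) = P (max (\<rho> t x powr m) a)" by (auto simp: F_def max_def)
      moreover have "(max (\<rho> t x) \<epsilon> powr m) powr ((m - 1) / m) = max (\<rho> t x) \<epsilon> powr (m - 1)"
        using m by (simp add: powr_powr)
      ultimately show ?case by (simp add: U1_def P_def)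
    qed
    show "AE x in M. (if \<epsilon> < \<rho> t x then G e (t, x) / \<rho> t x else 0) =
        F' (max (\<rho> t x powr m) a) * (if a < \<rho> t x powr m then G e (t, x) else 0)"
      using nn
    proof eventually_elim
      case (elim x)
      have iff: "a < \<rho> t x powr m \<longleftrightarrow> \<epsilon> < \<rho> t x"
        unfolding a_def using elim \<epsilon> m by (meson less_imp_le not_le powr_less_mono2 powr_mono2)
      show ?case
      proof (cases "\<epsilon> < \<rho> t x")
        case True
        then have "a < \<rho> t x powr m" using iff by simp
        then have "F' (max (\<rho> t x powr m) a) = (\<rho> t x powr m) powr (- 1 / m)" by (simp add: F'm P'_def max_def)
        also have "\<dots> = 1 / \<rho> t x" using m True \<epsilon> by (simp add: powr_powr powr_minus_divide)
        finally show ?thesis using True iff by simp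
      qed (use iff in simp)
    qed
  qed
qed

text \<open>The explicit candidate J/\<rho> for the gradient of the potential. On the vacuum the
  potential is -\<infinity>, and \<open>has_gen_grad\<close> forces the value 0.\<close>

definition \<Gamma> where "\<Gamma> t x = (if 0 < \<rho> t x then (\<Sum>e\<in>Basis. (J e t x / \<rho> t x) *\<^sub>R e) else 0)"

lemma potential_cases:
  "potential m R V K (\<rho> t) x = (if 0 < \<rho> t x then ereal (m / (m - 1) * \<rho> t x powr (m - 1) + \<psi> t x) else - \<infinity>)"
  by (simp add: potential_def U_deriv_def \<psi>_def)

lemma U1_tendsto: "\<exists>\<epsilon>>0. m / (m - 1) * \<epsilon> powr (m - 1) < - k"
proof -
  have "LIM \<epsilon> at_right 0. m / (1 - m) * \<epsilon> powr (m - 1) :> at_top"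
    using m by real_asymp
  then have "\<forall>\<^sub>F \<epsilon> in at_right 0. k < m / (1 - m) * \<epsilon> powr (m - 1)"
    by (rule filterlim_at_top_dense[THEN iffD1, rule_format])
  then obtain b where b: "b > 0" "\<And>\<epsilon>. 0 < \<epsilon> \<Longrightarrow> \<epsilon> < b \<Longrightarrow> k < m / (1 - m) * \<epsilon> powr (m - 1)"
    unfolding eventually_at_right_field by blast
  have "m / (m - 1) = - (m / (1 - m))" by (metis minus_diff_eq minus_divide_right)
  then have "m / (m - 1) * (b / 2) powr (m - 1) < - k" using b(2)[of "b / 2"] b(1) by simp
  then show ?thesis using b(1) by (intro exI[of _ "b / 2"]) simp
qed

lemma U1_mono:
  assumes "0 < s" "s \<le> r" shows "m / (m - 1) * s powr (m - 1) \<le> m / (m - 1) * r powr (m - 1)"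
proof -
  have "r powr (m - 1) \<le> s powr (m - 1)" using assms m by (intro powr_mono2') auto
  then show ?thesis using m by (intro mult_left_mono_neg) (auto simp: divide_le_0_iff)
qed

text \<open>Let B bound \<psi> and choose \<epsilon> with U'(\<epsilon>) < -(k + B). Where \<rho>
  \<le> \<epsilon>, the potential and its regularization are both below -k; elsewhere they coincide.
  Truncation at level k cannot tell them apart, and the regularized potential is in H^1.\<close>

lemma has_gen_grad_potential:
  assumes t: "t \<in> {0..T}" and H: "\<And>e. e \<in> Basis \<Longrightarrow> H1_deriv R e (\<lambda>x. \<rho> t x powr m) (\<lambda>x. G e (t, x))"
  shows "has_gen_grad \<Omega> (potential m R V K (\<rho> t)) (\<Gamma> t)"
  unfolding has_gen_grad_def
proof (intro conjI allI impI ballI)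
  fix x assume "\<bar>potential m R V K (\<rho> t) x\<bar> = \<infinity>"
  then show "\<Gamma> t x = 0" by (auto simp: potential_cases \<Gamma>_def split: if_splits)
next
  fix k :: real assume k: "0 < k"
  let ?u = "potential m R V K (\<rho> t)"
  obtain B where B: "AE x in M. \<bar>\<psi> t x\<bar> \<le> B" using \<psi>_bounded t by blast
  obtain \<epsilon> where \<epsilon>: "0 < \<epsilon>" "m / (m - 1) * \<epsilon> powr (m - 1) < - (k + B)" using U1_tendsto by blast
  define \<eta> where "\<eta> x = U1 \<epsilon> (\<rho> t x) + \<psi> t x" for x
  have key: "AE x in M. trunc k (?u x) = max (- k) (min k (\<eta> x)) \<and>
      (\<bar>?u x\<bar> < ereal k \<longleftrightarrow> \<bar>\<eta> x\<bar> < k) \<and> (\<bar>\<eta> x\<bar> < k \<longrightarrow> \<epsilon> < \<rho> t x)"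
    using B
  proof eventually_elim
    case (elim x)
    show ?case
    proof (cases "\<epsilon> < \<rho> t x")
      case True
      then have "?u x = ereal (\<eta> x)" using \<epsilon>(1) by (simp add: potential_cases \<eta>_def U1_def max_def)
      then show ?thesis using True by (simp add: trunc_simps)
    next
      case False
      then have \<eta>k: "\<eta> x < - k" using \<epsilon>(2) elim by (simp add: \<eta>_def U1_def max_def)
      show ?thesis
      proof (cases "0 < \<rho> t x")
        case True
        have "m / (m - 1) * \<rho> t x powr (m - 1) + \<psi> t x < - k"
          using U1_mono[OF True, of \<epsilon>] False \<epsilon>(2) elim by simp
        then show ?thesis using \<eta>k k True by (simp add: potential_cases trunc_simps)
      next
        case False
        then show ?thesis using \<eta>k k by (simp add: potential_cases trunc_simps)
      qed
    qed
  qed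
  show "has_weak_grad \<Omega> (\<lambda>x. trunc k (?u x)) (\<lambda>x. if \<bar>?u x\<bar> < ereal k then \<Gamma> t x else 0)"
    unfolding has_weak_grad_def
  proof
    fix e :: 'a assume e: "e \<in> Basis"
    have "H1_deriv R e \<eta> (\<lambda>x. (if \<epsilon> < \<rho> t x then G e (t, x) / \<rho> t x else 0) + g\<psi> t x \<bullet> e)"
      unfolding \<eta>_def by (rule H1_deriv_add[OF e power_max_H1[OF \<epsilon>(1) e t H[OF e]] \<psi>_H1[OF t e]])
    from H1_derivD(1)[OF H1_deriv_clamp[OF R e this k]]
    show "weak_deriv \<Omega> e (\<lambda>x. trunc k (?u x)) (\<lambda>x. (if \<bar>?u x\<bar> < ereal k then \<Gamma> t x else 0) \<bullet> e)"
    proof (rule weak_deriv_cong_AE[OF \<Omega>(2) e])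
      show "AE x in M. trunc k (?u x) = max (- k) (min k (\<eta> x))" using key by eventually_elim simp
      show "AE x in M. (if \<bar>?u x\<bar> < ereal k then \<Gamma> t x else 0) \<bullet> e =
          (if \<bar>\<eta> x\<bar> < k then (if \<epsilon> < \<rho> t x then G e (t, x) / \<rho> t x else 0) + g\<psi> t x \<bullet> e else 0)"
        using key
      proof eventually_elim
        case (elim x)
        have "\<Gamma> t x \<bullet> e = G e (t, x) / \<rho> t x + g\<psi> t x \<bullet> e" if "\<epsilon> < \<rho> t x"
          using that \<epsilon>(1) e
          by (simp add: \<Gamma>_def J_def inner_sum_left inner_Basis if_distrib add_divide_distrib cong: if_cong)
        then show ?case using elim by auto
      qed
    qed
  qed
qed

text \<open>An explicit form of \<rho> |\<Gamma>|^2. In contrast to \<open>dissipation\<close>,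
  which rests on a choice made at each time, it is visibly measurable in time and space
  together.\<close>

definition diss where "diss t x = (if 0 < \<rho> t x then (\<Sum>e\<in>Basis. (J e t x)\<^sup>2) / \<rho> t x else 0)"

lemma dissipation_AE:
  assumes t: "t \<in> {0..T}" and H: "\<And>e. e \<in> Basis \<Longrightarrow> H1_deriv R e (\<lambda>x. \<rho> t x powr m) (\<lambda>x. G e (t, x))"
  shows "AE x in M. dissipation m R V K (\<rho> t) x = diss t x"
proof -
  have g: "has_gen_grad \<Omega> (potential m R V K (\<rho> t)) (\<Gamma> t)" by (rule has_gen_grad_potential[OF t H])
  have "has_gen_grad \<Omega> (potential m R V K (\<rho> t)) (gen_grad \<Omega> (potential m R V K (\<rho> t)))"
    unfolding gen_grad_def by (rule someI[of "has_gen_grad \<Omega> (potential m R V K (\<rho> t))", OF g])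
  from has_gen_grad_unique[OF \<Omega>(4) this g] \<rho>_bounds[OF t] show ?thesis
  proof eventually_elim
    case (elim x)
    have "(norm (\<Gamma> t x))\<^sup>2 = (\<Sum>e\<in>Basis. (J e t x / \<rho> t x)\<^sup>2)" if "0 < \<rho> t x"
    proof -
      have "(norm (\<Gamma> t x))\<^sup>2 = (\<Sum>e\<in>Basis. (\<Gamma> t x \<bullet> e)\<^sup>2)"
        by (subst power2_norm_eq_inner, subst euclidean_inner) (simp add: power2_eq_square)
      also have "\<dots> = (\<Sum>e\<in>Basis. (J e t x / \<rho> t x)\<^sup>2)"
        using that by (intro sum.cong refl) (simp add: \<Gamma>_def inner_sum_left inner_Basis if_distrib cong: if_cong)
      finally show ?thesis .
    qed
    then show ?case using elim
      by (auto simp: dissipation_def diss_def power_divide power2_eq_square sum_divide_distrib sum_distrib_left)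
  qed
qed

end

section \<open>The regularized energy\<close>

text \<open>Young's inequality with weight k: if q is of order k in L^2, its pairing with p is of
  order k.\<close>

lemma weighted_integral_le:
  assumes p: "L_two S p" and q: "L_two S q" and k: "0 < k"
    and qb: "(\<integral>x. (q x)\<^sup>2 \<partial>lebesgue_on S) \<le> k\<^sup>2 * c"
  shows "(\<integral>x. \<bar>p x\<bar> * \<bar>q x\<bar> \<partial>lebesgue_on S) \<le> k * ((\<integral>x. (p x)\<^sup>2 \<partial>lebesgue_on S) + c)"
proof -
  have "(\<integral>x. \<bar>p x\<bar> * \<bar>q x\<bar> \<partial>lebesgue_on S) \<le> (\<integral>x. k * (p x)\<^sup>2 + (1 / k) * (q x)\<^sup>2 \<partial>lebesgue_on S)"
  proof (rule integral_mono)
    show "integrable (lebesgue_on S) (\<lambda>x. \<bar>p x\<bar> * \<bar>q x\<bar>)"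
      using integrable_abs[OF L_two_mult[OF p q]] by (simp add: abs_mult)
    show "integrable (lebesgue_on S) (\<lambda>x. k * (p x)\<^sup>2 + (1 / k) * (q x)\<^sup>2)"
      using L_twoD(2)[OF p] L_twoD(2)[OF q] by simp
    fix x
    have "0 \<le> (k * \<bar>p x\<bar> - \<bar>q x\<bar>)\<^sup>2" by simp
    then have "2 * (k * (\<bar>p x\<bar> * \<bar>q x\<bar>)) \<le> k\<^sup>2 * (p x)\<^sup>2 + (q x)\<^sup>2"
      by (simp add: power2_diff power_mult_distrib mult.assoc)
    moreover have "0 \<le> k * (\<bar>p x\<bar> * \<bar>q x\<bar>)" using k by simp
    ultimately have "k * (\<bar>p x\<bar> * \<bar>q x\<bar>) \<le> k\<^sup>2 * (p x)\<^sup>2 + (q x)\<^sup>2" by linarith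
    then have "\<bar>p x\<bar> * \<bar>q x\<bar> \<le> (k\<^sup>2 * (p x)\<^sup>2 + (q x)\<^sup>2) / k" using k by (simp add: pos_le_divide_eq mult.commute)
    then show "\<bar>p x\<bar> * \<bar>q x\<bar> \<le> k * (p x)\<^sup>2 + (1 / k) * (q x)\<^sup>2"
      using k by (simp add: add_divide_distrib power2_eq_square)
  qed
  also have "\<dots> = k * (\<integral>x. (p x)\<^sup>2 \<partial>lebesgue_on S) + (1 / k) * (\<integral>x. (q x)\<^sup>2 \<partial>lebesgue_on S)"
    using L_twoD(2)[OF p] L_twoD(2)[OF q] by simp
  also have "\<dots> \<le> k * (\<integral>x. (p x)\<^sup>2 \<partial>lebesgue_on S) + (1 / k) * (k\<^sup>2 * c)"
    using qb k by (intro add_left_mono mult_left_mono) auto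
  also have "\<dots> = k * ((\<integral>x. (p x)\<^sup>2 \<partial>lebesgue_on S) + c)"
    using k by (simp add: power2_eq_square distrib_left)
  finally show ?thesis .
qed

context aggregation_diffusion
begin

text \<open>The product of J with the gradient of the regularized potential: that gradient is
  J/\<rho> where \<rho> > \<epsilon>, and only \<nabla>\<psi> remains where U'(max \<rho>
  \<epsilon>) is constant.\<close>

definition flux where
  "flux \<epsilon> t x = (if \<epsilon> < \<rho> t x then (\<Sum>e\<in>Basis. (J e t x)\<^sup>2) / \<rho> t x else (\<Sum>e\<in>Basis. J e t x * (g\<psi> t x \<bullet> e)))"

lemma tested_equation:
  "AE t in lebesgue_on I. \<forall>\<epsilon>>0. integrable M (\<lambda>x. \<sigma> (t, x) * (U1 \<epsilon> (\<rho> t x) + \<psi> t x)) \<and>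
     (\<integral>x. \<sigma> (t, x) * (U1 \<epsilon> (\<rho> t x) + \<psi> t x) \<partial>M) = - (\<integral>x. flux \<epsilon> t x \<partial>M)"
proof -
  have "AE t in lebesgue_on I. t \<in> I" by (rule AE_I2) simp
  with weak_equation_H1 G_H1 J_slice L_two_slice[OF I(1,2) \<Omega>(3,5) \<sigma>(2)] show ?thesis
  proof eventually_elim
    case (elim t)
    have t: "t \<in> {0..T}" using elim(5) by auto
    show ?case
    proof (intro allI impI)
      fix \<epsilon> :: real assume \<epsilon>: "0 < \<epsilon>"
      define \<eta> where "\<eta> x = U1 \<epsilon> (\<rho> t x) + \<psi> t x" for x
      define \<eta>' where "\<eta>' e x = (if \<epsilon> < \<rho> t x then G e (t, x) / \<rho> t x else 0) + g\<psi> t x \<bullet> e" for e x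
      have H: "H1_deriv R e \<eta> (\<eta>' e)" if e: "e \<in> Basis" for e
        unfolding \<eta>_def \<eta>'_def
        by (rule H1_deriv_add[OF e power_max_H1[OF \<epsilon> e t] \<psi>_H1[OF t e]]) (use elim(2) e in blast)
      have \<eta>L: "L_two \<Omega> \<eta>" using H nonempty_Basis H1_derivD(2) by blast
      have "(\<integral>x. \<sigma> (t, x) * \<eta> x \<partial>M) + (\<Sum>e\<in>Basis. \<integral>x. J e t x * \<eta>' e x \<partial>M) = 0"
        using elim(1) H by blast
      moreover have "(\<Sum>e\<in>Basis. \<integral>x. J e t x * \<eta>' e x \<partial>M) = (\<integral>x. (\<Sum>e\<in>Basis. J e t x * \<eta>' e x) \<partial>M)"
        using elim(3) H1_derivD(3)[OF H] by (intro Bochner_Integration.integral_sum[symmetric] L_two_mult) auto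
      moreover have "(\<Sum>e\<in>Basis. J e t x * \<eta>' e x) = flux \<epsilon> t x" for x
      proof (cases "\<epsilon> < \<rho> t x")
        case True
        have "J e t x * \<eta>' e x = (J e t x)\<^sup>2 / \<rho> t x" for e
        proof -
          have "\<eta>' e x = J e t x / \<rho> t x" using True \<epsilon> by (simp add: \<eta>'_def J_def add_divide_distrib)
          then show ?thesis by (simp add: power2_eq_square)
        qed
        then show ?thesis using True by (simp add: flux_def sum_divide_distrib)
      qed (simp add: flux_def \<eta>'_def)
      ultimately show "integrable M (\<lambda>x. \<sigma> (t, x) * (U1 \<epsilon> (\<rho> t x) + \<psi> t x)) \<and>
          (\<integral>x. \<sigma> (t, x) * (U1 \<epsilon> (\<rho> t x) + \<psi> t x) \<partial>M) = - (\<integral>x. flux \<epsilon> t x \<partial>M)"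
        using L_two_mult[OF elim(4) \<eta>L] by (simp add: \<eta>_def)
    qed
  qed
qed

text \<open>\<open>flux\<close> is split into the integrable functions \<open>f1\<close>,
  \<open>f2\<close> and the coefficients \<open>b1\<close>, \<open>b2\<close>, bounded for
  \<epsilon> > 0. Only the coefficients depend on \<epsilon>, and their values at \<epsilon> = 0 are
  their limits.\<close>

definition f1 where "f1 z = (\<Sum>e\<in>Basis. (J e (fst z) (snd z))\<^sup>2)"

definition f2 where "f2 z = (\<Sum>e\<in>Basis. J e (fst z) (snd z) * (g\<psi> (fst z) (snd z) \<bullet> e))"

definition b1 where "b1 \<epsilon> z = (if \<epsilon> < \<rho> (fst z) (snd z) then 1 / \<rho> (fst z) (snd z) else 0)"

definition b2 where "b2 \<epsilon> z = (if \<epsilon> < \<rho> (fst z) (snd z) then 0 else 1 :: real)"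

lemma f_integrable: "integrable (lebesgue_on (I \<times> \<Omega>)) f1" "integrable (lebesgue_on (I \<times> \<Omega>)) f2"
proof -
  show "integrable (lebesgue_on (I \<times> \<Omega>)) f1"
    unfolding f1_def by (intro Bochner_Integration.integrable_sum L_twoD(2)[OF J_L_two])
  obtain B where B: "\<forall>t\<in>{0..T}. \<forall>x\<in>cball 0 R. norm (g\<psi> t x) \<le> B" using g\<psi>_bounded by blast
  show "integrable (lebesgue_on (I \<times> \<Omega>)) f2"
    unfolding f2_def
  proof (rule Bochner_Integration.integrable_sum)
    fix e :: 'a assume e: "e \<in> Basis"
    have "AE z in lebesgue_on (I \<times> \<Omega>). \<bar>g\<psi> (fst z) (snd z) \<bullet> e\<bar> \<le> B"
    proof (rule AE_I2)
      fix z assume "z \<in> space (lebesgue_on (I \<times> \<Omega>))"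
      then have "norm (g\<psi> (fst z) (snd z)) \<le> B" using B by auto
      then show "\<bar>g\<psi> (fst z) (snd z) \<bullet> e\<bar> \<le> B" using Basis_le_norm[OF e, of "g\<psi> (fst z) (snd z)"] by linarith
    qed
    from integrable_mult_bounded[OF L_two_integrable[OF Q(2) J_L_two[OF e]] g\<psi>Q this]
    show "integrable (lebesgue_on (I \<times> \<Omega>)) (\<lambda>z. J e (fst z) (snd z) * (g\<psi> (fst z) (snd z) \<bullet> e))"
      by (simp add: mult.commute)
  qed
qed

lemma \<rho>_measurable_Q: "(\<lambda>z. \<rho> (fst z) (snd z)) \<in> borel_measurable (lebesgue_on (I \<times> \<Omega>))"
  using \<rho>Q(1) by (simp add: case_prod_unfold)

lemma b_measurable: "b1 \<epsilon> \<in> borel_measurable (lebesgue_on (I \<times> \<Omega>))" "b2 \<epsilon> \<in> borel_measurable (lebesgue_on (I \<times> \<Omega>))"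
proof -
  note [measurable] = \<rho>_measurable_Q
  show "b1 \<epsilon> \<in> borel_measurable (lebesgue_on (I \<times> \<Omega>))" "b2 \<epsilon> \<in> borel_measurable (lebesgue_on (I \<times> \<Omega>))"
    unfolding b1_def b2_def by measurable
qed

lemma b_bounded: "0 < \<epsilon> \<Longrightarrow> \<bar>b1 \<epsilon> z\<bar> \<le> 1 / \<epsilon>" "\<bar>b2 \<epsilon> z\<bar> \<le> 1"
  by (auto simp: b1_def b2_def frac_le)

lemma flux_eq: "flux \<epsilon> t x = b1 \<epsilon> (t, x) * f1 (t, x) + b2 \<epsilon> (t, x) * f2 (t, x)"
  by (simp add: flux_def b1_def b2_def f1_def f2_def)

lemma bf_integrable:
  "0 < \<epsilon> \<Longrightarrow> integrable (lebesgue_on (I \<times> \<Omega>)) (\<lambda>z. b1 \<epsilon> z * f1 z)"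
  "integrable (lebesgue_on (I \<times> \<Omega>)) (\<lambda>z. b2 \<epsilon> z * f2 z)"
  by (rule integrable_mult_bounded[OF f_integrable(1) b_measurable(1), of _ "1 / \<epsilon>"], simp add: b_bounded)
    (rule integrable_mult_bounded[OF f_integrable(2) b_measurable(2), of _ 1], simp add: b_bounded)

lemma flux_integrable:
  assumes "0 < \<epsilon>" shows "integrable (lebesgue_on (I \<times> \<Omega>)) (\<lambda>z. flux \<epsilon> (fst z) (snd z))"
  unfolding flux_eq using bf_integrable[of \<epsilon>] assms by simp

text \<open>The primitive of \<open>U1 \<epsilon>\<close> that vanishes at 0: linear up to
  \<epsilon>, and U(s) + \<epsilon>^m beyond.\<close>

definition Ureg where
  "Ureg \<epsilon> s = (if s \<le> \<epsilon> then m / (m - 1) * \<epsilon> powr (m - 1) * s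
     else m / (m - 1) * \<epsilon> powr (m - 1) * \<epsilon> + (s powr m - \<epsilon> powr m) / (m - 1))"

lemma Ureg_deriv:
  assumes \<epsilon>: "0 < \<epsilon>" shows "(Ureg \<epsilon> has_real_derivative U1 \<epsilon> s) (at s)"
proof -
  have "((\<lambda>s. if s \<le> \<epsilon> then m / (m - 1) * \<epsilon> powr (m - 1) * s
     else m / (m - 1) * \<epsilon> powr (m - 1) * \<epsilon> + (s powr m - \<epsilon> powr m) / (m - 1)) has_real_derivative
     (if s \<le> \<epsilon> then m / (m - 1) * \<epsilon> powr (m - 1) else m / (m - 1) * s powr (m - 1))) (at s)"
    by (rule DERIV_piecewise) (use \<epsilon> m in \<open>auto intro!: derivative_eq_intros\<close>)
  moreover have "(if s \<le> \<epsilon> then m / (m - 1) * \<epsilon> powr (m - 1) else m / (m - 1) * s powr (m - 1)) = U1 \<epsilon> s"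
    by (simp add: U1_def max_def)
  ultimately show ?thesis unfolding Ureg_def[abs_def] by (simp only:)
qed

lemma U1_abs_le: "0 < \<epsilon> \<Longrightarrow> \<bar>U1 \<epsilon> s\<bar> \<le> m / (1 - m) * \<epsilon> powr (m - 1)"
proof -
  assume \<epsilon>: "0 < \<epsilon>"
  have "max s \<epsilon> powr (m - 1) \<le> \<epsilon> powr (m - 1)" using \<epsilon> m by (intro powr_mono2') auto
  then have "m / (1 - m) * max s \<epsilon> powr (m - 1) \<le> m / (1 - m) * \<epsilon> powr (m - 1)"
    using m by (intro mult_left_mono) auto
  moreover have "\<bar>U1 \<epsilon> s\<bar> = m / (1 - m) * max s \<epsilon> powr (m - 1)"
    using m by (simp add: U1_def abs_mult)
  ultimately show ?thesis by simp
qed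

text \<open>The derivative m s^(m-2) of U' is decreasing, so on [\<epsilon>, \<infinity>) it is
  largest at \<epsilon>.\<close>

lemma U1_lipschitz:
  assumes \<epsilon>: "0 < \<epsilon>" shows "\<bar>U1 \<epsilon> s - U1 \<epsilon> r\<bar> \<le> m * \<epsilon> powr (m - 2) * \<bar>s - r\<bar>"
proof -
  have "norm (m / (m - 1) * max s \<epsilon> powr (m - 1) - m / (m - 1) * max r \<epsilon> powr (m - 1))
      \<le> m * \<epsilon> powr (m - 2) * norm (max s \<epsilon> - max r \<epsilon>)"
  proof (rule field_differentiable_bound[of "{\<epsilon>..}" "\<lambda>s. m / (m - 1) * s powr (m - 1)" "\<lambda>s. m * s powr (m - 2)"])
    fix z assume "z \<in> {\<epsilon>..}"
    then have z: "\<epsilon> \<le> z" "0 < z" using \<epsilon> by auto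
    have "((\<lambda>s. m / (m - 1) * s powr (m - 1)) has_real_derivative m * z powr (m - 2)) (at z)"
      using z m by (auto intro!: derivative_eq_intros)
    then show "((\<lambda>s. m / (m - 1) * s powr (m - 1)) has_field_derivative m * z powr (m - 2)) (at z within {\<epsilon>..})"
      by (rule has_field_derivative_at_within)
    have "z powr (m - 2) \<le> \<epsilon> powr (m - 2)" using z \<epsilon> m by (intro powr_mono2') auto
    then show "norm (m * z powr (m - 2)) \<le> m * \<epsilon> powr (m - 2)" using m by (simp add: abs_mult)
  qed auto
  also have "\<dots> \<le> m * \<epsilon> powr (m - 2) * \<bar>s - r\<bar>"
    using m by (intro mult_left_mono) (auto simp: max_def)
  finally show ?thesis by (simp add: U1_def)
qed

lemma U1_measurable: "U1 \<epsilon> \<in> borel_measurable borel" unfolding U1_def by measurable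

lemma Ureg_measurable: "Ureg \<epsilon> \<in> borel_measurable borel" unfolding Ureg_def by measurable

text \<open>The difference quotient of \<open>Ureg\<close>; its value on the diagonal keeps it bounded and close to
  the derivative.\<close>

definition dq where
  "dq \<epsilon> r s = (if s = r then U1 \<epsilon> r else (Ureg \<epsilon> s - Ureg \<epsilon> r) / (s - r))"

text \<open>By the mean value theorem the quotient is a value of \<open>U1 \<epsilon>\<close>
  between r and s; both estimates are then those of \<open>U1 \<epsilon>\<close>.\<close>

lemma dq:
  assumes \<epsilon>: "0 < \<epsilon>"
  shows "dq \<epsilon> r s * (s - r) = Ureg \<epsilon> s - Ureg \<epsilon> r"
    and "\<bar>dq \<epsilon> r s\<bar> \<le> m / (1 - m) * \<epsilon> powr (m - 1)"
    and "\<bar>dq \<epsilon> r s - U1 \<epsilon> q\<bar> \<le> m * \<epsilon> powr (m - 2) * (\<bar>s - q\<bar> + \<bar>r - q\<bar>)"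
proof -
  show "dq \<epsilon> r s * (s - r) = Ureg \<epsilon> s - Ureg \<epsilon> r" by (simp add: dq_def)
  have "\<exists>z. dq \<epsilon> r s = U1 \<epsilon> z \<and> min r s \<le> z \<and> z \<le> max r s"
  proof -
    have mv: "\<exists>z. a < z \<and> z < b \<and> (Ureg \<epsilon> b - Ureg \<epsilon> a) / (b - a) = U1 \<epsilon> z" if ab: "a < b" for a b
    proof -
      have "\<exists>z. a < z \<and> z < b \<and> Ureg \<epsilon> b - Ureg \<epsilon> a = (b - a) * U1 \<epsilon> z"
        by (rule MVT2[OF ab Ureg_deriv[OF \<epsilon>]])
      then show ?thesis using ab by auto
    qed
    consider "r = s" | "r < s" | "s < r" by linarith
    then show ?thesis
    proof cases
      case 1
      then show ?thesis by (auto simp: dq_def)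
    next
      case 2
      then show ?thesis using mv[OF 2] by (fastforce simp: dq_def)
    next
      case 3
      have "(Ureg \<epsilon> s - Ureg \<epsilon> r) / (s - r) = (Ureg \<epsilon> r - Ureg \<epsilon> s) / (r - s)"
        by (metis minus_diff_eq minus_divide_divide)
      then show ?thesis using mv[OF 3] 3 by (fastforce simp: dq_def)
    qed
  qed
  then obtain z where z: "dq \<epsilon> r s = U1 \<epsilon> z" "min r s \<le> z" "z \<le> max r s" by blast
  show "\<bar>dq \<epsilon> r s\<bar> \<le> m / (1 - m) * \<epsilon> powr (m - 1)" unfolding z(1) by (rule U1_abs_le[OF \<epsilon>])
  have "\<bar>dq \<epsilon> r s - U1 \<epsilon> q\<bar> \<le> m * \<epsilon> powr (m - 2) * \<bar>z - q\<bar>" unfolding z(1) by (rule U1_lipschitz[OF \<epsilon>])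
  also have "\<dots> \<le> m * \<epsilon> powr (m - 2) * (\<bar>s - q\<bar> + \<bar>r - q\<bar>)"
    using m z by (intro mult_left_mono) auto
  finally show "\<bar>dq \<epsilon> r s - U1 \<epsilon> q\<bar> \<le> m * \<epsilon> powr (m - 2) * (\<bar>s - q\<bar> + \<bar>r - q\<bar>)" .
qed

definition Freg where
  "Freg \<epsilon> t = (\<integral>x. Ureg \<epsilon> (\<rho> t x) \<partial>M) + (\<integral>x. V x * \<rho> t x \<partial>M) + 1 / 2 * (\<integral>x. \<rho> t x * interaction R K (\<rho> t) x \<partial>M)"

text \<open>Arranged so that the energy increment is exactly the integral of \<open>avg\<close>
  times the increment of \<rho>. For a symmetric bilinear form B one has B(b,b)/2 - B(a,a)/2 =
  B((a+b)/2, b-a), whence the mean of the two interaction potentials.\<close>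

definition avg where
  "avg \<epsilon> s t x = dq \<epsilon> (\<rho> s x) (\<rho> t x) + V x + (interaction R K (\<rho> t) x + interaction R K (\<rho> s) x) / 2"

lemma avg_measurable:
  assumes "s \<in> {0..T}" "t \<in> {0..T}" shows "avg \<epsilon> s t \<in> borel_measurable M"
proof -
  note [measurable] = V(1) interaction_measurable[OF assms(1)] interaction_measurable[OF assms(2)]
    borel_measurable_integrable[OF \<rho>_integrable[OF assms(1)]] borel_measurable_integrable[OF \<rho>_integrable[OF assms(2)]]
    U1_measurable Ureg_measurable
  show ?thesis unfolding avg_def dq_def by measurable
qed

lemma interaction_bounded: "\<exists>B. \<forall>t\<in>{0..T}. AE x in M. \<bar>interaction R K (\<rho> t) x\<bar> \<le> B"
proof -
  obtain B where B: "\<forall>t\<in>{0..T}. AE x in M. \<bar>\<psi> t x\<bar> \<le> B" using \<psi>_bounded by blast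
  have "AE x in M. \<bar>interaction R K (\<rho> t) x\<bar> \<le> B + CV" if "t \<in> {0..T}" for t
    using B[rule_format, OF that] V(2) by eventually_elim (simp add: \<psi>_def)
  then show ?thesis by blast
qed

lemma avg_bounded:
  assumes st: "s \<in> {0..T}" "t \<in> {0..T}" and \<epsilon>: "0 < \<epsilon>"
  shows "\<exists>B. AE x in M. \<bar>avg \<epsilon> s t x\<bar> \<le> B"
proof -
  obtain B where B: "\<forall>t\<in>{0..T}. AE x in M. \<bar>interaction R K (\<rho> t) x\<bar> \<le> B" using interaction_bounded by blast
  have "AE x in M. \<bar>avg \<epsilon> s t x\<bar> \<le> m / (1 - m) * \<epsilon> powr (m - 1) + CV + B"
    using B[rule_format, OF st(1)] B[rule_format, OF st(2)] V(2)
  proof eventually_elim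
    case (elim x)
    have "\<bar>d + v + (i + j) / 2\<bar> \<le> D + W + B'" if "\<bar>d\<bar> \<le> D" "\<bar>v\<bar> \<le> W" "\<bar>i\<bar> \<le> B'" "\<bar>j\<bar> \<le> B'" for d v i j D W B' :: real
      using that by (simp add: abs_le_iff field_simps)
    from this[OF dq(2)[OF \<epsilon>, of "\<rho> s x" "\<rho> t x"] elim(3) elim(2) elim(1)] show ?case unfolding avg_def .
  qed
  then show ?thesis by blast
qed

lemma Freg_increment:
  assumes st: "s \<in> {0..T}" "t \<in> {0..T}" and \<epsilon>: "0 < \<epsilon>"
  shows "Freg \<epsilon> t - Freg \<epsilon> s = (\<integral>x. avg \<epsilon> s t x * (\<rho> t x - \<rho> s x) \<partial>M)"
proof -
  note \<rho>s = \<rho>_integrable[OF st(1)] and \<rho>t = \<rho>_integrable[OF st(2)]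
  have Ui: "integrable M (\<lambda>x. Ureg \<epsilon> (\<rho> r x))" if r: "r \<in> {0..T}" for r
  proof (rule Bochner_Integration.integrable_bound)
    show "integrable M (\<lambda>x. m / (1 - m) * \<epsilon> powr (m - 1) * \<rho> r x)" using \<rho>_integrable[OF r] by simp
    show "(\<lambda>x. Ureg \<epsilon> (\<rho> r x)) \<in> borel_measurable M"
      using borel_measurable_integrable[OF \<rho>_integrable[OF r]] Ureg_measurable by measurable
    have "\<bar>Ureg \<epsilon> q\<bar> \<le> m / (1 - m) * \<epsilon> powr (m - 1) * \<bar>q\<bar>" for q
    proof -
      have "Ureg \<epsilon> 0 = 0" using \<epsilon> by (simp add: Ureg_def)
      then have "\<bar>Ureg \<epsilon> q\<bar> = \<bar>dq \<epsilon> 0 q\<bar> * \<bar>q\<bar>" using dq(1)[OF \<epsilon>, of 0 q] by (simp add: abs_mult[symmetric])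
      then show ?thesis using mult_right_mono[OF dq(2)[OF \<epsilon>, of 0 q], of "\<bar>q\<bar>"] by simp
    qed
    then show "AE x in M. norm (Ureg \<epsilon> (\<rho> r x)) \<le> norm (m / (1 - m) * \<epsilon> powr (m - 1) * \<rho> r x)"
      using m by (intro AE_I2) (simp add: abs_mult)
  qed
  have Vi: "integrable M (\<lambda>x. V x * \<rho> r x)" if "r \<in> {0..T}" for r
    by (rule integrable_mult_bounded[OF \<rho>_integrable[OF that] V])
  note sy = interaction_symmetric[OF K]
  have ii: "integrable M (\<lambda>x. \<rho> a x * interaction R K (\<rho> b) x)" if "a \<in> {0..T}" "b \<in> {0..T}" for a b
    by (rule sy(2)[OF \<rho>_integrable[OF that(1)] \<rho>_integrable[OF that(2)]])
  have eq: "avg \<epsilon> s t x * (\<rho> t x - \<rho> s x) = (Ureg \<epsilon> (\<rho> t x) - Ureg \<epsilon> (\<rho> s x)) + (V x * \<rho> t x - V x * \<rho> s x) +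
      (1 / 2 * (\<rho> t x * interaction R K (\<rho> t) x + \<rho> t x * interaction R K (\<rho> s) x)
       - 1 / 2 * (\<rho> s x * interaction R K (\<rho> t) x + \<rho> s x * interaction R K (\<rho> s) x))" for x
    unfolding avg_def distrib_right dq(1)[OF \<epsilon>] by (simp add: field_simps)
  have "(\<integral>x. avg \<epsilon> s t x * (\<rho> t x - \<rho> s x) \<partial>M) =
      ((\<integral>x. Ureg \<epsilon> (\<rho> t x) \<partial>M) - (\<integral>x. Ureg \<epsilon> (\<rho> s x) \<partial>M)) + ((\<integral>x. V x * \<rho> t x \<partial>M) - (\<integral>x. V x * \<rho> s x \<partial>M)) +
      (1 / 2 * ((\<integral>x. \<rho> t x * interaction R K (\<rho> t) x \<partial>M) + (\<integral>x. \<rho> t x * interaction R K (\<rho> s) x \<partial>M))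
       - 1 / 2 * ((\<integral>x. \<rho> s x * interaction R K (\<rho> t) x \<partial>M) + (\<integral>x. \<rho> s x * interaction R K (\<rho> s) x \<partial>M)))"
    unfolding eq using Ui[OF st(1)] Ui[OF st(2)] Vi[OF st(1)] Vi[OF st(2)]
      ii[OF st(1,1)] ii[OF st(1,2)] ii[OF st(2,1)] ii[OF st(2,2)] by simp
  \<comment> \<open>By symmetry the two mixed terms cancel.\<close>
  also have "(\<integral>x. \<rho> t x * interaction R K (\<rho> s) x \<partial>M) = (\<integral>x. \<rho> s x * interaction R K (\<rho> t) x \<partial>M)"
    by (rule sy(1)[OF \<rho>t \<rho>s])
  finally show ?thesis by (simp add: Freg_def add_divide_distrib)
qed

end

section \<open>The chain rule in time\<close>

lemma abs_integral_diff_le: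
  fixes f g h :: "'a \<Rightarrow> real"
  assumes "integrable M f" "integrable M g" "integrable M h" "AE x in M. \<bar>f x - g x\<bar> \<le> e * h x"
  shows "\<bar>integral\<^sup>L M f - integral\<^sup>L M g\<bar> \<le> e * integral\<^sup>L M h"
proof -
  have "\<bar>\<integral>x. f x - g x \<partial>M\<bar> \<le> (\<integral>x. \<bar>f x - g x\<bar> \<partial>M)" by (rule integral_abs_bound)
  also have "\<dots> \<le> (\<integral>x. e * h x \<partial>M)" using assms by (intro integral_mono_AE) auto
  finally show ?thesis using assms by simp
qed

context aggregation_diffusion
begin

text \<open>The first two terms come from the Lipschitz bound on \<open>U1 \<epsilon>\<close>, one
  for each end of the interval. The interaction part is bounded pointwise by an L^1 distance, which
  is small by continuity in time.\<close>

lemma avg_close: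
  assumes st: "s \<in> {0..T}" "t \<in> {0..T}" "r \<in> {0..T}" and \<epsilon>: "0 < \<epsilon>"
    and \<omega>: "(\<integral>y. \<bar>\<rho> t y - \<rho> r y\<bar> \<partial>M) \<le> \<omega>" "(\<integral>y. \<bar>\<rho> s y - \<rho> r y\<bar> \<partial>M) \<le> \<omega>"
  shows "AE x in M. \<bar>avg \<epsilon> s t x - (U1 \<epsilon> (\<rho> r x) + \<psi> r x)\<bar> \<le>
    m * \<epsilon> powr (m - 2) * \<bar>\<rho> t x - \<rho> r x\<bar> + m * \<epsilon> powr (m - 2) * \<bar>\<rho> s x - \<rho> r x\<bar> + \<bar>CK\<bar> * \<omega>"
proof -
  have le: "CK * a \<le> \<bar>CK\<bar> * \<omega>" if "0 \<le> a" "a \<le> \<omega>" for a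
  proof -
    have "CK * a \<le> \<bar>CK\<bar> * a" using that(1) by (intro mult_right_mono) auto
    also have "\<dots> \<le> \<bar>CK\<bar> * \<omega>" using that(2) by (intro mult_left_mono) auto
    finally show ?thesis .
  qed
  have w: "CK * (\<integral>y. \<bar>\<rho> t y - \<rho> r y\<bar> \<partial>M) \<le> \<bar>CK\<bar> * \<omega>" "CK * (\<integral>y. \<bar>\<rho> s y - \<rho> r y\<bar> \<partial>M) \<le> \<bar>CK\<bar> * \<omega>"
    using \<omega> by (auto intro!: le)
  show ?thesis
    using interaction_le[OF st(2,3)] interaction_le[OF st(1,3)]
  proof eventually_elim
    case (elim x)
    have "\<bar>d + v + (i + j) / 2 - (u + (v + k))\<bar> \<le> A + B + E" if "\<bar>d - u\<bar> \<le> A + B" "\<bar>i - k\<bar> \<le> E" "\<bar>j - k\<bar> \<le> E"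
      for d u v i j k A B E :: real
      using that by (simp add: abs_le_iff field_simps)
    from this[of "dq \<epsilon> (\<rho> s x) (\<rho> t x)" "U1 \<epsilon> (\<rho> r x)"] show ?case
      unfolding avg_def \<psi>_def
      using dq(3)[OF \<epsilon>, of "\<rho> s x" "\<rho> t x" "\<rho> r x"] order_trans[OF elim(1) w(1)] order_trans[OF elim(2) w(2)]
      by (simp add: distrib_left)
  qed
qed

text \<open>The summand 2 |C| stems from \<open>increment_square_le\<close>; the volume of the ball
  stems from the term in which a constant is paired with \<open>\<sigma>\<close>.\<close>

definition c0 where "c0 = 2 * \<bar>C\<bar> + (\<integral>x. 1 \<partial>M)"

text \<open>Interpolation between L^1 and L^\<infinity>: increments of \<rho> are bounded by 2 |C|.
  An L^1 distance of order k^2 thus gives an L^2 distance of order k, the form that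
  \<open>weighted_integral_le\<close> takes.\<close>

lemma increment_square_le:
  assumes st: "t \<in> {0..T}" "r \<in> {0..T}" and k: "(\<integral>y. \<bar>\<rho> t y - \<rho> r y\<bar> \<partial>M) \<le> k\<^sup>2"
  shows "(\<integral>x. (\<rho> t x - \<rho> r x)\<^sup>2 \<partial>M) \<le> k\<^sup>2 * (2 * \<bar>C\<bar>)"
proof -
  have L: "L_two \<Omega> (\<lambda>x. \<rho> t x - \<rho> r x)" by (rule L_two_diff[OF \<rho>_L_two[OF st(1)] \<rho>_L_two[OF st(2)]])
  have "(\<integral>x. (\<rho> t x - \<rho> r x)\<^sup>2 \<partial>M) \<le> (\<integral>x. 2 * \<bar>C\<bar> * \<bar>\<rho> t x - \<rho> r x\<bar> \<partial>M)"
  proof (rule integral_mono_AE[OF L_twoD(2)[OF L]])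
    show "integrable M (\<lambda>x. 2 * \<bar>C\<bar> * \<bar>\<rho> t x - \<rho> r x\<bar>)"
      using \<rho>_integrable[OF st(1)] \<rho>_integrable[OF st(2)] by simp
    show "AE x in M. (\<rho> t x - \<rho> r x)\<^sup>2 \<le> 2 * \<bar>C\<bar> * \<bar>\<rho> t x - \<rho> r x\<bar>"
      using \<rho>_abs_le[OF st(1)] \<rho>_abs_le[OF st(2)]
    proof eventually_elim
      case (elim x)
      then have "\<bar>\<rho> t x - \<rho> r x\<bar> \<le> 2 * \<bar>C\<bar>" by linarith
      then have "\<bar>\<rho> t x - \<rho> r x\<bar> * \<bar>\<rho> t x - \<rho> r x\<bar> \<le> 2 * \<bar>C\<bar> * \<bar>\<rho> t x - \<rho> r x\<bar>"
        by (intro mult_right_mono) auto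
      then show ?case by (simp add: power2_eq_square)
    qed
  qed
  also have "\<dots> = 2 * \<bar>C\<bar> * (\<integral>x. \<bar>\<rho> t x - \<rho> r x\<bar> \<partial>M)" by simp
  also have "\<dots> \<le> 2 * \<bar>C\<bar> * k\<^sup>2" using k by (intro mult_left_mono) auto
  finally show ?thesis by (simp add: mult.commute)
qed

text \<open>The pointwise bound of \<open>avg_close\<close> is integrated against |\<sigma>|. Each
  of its three terms is at most a constant times k times (norm of \<sigma> squared +
  \<open>c0\<close>): a relative error with a weight integrable in time, though no bound on \<sigma>
  uniform in time is at hand.\<close>

lemma approximate_derivative:
  assumes st: "s \<in> {0..T}" "t \<in> {0..T}" "r \<in> {0..T}" and \<epsilon>: "0 < \<epsilon>" and k: "0 < k" "k \<le> 1"
    and \<omega>: "(\<integral>y. \<bar>\<rho> t y - \<rho> r y\<bar> \<partial>M) \<le> k\<^sup>2" "(\<integral>y. \<bar>\<rho> s y - \<rho> r y\<bar> \<partial>M) \<le> k\<^sup>2"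
    and \<sigma>L: "L_two \<Omega> (\<lambda>x. \<sigma> (r, x))" and i: "integrable M (\<lambda>x. \<sigma> (r, x) * (U1 \<epsilon> (\<rho> r x) + \<psi> r x))"
  shows "\<bar>(\<integral>x. avg \<epsilon> s t x * \<sigma> (r, x) \<partial>M) - (\<integral>x. \<sigma> (r, x) * (U1 \<epsilon> (\<rho> r x) + \<psi> r x) \<partial>M)\<bar> \<le>
    k * (2 * (m * \<epsilon> powr (m - 2)) + \<bar>CK\<bar>) * ((\<integral>x. (\<sigma> (r, x))\<^sup>2 \<partial>M) + c0)"
proof -
  define L where "L = m * \<epsilon> powr (m - 2)"
  define S where "S = (\<integral>x. (\<sigma> (r, x))\<^sup>2 \<partial>M)"
  define p where "p x = \<rho> t x - \<rho> r x" for x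
  define q where "q x = \<rho> s x - \<rho> r x" for x
  have L0: "0 \<le> L" using m by (simp add: L_def)
  have vol: "0 \<le> (\<integral>x. (1::real) \<partial>M)" by simp
  have pL: "L_two \<Omega> p" unfolding p_def by (rule L_two_diff[OF \<rho>_L_two[OF st(2)] \<rho>_L_two[OF st(3)]])
  have qL: "L_two \<Omega> q" unfolding q_def by (rule L_two_diff[OF \<rho>_L_two[OF st(1)] \<rho>_L_two[OF st(3)]])
  have kL: "L_two \<Omega> (\<lambda>x. k)" by (rule L_two_bounded[OF \<Omega>(1), where C = "\<bar>k\<bar>"]) auto
  have \<sigma>i: "integrable M (\<lambda>x. \<sigma> (r, x))" by (rule L_two_integrable[OF \<Omega>(1) \<sigma>L])
  obtain B where B: "AE x in M. \<bar>avg \<epsilon> s t x\<bar> \<le> B" using avg_bounded[OF st(1,2) \<epsilon>] by blast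
  have ai: "integrable M (\<lambda>x. avg \<epsilon> s t x * \<sigma> (r, x))"
    by (rule integrable_mult_bounded[OF \<sigma>i avg_measurable[OF st(1,2)] B])
  have 1: "(\<integral>x. \<bar>\<sigma> (r, x)\<bar> * \<bar>p x\<bar> \<partial>M) \<le> k * (S + c0)"
  proof -
    have "(\<integral>x. \<bar>\<sigma> (r, x)\<bar> * \<bar>p x\<bar> \<partial>M) \<le> k * (S + 2 * \<bar>C\<bar>)"
      unfolding S_def p_def by (rule weighted_integral_le[OF \<sigma>L pL[unfolded p_def] k(1) increment_square_le[OF st(2,3) \<omega>(1)]])
    also have "\<dots> \<le> k * (S + c0)" using k vol by (intro mult_left_mono) (auto simp: c0_def)
    finally show ?thesis .
  qed
  have 2: "(\<integral>x. \<bar>\<sigma> (r, x)\<bar> * \<bar>q x\<bar> \<partial>M) \<le> k * (S + c0)"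
  proof -
    have "(\<integral>x. \<bar>\<sigma> (r, x)\<bar> * \<bar>q x\<bar> \<partial>M) \<le> k * (S + 2 * \<bar>C\<bar>)"
      unfolding S_def q_def by (rule weighted_integral_le[OF \<sigma>L qL[unfolded q_def] k(1) increment_square_le[OF st(1,3) \<omega>(2)]])
    also have "\<dots> \<le> k * (S + c0)" using k vol by (intro mult_left_mono) (auto simp: c0_def)
    finally show ?thesis .
  qed
  \<comment> \<open>\<open>weighted_integral_le\<close> with the constant function k handles one
    factor k; the other is bounded by 1.\<close>
  have 3: "k\<^sup>2 * (\<integral>x. \<bar>\<sigma> (r, x)\<bar> \<partial>M) \<le> k * (S + c0)"
  proof -
    have "(\<integral>x. \<bar>\<sigma> (r, x)\<bar> * \<bar>k\<bar> \<partial>M) \<le> k * (S + (\<integral>x. 1 \<partial>M))"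
      unfolding S_def by (rule weighted_integral_le[OF \<sigma>L kL k(1)]) simp
    then have "k * (\<integral>x. \<bar>\<sigma> (r, x)\<bar> \<partial>M) \<le> k * (S + (\<integral>x. 1 \<partial>M))" using k by (simp add: mult.commute)
    then have "k * (k * (\<integral>x. \<bar>\<sigma> (r, x)\<bar> \<partial>M)) \<le> 1 * (k * (S + (\<integral>x. 1 \<partial>M)))"
      using k by (intro mult_mono) auto
    also have "\<dots> \<le> k * (S + c0)" using k by (simp add: c0_def)
    finally show ?thesis by (simp add: power2_eq_square)
  qed
  have "\<bar>(\<integral>x. avg \<epsilon> s t x * \<sigma> (r, x) \<partial>M) - (\<integral>x. \<sigma> (r, x) * (U1 \<epsilon> (\<rho> r x) + \<psi> r x) \<partial>M)\<bar> =
      \<bar>\<integral>x. avg \<epsilon> s t x * \<sigma> (r, x) - \<sigma> (r, x) * (U1 \<epsilon> (\<rho> r x) + \<psi> r x) \<partial>M\<bar>" using ai i by simp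
  also have "\<dots> \<le> (\<integral>x. \<bar>avg \<epsilon> s t x * \<sigma> (r, x) - \<sigma> (r, x) * (U1 \<epsilon> (\<rho> r x) + \<psi> r x)\<bar> \<partial>M)"
    by (rule integral_abs_bound)
  also have "\<dots> \<le> (\<integral>x. L * (\<bar>\<sigma> (r, x)\<bar> * \<bar>p x\<bar>) + L * (\<bar>\<sigma> (r, x)\<bar> * \<bar>q x\<bar>) + \<bar>CK\<bar> * k\<^sup>2 * \<bar>\<sigma> (r, x)\<bar> \<partial>M)"
  proof (rule integral_mono_AE)
    show "integrable M (\<lambda>x. \<bar>avg \<epsilon> s t x * \<sigma> (r, x) - \<sigma> (r, x) * (U1 \<epsilon> (\<rho> r x) + \<psi> r x)\<bar>)" using ai i by simp
    show "integrable M (\<lambda>x. L * (\<bar>\<sigma> (r, x)\<bar> * \<bar>p x\<bar>) + L * (\<bar>\<sigma> (r, x)\<bar> * \<bar>q x\<bar>) + \<bar>CK\<bar> * k\<^sup>2 * \<bar>\<sigma> (r, x)\<bar>)"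
      using integrable_abs[OF L_two_mult[OF \<sigma>L pL]] integrable_abs[OF L_two_mult[OF \<sigma>L qL]] \<sigma>i
      by (simp add: abs_mult)
    show "AE x in M. \<bar>avg \<epsilon> s t x * \<sigma> (r, x) - \<sigma> (r, x) * (U1 \<epsilon> (\<rho> r x) + \<psi> r x)\<bar> \<le>
        L * (\<bar>\<sigma> (r, x)\<bar> * \<bar>p x\<bar>) + L * (\<bar>\<sigma> (r, x)\<bar> * \<bar>q x\<bar>) + \<bar>CK\<bar> * k\<^sup>2 * \<bar>\<sigma> (r, x)\<bar>"
      using avg_close[OF st \<epsilon> \<omega>]
    proof eventually_elim
      case (elim x)
      have "\<bar>avg \<epsilon> s t x * \<sigma> (r, x) - \<sigma> (r, x) * (U1 \<epsilon> (\<rho> r x) + \<psi> r x)\<bar> =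
          \<bar>avg \<epsilon> s t x - (U1 \<epsilon> (\<rho> r x) + \<psi> r x)\<bar> * \<bar>\<sigma> (r, x)\<bar>"
        unfolding abs_mult[symmetric] by (simp add: algebra_simps)
      also have "\<dots> \<le> (L * \<bar>p x\<bar> + L * \<bar>q x\<bar> + \<bar>CK\<bar> * k\<^sup>2) * \<bar>\<sigma> (r, x)\<bar>"
        using elim by (intro mult_right_mono) (auto simp: L_def p_def q_def)
      finally show ?case by (simp add: algebra_simps)
    qed
  qed
  also have "\<dots> = L * (\<integral>x. \<bar>\<sigma> (r, x)\<bar> * \<bar>p x\<bar> \<partial>M) + L * (\<integral>x. \<bar>\<sigma> (r, x)\<bar> * \<bar>q x\<bar> \<partial>M) + \<bar>CK\<bar> * (k\<^sup>2 * (\<integral>x. \<bar>\<sigma> (r, x)\<bar> \<partial>M))"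
    using integrable_abs[OF L_two_mult[OF \<sigma>L pL]] integrable_abs[OF L_two_mult[OF \<sigma>L qL]] \<sigma>i
    by (simp add: abs_mult)
  also have "\<dots> \<le> L * (k * (S + c0)) + L * (k * (S + c0)) + \<bar>CK\<bar> * (k * (S + c0))"
    using 1 2 3 L0 by (intro add_mono mult_left_mono) auto
  also have "\<dots> = k * (2 * L + \<bar>CK\<bar>) * (S + c0)" by (simp add: algebra_simps)
  finally show ?thesis by (simp add: L_def S_def)
qed

text \<open>On a short interval the increment is the integral of \<open>avg\<close> against
  \<open>\<sigma>\<close>; replacing \<open>avg\<close> by the regularized potential at the running
  time gives minus the flux by \<open>tested_equation\<close>. The error is e times the integral of
  an integrable weight, which \<open>integral_of_approximate_derivative\<close> removes.\<close>

lemma Freg_dissipation: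
  assumes \<epsilon>: "0 < \<epsilon>" and st: "0 \<le> s" "s \<le> t" "t \<le> T"
  shows "Freg \<epsilon> t - Freg \<epsilon> s = (\<integral>r. - (\<integral>x. flux \<epsilon> r x \<partial>M) \<partial>lebesgue_on {s<..<t})"
proof (rule integral_of_approximate_derivative[OF _ _ _ st])
  note FF = lebesgue_on_Times_Fubini[OF I(1) \<Omega>(3) flux_integrable[OF \<epsilon>], simplified]
  show Di: "integrable (lebesgue_on I) (\<lambda>r. - (\<integral>x. flux \<epsilon> r x \<partial>M))" using FF(2) by simp
  have S2i: "integrable (lebesgue_on I) (\<lambda>r. \<integral>x. (\<sigma> (r, x))\<^sup>2 \<partial>M)"
    by (rule lebesgue_on_Times_Fubini(2)[OF I(1) \<Omega>(3) L_twoD(2)[OF \<sigma>(2)]])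
  have Il: "I \<in> lmeasurable" by auto
  show Wi: "integrable (lebesgue_on I) (\<lambda>r. (\<integral>x. (\<sigma> (r, x))\<^sup>2 \<partial>M) + c0)"
    using S2i integrable_const_lebesgue_on[OF Il, of c0] by simp
  fix e :: real assume e: "0 < e"
  define L where "L = 2 * (m * \<epsilon> powr (m - 2)) + \<bar>CK\<bar>"
  have L0: "0 \<le> L" using m by (simp add: L_def)
  \<comment> \<open>Makes k L at most e and k at most 1; k^2 is the oscillation of \<rho> in L^1
    allowed over an interval of length \<delta>.\<close>
  define k where "k = min 1 (e / (L + 1))"
  have k: "0 < k" "k \<le> 1" using e L0 by (auto simp: k_def)
  have kL: "k * L \<le> e"
  proof -
    have "k * L \<le> e / (L + 1) * (L + 1)" using k L0 by (intro mult_mono) (auto simp: k_def)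
    then show ?thesis using L0 by simp
  qed
  have "0 < k\<^sup>2" using k by simp
  then have "\<exists>\<delta>>0. \<forall>s\<in>{0..T}. \<forall>t\<in>{0..T}. \<bar>s - t\<bar> < \<delta> \<longrightarrow> (\<integral>x. \<bar>\<rho> s x - \<rho> t x\<bar> \<partial>M) < k\<^sup>2"
    by (rule C_L1_uniform[OF CL1]) blast
  then obtain \<delta> where \<delta>: "0 < \<delta>" and "\<forall>s\<in>{0..T}. \<forall>t\<in>{0..T}. \<bar>s - t\<bar> < \<delta> \<longrightarrow> (\<integral>x. \<bar>\<rho> s x - \<rho> t x\<bar> \<partial>M) < k\<^sup>2"
    by blast
  then have close: "(\<integral>x. \<bar>\<rho> s x - \<rho> t x\<bar> \<partial>M) < k\<^sup>2" if "s \<in> {0..T}" "t \<in> {0..T}" "\<bar>s - t\<bar> < \<delta>" for s t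
    using that by blast
  show "\<exists>\<delta>>0. \<forall>s t. 0 \<le> s \<and> s \<le> t \<and> t \<le> T \<and> t - s < \<delta> \<longrightarrow>
      \<bar>Freg \<epsilon> t - Freg \<epsilon> s - (\<integral>r. - (\<integral>x. flux \<epsilon> r x \<partial>M) \<partial>lebesgue_on {s<..<t})\<bar>
      \<le> e * (\<integral>r. (\<integral>x. (\<sigma> (r, x))\<^sup>2 \<partial>M) + c0 \<partial>lebesgue_on {s<..<t})"
  proof (intro exI[of _ \<delta>] conjI \<delta> allI impI, elim conjE)
    fix s t assume st: "0 \<le> s" "s \<le> t" "t \<le> T" "t - s < \<delta>"
    have s_in: "s \<in> {0..T}" and t_in: "t \<in> {0..T}" using st by auto
    let ?J = "{s<..<t}"
    have JI: "?J \<subseteq> I" using st by auto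
    have Jm: "?J \<in> sets lebesgue" by simp
    obtain B where B: "AE x in M. \<bar>avg \<epsilon> s t x\<bar> \<le> B" using avg_bounded[OF s_in t_in \<epsilon>] by blast
    note inc = time_increment_integral[OF \<Omega>(4,5) CL1 \<sigma> st(1-3) avg_measurable[OF s_in t_in] B]
    note DJ = integrable_lebesgue_on_subset[OF Di I(3) _ JI]
    note WJ = integrable_lebesgue_on_subset[OF Wi I(3) _ JI]
    have "AE r in lebesgue_on I. r \<in> I" by (rule AE_I2) simp
    then have "AE r in lebesgue_on I. r \<in> I \<and> L_two \<Omega> (\<lambda>x. \<sigma> (r, x)) \<and>
        integrable M (\<lambda>x. \<sigma> (r, x) * (U1 \<epsilon> (\<rho> r x) + \<psi> r x)) \<and>
        (\<integral>x. \<sigma> (r, x) * (U1 \<epsilon> (\<rho> r x) + \<psi> r x) \<partial>M) = - (\<integral>x. flux \<epsilon> r x \<partial>M)"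
      using tested_equation L_two_slice[OF I(1,2) \<Omega>(3,5) \<sigma>(2)]
      by eventually_elim (use \<epsilon> in blast)
    from AE_lebesgue_on_subset[OF this I(3) _ JI]
    have aeJ: "AE r in lebesgue_on ?J. r \<in> I \<and> L_two \<Omega> (\<lambda>x. \<sigma> (r, x)) \<and>
        integrable M (\<lambda>x. \<sigma> (r, x) * (U1 \<epsilon> (\<rho> r x) + \<psi> r x)) \<and>
        (\<integral>x. \<sigma> (r, x) * (U1 \<epsilon> (\<rho> r x) + \<psi> r x) \<partial>M) = - (\<integral>x. flux \<epsilon> r x \<partial>M)" by simp
    have "AE r in lebesgue_on ?J. r \<in> ?J" by (rule AE_I2) simp
    with aeJ have bnd: "AE r in lebesgue_on ?J. \<bar>(\<integral>x. avg \<epsilon> s t x * \<sigma> (r, x) \<partial>M) - (- (\<integral>x. flux \<epsilon> r x \<partial>M))\<bar>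
        \<le> e * ((\<integral>x. (\<sigma> (r, x))\<^sup>2 \<partial>M) + c0)"
    proof eventually_elim
      case (elim r)
      have r: "r \<in> {0..T}" using elim(1) by auto
      have d: "(\<integral>y. \<bar>\<rho> t y - \<rho> r y\<bar> \<partial>M) \<le> k\<^sup>2" "(\<integral>y. \<bar>\<rho> s y - \<rho> r y\<bar> \<partial>M) \<le> k\<^sup>2"
        using close[OF t_in r] close[OF s_in r] elim(2) st(4) by auto
      have "\<bar>(\<integral>x. avg \<epsilon> s t x * \<sigma> (r, x) \<partial>M) - (- (\<integral>x. flux \<epsilon> r x \<partial>M))\<bar>
          \<le> k * L * ((\<integral>x. (\<sigma> (r, x))\<^sup>2 \<partial>M) + c0)"
        using approximate_derivative[OF s_in t_in r \<epsilon> k d] elim(1) by (simp add: L_def)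
      also have "\<dots> \<le> e * ((\<integral>x. (\<sigma> (r, x))\<^sup>2 \<partial>M) + c0)"
        using kL by (intro mult_right_mono) (auto simp: c0_def)
      finally show ?case .
    qed
    have "Freg \<epsilon> t - Freg \<epsilon> s = (\<integral>r. (\<integral>x. avg \<epsilon> s t x * \<sigma> (r, x) \<partial>M) \<partial>lebesgue_on ?J)"
      using Freg_increment[OF s_in t_in \<epsilon>] inc by simp
    then show "\<bar>Freg \<epsilon> t - Freg \<epsilon> s - (\<integral>r. - (\<integral>x. flux \<epsilon> r x \<partial>M) \<partial>lebesgue_on ?J)\<bar>
      \<le> e * (\<integral>r. (\<integral>x. (\<sigma> (r, x))\<^sup>2 \<partial>M) + c0 \<partial>lebesgue_on ?J)"
      using abs_integral_diff_le[OF inc(2) DJ[OF Jm] WJ[OF Jm] bnd] by (simp only:)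
  qed
qed

section \<open>Removing the regularization\<close>

lemma Freg_tendsto:
  assumes t: "t \<in> {0..T}"
  shows "(\<lambda>n. Freg (1 / (real n + 1)) t) \<longlonglongrightarrow> free_energy m R V K (\<rho> t)"
proof -
  have \<rho>m[measurable]: "\<rho> t \<in> borel_measurable M" by (rule borel_measurable_integrable[OF \<rho>_integrable[OF t]])
  note [measurable] = Ureg_measurable
  \<comment> \<open>For s > \<epsilon> the difference is exactly \<epsilon>^m. For s \<le>
    \<epsilon> it is (s^m - m \<epsilon>^(m-1) s) / (1 - m), with s^m at most \<epsilon>^m and the
    other term at most m \<epsilon>^m. Hence U_\<epsilon> converges to U uniformly on the
    half-line.\<close>
  have bd: "\<bar>Ureg \<epsilon> s - s powr m / (m - 1)\<bar> \<le> (1 + m) / (1 - m) * \<epsilon> powr m" if \<epsilon>: "0 < \<epsilon>" and s: "0 \<le> s" for \<epsilon> s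
  proof -
    have ee: "\<epsilon> powr (m - 1) * \<epsilon> = \<epsilon> powr m" using \<epsilon> by (simp add: powr_mult_base mult.commute[of _ \<epsilon>])
    have neg: "m / (m - 1) = - (m / (1 - m))" "\<And>a. a / (m - 1) = - (a / (1 - m))"
      by (metis minus_diff_eq minus_divide_right)+
    show ?thesis
    proof (cases "s \<le> \<epsilon>")
      case True
      have "\<epsilon> powr (m - 1) * s \<le> \<epsilon> powr (m - 1) * \<epsilon>" using True by (intro mult_left_mono) auto
      then have 1: "0 \<le> \<epsilon> powr (m - 1) * s" "\<epsilon> powr (m - 1) * s \<le> \<epsilon> powr m" using ee s by auto
      have 2: "0 \<le> s powr m" "s powr m \<le> \<epsilon> powr m" using True s m by (auto intro: powr_mono2)
      have "(1 - m) * \<bar>Ureg \<epsilon> s - s powr m / (m - 1)\<bar> = \<bar>(1 - m) * (Ureg \<epsilon> s - s powr m / (m - 1))\<bar>"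
        using m by (simp add: abs_mult)
      also have "(1 - m) * (Ureg \<epsilon> s - s powr m / (m - 1)) = s powr m - m * (\<epsilon> powr (m - 1) * s)"
        using True m by (simp add: Ureg_def neg right_diff_distrib)
      also have "\<bar>s powr m - m * (\<epsilon> powr (m - 1) * s)\<bar> \<le> s powr m + m * (\<epsilon> powr (m - 1) * s)"
        using 1 2 m by (simp add: abs_le_iff)
      also have "\<dots> \<le> \<epsilon> powr m + m * \<epsilon> powr m" using 1 2 m by (intro add_mono mult_left_mono) auto
      finally show ?thesis using m by (simp add: field_simps)
    next
      case False
      have "Ureg \<epsilon> s - s powr m / (m - 1) = m / (m - 1) * \<epsilon> powr m - \<epsilon> powr m / (m - 1)"
        using False ee by (simp add: Ureg_def diff_divide_distrib mult.assoc)
      also have "\<dots> = ((m - 1) * \<epsilon> powr m) / (m - 1)" by (simp add: diff_divide_distrib left_diff_distrib)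
      also have "\<dots> = \<epsilon> powr m" using m by simp
      finally have "\<bar>Ureg \<epsilon> s - s powr m / (m - 1)\<bar> = 1 * \<epsilon> powr m" by simp
      also have "\<dots> \<le> (1 + m) / (1 - m) * \<epsilon> powr m" using m by (intro mult_right_mono) (auto simp: field_simps)
      finally show ?thesis .
    qed
  qed
  have e0: "(\<lambda>n. (1 / (real n + 1)) powr m) \<longlonglongrightarrow> 0" using m by real_asymp
  have lim: "(\<lambda>n. \<integral>x. Ureg (1 / (real n + 1)) (\<rho> t x) \<partial>M) \<longlonglongrightarrow> (\<integral>x. \<rho> t x powr m / (m - 1) \<partial>M)"
  proof (rule integral_dominated_convergence[where w = "\<lambda>x. C powr m / (1 - m) + (1 + m) / (1 - m)"])
    show "integrable M (\<lambda>x. C powr m / (1 - m) + (1 + m) / (1 - m))" by (rule integrable_const_lebesgue_on[OF \<Omega>(1)])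
    show "AE x in M. (\<lambda>n. Ureg (1 / (real n + 1)) (\<rho> t x)) \<longlonglongrightarrow> \<rho> t x powr m / (m - 1)"
      using \<rho>_bounds[OF t]
    proof eventually_elim
      case (elim x)
      have "(\<lambda>n. Ureg (1 / (real n + 1)) (\<rho> t x) - \<rho> t x powr m / (m - 1)) \<longlonglongrightarrow> 0"
      proof (rule Lim_null_comparison)
        show "(\<lambda>n. (1 + m) / (1 - m) * (1 / (real n + 1)) powr m) \<longlonglongrightarrow> 0" using tendsto_mult_right_zero[OF e0] .
        show "\<forall>\<^sub>F n in sequentially. norm (Ureg (1 / (real n + 1)) (\<rho> t x) - \<rho> t x powr m / (m - 1)) \<le> (1 + m) / (1 - m) * (1 / (real n + 1)) powr m"
          using bd elim by (intro always_eventually) simp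
      qed
      then show ?case by (simp add: LIM_zero_iff)
    qed
    show "AE x in M. norm (Ureg (1 / (real n + 1)) (\<rho> t x)) \<le> C powr m / (1 - m) + (1 + m) / (1 - m)" for n
      using \<rho>_bounds[OF t]
    proof eventually_elim
      case (elim x)
      have "\<rho> t x powr m \<le> C powr m" using elim m by (intro powr_mono2) auto
      then have "\<bar>\<rho> t x powr m / (m - 1)\<bar> \<le> C powr m / (1 - m)" using m by (simp add: abs_divide divide_right_mono)
      moreover have "(1 / (real n + 1)) powr m \<le> 1 powr m" using m by (intro powr_mono2) auto
      then have "(1 + m) / (1 - m) * (1 / (real n + 1)) powr m \<le> (1 + m) / (1 - m)" using mult_left_mono[of "(1 / (real n + 1)) powr m" 1 "(1 + m) / (1 - m)"] m by simp
      moreover have "\<bar>Ureg (1 / (real n + 1)) (\<rho> t x) - \<rho> t x powr m / (m - 1)\<bar> \<le> (1 + m) / (1 - m) * (1 / (real n + 1)) powr m"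
        using bd[of "1 / (real n + 1)" "\<rho> t x"] elim by simp
      moreover have "\<bar>a\<bar> \<le> A + D" if "\<bar>b\<bar> \<le> A" "\<bar>a - b\<bar> \<le> c" "c \<le> D" for a b c A D :: real using that by linarith
      ultimately show ?case unfolding real_norm_def by blast
    qed
  qed measurable
  have "(\<lambda>n. Freg (1 / (real n + 1)) t) \<longlonglongrightarrow> (\<integral>x. \<rho> t x powr m / (m - 1) \<partial>M) + (\<integral>x. V x * \<rho> t x \<partial>M)
      + 1 / 2 * (\<integral>x. \<rho> t x * interaction R K (\<rho> t) x \<partial>M)"
    unfolding Freg_def by (intro tendsto_intros lim)
  moreover have "free_energy m R V K (\<rho> t) = (\<integral>x. \<rho> t x powr m / (m - 1) \<partial>M) + (\<integral>x. V x * \<rho> t x \<partial>M)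
      + 1 / 2 * (\<integral>x. \<rho> t x * interaction R K (\<rho> t) x \<partial>M)"
    by (simp add: free_energy_def interaction_def mult.commute)
  ultimately show ?thesis by simp
qed

text \<open>Up to a null set, the vacuum is the zero level set of the H^1 function \<rho>^m, on
  which \<open>G\<close> vanishes almost everywhere; the other term of \<open>J\<close> carries the
  factor \<rho>.\<close>

lemma J_zero: "AE t in lebesgue_on I. AE x in M. \<rho> t x \<le> 0 \<longrightarrow> (\<forall>e\<in>Basis. J e t x = 0)"
proof -
  have "AE t in lebesgue_on I. t \<in> I" by (rule AE_I2) simp
  with G_H1 show ?thesis
  proof eventually_elim
    case (elim t)
    have t: "t \<in> {0..T}" using elim(2) by auto
    have "AE x in M. \<forall>e\<in>Basis. \<rho> t x powr m = 0 \<longrightarrow> G e (t, x) = 0"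
      by (subst AE_finite_all[OF finite_Basis])
        (use H1_deriv_zero_on_level_set[OF R] elim(1) in blast)
    with \<rho>_bounds[OF t] show ?case by eventually_elim (auto simp: J_def)
  qed
qed

text \<open>All other terms of the regularized identity converge, hence so do the integrals of |J|^2
  / \<rho> over {\<rho> > \<epsilon>}. These integrands are nonnegative and increase as \<epsilon>
  decreases, so monotone convergence yields the integrability of the limit together with its
  integral.\<close>

lemma energy_dissipation:
  assumes st: "0 \<le> s" "s \<le> t" "t \<le> T"
  shows "integrable (lebesgue_on ({s<..<t} \<times> \<Omega>)) (\<lambda>z. diss (fst z) (snd z))"
    and "(\<integral>z. diss (fst z) (snd z) \<partial>lebesgue_on ({s<..<t} \<times> \<Omega>)) = free_energy m R V K (\<rho> s) - free_energy m R V K (\<rho> t)"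
proof -
  let ?J = "{s<..<t}"
  let ?N = "lebesgue_on (?J \<times> \<Omega>)"
  have s_in: "s \<in> {0..T}" and t_in: "t \<in> {0..T}" using st by auto
  have Jb: "?J \<in> sets borel" by simp
  have Jm: "?J \<times> \<Omega> \<in> sets lebesgue" by (rule borel_Times_lebesgue[OF Jb \<Omega>(3)])
  have JI: "?J \<subseteq> I" and sub: "?J \<times> \<Omega> \<subseteq> I \<times> \<Omega>" using st by auto
  define \<epsilon> where "\<epsilon> n = 1 / (real n + 1)" for n :: nat
  have \<epsilon>: "0 < \<epsilon> n" for n by (simp add: \<epsilon>_def)
  have \<epsilon>0: "\<epsilon> \<longlonglongrightarrow> 0" unfolding \<epsilon>_def by real_asymp
  note res = integrable_lebesgue_on_subset[OF _ Q(1) Jm sub]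
  have i1: "integrable ?N (\<lambda>z. b1 (\<epsilon> n) z * f1 z)" for n by (rule res[OF bf_integrable(1)[OF \<epsilon>]])
  have i2: "integrable ?N (\<lambda>z. b2 (\<epsilon> n) z * f2 z)" for n by (rule res[OF bf_integrable(2)])
  have f2i: "integrable ?N f2" by (rule res[OF f_integrable(2)])
  have f1i: "integrable ?N f1" by (rule res[OF f_integrable(1)])
  have bm: "b2 e \<in> borel_measurable ?N" for e by (rule borel_measurable_lebesgue_on_subset[OF b_measurable(2) sub])
  have inc: "Freg (\<epsilon> n) s - Freg (\<epsilon> n) t = (\<integral>z. b1 (\<epsilon> n) z * f1 z \<partial>?N) + (\<integral>z. b2 (\<epsilon> n) z * f2 z \<partial>?N)" for n
  proof -
    have fi: "integrable ?N (\<lambda>z. flux (\<epsilon> n) (fst z) (snd z))" by (rule res[OF flux_integrable[OF \<epsilon>]])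
    have "Freg (\<epsilon> n) s - Freg (\<epsilon> n) t = (\<integral>z. flux (\<epsilon> n) (fst z) (snd z) \<partial>?N)"
      using Freg_dissipation[OF \<epsilon> st, of n] lebesgue_on_Times_Fubini(3)[OF Jb \<Omega>(3) fi] by simp
    then show ?thesis using i1 i2 by (simp add: flux_eq)
  qed
  have lim2: "(\<lambda>n. \<integral>z. b2 (\<epsilon> n) z * f2 z \<partial>?N) \<longlonglongrightarrow> (\<integral>z. b2 0 z * f2 z \<partial>?N)"
  proof (rule integral_dominated_convergence[where w = "\<lambda>z. \<bar>f2 z\<bar>"])
    show "AE z in ?N. (\<lambda>n. b2 (\<epsilon> n) z * f2 z) \<longlonglongrightarrow> b2 0 z * f2 z"
    proof (intro AE_I2 tendsto_mult tendsto_const tendsto_eventually)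
      fix z
      show "\<forall>\<^sub>F n in sequentially. b2 (\<epsilon> n) z = b2 0 z"
      proof (cases "0 < \<rho> (fst z) (snd z)")
        case True
        then have "\<forall>\<^sub>F n in sequentially. \<epsilon> n < \<rho> (fst z) (snd z)" by (rule order_tendstoD(2)[OF \<epsilon>0])
        then show ?thesis by eventually_elim (use True in \<open>simp add: b2_def\<close>)
      next
        case False
        then have "\<not> \<epsilon> n < \<rho> (fst z) (snd z)" for n using \<epsilon>[of n] by linarith
        then show ?thesis using False by (simp add: b2_def)
      qed
    qed
    show "AE z in ?N. norm (b2 (\<epsilon> n) z * f2 z) \<le> \<bar>f2 z\<bar>" for n by (rule AE_I2) (simp add: b2_def)
  qed (use f2i i2 bm in auto)
  have zero: "(\<integral>z. b2 0 z * f2 z \<partial>?N) = 0"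
  proof -
    have i: "integrable ?N (\<lambda>z. b2 0 z * f2 z)" by (rule res[OF bf_integrable(2)])
    have "AE r in lebesgue_on ?J. (\<integral>x. b2 0 (r, x) * f2 (r, x) \<partial>M) = 0"
      using AE_lebesgue_on_subset[OF J_zero I(3) _ JI, simplified]
    proof eventually_elim
      case (elim r)
      then have "AE x in M. b2 0 (r, x) * f2 (r, x) = 0" by eventually_elim (simp add: b2_def f2_def)
      then show ?case by (rule integral_eq_zero_AE)
    qed
    then have "(\<integral>r. (\<integral>x. b2 0 (r, x) * f2 (r, x) \<partial>M) \<partial>lebesgue_on ?J) = 0" by (rule integral_eq_zero_AE)
    then show ?thesis using lebesgue_on_Times_Fubini(3)[OF Jb \<Omega>(3) i] by simp
  qed
  have "(\<lambda>n. Freg (\<epsilon> n) s - Freg (\<epsilon> n) t) \<longlonglongrightarrow> free_energy m R V K (\<rho> s) - free_energy m R V K (\<rho> t)"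
    unfolding \<epsilon>_def by (intro tendsto_diff Freg_tendsto s_in t_in)
  from tendsto_diff[OF this lim2]
  have "(\<lambda>n. (Freg (\<epsilon> n) s - Freg (\<epsilon> n) t) - (\<integral>z. b2 (\<epsilon> n) z * f2 z \<partial>?N)) \<longlonglongrightarrow>
      (free_energy m R V K (\<rho> s) - free_energy m R V K (\<rho> t)) - 0" by (simp only: zero)
  then have lim: "(\<lambda>n. \<integral>z. b1 (\<epsilon> n) z * f1 z \<partial>?N) \<longlonglongrightarrow> free_energy m R V K (\<rho> s) - free_energy m R V K (\<rho> t)"
    by (simp add: inc)
  have f1n: "0 \<le> f1 z" for z unfolding f1_def by (intro sum_nonneg) simp
  have diss: "diss (fst z) (snd z) = b1 0 z * f1 z" for z by (simp add: diss_def b1_def f1_def)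
  have "AE z in ?N. mono (\<lambda>n. b1 (\<epsilon> n) z * f1 z)"
  proof (rule AE_I2, rule monoI)
    fix z and i j :: nat assume ij: "i \<le> j"
    have "\<epsilon> j \<le> \<epsilon> i" using ij by (simp add: \<epsilon>_def frac_le)
    then have "b1 (\<epsilon> i) z \<le> b1 (\<epsilon> j) z" using \<epsilon>[of j] by (auto simp: b1_def)
    then show "b1 (\<epsilon> i) z * f1 z \<le> b1 (\<epsilon> j) z * f1 z" by (intro mult_right_mono f1n)
  qed
  moreover have "AE z in ?N. (\<lambda>n. b1 (\<epsilon> n) z * f1 z) \<longlonglongrightarrow> diss (fst z) (snd z)"
    unfolding diss
  proof (intro AE_I2 tendsto_mult tendsto_const tendsto_eventually)
    fix z
    show "\<forall>\<^sub>F n in sequentially. b1 (\<epsilon> n) z = b1 0 z"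
    proof (cases "0 < \<rho> (fst z) (snd z)")
      case True
      then have "\<forall>\<^sub>F n in sequentially. \<epsilon> n < \<rho> (fst z) (snd z)" by (rule order_tendstoD(2)[OF \<epsilon>0])
      then show ?thesis by eventually_elim (use True in \<open>simp add: b1_def\<close>)
    next
      case False
      then have "\<not> \<epsilon> n < \<rho> (fst z) (snd z)" for n using \<epsilon>[of n] by linarith
      then show ?thesis using False by (simp add: b1_def)
    qed
  qed
  moreover have "(\<lambda>z. diss (fst z) (snd z)) \<in> borel_measurable ?N"
    unfolding diss
    by (intro borel_measurable_times borel_measurable_lebesgue_on_subset[OF b_measurable(1) sub] borel_measurable_integrable[OF f1i])
  ultimately show "integrable ?N (\<lambda>z. diss (fst z) (snd z))"
    and "(\<integral>z. diss (fst z) (snd z) \<partial>?N) = free_energy m R V K (\<rho> s) - free_energy m R V K (\<rho> t)"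
    by - (rule integrable_monotone_convergence[OF i1 _ _ lim], assumption+,
      rule integral_monotone_convergence[OF i1 _ _ lim], assumption+)
qed

end

section \<open>The energy identity\<close>

lemma AE_lebesgue_on_Icc:
  fixes s t :: real
  assumes "AE r in lebesgue_on {s<..<t}. P r"
  shows "AE r in lebesgue_on {s..t}. P r"
proof -
  have "AE r in lborel. r \<noteq> s" "AE r in lborel. r \<noteq> t" by (rule AE_lborel_singleton)+
  moreover have "AE r in lborel. r \<in> {s<..<t} \<longrightarrow> P r" using assms by (simp add: AE_lebesgue_on_iff)
  ultimately have "AE r in lborel. r \<in> {s..t} \<longrightarrow> P r" by eventually_elim auto
  then show ?thesis by (simp add: AE_lebesgue_on_iff)
qed

lemma integral_lebesgue_on_Icc:
  fixes f :: "real \<Rightarrow> real"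
  assumes f: "integrable (lebesgue_on {s<..<t}) f"
  shows "integrable (lebesgue_on {s..t}) f"
    and "integral\<^sup>L (lebesgue_on {s..t}) f = integral\<^sup>L (lebesgue_on {s<..<t}) f"
proof -
  let ?h = "\<lambda>r. indicator {s<..<t} r * f r"
  have S: "{s..t} \<in> sets lebesgue" "{s<..<t} \<in> sets lebesgue" by simp_all
  have ind: "indicator {s..t} r * ?h r = ?h r" for r by (simp add: indicator_def)
  have "integrable lebesgue ?h" using f by (simp add: integrable_restrict_space)
  then have hi: "integrable (lebesgue_on {s..t}) ?h"
    by (simp add: integrable_restrict_space ind)
  have hI: "integral\<^sup>L (lebesgue_on {s..t}) ?h = integral\<^sup>L (lebesgue_on {s<..<t}) f"
    by (simp add: integral_restrict_space ind)
  have ae: "AE r in lebesgue_on {s..t}. f r = ?h r"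
    by (rule AE_lebesgue_on_Icc, rule AE_I2) simp
  show "integrable (lebesgue_on {s..t}) f" by (rule lebesgue_on_cong_AE(1)[OF S(1) hi ae])
  show "integral\<^sup>L (lebesgue_on {s..t}) f = integral\<^sup>L (lebesgue_on {s<..<t}) f"
    using lebesgue_on_cong_AE(2)[OF S(1) hi ae] hI by simp
qed

context aggregation_diffusion
begin

lemma gen_grad_AE:
  "AE t in lebesgue_on I. (\<exists>g. has_gen_grad \<Omega> (potential m R V K (\<rho> t)) g) \<and>
    (AE x in M. dissipation m R V K (\<rho> t) x = diss t x)"
proof -
  have "AE t in lebesgue_on I. t \<in> I" by (rule AE_I2) simp
  with G_H1 show ?thesis
  proof eventually_elim
    case (elim t)
    then have "t \<in> {0..T}" "\<And>e. e \<in> Basis \<Longrightarrow> H1_deriv R e (\<lambda>x. \<rho> t x powr m) (\<lambda>x. G e (t, x))" by auto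
    from has_gen_grad_potential[OF this] dissipation_AE[OF this] show ?case by blast
  qed
qed

text \<open>The passage from \<open>diss\<close> to \<open>dissipation\<close> is made slice by
  slice after Fubini, because \<open>dissipation\<close> depends on a separate choice at each
  time.\<close>

lemma energy_equality:
  assumes st: "0 \<le> s" "s \<le> t" "t \<le> T"
  shows "AE r in lebesgue_on {s..t}. integrable M (dissipation m R V K (\<rho> r))"
    and "integrable (lebesgue_on {s..t}) (\<lambda>r. \<integral>x. dissipation m R V K (\<rho> r) x \<partial>M)"
    and "(\<integral>r. (\<integral>x. dissipation m R V K (\<rho> r) x \<partial>M) \<partial>lebesgue_on {s..t}) =
      free_energy m R V K (\<rho> s) - free_energy m R V K (\<rho> t)"
    and "free_energy m R V K (\<rho> t) \<le> free_energy m R V K (\<rho> s)"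
proof -
  let ?D = "\<lambda>r. dissipation m R V K (\<rho> r)"
  have J: "{s<..<t} \<in> sets borel" "{s<..<t} \<in> sets lebesgue" by simp_all
  have JI: "{s<..<t} \<subseteq> I" using st by auto
  note ed = energy_dissipation[OF st]
  note F = lebesgue_on_Times_Fubini[OF J(1) \<Omega>(3) ed(1), simplified]
  have ae: "AE r in lebesgue_on {s<..<t}. integrable M (?D r) \<and> integral\<^sup>L M (?D r) = integral\<^sup>L M (diss r)"
    using AE_lebesgue_on_subset[OF gen_grad_AE I(3) J(2) JI] F(1)
    by eventually_elim (use lebesgue_on_cong_AE[OF \<Omega>(2)] in blast)
  then have ae2: "AE r in lebesgue_on {s<..<t}. integral\<^sup>L M (?D r) = integral\<^sup>L M (diss r)" by eventually_elim blast
  note D = lebesgue_on_cong_AE[OF J(2) F(2) ae2]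
  show "AE r in lebesgue_on {s..t}. integrable M (?D r)"
    by (rule AE_lebesgue_on_Icc) (use ae in \<open>eventually_elim, blast\<close>)
  show "integrable (lebesgue_on {s..t}) (\<lambda>r. integral\<^sup>L M (?D r))" by (rule integral_lebesgue_on_Icc(1)[OF D(1)])
  show "(\<integral>r. integral\<^sup>L M (?D r) \<partial>lebesgue_on {s..t}) = free_energy m R V K (\<rho> s) - free_energy m R V K (\<rho> t)"
    using integral_lebesgue_on_Icc(2)[OF D(1)] D(2) F(3) ed(2) by simp
  have "0 \<le> diss r x" for r x by (simp add: diss_def sum_nonneg)
  then have "0 \<le> (\<integral>z. diss (fst z) (snd z) \<partial>lebesgue_on ({s<..<t} \<times> \<Omega>))" by simp
  then show "free_energy m R V K (\<rho> t) \<le> free_energy m R V K (\<rho> s)" using ed(2) by simp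
qed

end

text \<open>Compact support of \<theta> in (0, T) makes the product vanish at time T, hence
  admissible, and at time 0, which removes the initial term.\<close>

lemma strong_solution_tensor:
  fixes \<rho> :: "real \<Rightarrow> 'a::euclidean_space \<Rightarrow> real"
  assumes sol: "strong_solution m R V K \<rho>0 \<rho>" and T: "0 < T" and \<theta>: "test_fun {0<..<T} \<theta>" and \<zeta>: "smooth \<zeta>"
  shows "(\<integral>t. (\<integral>x. \<rho> t x * (dir_deriv 1 \<theta> t * \<zeta> x) \<partial>lebesgue_on (ball 0 R)) \<partial>lebesgue_on {0<..<T}) =
      (\<integral>t. (\<integral>x. weak_grad (ball 0 R) (\<lambda>x. \<rho> t x powr m) x \<bullet> (\<Sum>e\<in>Basis. (\<theta> t * dir_deriv e \<zeta> x) *\<^sub>R e)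
        \<partial>lebesgue_on (ball 0 R)) \<partial>lebesgue_on {0<..<T})
      + (\<integral>t. (\<integral>x. \<rho> t x * ((weak_grad (ball 0 R) V x + weak_grad (ball 0 R) (interaction R K (\<rho> t)) x)
          \<bullet> (\<Sum>e\<in>Basis. (\<theta> t * dir_deriv e \<zeta> x) *\<^sub>R e)) \<partial>lebesgue_on (ball 0 R)) \<partial>lebesgue_on {0<..<T})"
proof -
  let ?\<phi> = "\<lambda>z. \<theta> (fst z) * \<zeta> (snd z)"
  have \<theta>0: "\<theta> t = 0" if "t \<notin> {0<..<T}" for t
    using \<theta> that unfolding test_fun_def by blast
  have s\<theta>: "smooth \<theta>" using \<theta> by (simp add: test_fun_def)
  note st = smooth_tensor[OF s\<theta> \<zeta>]
  have td: "time_deriv ?\<phi> t x = dir_deriv 1 \<theta> t * \<zeta> x" for t x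
    unfolding time_deriv_def by (rule st(2)) simp
  have sg: "space_grad ?\<phi> t x = (\<Sum>e\<in>Basis. (\<theta> t * dir_deriv e \<zeta> x) *\<^sub>R e)" for t x
    unfolding space_grad_def by (intro sum.cong refl) (simp add: st(3))
  have end0: "\<forall>x\<in>cball 0 R. ?\<phi> (T, x) = 0" and start0: "?\<phi> (0, x) = 0" for x
    using \<theta>0[of T] \<theta>0[of 0] by simp_all
  note E = sol[unfolded strong_solution_def, THEN conjunct2, THEN spec, THEN mp, OF T,
      THEN conjunct2, THEN conjunct2, THEN conjunct2, THEN conjunct2, THEN spec, THEN mp, OF conjI[OF st(1) end0]]
  then show ?thesis by (simp only: td sg start0 mult_zero_right integral_zero add_0_left)
qed

text \<open>The Neumann predicates supply gradients of V and K that are continuous up to the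
  boundary, and \<open>W_inf\<close> supplies the bounds \<open>CV\<close> and
  \<open>CK\<close>.\<close>

lemma strong_solution_locale:
  fixes V :: "'a::euclidean_space \<Rightarrow> real"
  assumes m: "0 < m" "m < 1" and R: "0 < R" and V: "W_inf 2 (ball 0 R) V" "neumann R V"
    and K: "W_inf 2 (ball 0 R \<times> ball 0 R) (\<lambda>(x, y). K x y)"
      "AE (x, y) in lebesgue_on (ball 0 R \<times> ball 0 R). K x y = K y x \<and> K x y \<ge> 0" "neumann_fst R K"
    and sol: "strong_solution m R V K \<rho>0 \<rho>" and T: "0 < T"
  shows "\<exists>C CV CK gV gK \<sigma> G. aggregation_diffusion m R T C CV CK V K \<rho> gV gK \<sigma> G"
proof -
  have "L_inf (ball 0 R) V" using V(1) by (simp add: numeral_2_eq_2)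
  then obtain CV where V': "V \<in> borel_measurable (lebesgue_on (ball 0 R))" "AE x in lebesgue_on (ball 0 R). \<bar>V x\<bar> \<le> CV"
    unfolding L_inf_def by blast
  have "L_inf (ball 0 R \<times> ball 0 R) (\<lambda>(x, y). K x y)" using K(1) by (simp add: numeral_2_eq_2)
  then obtain CK where K': "(\<lambda>(x, y). K x y) \<in> borel_measurable (lebesgue_on (ball 0 R \<times> ball 0 R))"
      "AE z in lebesgue_on (ball 0 R \<times> ball 0 R). \<bar>case z of (x, y) \<Rightarrow> K x y\<bar> \<le> CK"
    unfolding L_inf_def by blast
  have sym: "AE z in lebesgue_on (ball 0 R \<times> ball 0 R). case z of (x, y) \<Rightarrow> K x y = K y x"
    using K(2) by eventually_elim auto
  obtain gV where gV: "continuous_on (cball 0 R) gV" "\<And>e. e \<in> Basis \<Longrightarrow> weak_deriv (ball 0 R) e V (\<lambda>x. gV x \<bullet> e)"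
    using V(2) unfolding neumann_def has_weak_grad_def by blast
  obtain gK :: "'a \<times> 'a \<Rightarrow> 'a" where gK: "continuous_on (cball 0 R \<times> cball 0 R) gK"
      "\<And>e. e \<in> Basis \<Longrightarrow> weak_deriv (ball 0 R \<times> ball 0 R) (e, 0) (\<lambda>(x, y). K x y) (\<lambda>z. gK z \<bullet> e)"
    using K(3) unfolding neumann_fst_def by blast
  have nonneg: "\<And>t. 0 \<le> t \<Longrightarrow> AE x in lebesgue_on (ball 0 R). 0 \<le> \<rho> t x"
    and CL1: "C_L1 T (ball 0 R) \<rho>" and Li: "L_inf ({0<..<T} \<times> ball 0 R) (\<lambda>(t, x). \<rho> t x)"
    and H2: "L2_H 2 T (ball 0 R) (\<lambda>t x. \<rho> t x powr m)"
    and \<sigma>ex: "\<exists>\<sigma>. weak_deriv ({0<..<T} \<times> ball 0 R) (1, 0) (\<lambda>(t, x). \<rho> t x) \<sigma> \<and> L_two ({0<..<T} \<times> ball 0 R) \<sigma>"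
    using sol T unfolding strong_solution_def by blast+
  obtain C where C: "(\<lambda>(t, x). \<rho> t x) \<in> borel_measurable (lebesgue_on ({0<..<T} \<times> ball 0 R))"
      "AE z in lebesgue_on ({0<..<T} \<times> ball 0 R). \<bar>case z of (t, x) \<Rightarrow> \<rho> t x\<bar> \<le> C"
    using Li unfolding L_inf_def by blast
  obtain \<sigma> where \<sigma>: "weak_deriv ({0<..<T} \<times> ball 0 R) (1, 0) (\<lambda>(t, x). \<rho> t x) \<sigma>" "L_two ({0<..<T} \<times> ball 0 R) \<sigma>"
    using \<sigma>ex by blast
  have "\<forall>e\<in>Basis. \<exists>g. (AE t in lebesgue_on {0<..<T}. weak_deriv (ball 0 R) e (\<lambda>x. \<rho> t x powr m) (g t)) \<and>
      L_two ({0<..<T} \<times> ball 0 R) (\<lambda>(t, x). g t x)"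
    using H2 by (fastforce simp: numeral_2_eq_2)
  from bchoice[OF this] obtain g where "\<forall>e\<in>Basis. (AE t in lebesgue_on {0<..<T}. weak_deriv (ball 0 R) e (\<lambda>x. \<rho> t x powr m) (g e t)) \<and>
      L_two ({0<..<T} \<times> ball 0 R) (\<lambda>(t, x). g e t x)" by blast
  then have g: "\<And>e. e \<in> Basis \<Longrightarrow> AE t in lebesgue_on {0<..<T}. weak_deriv (ball 0 R) e (\<lambda>x. \<rho> t x powr m) (g e t)"
      "\<And>e. e \<in> Basis \<Longrightarrow> L_two ({0<..<T} \<times> ball 0 R) (\<lambda>(t, x). g e t x)"
    by blast+
  have "aggregation_diffusion m R T C CV CK V K \<rho> gV gK \<sigma> (\<lambda>e (t, x). g e t x)"
    by (rule aggregation_diffusion.intro, fact m(1), fact m(2), fact R, fact T, fact V'(1), fact V'(2),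
        fact K'(1), fact K'(2), fact sym, fact gV(1), erule gV(2), fact gK(1), erule gK(2), erule nonneg,
        fact CL1, fact C(1), fact C(2), fact \<sigma>(1), fact \<sigma>(2), simp add: g(1), erule g(2))
      (rule strong_solution_tensor[OF sol T])
  then show ?thesis by blast
qed

theorem proposition2p3:
  fixes m R :: real
    and \<rho>0 V :: "'a::euclidean_space \<Rightarrow> real"
    and K :: "'a \<Rightarrow> 'a \<Rightarrow> real"
    and \<rho> :: "real \<Rightarrow> 'a \<Rightarrow> real"
  assumes "0 < m" "m < 1" "R > 0"
    and "L_inf (ball 0 R) \<rho>0" "AE x in lebesgue_on (ball 0 R). \<rho>0 x \<ge> 0"
    and "W_inf 2 (ball 0 R) V" "AE x in lebesgue_on (ball 0 R). V x \<ge> 0" "neumann R V"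
    and "W_inf 2 (ball 0 R \<times> ball 0 R) (\<lambda>(x, y). K x y)"
    and "AE (x, y) in lebesgue_on (ball 0 R \<times> ball 0 R). K x y = K y x \<and> K x y \<ge> 0"
    and "neumann_fst R K"
    and "strong_solution m R V K \<rho>0 \<rho>"
  shows "(AE t in lebesgue_on {0<..}. \<exists>g. has_gen_grad (ball 0 R) (potential m R V K (\<rho> t)) g)
    \<and> (\<forall>t1 t2. 0 \<le> t1 \<and> t1 \<le> t2 \<longrightarrow>
          (AE t in lebesgue_on {t1..t2}.
             integrable (lebesgue_on (ball 0 R)) (dissipation m R V K (\<rho> t)))
        \<and> integrable (lebesgue_on {t1..t2})
             (\<lambda>t. \<integral>x. dissipation m R V K (\<rho> t) x \<partial>lebesgue_on (ball 0 R))
        \<and> (\<integral>t. (\<integral>x. dissipation m R V K (\<rho> t) x \<partial>lebesgue_on (ball 0 R)) \<partial>lebesgue_on {t1..t2})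
          = free_energy m R V K (\<rho> t1) - free_energy m R V K (\<rho> t2))
    \<and> antimono_on {0..} (\<lambda>t. free_energy m R V K (\<rho> t))"
proof (intro conjI allI impI, goal_cases)
  case 1
  let ?P = "\<lambda>t. \<exists>g. has_gen_grad (ball 0 R) (potential m R V K (\<rho> t)) g"
  \<comment> \<open>The locale has a finite final time, so the half-line is exhausted by countably
    many intervals, whose exceptional sets have a null union.\<close>
  have "AE t in lborel. t \<in> {0<..<real n + 1} \<longrightarrow> ?P t" for n
  proof -
    obtain C CV CK gV gK \<sigma> G where "aggregation_diffusion m R (real n + 1) C CV CK V K \<rho> gV gK \<sigma> G"
      using strong_solution_locale[OF assms(1-3,6,8-12), of "real n + 1"] by auto
    then interpret aggregation_diffusion m R "real n + 1" C CV CK V K \<rho> gV gK \<sigma> G .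
    have "AE t in lebesgue_on {0<..<real n + 1}. ?P t" using gen_grad_AE by eventually_elim blast
    then show ?thesis by (simp add: AE_lebesgue_on_iff)
  qed
  then have "AE t in lborel. \<forall>n. t \<in> {0<..<real n + 1} \<longrightarrow> ?P t" by (intro AE_all_countable[THEN iffD2] allI)
  then have "AE t in lborel. t \<in> {0<..} \<longrightarrow> ?P t"
  proof eventually_elim
    case (elim t)
    obtain n where "t < real n + 1" using reals_Archimedean2[of t] by (metis add.commute less_add_one order_less_trans)
    with elim show ?case by auto
  qed
  then show ?case by (simp add: AE_lebesgue_on_iff)
next
  have energy: "(AE r in lebesgue_on {s..t}. integrable (lebesgue_on (ball 0 R)) (dissipation m R V K (\<rho> r))) \<and>
      integrable (lebesgue_on {s..t}) (\<lambda>r. \<integral>x. dissipation m R V K (\<rho> r) x \<partial>lebesgue_on (ball 0 R)) \<and>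
      (\<integral>r. (\<integral>x. dissipation m R V K (\<rho> r) x \<partial>lebesgue_on (ball 0 R)) \<partial>lebesgue_on {s..t}) =
        free_energy m R V K (\<rho> s) - free_energy m R V K (\<rho> t) \<and>
      free_energy m R V K (\<rho> t) \<le> free_energy m R V K (\<rho> s)" if st: "0 \<le> s" "s \<le> t" for s t
  proof -
    \<comment> \<open>The final time t + 1 is positive also when t = 0.\<close>
    obtain C CV CK gV gK \<sigma> G where "aggregation_diffusion m R (t + 1) C CV CK V K \<rho> gV gK \<sigma> G"
      using strong_solution_locale[OF assms(1-3,6,8-12), of "t + 1"] st by auto
    from aggregation_diffusion.energy_equality[OF this st] show ?thesis by simp
  qed
  {
    case (2 t1 t2) then show ?case using energy by blast
  next
    case (3 t1 t2) then show ?case using energy by blast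
  next
    case (4 t1 t2) then show ?case using energy by blast
  next
    case 5 then show ?case using energy by (auto simp: monotone_on_def)
  }
qed

end
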